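(* There is an absolute constant $K>0$ with the following two properties. (1) For each $\mathbb F\in\{\mathbb R,\mathbb C\}$ and every $n\ge1$, every traceless $A\in M_n(\mathbb F)$ admits $B,C\in M_n(\mathbb F)$ with $A=[B,C]$ and $\|B\|\,\|C\|\le K\|A\|$. (2) With the same constant $K$: for each $\mathbb F\in\{\mathbb R,\mathbb C\}$, every sequence $(n_k)_{k\in\mathbb N}$ of positive integers and every nonprincipal ultrafilter $\omega$ on $\mathbb N$, if $\mathcal M=\prod_\omega M_{n_k}(\mathbb F)$ is the tracial ultraproduct and $T\in\mathcal M$ satisfies $\tau_\omega(T)=0$, then there are $B,C\in\mathcal M$ with $T=[B,C]$ and $\|B\|\,\|C\|\le K\|T\|$.
   Context: $[B,C]=BC-CB$, and $\|\cdot\|$ on matrices is the operator norm. Let $\tau_k=n_k^{-1}\operatorname{Tr}$ be the normalized trace on $M_{n_k}(\mathbb F)$, and let $*$ be the transpose if $\mathbb F=\mathbb R$ and the conjugate transpose if $\mathbb F=\mathbb C$. The tracial ultraproduct $\mathcal M=\prod_\omega M_{n_k}(\mathbb F)$ is the quotient of the algebra of sequences $(a_k)$, $a_k\in M_{n_k}(\mathbb F)$, bounded in operator norm ($\sup_k\|a_k\|<\infty$), by the ideal of those sequences satisfying $\lim_\omega\tau_k(a_k^*a_k)=0$. It carries the quotient norm (from the norm $\sup_k\|a_k\|$), and the induced trace is $\tau_\omega([(a_k)])=\lim_\omega\tau_k(a_k)$. Part (1) is included only to specify that the constant $K$ in part (2) is the constant of the matrix theorem. *)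

theory Defs
  imports
    "HOL-Analysis.L2_Norm"
    "HOL-Algebra.QuotRing"
    "Jordan_Normal_Form.Schur_Decomposition"
begin

text \<open>
  Matrices are those of \<^theory>\<open>Jordan_Normal_Form.Matrix\<close>, whose size is a value, so that one sequence
  can run through matrices of different sizes. The scalars range over the class
  \<open>{real_normed_field, conjugatable_field}\<close>, which has both real and complex as instances;
  \<^const>\<open>conjugate\<close> is the identity on the reals, so \<^const>\<open>mat_adjoint\<close> is the transpose over the
  reals and the conjugate transpose over the complex numbers.
\<close>

definition vec_l2_norm :: "'a::real_normed_field vec \<Rightarrow> real" where
  "vec_l2_norm v = L2_set (\<lambda>i. norm (vec_index v i)) {..<dim_vec v}"

definition mat_op_norm :: "'a::real_normed_field mat \<Rightarrow> real" where
  "mat_op_norm A = (SUP v \<in> {v \<in> carrier_vec (dim_col A). vec_l2_norm v \<le> 1}. vec_l2_norm (A *\<^sub>v v))"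

definition mat_trace :: "'a::comm_monoid_add mat \<Rightarrow> 'a" where
  "mat_trace A = (\<Sum>i<dim_row A. A $$ (i, i))"

definition normalized_trace :: "'a::field mat \<Rightarrow> 'a" where
  "normalized_trace A = mat_trace A / of_nat (dim_row A)"

text \<open>An ultrafilter on \<open>'b\<close> is principal iff it consists of all sets containing some fixed point.\<close>

definition nonprincipal_ultrafilter :: "'b filter \<Rightarrow> bool" where
  "nonprincipal_ultrafilter \<omega> \<longleftrightarrow>
     \<omega> \<noteq> bot \<and> (\<forall>P. eventually P \<omega> \<or> eventually (\<lambda>x. \<not> P x) \<omega>) \<and> (\<forall>x. \<omega> \<noteq> principal {x})"

definition bounded_seq_ring :: "(nat \<Rightarrow> nat) \<Rightarrow> (nat \<Rightarrow> 'a::real_normed_field mat) ring" where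
  "bounded_seq_ring n =
    \<lparr>carrier = {a. (\<forall>k. a k \<in> carrier_mat (n k) (n k)) \<and> bdd_above (range (\<lambda>k. mat_op_norm (a k)))},
     monoid.mult = (\<lambda>a b k. a k * b k),
     one = (\<lambda>k. 1\<^sub>m (n k)),
     zero = (\<lambda>k. 0\<^sub>m (n k) (n k)),
     add = (\<lambda>a b k. a k + b k)\<rparr>"

definition trace_null_ideal ::
    "(nat \<Rightarrow> nat) \<Rightarrow> nat filter \<Rightarrow> (nat \<Rightarrow> 'a::{real_normed_field, conjugatable_field} mat) set" where
  "trace_null_ideal n \<omega> =
    {a \<in> carrier (bounded_seq_ring n).
       ((\<lambda>k. normalized_trace (mat_adjoint (a k) * a k)) \<longlongrightarrow> 0) \<omega>}"

definition tracial_ultraproduct ::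
    "(nat \<Rightarrow> nat) \<Rightarrow> nat filter \<Rightarrow> (nat \<Rightarrow> 'a::{real_normed_field, conjugatable_field} mat) set ring" where
  "tracial_ultraproduct n \<omega> = bounded_seq_ring n Quot trace_null_ideal n \<omega>"

text \<open>
  The elements of the ultraproduct are cosets, i.e. sets of sequences, and \<open>a \<in> X\<close> says that \<open>X\<close> is the
  class of \<open>a\<close>. The norm of the coset \<open>a + I\<close>, the infimum of the norms of \<open>a + i\<close> for \<open>i \<in> I\<close>, is thus
  the infimum of the norms of its members; the limit in the trace is the same for all members.
\<close>

definition ultraproduct_norm :: "(nat \<Rightarrow> 'a::real_normed_field mat) set \<Rightarrow> real" where
  "ultraproduct_norm X = (INF a \<in> X. SUP k. mat_op_norm (a k))"

definition ultraproduct_trace :: "nat filter \<Rightarrow> (nat \<Rightarrow> 'a::real_normed_field mat) set \<Rightarrow> 'a" where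
  "ultraproduct_trace \<omega> X = (THE t. \<exists>a \<in> X. t = Lim \<omega> (\<lambda>k. normalized_trace (a k)))"

definition ring_commutator :: "('b, 'm) ring_scheme \<Rightarrow> 'b \<Rightarrow> 'b \<Rightarrow> 'b" where
  "ring_commutator R x y = (x \<otimes>\<^bsub>R\<^esub> y) \<ominus>\<^bsub>R\<^esub> (y \<otimes>\<^bsub>R\<^esub> x)"

end

theory Submission
  imports Defs "HOL-Analysis.Starlike" "Jordan_Normal_Form.Spectral_Radius"
begin

text \<open>
  If \<open>C\<^sup>n\<close> is split into orthogonal pieces on which the compressions of \<open>A\<close> are commutators \<open>[B\<^sub>i, C\<^sub>i]\<close>
  with the \<open>B\<^sub>i\<close> in disjoint discs, then Sylvester's equation yields the off-diagonal blocks of a \<open>C\<close> with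
  \<open>A = [B, C]\<close>, \<open>B\<close> block diagonal. Four blocks of equal size can be mixed by unitaries so that all of
  them are traceless with norm about a quarter of that of \<open>A\<close>, provided \<open>A\<close> is small off a subspace of
  small dimension; this improves the constant from \<open>K\<close> to \<open>13/5 * K/4 + O(1)\<close>. For general \<open>A\<close> one splits off
  isotropic or balanced pieces: greedily, either a large subspace is isotropic for \<open>A\<close>, or a multiple
  of \<open>A\<close> has almost nonnegative real part \<open>H\<close>, which is then small off a few directions since its trace
  vanishes. If the imaginary part \<open>G\<close> is small as well, the first case applies; otherwise \<open>G\<close> has many positive
  and many negative eigenvalues, and a large traceless piece on which \<open>A\<close> is small is found by rotating an
  isotropic space of \<open>G\<close>. Real matrices are split as \<open>P\<close> plus its complex conjugate. In the ultraproduct one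
  solves the matrix problem for the terms of a representative whose traces are subtracted.
\<close>

subsection \<open>The star ring of finitely supported complex matrices\<close>

text \<open>A recursion on the dimension must return a smaller constant than it consumes. Squeezing
  \<open>B\<close> into a disc of radius \<open>d\<close> multiplies the cost of \<open>C\<close> by
  \<open>1 / d\<close>. Two equal blocks gain nothing: their discs have radius at most 1/2, and this
  factor 2 eats up the halving of the norm. Four discs of radius 2/5 fit around the points
  \<open>(3/5) * \<i> ^ k\<close>, and 5/2 times the quarter of the norm is 5/8; rounding of sizes
  raises 5/2 to 13/5, so 13/20 is the rate of contraction. Any other matrix has to be cut up. A cut
  with weight \<theta> multiplies the cost of the rest by \<open>1 / (1 - 3 * \<theta>)\<close> and
  adds \<open>1 / \<theta>\<close>; with weights proportional to the relative sizes of the pieces,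
  the product of all these factors is a small power of a bounded ratio of dimensions. What is left
  over at the end cannot be handed to the recursion alone, which would return the full constant
  \<open>K\<close>. It is solved together with the first piece, which is kept aside for this purpose
  and is small off few directions.\<close>

text \<open>All sizes live in one ring: the \<open>p \<times> q\<close> matrices are the \<open>A\<close> with \<open>un p * A = A = A * un q\<close>, and the
  vectors of length \<open>n\<close> are the \<open>n \<times> 1\<close> matrices.\<close>

typedef fmat = "{f :: nat \<Rightarrow> nat \<Rightarrow> complex. \<exists>N. \<forall>i j. N \<le> i \<or> N \<le> j \<longrightarrow> f i j = 0}"
  morphisms ent Fmat
  by (rule exI[of _ "\<lambda>_ _. 0"]) auto

lemma ent_bounded: obtains N where "\<And>i j. N \<le> i \<or> N \<le> j \<Longrightarrow> ent A i j = 0"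
  using ent[of A] by blast

lemma ent_Fmat: "(\<And>i j. N \<le> i \<or> N \<le> j \<Longrightarrow> f i j = 0) \<Longrightarrow> ent (Fmat f) = f"
  by (rule Fmat_inverse) blast

lemma fmat_eqI: "(\<And>i j. ent A i j = ent B i j) \<Longrightarrow> A = B"
  by (metis ent_inject ext)

lemma common_bound:
  obtains N where "\<And>i j. N \<le> i \<or> N \<le> j \<Longrightarrow> ent A i j = 0"
    "\<And>i j. N \<le> i \<or> N \<le> j \<Longrightarrow> ent B i j = 0" "\<And>i j. N \<le> i \<or> N \<le> j \<Longrightarrow> ent C i j = 0"
proof -
  obtain a b c where "\<And>i j. a \<le> i \<or> a \<le> j \<Longrightarrow> ent A i j = 0"
    "\<And>i j. b \<le> i \<or> b \<le> j \<Longrightarrow> ent B i j = 0" "\<And>i j. c \<le> i \<or> c \<le> j \<Longrightarrow> ent C i j = 0"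
    by (metis ent_bounded)
  then show ?thesis by (intro that[of "max a (max b c)"]) auto
qed

lemma ent_Fmat_pointwise:
  assumes "\<And>i j. ent A i j = 0 \<Longrightarrow> ent B i j = 0 \<Longrightarrow> ent A j i = 0 \<Longrightarrow> f i j = 0"
  shows "ent (Fmat f) = f"
  by (rule common_bound[of A B A], rule ent_Fmat, rule assms) auto

definition star :: "fmat \<Rightarrow> fmat" where "star A = Fmat (\<lambda>i j. cnj (ent A j i))"
definition cs :: "complex \<Rightarrow> fmat \<Rightarrow> fmat" where "cs c A = Fmat (\<lambda>i j. c * ent A i j)"
definition cnjm :: "fmat \<Rightarrow> fmat" where "cnjm A = Fmat (\<lambda>i j. cnj (ent A i j))"
definition un :: "nat \<Rightarrow> fmat" where "un n = Fmat (\<lambda>i j. if i = j \<and> i < n then 1 else 0)"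
definition eu :: "nat \<Rightarrow> nat \<Rightarrow> fmat" where "eu a b = Fmat (\<lambda>i j. if i = a \<and> j = b then 1 else 0)"
definition tr :: "fmat \<Rightarrow> complex" where "tr A = (\<Sum>i | ent A i i \<noteq> 0. ent A i i)"

instantiation fmat :: "{ab_group_add, times}"
begin
definition "0 = Fmat (\<lambda>_ _. 0)"
definition "A + B = Fmat (\<lambda>i j. ent A i j + ent B i j)"
definition "- A = Fmat (\<lambda>i j. - ent A i j)"
definition "(A :: fmat) - B = Fmat (\<lambda>i j. ent A i j - ent B i j)"
definition "A * B = Fmat (\<lambda>i j. \<Sum>k | ent A i k \<noteq> 0. ent A i k * ent B k j)"

lemma ent_0 [simp]: "ent 0 i j = 0"
  by (simp add: zero_fmat_def ent_Fmat)
lemma ent_add [simp]: "ent (A + B) i j = ent A i j + ent B i j"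
  unfolding plus_fmat_def by (subst ent_Fmat_pointwise[of A B]) auto
lemma ent_uminus [simp]: "ent (- A) i j = - ent A i j"
  unfolding uminus_fmat_def by (subst ent_Fmat_pointwise[of A A]) auto
lemma ent_diff [simp]: "ent (A - B) i j = ent A i j - ent B i j"
  unfolding minus_fmat_def by (subst ent_Fmat_pointwise[of A B]) auto

instance by standard (auto intro!: fmat_eqI)
end

lemma ent_star [simp]: "ent (star A) i j = cnj (ent A j i)"
  unfolding star_def by (subst ent_Fmat_pointwise[of A A]) auto
lemma ent_cs [simp]: "ent (cs c A) i j = c * ent A i j"
  unfolding cs_def by (subst ent_Fmat_pointwise[of A A]) auto
lemma ent_cnjm [simp]: "ent (cnjm A) i j = cnj (ent A i j)"
  unfolding cnjm_def by (subst ent_Fmat_pointwise[of A A]) auto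
lemma ent_un [simp]: "ent (un n) i j = (if i = j \<and> i < n then 1 else 0)"
  unfolding un_def by (subst ent_Fmat[of n]) auto
lemma ent_eu [simp]: "ent (eu a b) i j = (if i = a \<and> j = b then 1 else 0)"
  unfolding eu_def by (subst ent_Fmat[of "Suc (max a b)"]) auto
lemma ent_sum [simp]: "ent (sum f I) i j = (\<Sum>k\<in>I. ent (f k) i j)"
  by (induction I rule: infinite_finite_induct) auto

lemma ent_mult:
  assumes "\<And>k. N \<le> k \<Longrightarrow> ent A i k = 0"
  shows "ent (A * B) i j = (\<Sum>k<N. ent A i k * ent B k j)"
proof -
  have fin: "finite {k. ent A i k \<noteq> 0}" for i
    by (rule ent_bounded[of A]) (metis (mono_tags, lifting) bounded_nat_set_is_finite mem_Collect_eq not_le_imp_less)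
  have "ent (A * B) i j = (\<Sum>k | ent A i k \<noteq> 0. ent A i k * ent B k j)"
  proof -
    obtain M where M: "\<And>i j. M \<le> i \<or> M \<le> j \<Longrightarrow> ent A i j = 0" "\<And>i j. M \<le> i \<or> M \<le> j \<Longrightarrow> ent B i j = 0"
      using common_bound[of A B A] by metis
    show ?thesis unfolding times_fmat_def
      by (subst ent_Fmat[of M]) (auto simp: M)
  qed
  also have "\<dots> = (\<Sum>k<N. ent A i k * ent B k j)"
    using assms by (intro sum.mono_neutral_left) (auto simp: not_less fin intro: leI)
  finally show ?thesis .
qed

lemma ent_mult': 
  assumes "\<And>k. N \<le> k \<Longrightarrow> ent B k j = 0"
  shows "ent (A * B) i j = (\<Sum>k<N. ent A i k * ent B k j)"
proof -
  obtain M where M: "\<And>i j. M \<le> i \<or> M \<le> j \<Longrightarrow> ent A i j = 0" using ent_bounded[of A] by metis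
  have "ent (A * B) i j = (\<Sum>k<max M N. ent A i k * ent B k j)"
    by (rule ent_mult) (simp add: M)
  also have "\<dots> = (\<Sum>k<N. ent A i k * ent B k j)"
    using assms by (intro sum.mono_neutral_right) auto
  finally show ?thesis .
qed

instance fmat :: ring
proof
  fix A B C :: fmat
  obtain N where N: "\<And>i j. N \<le> i \<or> N \<le> j \<Longrightarrow> ent A i j = 0" "\<And>i j. N \<le> i \<or> N \<le> j \<Longrightarrow> ent B i j = 0"
    "\<And>i j. N \<le> i \<or> N \<le> j \<Longrightarrow> ent C i j = 0"
    using common_bound[of A B C] by metis
  have AB: "ent (A * X) i j = (\<Sum>k<N. ent A i k * ent X k j)" for i j X by (rule ent_mult) (simp add: N)
  have BC: "ent (B * X) i j = (\<Sum>k<N. ent B i k * ent X k j)" for i j X by (rule ent_mult) (simp add: N)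
  have XC: "ent (X * C) i j = (\<Sum>k<N. ent X i k * ent C k j)" for i j X by (rule ent_mult') (simp add: N)
  show "A * B * C = A * (B * C)"
  proof (rule fmat_eqI)
    fix i j
    have "ent (A * B * C) i j = (\<Sum>k<N. (\<Sum>l<N. ent A i l * ent B l k * ent C k j))"
      by (simp add: XC AB sum_distrib_right)
    also have "\<dots> = (\<Sum>l<N. (\<Sum>k<N. ent A i l * ent B l k * ent C k j))" by (rule sum.swap)
    finally show "ent (A * B * C) i j = ent (A * (B * C)) i j"
      by (simp add: AB XC sum_distrib_left mult.assoc)
  qed
  show "(A + B) * C = A * C + B * C"
    by (rule fmat_eqI) (simp add: XC sum.distrib algebra_simps)
  show "A * (B + C) = A * B + A * C"
    by (rule fmat_eqI) (simp add: AB sum.distrib algebra_simps)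
qed

lemma star_star [simp]: "star (star A) = A" by (rule fmat_eqI) simp
lemma star_add [simp]: "star (A + B) = star A + star B" by (rule fmat_eqI) simp
lemma star_diff [simp]: "star (A - B) = star A - star B" by (rule fmat_eqI) simp
lemma star_uminus [simp]: "star (- A) = - star A" by (rule fmat_eqI) simp
lemma star_0 [simp]: "star 0 = 0" by (rule fmat_eqI) simp
lemma star_cs [simp]: "star (cs c A) = cs (cnj c) (star A)" by (rule fmat_eqI) simp
lemma star_un [simp]: "star (un n) = un n" by (rule fmat_eqI) auto
lemma star_eu [simp]: "star (eu a b) = eu b a" by (rule fmat_eqI) auto
lemma star_sum [simp]: "star (sum f I) = (\<Sum>k\<in>I. star (f k))" by (rule fmat_eqI) simp
lemma star_mult [simp]: "star (A * B) = star B * star A"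
proof (rule fmat_eqI)
  fix i j
  obtain N where N: "\<And>i j. N \<le> i \<or> N \<le> j \<Longrightarrow> ent A i j = 0" using ent_bounded[of A] by metis
  show "ent (star (A * B)) i j = ent (star B * star A) i j"
    by (subst ent_mult'[of N], simp add: N) (simp add: ent_mult[of N] N mult.commute)
qed

lemma cnjm_cnjm [simp]: "cnjm (cnjm A) = A" by (rule fmat_eqI) simp
lemma cnjm_add [simp]: "cnjm (A + B) = cnjm A + cnjm B" by (rule fmat_eqI) simp
lemma cnjm_diff [simp]: "cnjm (A - B) = cnjm A - cnjm B" by (rule fmat_eqI) simp
lemma cnjm_cs [simp]: "cnjm (cs c A) = cs (cnj c) (cnjm A)" by (rule fmat_eqI) simp
lemma cnjm_0 [simp]: "cnjm 0 = 0" by (rule fmat_eqI) simp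
lemma cnjm_un [simp]: "cnjm (un n) = un n" by (rule fmat_eqI) auto
lemma cnjm_eu [simp]: "cnjm (eu a b) = eu a b" by (rule fmat_eqI) auto
lemma cnjm_sum [simp]: "cnjm (sum f I) = (\<Sum>k\<in>I. cnjm (f k))" by (rule fmat_eqI) simp
lemma cnjm_star: "cnjm (star A) = star (cnjm A)" by (rule fmat_eqI) simp
lemma cnjm_mult [simp]: "cnjm (A * B) = cnjm A * cnjm B"
proof (rule fmat_eqI)
  fix i j
  obtain N where N: "\<And>i j. N \<le> i \<or> N \<le> j \<Longrightarrow> ent A i j = 0" using ent_bounded[of A] by metis
  show "ent (cnjm (A * B)) i j = ent (cnjm A * cnjm B) i j"
    by (subst ent_mult[of N], simp add: N) (simp add: ent_mult[of N] N)
qed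

lemma cs_mult_left [simp]: "cs c A * B = cs c (A * B)"
proof (rule fmat_eqI)
  fix i j
  obtain N where N: "\<And>i j. N \<le> i \<or> N \<le> j \<Longrightarrow> ent A i j = 0" using ent_bounded[of A] by metis
  show "ent (cs c A * B) i j = ent (cs c (A * B)) i j"
    by (subst ent_mult[of N], simp add: N) (simp add: ent_mult[of N] N sum_distrib_left mult.assoc)
qed
lemma cs_mult_right [simp]: "A * cs c B = cs c (A * B)"
  using cs_mult_left[of "cnj c" "star B" "star A"] by (metis star_mult star_star star_cs complex_cnj_cnj)
lemma cs_cs [simp]: "cs c (cs d A) = cs (c * d) A" by (rule fmat_eqI) simp
lemma cs_add: "cs c (A + B) = cs c A + cs c B" by (rule fmat_eqI) (simp add: algebra_simps)
lemma cs_diff: "cs c (A - B) = cs c A - cs c B" by (rule fmat_eqI) (simp add: algebra_simps)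
lemma cs_add_left: "cs (c + d) A = cs c A + cs d A" by (rule fmat_eqI) (simp add: algebra_simps)
lemma cs_diff_left: "cs (c - d) A = cs c A - cs d A" by (rule fmat_eqI) (simp add: algebra_simps)
lemma cs_0 [simp]: "cs 0 A = 0" "cs c 0 = 0" by (auto intro: fmat_eqI)
lemma cs_1 [simp]: "cs 1 A = A" by (rule fmat_eqI) simp
lemma cs_minus: "cs (- c) A = - cs c A" "cs c (- A) = - cs c A" by (auto intro: fmat_eqI)

lemma ent_un_mult [simp]: "ent (un n * A) i j = (if i < n then ent A i j else 0)"
  by (subst ent_mult[of n]) (auto simp: if_distrib[of "\<lambda>x. x * _"] cong: if_cong)
lemma ent_mult_un [simp]: "ent (A * un n) i j = (if j < n then ent A i j else 0)"
  by (subst ent_mult'[of n]) (auto simp: if_distrib cong: if_cong)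
lemma ent_eu_mult [simp]: "ent (eu a b * A) i j = (if i = a then ent A b j else 0)"
  by (subst ent_mult[of "Suc b"]) (auto simp: if_distrib[of "\<lambda>x. x * _"] cong: if_cong)
lemma ent_mult_eu [simp]: "ent (A * eu a b) i j = (if j = b then ent A i a else 0)"
  by (subst ent_mult'[of "Suc a"]) (auto simp: if_distrib cong: if_cong)

lemma un_un [simp]: "un m * un n = un (min m n)" by (rule fmat_eqI) auto
lemma eu_eu: "eu a b * eu c d = (if b = c then eu a d else 0)" by (rule fmat_eqI) auto
lemma un_eu [simp]: "un n * eu a b = (if a < n then eu a b else 0)" by (rule fmat_eqI) auto
lemma eu_un [simp]: "eu a b * un n = (if b < n then eu a b else 0)" by (rule fmat_eqI) auto
lemma un_0 [simp]: "un 0 = 0" by (rule fmat_eqI) auto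
lemma un_sum: "un n = (\<Sum>i<n. eu i i)"
  by (rule fmat_eqI) (auto simp: if_distrib cong: if_cong intro!: sum.neutral)

lemma tr_bound:
  assumes "\<And>i. N \<le> i \<Longrightarrow> ent A i i = 0" shows "tr A = (\<Sum>i<N. ent A i i)"
  unfolding tr_def using assms by (intro sum.mono_neutral_left) (auto simp: not_less intro: leI)

lemma tr_add: "tr (A + B) = tr A + tr B"
proof -
  obtain N where N: "\<And>i j. N \<le> i \<or> N \<le> j \<Longrightarrow> ent A i j = 0" "\<And>i j. N \<le> i \<or> N \<le> j \<Longrightarrow> ent B i j = 0"
    using common_bound[of A B A] by metis
  show ?thesis by (simp add: tr_bound[of N] N sum.distrib)
qed
lemma tr_0 [simp]: "tr 0 = 0" by (simp add: tr_def)
lemma tr_cs [simp]: "tr (cs c A) = c * tr A"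
proof -
  obtain N where N: "\<And>i j. N \<le> i \<or> N \<le> j \<Longrightarrow> ent A i j = 0" using ent_bounded[of A] by metis
  show ?thesis by (simp add: tr_bound[of N] N sum_distrib_left)
qed
lemma tr_uminus: "tr (- A) = - tr A" using tr_cs[of "-1" A] by (simp add: cs_minus)
lemma tr_diff: "tr (A - B) = tr A - tr B"
  using tr_add[of A "- B"] by (simp add: tr_uminus)
lemma tr_sum: "tr (sum f I) = (\<Sum>k\<in>I. tr (f k))"
  by (induction I rule: infinite_finite_induct) (auto simp: tr_add)
lemma tr_star: "tr (star A) = cnj (tr A)"
proof -
  obtain N where N: "\<And>i j. N \<le> i \<or> N \<le> j \<Longrightarrow> ent A i j = 0" using ent_bounded[of A] by metis
  show ?thesis by (simp add: tr_bound[of N] N)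
qed
lemma tr_cnjm: "tr (cnjm A) = cnj (tr A)"
proof -
  obtain N where N: "\<And>i j. N \<le> i \<or> N \<le> j \<Longrightarrow> ent A i j = 0" using ent_bounded[of A] by metis
  show ?thesis by (simp add: tr_bound[of N] N)
qed
lemma tr_un [simp]: "tr (un n) = of_nat n" by (subst tr_bound[of n]) auto

lemma tr_mult_bound:
  assumes "\<And>i j. N \<le> i \<or> N \<le> j \<Longrightarrow> ent A i j = 0" "\<And>i j. N \<le> i \<or> N \<le> j \<Longrightarrow> ent B i j = 0"
  shows "tr (A * B) = (\<Sum>i<N. \<Sum>j<N. ent A i j * ent B j i)"
  by (subst tr_bound[of N]) (auto simp: assms ent_mult[of N])

lemma tr_mult_commute: "tr (A * B) = tr (B * A)"
proof -
  obtain N where N: "\<And>i j. N \<le> i \<or> N \<le> j \<Longrightarrow> ent A i j = 0" "\<And>i j. N \<le> i \<or> N \<le> j \<Longrightarrow> ent B i j = 0"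
    using common_bound[of A B A] by metis
  show ?thesis 
    by (simp add: tr_mult_bound[OF N] tr_mult_bound[OF N(2,1)] mult.commute) (rule sum.swap)
qed

text \<open>The class norm of \<^typ>\<open>fmat\<close> is the Hilbert--Schmidt norm, which on matrices with a single
  nonzero column is the Euclidean norm; the operator norm is the separate function \<open>opn\<close> below.\<close>

lemma Re_cnj_mult: "Re (cnj z * z) = (cmod z)\<^sup>2"
  by (simp add: cmod_power2) (simp add: power2_eq_square)

instantiation fmat :: real_inner
begin
definition "scaleR (r::real) A = cs (of_real r) A"
definition "inner A B = Re (tr (star A * B))"
definition "norm (A::fmat) = sqrt (inner A A)"
definition "sgn (A::fmat) = inverse (norm A) *\<^sub>R A"
definition "dist (A::fmat) B = norm (A - B)"
definition "(uniformity :: (fmat \<times> fmat) filter) = (INF e\<in>{0<..}. principal {(x, y). dist x y < e})"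
definition "open (U :: fmat set) = (\<forall>x\<in>U. \<forall>\<^sub>F (x', y) in uniformity. x' = x \<longrightarrow> y \<in> U)"

instance
proof
  fix A B C :: fmat and r s :: real and U :: "fmat set"
  show "r *\<^sub>R (A + B) = r *\<^sub>R A + r *\<^sub>R B" "(r + s) *\<^sub>R A = r *\<^sub>R A + s *\<^sub>R A"
    "r *\<^sub>R s *\<^sub>R A = (r * s) *\<^sub>R A" "1 *\<^sub>R A = A"
    by (simp_all add: scaleR_fmat_def cs_add cs_add_left)
  show "inner A B = inner B A"
    using tr_star[of "star A * B"] by (simp add: inner_fmat_def)
  show "inner (A + B) C = inner A C + inner B C"
    by (simp add: inner_fmat_def distrib_right tr_add)
  show "inner (r *\<^sub>R A) B = r * inner A B"
    by (simp add: inner_fmat_def scaleR_fmat_def)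
  obtain N where N: "\<And>i j. N \<le> i \<or> N \<le> j \<Longrightarrow> ent A i j = 0" using ent_bounded[of A] by metis
  have *: "inner A A = (\<Sum>i<N. \<Sum>j<N. (cmod (ent A j i))\<^sup>2)"
    unfolding inner_fmat_def
    by (subst tr_mult_bound[of N]) (auto simp: N Re_sum Re_cnj_mult simp del: times_complex.sel)
  show "0 \<le> inner A A" by (simp add: * sum_nonneg)
  show "(inner A A = 0) = (A = 0)"
  proof
    assume "inner A A = 0"
    then have "\<forall>i\<in>{..<N}. \<forall>j\<in>{..<N}. (cmod (ent A j i))\<^sup>2 = 0"
      unfolding * by (simp add: sum_nonneg_eq_0_iff sum_nonneg)
    then have "ent A i j = 0" for i j using N by (cases "i < N \<and> j < N") (auto simp: not_less)
    then show "A = 0" by (intro fmat_eqI) simp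
  qed (simp add: inner_fmat_def)
qed (simp_all add: norm_fmat_def sgn_fmat_def dist_fmat_def uniformity_fmat_def open_fmat_def)
end

lemma norm_sq: "(norm A)\<^sup>2 = Re (tr (star A * A))"
  by (simp add: power2_norm_eq_inner inner_fmat_def)

lemma tr_star_self: "tr (star A * A) = of_real ((norm A)\<^sup>2)"
proof -
  have "Im (tr (star A * A)) = 0" using tr_star[of "star A * A"] by (simp add: complex_eq_iff)
  then show ?thesis by (simp add: complex_eq_iff norm_sq)
qed

lemma norm_star [simp]: "norm (star A) = norm A"
  using norm_sq[of A] norm_sq[of "star A"]
  by (metis norm_ge_zero power2_eq_imp_eq star_star tr_mult_commute)

lemma norm_cs [simp]: "norm (cs c A) = cmod c * norm A"
proof -
  have "cnj c * c = of_real ((cmod c)\<^sup>2)" by (metis complex_norm_square mult.commute)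
  moreover have "tr (star (cs c A) * cs c A) = cnj c * c * tr (star A * A)"
    by (simp add: mult.commute)
  ultimately have "tr (star (cs c A) * cs c A) = of_real ((cmod c)\<^sup>2) * of_real ((norm A)\<^sup>2)"
    by (simp only: tr_star_self)
  then have "(norm (cs c A))\<^sup>2 = (cmod c * norm A)\<^sup>2"
    unfolding norm_sq by (metis Re_complex_of_real norm_sq of_real_mult power_mult_distrib)
  then show ?thesis by (simp add: power2_eq_iff_nonneg)
qed

text \<open>The complex Hilbert--Schmidt pairing with real part \<open>inner\<close>, conjugate
  linear in the first argument. On vectors it is the usual inner product.\<close>

definition cip :: "fmat \<Rightarrow> fmat \<Rightarrow> complex" where "cip A B = tr (star A * B)"

text \<open>A phase \<open>u\<close> makes the pairing of \<open>A\<close> with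
  \<open>cs u B\<close> real and nonnegative, which reduces the claim to the real Cauchy--Schwarz
  inequality of \<open>inner\<close>.\<close>

lemma cip_bound: "cmod (cip A B) \<le> norm A * norm B"
proof -
  obtain u where u: "cmod u = 1" "u * cip A B = of_real (cmod (cip A B))"
  proof (cases "cip A B = 0")
    case False
    show ?thesis
      by (rule that[of "cnj (cip A B) / of_real (cmod (cip A B))"])
        (use False in \<open>auto simp: norm_divide complex_norm_square[symmetric] field_simps power2_eq_square\<close>)
  qed (auto intro: that[of 1])
  have "cmod (cip A B) = inner A (cs u B)"
    using u(2) by (simp add: inner_fmat_def cip_def)
  also have "\<dots> \<le> norm A * norm (cs u B)" by (rule norm_cauchy_schwarz)
  finally show ?thesis by (simp add: u)
qed

lemma cip_add_right: "cip A (B + C) = cip A B + cip A C" by (simp add: cip_def algebra_simps tr_add)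
lemma cip_add_left: "cip (A + B) C = cip A C + cip B C" by (simp add: cip_def algebra_simps tr_add)
lemma cip_diff_right: "cip A (B - C) = cip A B - cip A C" by (simp add: cip_def algebra_simps tr_diff)
lemma cip_diff_left: "cip (A - B) C = cip A C - cip B C" by (simp add: cip_def algebra_simps tr_diff)
lemma cip_cs_right [simp]: "cip A (cs c B) = c * cip A B" by (simp add: cip_def)
lemma cip_cs_left [simp]: "cip (cs c A) B = cnj c * cip A B" by (simp add: cip_def)
lemma cip_0 [simp]: "cip 0 A = 0" "cip A 0 = 0" by (simp_all add: cip_def)
lemma cip_sum_right: "cip A (sum f I) = (\<Sum>k\<in>I. cip A (f k))" by (simp add: cip_def sum_distrib_left tr_sum)
lemma cip_sum_left: "cip (sum f I) A = (\<Sum>k\<in>I. cip (f k) A)" by (simp add: cip_def sum_distrib_right tr_sum)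
lemma cip_star_mult: "cip (A * B) C = cip B (star A * C)" by (simp add: cip_def mult.assoc)
lemma cip_mult_right: "cip B (A * C) = cip (star A * B) C" by (simp add: cip_def mult.assoc)
lemma cip_commute: "cip A B = cnj (cip B A)" unfolding cip_def by (metis star_mult star_star tr_star)
lemma cip_self: "cip A A = of_real ((norm A)\<^sup>2)" by (simp add: cip_def tr_star_self)

subsection \<open>The operator norm\<close>

text \<open>Left multiplication by \<open>A\<close> treats the columns of \<open>X\<close>
  independently, so its norm with respect to the Hilbert--Schmidt norm is the usual operator norm;
  \<open>opn_vec_leI\<close> brings estimates back to vectors.\<close>

definition opb :: "fmat \<Rightarrow> real \<Rightarrow> bool" where
  "opb A c \<longleftrightarrow> 0 \<le> c \<and> (\<forall>X. norm (A * X) \<le> c * norm X)"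
definition opn :: "fmat \<Rightarrow> real" where "opn A = Inf {c. opb A c}"

lemma norm_sq_sum:
  assumes "\<And>i j. N \<le> i \<or> N \<le> j \<Longrightarrow> ent A i j = 0"
  shows "(norm A)\<^sup>2 = (\<Sum>i<N. \<Sum>j<N. (cmod (ent A j i))\<^sup>2)"
  unfolding norm_sq by (subst tr_mult_bound[of N]) (auto simp: assms Re_sum Re_cnj_mult simp del: times_complex.sel)

text \<open>Entrywise Cauchy--Schwarz. It provides one admissible constant, without which the
  infimum in \<open>opn\<close> would say nothing.\<close>

lemma norm_mult_le: "norm (A * X) \<le> norm A * norm (X::fmat)"
proof -
  obtain N where N: "\<And>i j. N \<le> i \<or> N \<le> j \<Longrightarrow> ent A i j = 0" "\<And>i j. N \<le> i \<or> N \<le> j \<Longrightarrow> ent X i j = 0"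
    using common_bound[of A X A] by metis
  have NAX: "ent (A * X) i j = 0" if "N \<le> i \<or> N \<le> j" for i j
    using that by (auto simp: ent_mult[of N] N)
  have 1: "(cmod (ent (A * X) j i))\<^sup>2 \<le> (\<Sum>k<N. (cmod (ent A j k))\<^sup>2) * (\<Sum>k<N. (cmod (ent X k i))\<^sup>2)" for i j
  proof -
    have "cmod (ent (A * X) j i) \<le> (\<Sum>k<N. cmod (ent A j k) * cmod (ent X k i))"
      by (simp add: ent_mult[of N] N norm_mult[symmetric] norm_sum)
    then have "(cmod (ent (A * X) j i))\<^sup>2 \<le> (\<Sum>k<N. cmod (ent A j k) * cmod (ent X k i))\<^sup>2"
      by (rule power_mono) simp
    also have "\<dots> \<le> (\<Sum>k<N. (cmod (ent A j k))\<^sup>2) * (\<Sum>k<N. (cmod (ent X k i))\<^sup>2)"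
      by (rule Cauchy_Schwarz_ineq_sum)
    finally show ?thesis .
  qed
  have "(norm (A * X))\<^sup>2 \<le> (\<Sum>i<N. \<Sum>j<N. (\<Sum>k<N. (cmod (ent A j k))\<^sup>2) * (\<Sum>k<N. (cmod (ent X k i))\<^sup>2))"
    by (subst norm_sq_sum[of N "A * X"]) (auto intro!: sum_mono 1 NAX)
  also have "\<dots> = (\<Sum>j<N. \<Sum>k<N. (cmod (ent A j k))\<^sup>2) * (\<Sum>i<N. \<Sum>k<N. (cmod (ent X k i))\<^sup>2)"
    by (subst sum.swap) (rule sum_product[symmetric])
  also have "(\<Sum>j<N. \<Sum>k<N. (cmod (ent A j k))\<^sup>2) = (norm A)\<^sup>2"
    by (subst norm_sq_sum[of N A]) (auto simp: N intro: sum.swap)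
  also have "(\<Sum>i<N. \<Sum>k<N. (cmod (ent X k i))\<^sup>2) = (norm X)\<^sup>2"
    by (subst norm_sq_sum[of N X]) (auto simp: N)
  finally have "(norm (A * X))\<^sup>2 \<le> (norm A * norm X)\<^sup>2" by (simp add: power_mult_distrib)
  then show ?thesis by (rule power2_le_imp_le) simp
qed

lemma opn_nonneg: "0 \<le> opn A"
  unfolding opn_def by (rule cInf_greatest) (auto simp: opb_def intro: exI[of _ "norm A"] norm_mult_le)

lemma opn_opb: "opb A (opn A)"
  unfolding opb_def
proof (intro conjI allI opn_nonneg)
  fix X
  show "norm (A * X) \<le> opn A * norm X"
  proof (cases "norm X = 0")
    case False
    have "norm (A * X) / norm X \<le> opn A" unfolding opn_def
      by (rule cInf_greatest)
        (use False in \<open>auto simp: opb_def divide_le_eq intro: exI[of _ "norm A"] norm_mult_le\<close>)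
    then show ?thesis using False by (simp add: divide_le_eq split: if_splits)
  qed simp
qed

lemma norm_mult_opn: "norm (A * X) \<le> opn A * norm X"
  using opn_opb[of A] by (simp add: opb_def)

lemma opn_leI: "0 \<le> c \<Longrightarrow> (\<And>X. norm (A * X) \<le> c * norm X) \<Longrightarrow> opn A \<le> c"
  unfolding opn_def by (intro cInf_lower) (auto simp: opb_def intro: bdd_belowI[of _ 0])

lemma opn_0 [simp]: "opn 0 = 0"
  using opn_leI[of 0 0] opn_nonneg[of 0] by simp

lemma opn_add: "opn (A + B) \<le> opn A + opn B"
proof (rule opn_leI)
  fix X have "norm ((A + B) * X) \<le> norm (A * X) + norm (B * X)" by (simp add: distrib_right norm_triangle_ineq)
  also have "\<dots> \<le> (opn A + opn B) * norm X"
    using norm_mult_opn[of A X] norm_mult_opn[of B X] by (simp add: distrib_right)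
  finally show "norm ((A + B) * X) \<le> (opn A + opn B) * norm X" .
qed (simp add: opn_nonneg)

lemma opn_mult: "opn (A * B) \<le> opn A * opn B"
proof (rule opn_leI)
  fix X have "norm (A * B * X) \<le> opn A * norm (B * X)" by (simp add: mult.assoc norm_mult_opn)
  also have "\<dots> \<le> opn A * (opn B * norm X)" by (intro mult_left_mono norm_mult_opn opn_nonneg)
  finally show "norm (A * B * X) \<le> opn A * opn B * norm X" by (simp add: mult.assoc)
qed (simp add: opn_nonneg)

lemma opn_cs [simp]: "opn (cs c A) = cmod c * opn A"
proof -
  have le: "opn (cs c A) \<le> cmod c * opn A" for c A
    by (rule opn_leI) (auto simp: opn_nonneg mult.assoc norm_mult_opn mult_left_mono)
  show ?thesis
  proof (cases "c = 0")
    case False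
    have "opn A = opn (cs (inverse c) (cs c A))" using False by simp
    also have "\<dots> \<le> cmod (inverse c) * opn (cs c A)" by (rule le)
    finally have "cmod c * opn A \<le> opn (cs c A)" using False by (simp add: norm_inverse norm_divide field_simps)
    then show ?thesis using le[of c A] by simp
  qed simp
qed

lemma opn_uminus [simp]: "opn (- A) = opn A" using opn_cs[of "-1" A] by (simp add: cs_minus)
lemma opn_diff: "opn (A - B) \<le> opn A + opn B" using opn_add[of A "- B"] by simp
lemma opn_sum: "opn (sum f I) \<le> (\<Sum>k\<in>I. opn (f k))"
proof (induction I rule: infinite_finite_induct)
  case (insert x F)
  then show ?case using opn_add[of "f x" "sum f F"] by simp
qed auto

lemma opn_star [simp]: "opn (star A) = opn A"
proof -
  have le: "opn (star A) \<le> opn A" for A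
  proof (rule opn_leI[OF opn_nonneg])
    fix X
    have "(norm (star A * X))\<^sup>2 = Re (cip X (A * (star A * X)))"
      by (simp add: norm_sq cip_def mult.assoc)
    also have "\<dots> \<le> norm X * norm (A * (star A * X))" 
      using cip_bound[of X "A * (star A * X)"] complex_Re_le_cmod order_trans by blast
    also have "\<dots> \<le> norm X * (opn A * norm (star A * X))" by (intro mult_left_mono norm_mult_opn) simp
    finally have "norm (star A * X) * norm (star A * X) \<le> (opn A * norm X) * norm (star A * X)"
      by (simp add: power2_eq_square ac_simps)
    then show "norm (star A * X) \<le> opn A * norm X"
      by (cases "norm (star A * X) = 0") (auto simp: opn_nonneg mult_le_cancel_right)
  qed
  show ?thesis using le[of A] le[of "star A"] by simp
qed

lemma opn_eq_0: "opn A = 0 \<Longrightarrow> A = 0"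
proof -
  assume "opn A = 0"
  obtain N where N: "\<And>i j. N \<le> i \<or> N \<le> j \<Longrightarrow> ent A i j = 0" using ent_bounded[of A] by metis
  then have "A * un N = A" by (intro fmat_eqI) (auto simp: not_less)
  with norm_mult_opn[of A "un N"] \<open>opn A = 0\<close> show "A = 0" by simp
qed

lemma cip_opn: "cmod (cip x (A * y)) \<le> opn A * norm x * norm y"
proof -
  have "cmod (cip x (A * y)) \<le> norm x * norm (A * y)" by (rule cip_bound)
  also have "\<dots> \<le> norm x * (opn A * norm y)" by (intro mult_left_mono norm_mult_opn) simp
  finally show ?thesis by (simp add: ac_simps)
qed

lemma norm_cnjm [simp]: "norm (cnjm A) = norm A"
proof -
  have "tr (star (cnjm A) * cnjm A) = cnj (tr (star A * A))"
    by (simp only: cnjm_star[symmetric] cnjm_mult[symmetric] tr_cnjm)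
  then have "(norm (cnjm A))\<^sup>2 = (norm A)\<^sup>2" by (simp only: norm_sq) simp
  then show ?thesis by (simp add: power2_eq_iff_nonneg)
qed

lemma opn_cnjm [simp]: "opn (cnjm A) = opn A"
proof -
  have le: "opn (cnjm A) \<le> opn A" for A
  proof (rule opn_leI[OF opn_nonneg])
    fix X show "norm (cnjm A * X) \<le> opn A * norm X"
      using norm_mult_opn[of A "cnjm X"] norm_cnjm[of "A * cnjm X"] by simp
  qed
  show ?thesis using le[of A] le[of "cnjm A"] by simp
qed

subsection \<open>Vectors, isometries and constraints\<close>

text \<open>Gaussian elimination: if equation \<open>e\<close> involves some unknown
  \<open>p\<close>, then \<open>p\<close> is eliminated from the other equations and recovered from
  \<open>e\<close> at the end. Perpendicular vectors, surjectivity of injective maps and the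
  eigenvalue count in \<open>halfplane_card_neg\<close> are all obtained from this.\<close>

lemma underdetermined:
  fixes a :: "'e \<Rightarrow> 'b \<Rightarrow> complex"
  assumes "finite I" "finite S" "card I < card S"
  shows "\<exists>x. (\<exists>k\<in>S. x k \<noteq> 0) \<and> (\<forall>k. k \<notin> S \<longrightarrow> x k = 0) \<and> (\<forall>i\<in>I. (\<Sum>k\<in>S. a i k * x k) = 0)"
  using assms
proof (induction I arbitrary: S a rule: finite_induct)
  case empty
  then obtain k where "k \<in> S" by fastforce
  then show ?case by (intro exI[of _ "\<lambda>j. if j = k then 1 else 0"]) auto
next
  case (insert e I)
  show ?case
  proof (cases "\<forall>k\<in>S. a e k = 0")
    case True
    have "card I < card S" using insert by simp
    from insert.IH[OF insert.prems(1) this, of a] True show ?thesis by auto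
  next
    case False
    then obtain p where p: "p \<in> S" "a e p \<noteq> 0" by blast
    define a' where "a' i k = a i k - a i p / a e p * a e k" for i k
    have "card I < card (S - {p})" using insert p by simp
    from insert.IH[OF _ this, of a'] insert.prems(1)
    obtain x where x: "\<exists>k\<in>S - {p}. x k \<noteq> 0" "\<And>k. k \<notin> S - {p} \<Longrightarrow> x k = 0"
      "\<And>i. i \<in> I \<Longrightarrow> (\<Sum>k\<in>S - {p}. a' i k * x k) = 0" by auto
    define t where "t = - (\<Sum>k\<in>S - {p}. a e k * x k) / a e p"
    define y where "y = x(p := t)"
    have sum_y: "(\<Sum>k\<in>S. b k * y k) = b p * t + (\<Sum>k\<in>S - {p}. b k * x k)" for b
      using insert.prems(1) p(1) by (subst sum.remove[of S p]) (auto simp: y_def intro!: sum.cong)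
    have "(\<Sum>k\<in>S. a e k * y k) = 0" using p by (simp add: sum_y t_def)
    moreover have "(\<Sum>k\<in>S. a i k * y k) = 0" if "i \<in> I" for i
    proof -
      have "0 = (\<Sum>k\<in>S - {p}. a i k * x k) - a i p / a e p * (\<Sum>k\<in>S - {p}. a e k * x k)"
        using x(3)[OF that] by (simp add: a'_def left_diff_distrib sum_subtractf sum_distrib_left mult.assoc)
      then show ?thesis by (simp add: sum_y t_def)
    qed
    moreover have "\<exists>k\<in>S. y k \<noteq> 0" using x(1) by (auto simp: y_def)
    moreover have "\<forall>k. k \<notin> S \<longrightarrow> y k = 0" using x(2) p by (auto simp: y_def)
    ultimately show ?thesis by (intro exI[of _ y]) auto
  qed
qed

definition cvec :: "nat \<Rightarrow> fmat \<Rightarrow> bool" where "cvec n x \<longleftrightarrow> un n * x = x \<and> x * eu 0 0 = x"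
definition cor :: "nat \<Rightarrow> nat \<Rightarrow> fmat \<Rightarrow> bool" where "cor p q A \<longleftrightarrow> un p * A = A \<and> A * un q = A"
text \<open>Isometries stand for the subspaces that are their ranges: the compression
  \<open>star V * A * V\<close> is again a matrix of size \<open>p\<close>, to which statements
  about that size apply. That the columns of \<open>V\<close> beyond \<open>p\<close> vanish
  follows, see \<open>isom_un\<close>.\<close>

definition isom :: "nat \<Rightarrow> nat \<Rightarrow> fmat \<Rightarrow> bool" where "isom n p V \<longleftrightarrow> star V * V = un p \<and> un n * V = V"
definition orth :: "nat \<Rightarrow> nat \<Rightarrow> (nat \<Rightarrow> fmat) \<Rightarrow> bool" where
  "orth n p x \<longleftrightarrow> (\<forall>i<p. cvec n (x i)) \<and> (\<forall>i<p. \<forall>j<p. cip (x i) (x j) = (if i = j then 1 else 0))"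
definition of_cols :: "nat \<Rightarrow> (nat \<Rightarrow> fmat) \<Rightarrow> fmat" where "of_cols p x = (\<Sum>i<p. x i * eu 0 i)"

lemma cvec_iff: "cvec n x \<longleftrightarrow> (\<forall>i j. n \<le> i \<or> j \<noteq> 0 \<longrightarrow> ent x i j = 0)"
proof
  assume "cvec n x"
  then show "\<forall>i j. n \<le> i \<or> j \<noteq> 0 \<longrightarrow> ent x i j = 0"
    unfolding cvec_def by (metis ent_mult_eu ent_un_mult not_less)
next
  assume "\<forall>i j. n \<le> i \<or> j \<noteq> 0 \<longrightarrow> ent x i j = 0"
  then show "cvec n x" unfolding cvec_def by (auto intro!: fmat_eqI simp: not_less)
qed

lemma cor_iff: "cor p q A \<longleftrightarrow> (\<forall>i j. p \<le> i \<or> q \<le> j \<longrightarrow> ent A i j = 0)"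
proof
  assume "cor p q A"
  then show "\<forall>i j. p \<le> i \<or> q \<le> j \<longrightarrow> ent A i j = 0"
    unfolding cor_def by (metis ent_mult_un ent_un_mult not_less)
next
  assume "\<forall>i j. p \<le> i \<or> q \<le> j \<longrightarrow> ent A i j = 0"
  then show "cor p q A" unfolding cor_def by (auto intro!: fmat_eqI simp: not_less)
qed

lemma cvec_add: "cvec n x \<Longrightarrow> cvec n y \<Longrightarrow> cvec n (x + y)" by (simp add: cvec_def algebra_simps)
lemma cvec_cs: "cvec n x \<Longrightarrow> cvec n (cs c x)" by (simp add: cvec_def)
lemma cvec_sum: "(\<And>i. i \<in> I \<Longrightarrow> cvec n (f i)) \<Longrightarrow> cvec n (sum f I)"
  by (simp add: cvec_def sum_distrib_left sum_distrib_right)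
lemma cvec_mult: "cor n p A \<Longrightarrow> cvec q x \<Longrightarrow> cvec n (A * x)"
  by (simp add: cvec_def cor_def mult.assoc[symmetric]) (simp add: mult.assoc)

lemma cor_0 [simp]: "cor p q 0" by (simp add: cor_def)
lemma cor_add: "cor p q A \<Longrightarrow> cor p q B \<Longrightarrow> cor p q (A + B)" by (simp add: cor_def algebra_simps)
lemma cor_diff: "cor p q A \<Longrightarrow> cor p q B \<Longrightarrow> cor p q (A - B)" by (simp add: cor_def algebra_simps)
lemma cor_cs: "cor p q A \<Longrightarrow> cor p q (cs c A)" by (simp add: cor_def)
lemma cor_sum: "(\<And>i. i \<in> I \<Longrightarrow> cor p q (f i)) \<Longrightarrow> cor p q (sum f I)"
  by (simp add: cor_def sum_distrib_left sum_distrib_right)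
lemma cor_mult: "cor p q A \<Longrightarrow> cor r s B \<Longrightarrow> cor p s (A * B)"
  by (simp add: cor_def mult.assoc[symmetric]) (simp add: mult.assoc)
lemma cor_star: "cor p q A \<Longrightarrow> cor q p (star A)"
  unfolding cor_def by (metis star_mult star_un)
lemma cor_un [simp]: "cor n n (un n)" by (simp add: cor_def)
lemma cor_cnjm: "cor p q A \<Longrightarrow> cor p q (cnjm A)" unfolding cor_def by (metis cnjm_mult cnjm_un)

text \<open>The difference \<open>D\<close> of the two sides satisfies \<open>star D * D = 0\<close>
  by expansion, and the Hilbert--Schmidt norm is definite.\<close>

lemma isom_un: "isom n p V \<Longrightarrow> V * un p = V"
proof -
  assume V: "isom n p V"
  have "star (V - V * un p) * (V - V * un p) = star V * V - star V * V * un p - un p * (star V * V) + un p * (star V * V) * un p"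
    by (simp add: algebra_simps)
  also have "\<dots> = 0" using V by (simp add: isom_def)
  finally have "(norm (V - V * un p))\<^sup>2 = 0" by (simp only: norm_sq tr_0) simp
  then show ?thesis by simp
qed

lemma isom_cor: "isom n p V \<Longrightarrow> cor n p V" using isom_un by (simp add: cor_def isom_def)
lemma cor_compress: "isom n p V \<Longrightarrow> isom m q W \<Longrightarrow> cor n m A \<Longrightarrow> cor p q (star V * A * W)"
  by (rule cor_mult[OF cor_mult[OF cor_star[OF isom_cor]] isom_cor])
lemma cor_expand: "isom n p V \<Longrightarrow> isom m q W \<Longrightarrow> cor p q A \<Longrightarrow> cor n m (V * A * star W)"
  by (rule cor_mult[OF cor_mult[OF isom_cor] cor_star[OF isom_cor]])
lemma isom_star_mult: "isom n p V \<Longrightarrow> star V * V = un p" by (simp add: isom_def)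
lemma isom_star_un: "isom n p V \<Longrightarrow> star V * un n = star V"
  unfolding isom_def by (metis star_mult star_un)
lemma isom_un_star: "isom n p V \<Longrightarrow> un p * star V = star V"
  using isom_un by (metis star_mult star_un)
lemma isom_self [simp]: "isom n n (un n)" by (simp add: isom_def)
lemma isom_rules:
  assumes "isom n p V"
  shows "star V * V = un p" "star V * (V * X) = un p * X" "un n * V = V" "un n * (V * X) = V * X"
    "V * un p = V" "V * (un p * X) = V * X" "un p * star V = star V" "un p * (star V * X) = star V * X"
    "star V * un n = star V" "star V * (un n * X) = star V * X"
  using isom_un[OF assms] isom_star_un[OF assms] isom_un_star[OF assms] assms[unfolded isom_def]
  by (simp_all add: mult.assoc[symmetric])

lemma cor_rules:
  assumes "cor p q A"
  shows "un p * A = A" "un p * (A * X) = A * X" "A * un q = A" "A * (un q * X) = A * X"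
  using assms by (simp_all add: cor_def mult.assoc[symmetric])

lemma cvec_rules:
  assumes "cvec n x"
  shows "un n * x = x" "un n * (x * X) = x * X" "x * eu 0 0 = x" "x * (eu 0 0 * X) = x * X"
    "star x * un n = star x" "star x * (un n * X) = star x * X"
proof -
  show 1: "un n * x = x" "x * eu 0 0 = x" using assms by (auto simp: cvec_def)
  then show "un n * (x * X) = x * X" "x * (eu 0 0 * X) = x * X" by (metis mult.assoc)+
  show "star x * un n = star x" using 1 by (metis star_mult star_un)
  then show "star x * (un n * X) = star x * X" by (metis mult.assoc)
qed

lemma perp_rule: "star V * W = 0 \<Longrightarrow> star V * (W * X) = 0"
  by (metis mult.assoc mult_zero_left)

lemma isom_0 [simp]: "isom n 0 0" by (simp add: isom_def)
lemma isom_mult: "isom n p V \<Longrightarrow> isom p q W \<Longrightarrow> isom n q (V * W)"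
  unfolding isom_def by (metis mult.assoc star_mult)

lemma opn_un_le: "opn (un n) \<le> 1"
proof (rule opn_leI)
  fix X :: fmat
  have un2: "un n * (un n * Y) = un n * Y" for Y by (simp add: mult.assoc[symmetric])
  have "star (X - un n * X) * (X - un n * X) = star X * X - star X * (un n * X)"
    "star X * (un n * X) = star (un n * X) * (un n * X)"
    by (simp_all add: ring_distribs mult.assoc un2)
  then have "Re (tr (star X * X)) - Re (tr (star (un n * X) * (un n * X))) = (norm (X - un n * X))\<^sup>2"
    by (simp only: norm_sq minus_complex.sel[symmetric] tr_diff[symmetric])
  then have "(norm (un n * X))\<^sup>2 \<le> (norm X)\<^sup>2" 
    using zero_le_power2[of "norm (X - un n * X)"] unfolding norm_sq[of X] norm_sq[of "un n * X"] by linarith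
  then have "norm (un n * X) \<le> norm X" by (rule power2_le_imp_le) simp
  then show "norm (un n * X) \<le> 1 * norm X" by simp
qed simp

lemma norm_isom_le: "isom n p V \<Longrightarrow> norm (V * X) \<le> norm X"
proof -
  assume V: "isom n p V"
  have "star (V * X) * (V * X) = star X * (star V * V) * X" by (simp add: mult.assoc)
  also have "\<dots> = star (un p * X) * (un p * X)"
    using V by (simp add: isom_def mult.assoc) (simp add: mult.assoc[symmetric])
  finally have "norm (V * X) = norm (un p * X)" by (metis norm_sq norm_ge_zero power2_eq_imp_eq)
  also have "\<dots> \<le> norm X"
    using norm_mult_opn[of "un p" X] opn_un_le[of p] by (meson dual_order.trans mult_left_le_one_le norm_ge_zero opn_nonneg)
  finally show ?thesis .
qed

lemma opn_isom: "isom n p V \<Longrightarrow> opn V \<le> 1"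
  by (rule opn_leI) (auto simp: norm_isom_le)

lemma norm_isom_vec: "isom n p V \<Longrightarrow> cvec p x \<Longrightarrow> norm (V * x) = norm x"
proof -
  assume V: "isom n p V" and x: "cvec p x"
  have "star (V * x) * (V * x) = star x * x"
    using isom_rules[OF V] cvec_rules[OF x] by (simp add: mult.assoc)
  then show ?thesis by (metis norm_sq norm_ge_zero power2_eq_imp_eq)
qed

lemma opn_sandwich: "isom n p V \<Longrightarrow> isom m q W \<Longrightarrow> opn (star V * A * W) \<le> opn A"
proof -
  assume V: "isom n p V" and W: "isom m q W"
  have "opn (star V * A * W) \<le> opn (star V) * opn A * opn W"
    by (meson mult_right_mono opn_mult opn_nonneg order_trans)
  also have "\<dots> \<le> 1 * opn A * 1"
    using opn_isom[OF V] opn_isom[OF W] by (intro mult_mono) (auto simp: opn_nonneg)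
  finally show ?thesis by simp
qed

lemma opn_sandwich': "isom n p V \<Longrightarrow> isom m q W \<Longrightarrow> opn (V * A * star W) \<le> opn A"
proof -
  assume V: "isom n p V" and W: "isom m q W"
  have "opn (V * A * star W) \<le> opn V * opn A * opn (star W)"
    by (meson mult_right_mono opn_mult opn_nonneg order_trans)
  also have "\<dots> \<le> 1 * opn A * 1"
    using opn_isom[OF V] opn_isom[OF W] by (intro mult_mono) (auto simp: opn_nonneg)
  finally show ?thesis by simp
qed

lemma cip_vec: "cvec n y \<Longrightarrow> cip u y = (\<Sum>k<n. cnj (ent u k 0) * ent y k 0)"
proof -
  assume y: "cvec n y"
  have *: "ent (star u * y) i j = (\<Sum>k<n. cnj (ent u k i) * ent y k j)" for i j
    by (subst ent_mult'[of n]) (use y in \<open>auto simp: cvec_iff\<close>)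
  show ?thesis unfolding cip_def 
    by (subst tr_bound[of 1]) (use y in \<open>auto simp: * cvec_iff\<close>)
qed

lemma star_vec_mult: "cvec n x \<Longrightarrow> cvec n y \<Longrightarrow> star x * y = cs (cip x y) (eu 0 0)"
  using cip_vec[of n y x]
  by (intro fmat_eqI, subst ent_mult'[of n]) (auto simp: cvec_iff intro!: sum.neutral)

lemma cvec_eu: "a < n \<Longrightarrow> cvec n (eu a 0)" by (simp add: cvec_def eu_eu)

lemma cvec_col: "cor n p V \<Longrightarrow> cvec n (V * eu i 0)"
  by (simp add: cvec_def cor_def mult.assoc[symmetric]) (simp add: mult.assoc eu_eu)

lemma orth_vec: "orth n p x \<Longrightarrow> i < p \<Longrightarrow> cvec n (x i)" by (simp add: orth_def)
lemma orth_cip: "orth n p x \<Longrightarrow> i < p \<Longrightarrow> j < p \<Longrightarrow> cip (x i) (x j) = (if i = j then 1 else 0)"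
  by (simp add: orth_def)
lemma orth_norm: "orth n p x \<Longrightarrow> i < p \<Longrightarrow> norm (x i) = 1"
proof -
  assume "orth n p x" "i < p"
  then have "complex_of_real ((norm (x i))\<^sup>2) = 1" by (simp add: cip_self[symmetric] orth_cip del: of_real_power)
  then have "(norm (x i))\<^sup>2 = 1" by (simp only: of_real_eq_1_iff)
  then show ?thesis by (metis abs_norm_cancel real_sqrt_abs real_sqrt_one)
qed

lemma of_cols_ent: "(\<And>j. j < p \<Longrightarrow> cvec n (x j)) \<Longrightarrow> ent (of_cols p x) a i = (if i < p then ent (x i) a 0 else 0)"
  unfolding of_cols_def by (auto simp: if_distrib cong: if_cong intro!: sum.neutral)

lemma of_cols_compress:
  assumes "\<And>j. j < p \<Longrightarrow> cvec n (x j)" "\<And>j. j < q \<Longrightarrow> cvec m (y j)"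
  shows "ent (star (of_cols p x) * A * of_cols q y) i j = (if i < p \<and> j < q then cip (x i) (A * y j) else 0)"
proof -
  have "ent (star (of_cols p x) * A * of_cols q y) i j
     = (\<Sum>b<q. \<Sum>a<p. ent (eu a 0 * (star (x a) * A * y b) * eu 0 b) i j)"
    unfolding of_cols_def star_sum sum_distrib_left sum_distrib_right ent_sum
    by (intro sum.cong) (auto simp: mult.assoc)
  also have "\<dots> = (\<Sum>b<q. \<Sum>a<p. if b = j then (if a = i then ent (star (x a) * A * y b) 0 0 else 0) else 0)"
    by (intro sum.cong refl, subst mult.assoc) (simp, simp add: mult.assoc[symmetric])
  also have "\<dots> = (\<Sum>b<q. if b = j then (\<Sum>a<p. if a = i then ent (star (x a) * A * y b) 0 0 else 0) else 0)"
    by (intro sum.cong) auto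
  also have "\<dots> = (if i < p \<and> j < q then ent (star (x i) * A * y j) 0 0 else 0)"
    by simp
  also have "\<dots> = (if i < p \<and> j < q then cip (x i) (A * y j) else 0)"
  proof -
    have "ent (star (x i) * A * y j) 0 0 = cip (x i) (A * y j)" if "i < p" "j < q"
    proof -
      have "cip (x i) (A * y j) = tr (star (x i) * A * y j)" by (simp add: cip_def mult.assoc)
      also have "\<dots> = (\<Sum>k<1. ent (star (x i) * A * y j) k k)"
      proof (rule tr_bound)
        fix k :: nat assume "1 \<le> k"
        moreover have "y j = y j * eu 0 0" using assms(2)[OF that(2)] by (simp add: cvec_def)
        ultimately show "ent (star (x i) * A * y j) k k = 0"
          by (metis ent_mult_eu mult.assoc not_one_le_zero)
      qed
      finally show ?thesis by simp
    qed
    then show ?thesis by auto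
  qed
  finally show ?thesis .
qed

lemma cor_of_cols: "(\<And>j. j < p \<Longrightarrow> cvec n (x j)) \<Longrightarrow> cor n p (of_cols p x)"
  unfolding cor_iff using of_cols_ent[of p n x] by (auto simp: cvec_iff)

lemma isom_of_cols: "orth n p x \<Longrightarrow> isom n p (of_cols p x)"
proof -
  assume x: "orth n p x"
  then have v: "\<And>j. j < p \<Longrightarrow> cvec n (x j)" by (simp add: orth_def)
  then have c: "cor n p (of_cols p x)" by (rule cor_of_cols)
  have "star (of_cols p x) * of_cols p x = star (of_cols p x) * un n * of_cols p x"
    using c by (simp add: cor_def mult.assoc)
  also have "\<dots> = un p"
    by (rule fmat_eqI, subst of_cols_compress[OF v v]) (use x v in \<open>auto simp: orth_def cvec_rules\<close>)
  finally show ?thesis using c by (simp add: isom_def cor_def)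
qed

lemma isom_cip: "isom n p V \<Longrightarrow> cvec p x \<Longrightarrow> cip (V * x) (V * y) = cip x y"
proof -
  assume V: "isom n p V" and x: "cvec p x"
  have "star (V * x) * (V * y) = star x * y"
    using isom_rules[OF V] cvec_rules[OF x] by (simp add: mult.assoc)
  then show ?thesis by (simp add: cip_def)
qed

lemma orth_isom: "isom n p V \<Longrightarrow> orth n p (\<lambda>i. V * eu i 0)"
  unfolding orth_def
  by (auto simp: isom_cip cvec_eu cvec_col isom_cor)
    (auto simp: cip_def eu_eu tr_bound[of 1] intro: cvec_col isom_cor)

lemma orth_isom_mult: "isom n p V \<Longrightarrow> orth p q x \<Longrightarrow> orth n q (\<lambda>i. V * x i)"
  unfolding orth_def using isom_cip cvec_mult isom_cor by metis

lemma exists_unit_perp: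
  assumes "finite I" "card I < n"
  shows "\<exists>x. cvec n x \<and> norm x = 1 \<and> (\<forall>i\<in>I. cip (u i) x = 0)"
proof -
  obtain f :: "nat \<Rightarrow> complex" where f: "\<exists>k\<in>{..<n}. f k \<noteq> 0" "\<And>k. k \<notin> {..<n} \<Longrightarrow> f k = 0"
    "\<And>i. i \<in> I \<Longrightarrow> (\<Sum>k<n. cnj (ent (u i) k 0) * f k) = 0"
    using underdetermined[of I "{..<n}" "\<lambda>i k. cnj (ent (u i) k 0)"] assms by auto
  define y where "y = Fmat (\<lambda>i j. if j = 0 then f i else 0)"
  have ent_y: "ent y i j = (if j = 0 then f i else 0)" for i j
    unfolding y_def by (subst ent_Fmat[of "Suc n"]) (auto intro!: f(2))
  have y: "cvec n y" by (auto simp: cvec_iff ent_y intro!: f(2))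
  have "y \<noteq> 0" using f(1) ent_y by (metis ent_0)
  then have "norm (cs (of_real (inverse (norm y))) y) = 1" by (simp add: norm_inverse)
  moreover have "cip (u i) y = 0" if "i \<in> I" for i using f(3)[OF that] by (simp add: cip_vec[OF y] ent_y)
  ultimately show ?thesis using y by (intro exI[of _ "cs (of_real (inverse (norm y))) y"]) (simp add: cvec_cs)
qed

lemma orth_extend:
  assumes "orth n p x" "cvec n y" "norm y = 1" "\<And>i. i < p \<Longrightarrow> cip (x i) y = 0"
  shows "orth n (Suc p) (x(p := y))"
proof -
  have "cip y (x i) = 0" if "i < p" for i using assms(4)[OF that] cip_commute[of y "x i"] by simp
  then show ?thesis using assms by (auto simp: orth_def less_Suc_eq cip_self)
qed

lemma exists_orth:
  assumes "finite I" "card I + p \<le> n"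
  shows "\<exists>x. orth n p x \<and> (\<forall>i\<in>I. \<forall>j<p. cip (u i) (x j) = 0)"
  using assms(2)
proof (induction p)
  case 0
  then show ?case by (auto simp: orth_def)
next
  case (Suc p)
  then obtain x where x: "orth n p x" "\<And>i j. i \<in> I \<Longrightarrow> j < p \<Longrightarrow> cip (u i) (x j) = 0" by auto
  let ?u = "case_sum u x"
  have "card (I <+> {..<p}) < n" using assms(1) Suc by (simp add: card_Plus)
  then obtain y where y: "cvec n y" "norm y = 1" "\<And>i. i \<in> I <+> {..<p} \<Longrightarrow> cip (?u i) y = 0"
    using exists_unit_perp[of "I <+> {..<p}" n ?u] assms(1) by auto
  have "orth n (Suc p) (x(p := y))" 
    by (rule orth_extend[OF x(1) y(1,2)]) (use y(3)[of "Inr _"] in auto)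
  moreover have "cip (u i) y = 0" if "i \<in> I" for i using y(3)[of "Inl i"] that by auto
  ultimately show ?case using x(2)
    by (intro exI[of _ "x(p := y)"] conjI ballI allI impI) (auto simp: less_Suc_eq simp del: fun_upd_apply simp: fun_upd_def)
qed

lemma exists_isom:
  assumes "finite I" "card I + p \<le> n" "\<And>i. i \<in> I \<Longrightarrow> cvec n (u i)"
  shows "\<exists>V. isom n p V \<and> (\<forall>i\<in>I. star V * u i = 0)"
proof -
  obtain x where x: "orth n p x" "\<And>i j. i \<in> I \<Longrightarrow> j < p \<Longrightarrow> cip (u i) (x j) = 0"
    using exists_orth[of I p n u] assms by blast
  have "star (of_cols p x) * u i = 0" if "i \<in> I" for i
  proof -
    have "star (u i) * x j = 0" if "j < p" for j
      using x assms(3) \<open>i \<in> I\<close> that by (subst star_vec_mult[of n]) (auto simp: orth_def)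
    then have "star (u i) * of_cols p x = 0" by (simp add: of_cols_def sum_distrib_left mult.assoc[symmetric])
    then show ?thesis by (metis star_0 star_mult star_star)
  qed
  then show ?thesis using isom_of_cols[OF x(1)] by blast
qed

text \<open>Dimensions are read off from traces of projections: \<open>un n - V * star V\<close> is
  a projection of trace \<open>n - p\<close>, so \<open>p \<le> n\<close>; and the projection left
  over after removing the ranges of \<open>V\<close> and \<open>W\<close> has trace zero, hence
  vanishes.\<close>

lemma isom_complement:
  assumes "isom n p V"
  obtains W where "p \<le> n" "isom n (n - p) W" "star V * W = 0" "star W * V = 0"
    "V * star V + W * star W = un n"
proof -
  have le: "m \<le> n" if U: "isom n m U" for m U
  proof -
    have "star (un n - U * star U) * (un n - U * star U) = un n - U * star U"
      using isom_rules[OF U] by (simp add: ring_distribs mult.assoc)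
    then have "of_nat n - of_nat m = complex_of_real ((norm (un n - U * star U))\<^sup>2)"
      using isom_star_mult[OF U] by (simp add: tr_star_self[symmetric] tr_diff tr_mult_commute[of U] del: of_real_power)
    then have "real n - real m = (norm (un n - U * star U))\<^sup>2"
      by (metis of_real_diff of_real_eq_iff of_real_of_nat_eq)
    then show ?thesis by (smt (verit) of_nat_le_iff zero_le_power2)
  qed
  obtain W where W: "isom n (n - p) W" "\<forall>i\<in>{..<p}. star W * (V * eu i 0) = 0"
    using exists_isom[of "{..<p}" "n - p" n "\<lambda>i. V * eu i 0"] le[OF assms] cvec_col[OF isom_cor[OF assms]]
    by (metis card_lessThan finite_lessThan le_add_diff_inverse order_refl)
  have WV: "star W * V = 0"
  proof (rule fmat_eqI)
    fix i j
    have "ent (star W * V) i j = ent (star W * (V * eu j 0)) i 0" by (simp add: mult.assoc[symmetric])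
    moreover have "ent (star W * V) i j = 0" if "\<not> j < p"
      using cor_mult[OF cor_star[OF isom_cor[OF W(1)]] isom_cor[OF assms]] that by (simp add: cor_iff)
    ultimately show "ent (star W * V) i j = ent 0 i j" using W(2) by (cases "j < p") auto
  qed
  then have VW: "star V * W = 0" by (metis star_0 star_mult star_star)
  let ?Q = "un n - V * star V - W * star W"
  have "star ?Q * ?Q = ?Q"
    using perp_rule[OF WV] perp_rule[OF VW]
    by (simp add: ring_distribs mult.assoc isom_rules[OF assms] isom_rules[OF W(1)])
  moreover have "tr ?Q = 0"
    using assms W(1) le[OF assms] by (simp add: tr_diff tr_mult_commute[of V] tr_mult_commute[of W] isom_def)
  ultimately have "(norm ?Q)\<^sup>2 = 0" by (simp only: norm_sq) simp
  then show ?thesis using that[of W] le[OF assms] W(1) WV VW by (simp add: algebra_simps)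
qed

lemma norm_sq_cols:
  assumes "X * un N = X" shows "(norm X)\<^sup>2 = (\<Sum>j<N. (norm (X * eu j 0))\<^sup>2)"
proof -
  have "tr (star X * X) = (\<Sum>j<N. ent (star X * X) j j)"
    by (rule tr_bound) (metis assms ent_mult_un mult.assoc not_less)
  moreover have "tr (star (X * eu j 0) * (X * eu j 0)) = ent (star X * X) j j" for j
    by (subst tr_bound[of 1]) (auto simp: mult.assoc[symmetric], simp add: mult.assoc)
  ultimately show ?thesis by (simp add: norm_sq Re_sum)
qed

text \<open>The squared Hilbert--Schmidt norms of \<open>X\<close> and \<open>A * X\<close> are sums
  over columns, so a bound on vectors holds for every \<open>X\<close>.\<close>

lemma opn_vec_leI:
  assumes "0 \<le> c" "A * un n = A" "\<And>x. cvec n x \<Longrightarrow> norm (A * x) \<le> c * norm x"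
  shows "opn A \<le> c"
proof (rule opn_leI[OF assms(1)])
  fix X
  obtain N where N: "\<And>i j. N \<le> i \<or> N \<le> j \<Longrightarrow> ent X i j = 0" using ent_bounded[of X] by metis
  define Y where "Y = un n * X"
  have YN: "Y * un N = Y" unfolding Y_def by (rule fmat_eqI) (auto simp: N mult.assoc[symmetric] not_less)
  have "A * X = A * Y" unfolding Y_def by (simp add: mult.assoc[symmetric] assms(2))
  moreover have "(norm (A * Y))\<^sup>2 \<le> (c * norm Y)\<^sup>2"
  proof -
    have "cvec n (Y * eu j 0)" for j unfolding Y_def by (auto simp: cvec_iff mult.assoc)
    then have "(\<Sum>j<N. (norm (A * (Y * eu j 0)))\<^sup>2) \<le> (\<Sum>j<N. (c * norm (Y * eu j 0))\<^sup>2)"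
      by (intro sum_mono power_mono assms(3)) auto
    moreover have "(norm (A * Y))\<^sup>2 = (\<Sum>j<N. (norm (A * (Y * eu j 0)))\<^sup>2)"
      using norm_sq_cols[of "A * Y" N] YN by (simp add: mult.assoc)
    ultimately show ?thesis using norm_sq_cols[OF YN] by (simp add: power_mult_distrib sum_distrib_left)
  qed
  then have "norm (A * Y) \<le> c * norm Y" by (rule power2_le_imp_le) (simp add: assms(1))
  moreover have "norm Y \<le> norm X" unfolding Y_def 
    using norm_mult_opn[of "un n" X] opn_un_le[of n] by (meson dual_order.trans mult_left_le_one_le norm_ge_zero opn_nonneg)
  ultimately show "norm (A * X) \<le> c * norm X" using assms(1) by (metis dual_order.trans mult_left_mono)
qed

subsection \<open>Solving Sylvester equations and assembling commutators\<close>

text \<open>Surjectivity is an underdetermined system as well: the coefficient of \<open>X\<close>,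
  indexed by \<open>None\<close>, is an additional unknown besides the \<open>p * q\<close> entries
  of \<open>Y\<close>. Injectivity of \<open>L\<close> excludes a nontrivial solution in which that
  coefficient is zero.\<close>

lemma corner_inj_imp_surj:
  assumes add: "\<And>A B. L (A + B) = L A + L B" and scale: "\<And>c A. L (cs c A) = cs c (L A)"
    and cor: "\<And>A. cor p q A \<Longrightarrow> cor p q (L A)" and inj: "\<And>A. cor p q A \<Longrightarrow> L A = 0 \<Longrightarrow> A = 0"
    and X: "cor p q X"
  shows "\<exists>Y. cor p q Y \<and> L Y = X"
proof -
  let ?I = "{..<p} \<times> {..<q}"
  let ?S = "insert None (Some ` ?I)"
  define a where "a = (\<lambda>(i, j) k. case k of None \<Rightarrow> - ent X i j | Some (k, l) \<Rightarrow> ent (L (eu k l)) i j)"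
  have cS: "card ?I < card ?S" by (subst card_insert_disjoint) (auto simp: card_image)
  obtain x where x: "\<exists>k\<in>?S. x k \<noteq> 0" "\<And>i. i \<in> ?I \<Longrightarrow> (\<Sum>k\<in>?S. a i k * x k) = 0"
    using underdetermined[OF _ _ cS, of a] by auto
  define Y where "Y = (\<Sum>kl\<in>?I. cs (x (Some kl)) (eu (fst kl) (snd kl)))"
  have Lsum: "L (sum f J) = (\<Sum>k\<in>J. L (f k))" if "finite J" for f and J :: "(nat \<times> nat) set"
    using that by (induction J) (auto simp: add, metis add add_cancel_left_left)
  have cY: "cor p q Y" unfolding Y_def by (intro cor_sum cor_cs) (auto simp: cor_iff)
  have entY: "ent Y i j = x (Some (i, j))" if "i < p" "j < q" for i j
  proof -
    have "ent Y i j = (\<Sum>kl\<in>?I. if kl = (i, j) then x (Some kl) else 0)"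
      unfolding Y_def ent_sum by (intro sum.cong) auto
    then show ?thesis using that by (simp add: sum.delta)
  qed
  have LY: "L Y = cs (x None) X"
  proof (rule fmat_eqI)
    fix i j
    show "ent (L Y) i j = ent (cs (x None) X) i j"
    proof (cases "i < p \<and> j < q")
      case True
      have "(\<Sum>k\<in>?S. a (i, j) k * x k) = - ent X i j * x None + (\<Sum>kl\<in>?I. ent (L (eu (fst kl) (snd kl))) i j * x (Some kl))"
        by (subst sum.insert) (auto simp: sum.reindex a_def split_def)
      then have "(\<Sum>kl\<in>?I. x (Some kl) * ent (L (eu (fst kl) (snd kl))) i j) = x None * ent X i j"
        using x(2)[of "(i, j)"] True by (simp add: mult.commute)
      then show ?thesis by (simp add: Y_def Lsum scale)
    next
      case False
      then show ?thesis using cor[OF cY] X by (auto simp: cor_iff)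
    qed
  qed
  have "x None \<noteq> 0"
  proof
    assume "x None = 0"
    then have "Y = 0" using inj[OF cY] LY by simp
    then have "x (Some (i, j)) = 0" if "i < p" "j < q" for i j using entY[OF that] by simp
    then show False using x(1) \<open>x None = 0\<close> by auto
  qed
  then have "L (cs (inverse (x None)) Y) = X" by (simp add: scale LY)
  then show ?thesis using cY cor_cs by blast
qed

text \<open>\<open>B1\<close> and \<open>B2\<close> are scalars \<open>s1\<close>, \<open>s2\<close>
  plus perturbations of norm at most \<open>d1\<close> and \<open>d2\<close>. The scalars alone give
  \<open>s1 - s2\<close> times \<open>Y\<close>, so the gap yields the lower bound \<open>g\<close>
  for the Sylvester operator. This one bound gives injectivity, hence a solution, and also the
  estimate of its norm.\<close>

lemma sylvester:
  assumes B1: "cor p p B1" "opn (B1 - cs s1 (un p)) \<le> d1" and B2: "cor q q B2" "opn (B2 - cs s2 (un q)) \<le> d2"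
    and gap: "d1 + d2 + g \<le> cmod (s1 - s2)" "0 < g" and X: "cor p q X"
  shows "\<exists>Y. cor p q Y \<and> B1 * Y - Y * B2 = X \<and> opn Y \<le> opn X / g"
proof -
  have bound: "g * opn Y \<le> opn (B1 * Y - Y * B2)" if Y: "cor p q Y" for Y
  proof -
    let ?D1 = "B1 - cs s1 (un p)" and ?D2 = "B2 - cs s2 (un q)"
    have "cs (s1 - s2) Y = (B1 * Y - Y * B2) - ?D1 * Y + Y * ?D2"
      using Y by (simp add: algebra_simps cor_def cs_diff_left)
    then have "cmod (s1 - s2) * opn Y \<le> opn ((B1 * Y - Y * B2) - ?D1 * Y) + opn (Y * ?D2)"
      by (metis opn_add opn_cs)
    also have "\<dots> \<le> opn (B1 * Y - Y * B2) + opn (?D1 * Y) + opn (Y * ?D2)" using opn_diff by auto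
    also have "opn (?D1 * Y) \<le> d1 * opn Y"
      using opn_mult[of ?D1 Y] B1(2) by (meson mult_right_mono opn_nonneg order_trans)
    also have "opn (Y * ?D2) \<le> d2 * opn Y"
      using opn_mult[of Y ?D2] B2(2) by (metis mult.commute mult_left_mono opn_nonneg order_trans)
    finally have 1: "cmod (s1 - s2) * opn Y \<le> opn (B1 * Y - Y * B2) + d1 * opn Y + d2 * opn Y" by simp
    have "(d1 + d2 + g) * opn Y \<le> cmod (s1 - s2) * opn Y" by (intro mult_right_mono gap opn_nonneg)
    with 1 show ?thesis by (simp add: algebra_simps)
  qed
  have "\<exists>Y. cor p q Y \<and> B1 * Y - Y * B2 = X"
  proof (rule corner_inj_imp_surj[OF _ _ _ _ X])
    fix A assume A: "cor p q A"
    show "cor p q (B1 * A - A * B2)" using A B1(1) B2(1) by (intro cor_diff cor_mult)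
    assume "B1 * A - A * B2 = 0"
    with bound[OF A] have "opn A \<le> 0" using gap(2) by (simp add: mult_le_0_iff)
    then show "A = 0" using opn_nonneg[of A] by (intro opn_eq_0) simp
  qed (simp_all add: algebra_simps cs_diff)
  then obtain Y where "cor p q Y" "B1 * Y - Y * B2 = X" by blast
  with bound[of Y] gap(2) show ?thesis by (intro exI[of _ Y]) (auto simp: field_simps)
qed

lemma norm_sq_pythagoras:
  assumes "finite I" "\<And>i j. i \<in> I \<Longrightarrow> j \<in> I \<Longrightarrow> i \<noteq> j \<Longrightarrow> star (f i) * f j = 0"
  shows "(norm (\<Sum>i\<in>I. f i))\<^sup>2 = (\<Sum>i\<in>I. (norm (f i :: fmat))\<^sup>2)"
proof -
  have "star (\<Sum>i\<in>I. f i) * (\<Sum>i\<in>I. f i) = (\<Sum>i\<in>I. \<Sum>j\<in>I. star (f i) * f j)"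
    by (simp add: sum_distrib_left sum_distrib_right) (rule sum.swap)
  also have "\<dots> = (\<Sum>i\<in>I. \<Sum>j\<in>I. if j = i then star (f i) * f i else 0)"
    using assms(2) by (intro sum.cong) auto
  also have "\<dots> = (\<Sum>i\<in>I. star (f i) * f i)" using assms(1) by simp
  finally show ?thesis by (simp add: norm_sq tr_sum Re_sum)
qed

lemma power2_le_mult_imp_le: "(a::real)\<^sup>2 \<le> b * a \<Longrightarrow> 0 \<le> a \<Longrightarrow> 0 \<le> b \<Longrightarrow> a \<le> b"
  by (cases "a = 0") (auto simp: power2_eq_square mult_le_cancel_right)

text \<open>The outputs of the summands are orthogonal, and so are the projections of
  \<open>Z\<close> that they act on; the norm is therefore controlled by the largest block, and no
  factor counting the blocks appears.\<close>

lemma opn_direct_sum: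
  assumes "finite I" "\<And>i. i \<in> I \<Longrightarrow> isom n (p i) (V i)"
    "\<And>i j. i \<in> I \<Longrightarrow> j \<in> I \<Longrightarrow> i \<noteq> j \<Longrightarrow> star (V i) * V j = 0"
    "\<And>i. i \<in> I \<Longrightarrow> opn (X i) \<le> c" "0 \<le> c"
  shows "opn (\<Sum>i\<in>I. V i * X i * star (V i)) \<le> c"
proof (rule opn_leI[OF assms(5)])
  fix Z :: fmat
  have "(norm ((\<Sum>i\<in>I. V i * X i * star (V i)) * Z))\<^sup>2 = (norm (\<Sum>i\<in>I. V i * (X i * (star (V i) * Z))))\<^sup>2"
    by (simp add: sum_distrib_right mult.assoc)
  also have "\<dots> = (\<Sum>i\<in>I. (norm (V i * (X i * (star (V i) * Z))))\<^sup>2)"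
  proof (rule norm_sq_pythagoras[OF assms(1)])
    fix i j assume "i \<in> I" "j \<in> I" "i \<noteq> j"
    then have "star (V i) * (V j * R) = 0" for R using assms(3) by (metis mult.assoc mult_zero_left)
    then show "star (V i * (X i * (star (V i) * Z))) * (V j * (X j * (star (V j) * Z))) = 0"
      by (simp add: mult.assoc)
  qed
  also have "\<dots> \<le> (\<Sum>i\<in>I. (c * norm (star (V i) * Z))\<^sup>2)"
  proof (intro sum_mono power_mono)
    fix i assume i: "i \<in> I"
    have "norm (V i * (X i * (star (V i) * Z))) \<le> norm (X i * (star (V i) * Z))"
      using norm_isom_le[OF assms(2)[OF i]] .
    also have "\<dots> \<le> opn (X i) * norm (star (V i) * Z)" by (rule norm_mult_opn)
    also have "\<dots> \<le> c * norm (star (V i) * Z)" by (intro mult_right_mono assms(4)[OF i]) simp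
    finally show "norm (V i * (X i * (star (V i) * Z))) \<le> c * norm (star (V i) * Z)" .
  qed simp
  also have "\<dots> = c\<^sup>2 * (\<Sum>i\<in>I. (norm (star (V i) * Z))\<^sup>2)" by (simp add: power_mult_distrib sum_distrib_left)
  \<comment> \<open>Bessel's inequality: for the sum \<open>?P\<close> of the range projections the
    left side equals both \<open>(norm (?P * Z))\<^sup>2\<close> and the pairing of \<open>Z\<close>
    with \<open>?P * Z\<close>.\<close>
  also have "(\<Sum>i\<in>I. (norm (star (V i) * Z))\<^sup>2) \<le> (norm Z)\<^sup>2"
  proof -
    let ?P = "\<Sum>i\<in>I. V i * star (V i)"
    have PP: "(norm (?P * Z))\<^sup>2 = (\<Sum>i\<in>I. (norm (star (V i) * Z))\<^sup>2)"
    proof -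
      have "?P * Z = (\<Sum>i\<in>I. V i * (star (V i) * Z))" by (simp add: sum_distrib_right mult.assoc)
      moreover have "(norm (\<Sum>i\<in>I. V i * (star (V i) * Z)))\<^sup>2 = (\<Sum>i\<in>I. (norm (V i * (star (V i) * Z)))\<^sup>2)"
      proof (rule norm_sq_pythagoras[OF assms(1)])
        fix i j assume "i \<in> I" "j \<in> I" "i \<noteq> j"
        then have "star (V i) * (V j * R) = 0" for R using assms(3) by (metis mult.assoc mult_zero_left)
        then show "star (V i * (star (V i) * Z)) * (V j * (star (V j) * Z)) = 0" by (simp add: mult.assoc)
      qed
      moreover have "norm (V i * (star (V i) * Z)) = norm (star (V i) * Z)" if "i \<in> I" for i
      proof -
        have "star (V i * (star (V i) * Z)) * (V i * (star (V i) * Z)) = star Z * V i * (star (V i) * V i) * star (V i) * Z"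
          by (simp add: mult.assoc)
        also have "\<dots> = star (star (V i) * Z) * (star (V i) * Z)"
          using isom_rules[OF assms(2)[OF that]] by (simp add: mult.assoc)
        finally show ?thesis by (metis norm_sq norm_ge_zero power2_eq_imp_eq)
      qed
      ultimately show ?thesis by simp
    qed
    have "(\<Sum>i\<in>I. (norm (star (V i) * Z))\<^sup>2) = Re (cip Z (?P * Z))"
      by (simp add: cip_def sum_distrib_left sum_distrib_right tr_sum norm_sq mult.assoc)
    then have "(norm (?P * Z))\<^sup>2 \<le> norm Z * norm (?P * Z)"
      using cip_bound[of Z "?P * Z"] complex_Re_le_cmod[of "cip Z (?P * Z)"] PP by simp
    then have "norm (?P * Z) \<le> norm Z" by (rule power2_le_mult_imp_le) simp_all
    then show ?thesis by (simp add: PP[symmetric] power_mono del: norm_eq_zero)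
  qed
  finally have "(norm ((\<Sum>i\<in>I. V i * X i * star (V i)) * Z))\<^sup>2 \<le> (c * norm Z)\<^sup>2"
    by (simp add: power_mult_distrib mult_left_mono)
  then show "norm ((\<Sum>i\<in>I. V i * X i * star (V i)) * Z) \<le> c * norm Z"
    by (rule power2_le_imp_le) (simp add: assms(5))
qed

text \<open>For block diagonal \<open>B\<close> the equation \<open>A = B * D - D * B\<close>
  decouples into one equation for each block of \<open>D\<close>. The diagonal ones are solved by
  the given \<open>C i\<close>, the others are Sylvester equations. The diagonal costs only the
  maximum \<open>L\<close>; the off-diagonal blocks are counted crudely, at most
  \<open>r\<^sup>2\<close> of norm \<open>a / g\<close> each, which is affordable as an additive
  constant.\<close>

lemma assemble:
  fixes r :: nat
  assumes isom: "\<And>i. i < r \<Longrightarrow> isom n (p i) (V i)"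
    and perp: "\<And>i j. i < r \<Longrightarrow> j < r \<Longrightarrow> i \<noteq> j \<Longrightarrow> star (V i) * V j = 0"
    and compl: "(\<Sum>i<r. V i * star (V i)) = un n" and A: "cor n n A" "opn A \<le> a"
    and B: "\<And>i. i < r \<Longrightarrow> cor (p i) (p i) (B i)" "\<And>i. i < r \<Longrightarrow> opn (B i - cs (s i) (un (p i))) \<le> d i"
    and C: "\<And>i. i < r \<Longrightarrow> cor (p i) (p i) (C i)" "\<And>i. i < r \<Longrightarrow> opn (C i) \<le> L"
    and BC: "\<And>i. i < r \<Longrightarrow> star (V i) * A * V i = B i * C i - C i * B i"
    and disc: "\<And>i. i < r \<Longrightarrow> cmod (s i) + d i \<le> 1"
    and gap: "\<And>i j. i < r \<Longrightarrow> j < r \<Longrightarrow> i \<noteq> j \<Longrightarrow> d i + d j + g \<le> cmod (s i - s j)" "0 < g" "0 \<le> L"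
  shows "\<exists>D. cor n n D \<and> A = (\<Sum>i<r. V i * B i * star (V i)) * D - D * (\<Sum>i<r. V i * B i * star (V i)) \<and>
    opn D \<le> L + (real r)\<^sup>2 * a / g" and "cor n n (\<Sum>i<r. V i * B i * star (V i))"
    and "opn (\<Sum>i<r. V i * B i * star (V i)) \<le> 1"
proof -
  let ?B = "\<Sum>i<r. V i * B i * star (V i)"
  have a0: "0 \<le> a" using opn_nonneg[of A] A(2) by simp
  have ex: "\<exists>Y. (i = j \<longrightarrow> Y = C i) \<and> cor (p i) (p j) Y \<and> B i * Y - Y * B j = star (V i) * A * V j \<and>
      (i \<noteq> j \<longrightarrow> opn Y \<le> a / g)" if ij: "i < r" "j < r" for i j
  proof (cases "i = j")
    case True
    then show ?thesis using ij C(1) BC by auto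
  next
    case False
    have cX: "cor (p i) (p j) (star (V i) * A * V j)"
      by (rule cor_compress[OF isom isom A(1)]) (use ij in auto)
    obtain Y where "cor (p i) (p j) Y" "B i * Y - Y * B j = star (V i) * A * V j"
      "opn Y \<le> opn (star (V i) * A * V j) / g"
      using sylvester[OF B(1)[OF ij(1)] B(2)[OF ij(1)] B(1)[OF ij(2)] B(2)[OF ij(2)] gap(1)[OF ij False] gap(2) cX] by blast
    moreover have "opn (star (V i) * A * V j) / g \<le> a / g"
      using opn_sandwich[OF isom[OF ij(1)] isom[OF ij(2)], of A] A(2) gap(2) by (intro divide_right_mono) auto
    ultimately show ?thesis using False by (intro exI[of _ Y]) auto
  qed
  then obtain Y where Y: "\<And>i j. i < r \<Longrightarrow> j < r \<Longrightarrow> cor (p i) (p j) (Y i j)"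
    "\<And>i j. i < r \<Longrightarrow> j < r \<Longrightarrow> B i * Y i j - Y i j * B j = star (V i) * A * V j"
    "\<And>i. i < r \<Longrightarrow> Y i i = C i" "\<And>i j. i < r \<Longrightarrow> j < r \<Longrightarrow> i \<noteq> j \<Longrightarrow> opn (Y i j) \<le> a / g"
  proof -
    show thesis
      by (rule that[of "\<lambda>i j. SOME Y. (i = j \<longrightarrow> Y = C i) \<and> cor (p i) (p j) Y \<and>
        B i * Y - Y * B j = star (V i) * A * V j \<and> (i \<noteq> j \<longrightarrow> opn Y \<le> a / g)"])
        (use someI_ex[OF ex] in \<open>simp_all\<close>)
  qed
  let ?Z = "\<lambda>i j. V i * Y i j * star (V j)"
  define D where "D = (\<Sum>i<r. \<Sum>j<r. ?Z i j)"
  have BV: "?B * V j = V j * B j" if "j < r" for j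
  proof -
    have "?B * V j = (\<Sum>i<r. if i = j then V j * B j * (star (V j) * V j) else 0)"
      unfolding sum_distrib_right using that perp by (intro sum.cong) (auto simp: mult.assoc)
    also have "\<dots> = V j * B j * un (p j)" 
      using that isom_star_mult[OF isom[OF that]] by (subst sum.delta) auto
    also have "\<dots> = V j * B j" using B(1)[OF that] by (simp add: cor_def mult.assoc)
    finally show ?thesis .
  qed
  have VB: "star (V j) * ?B = B j * star (V j)" if "j < r" for j
  proof -
    have "star (V j) * ?B = (\<Sum>i<r. if i = j then star (V j) * V j * (B j * star (V j)) else 0)"
      unfolding sum_distrib_left using that perp by (intro sum.cong) (auto simp: mult.assoc[symmetric])
    also have "\<dots> = un (p j) * (B j * star (V j))" using that isom_star_mult[OF isom[OF that]] by simp
    also have "\<dots> = B j * star (V j)" using B(1)[OF that] by (simp add: cor_def mult.assoc[symmetric])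
    finally show ?thesis .
  qed
  have "X * D - D * X = (\<Sum>i<r. \<Sum>j<r. X * ?Z i j - ?Z i j * X)" for X
    unfolding D_def by (simp add: sum_distrib_left sum_distrib_right sum_subtractf)
  then have "?B * D - D * ?B = (\<Sum>i<r. \<Sum>j<r. ?B * ?Z i j - ?Z i j * ?B)" .
  also have "\<dots> = (\<Sum>i<r. \<Sum>j<r. V i * star (V i) * A * (V j * star (V j)))"
  proof (intro sum.cong refl)
    fix i j assume "i \<in> {..<r}" "j \<in> {..<r}"
    then have ij: "i < r" "j < r" by auto
    have "?B * ?Z i j - ?Z i j * ?B = (?B * V i) * Y i j * star (V j) - V i * Y i j * (star (V j) * ?B)"
      by (simp add: mult.assoc)
    also have "\<dots> = V i * (B i * Y i j - Y i j * B j) * star (V j)"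
      unfolding BV[OF ij(1)] VB[OF ij(2)] by (simp add: algebra_simps)
    finally show "?B * ?Z i j - ?Z i j * ?B = V i * star (V i) * A * (V j * star (V j))"
      using Y(2)[OF ij] by (simp add: mult.assoc)
  qed
  also have "\<dots> = (\<Sum>i<r. V i * star (V i)) * A * (\<Sum>i<r. V i * star (V i))"
    unfolding sum_distrib_left sum_distrib_right mult.assoc[of _ _ A, symmetric] by (rule sum.swap)
  also have "\<dots> = A" using A(1) by (simp add: compl cor_def)
  finally have AD: "A = ?B * D - D * ?B" by simp
  have cZ: "cor n n (?Z i j)" if "i < r" "j < r" for i j
    by (rule cor_expand[OF isom isom Y(1)]) (use that in auto)
  then have cD: "cor n n D" unfolding D_def by (intro cor_sum) auto
  have D_eq: "D = (\<Sum>i<r. V i * C i * star (V i)) + (\<Sum>i<r. \<Sum>j\<in>{..<r} - {i}. ?Z i j)"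
  proof -
    have "(\<Sum>j<r. ?Z i j) = V i * C i * star (V i) + (\<Sum>j\<in>{..<r} - {i}. ?Z i j)" if "i < r" for i
      using that Y(3) by (subst sum.remove[of _ i]) auto
    then show ?thesis unfolding D_def by (simp add: sum.distrib)
  qed
  have "opn D \<le> opn (\<Sum>i<r. V i * C i * star (V i)) + opn (\<Sum>i<r. \<Sum>j\<in>{..<r} - {i}. ?Z i j)"
    unfolding D_eq by (rule opn_add)
  also have "opn (\<Sum>i<r. V i * C i * star (V i)) \<le> L"
    by (rule opn_direct_sum[where n = n and p = p]) (use isom perp C(2) gap(3) in simp_all)
  also have "opn (\<Sum>i<r. \<Sum>j\<in>{..<r} - {i}. ?Z i j) \<le> (\<Sum>i<r. \<Sum>j\<in>{..<r} - {i}. a / g)"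
  proof (rule order_trans[OF opn_sum], rule sum_mono, rule order_trans[OF opn_sum], rule sum_mono)
    fix i j assume "i \<in> {..<r}" "j \<in> {..<r} - {i}"
    then show "opn (?Z i j) \<le> a / g"
      using opn_sandwich'[OF isom isom, of i j "Y i j"] Y(4)[of i j] by auto
  qed
  also have "\<dots> \<le> (\<Sum>i<r. \<Sum>j<r. a / g)" by (intro sum_mono sum_mono2) (use a0 gap(2) in auto)
  also have "\<dots> = (real r)\<^sup>2 * a / g" by (simp add: power2_eq_square)
  finally show "\<exists>D. cor n n D \<and> A = ?B * D - D * ?B \<and> opn D \<le> L + (real r)\<^sup>2 * a / g" using cD AD by auto
  show "cor n n ?B" by (rule cor_sum, rule cor_expand[OF isom isom B(1)]) auto
  show "opn ?B \<le> 1"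
  proof (rule opn_direct_sum[where n = n and p = p])
    fix i assume i: "i \<in> {..<r}"
    have "opn (B i) = opn ((B i - cs (s i) (un (p i))) + cs (s i) (un (p i)))" by simp
    also have "\<dots> \<le> opn (B i - cs (s i) (un (p i))) + opn (cs (s i) (un (p i)))" by (rule opn_add)
    also have "\<dots> \<le> d i + cmod (s i) * 1"
      using B(2)[of i] i opn_un_le[of "p i"] by (intro add_mono) (auto intro!: mult_left_le)
    also have "\<dots> \<le> 1" using disc[of i] i by simp
    finally show "opn (B i) \<le> 1" .
  qed (use isom perp in simp_all)
qed

subsection \<open>Commutator representations\<close>

text \<open>With \<open>B\<close> normalised to the unit ball, the norm of \<open>C\<close> is the
  only quantity left to follow; it is the cost of \<open>A\<close>.\<close>

definition Sol :: "nat \<Rightarrow> fmat \<Rightarrow> real \<Rightarrow> bool" where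
  "Sol n A L \<longleftrightarrow> (\<exists>B C. cor n n B \<and> cor n n C \<and> A = B * C - C * B \<and> opn B \<le> 1 \<and> opn C \<le> L)"
definition good :: "real \<Rightarrow> nat \<Rightarrow> bool" where
  "good K n \<longleftrightarrow> (\<forall>A. cor n n A \<longrightarrow> tr A = 0 \<longrightarrow> Sol n A (K * opn A))"

lemma Sol_mono: "Sol n A L \<Longrightarrow> L \<le> L' \<Longrightarrow> Sol n A L'"
  unfolding Sol_def using order_trans by blast
lemma Sol_nonneg: "Sol n A L \<Longrightarrow> 0 \<le> L"
  unfolding Sol_def using order_trans opn_nonneg by blast
lemma Sol_zero: "0 \<le> L \<Longrightarrow> Sol n 0 L"
  unfolding Sol_def by (intro exI[of _ 0]) auto
lemma Sol_cs: "Sol n A L \<Longrightarrow> Sol n (cs c A) (cmod c * L)"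
  unfolding Sol_def
proof (elim exE conjE)
  fix B C assume *: "cor n n B" "cor n n C" "A = B * C - C * B" "opn B \<le> 1" "opn C \<le> L"
  then show "\<exists>B C. cor n n B \<and> cor n n C \<and> cs c A = B * C - C * B \<and> opn B \<le> 1 \<and> opn C \<le> cmod c * L"
    by (intro exI[of _ B] exI[of _ "cs c C"]) (auto simp: cor_cs cs_diff mult_left_mono)
qed

text \<open>Adding a scalar to \<open>B\<close> does not affect the commutator, and a factor
  \<open>d\<close> can be moved from \<open>B\<close> to \<open>C\<close>: the price of a disc of
  radius \<open>d\<close> is \<open>1 / d\<close>.\<close>

lemma Sol_scale_disc:
  assumes "Sol n A L" "0 < d"
  shows "\<exists>B C. cor n n B \<and> cor n n C \<and> A = B * C - C * B \<and> opn (B - cs s (un n)) \<le> d \<and> opn C \<le> L / d"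
proof -
  obtain B C where *: "cor n n B" "cor n n C" "A = B * C - C * B" "opn B \<le> 1" "opn C \<le> L"
    using assms(1) unfolding Sol_def by blast
  let ?B = "cs s (un n) + cs (of_real d) B" and ?C = "cs (of_real (1 / d)) C"
  have "?B * ?C - ?C * ?B = cs (of_real (1/d) * s) (un n * C - C * un n) + cs (of_real d * of_real (1/d)) (B * C - C * B)"
    by (simp add: ring_distribs cs_add cs_diff mult.commute)
  also have "\<dots> = A" using assms(2) * by (simp add: cor_def)
  finally have A: "A = ?B * ?C - ?C * ?B" by (rule sym)
  have "opn (?B - cs s (un n)) \<le> d" using * assms(2) by (simp add: mult_left_le)
  moreover have "opn ?C \<le> L / d" using * assms(2) by (simp add: divide_right_mono norm_divide)
  moreover have "cor n n ?B" "cor n n ?C" using * by (auto intro!: cor_add cor_cs)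
  ultimately show ?thesis using A by blast
qed

lemma assemble_Sol:
  fixes r :: nat
  assumes isom: "\<And>i. i < r \<Longrightarrow> isom n (p i) (V i)"
    and perp: "\<And>i j. i < r \<Longrightarrow> j < r \<Longrightarrow> i \<noteq> j \<Longrightarrow> star (V i) * V j = 0"
    and compl: "(\<Sum>i<r. V i * star (V i)) = un n" and A: "cor n n A" "opn A \<le> a"
    and Sol: "\<And>i. i < r \<Longrightarrow> Sol (p i) (star (V i) * A * V i) (L i)"
    and disc: "\<And>i. i < r \<Longrightarrow> 0 < d i" "\<And>i. i < r \<Longrightarrow> cmod (s i) + d i \<le> 1"
    and gap: "\<And>i j. i < r \<Longrightarrow> j < r \<Longrightarrow> i \<noteq> j \<Longrightarrow> d i + d j + g \<le> cmod (s i - s j)" "0 < g"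
    and L: "\<And>i. i < r \<Longrightarrow> L i / d i \<le> M" "0 \<le> M"
  shows "Sol n A (M + (real r)\<^sup>2 * a / g)"
proof -
  have "\<exists>B C. cor (p i) (p i) B \<and> cor (p i) (p i) C \<and> star (V i) * A * V i = B * C - C * B \<and>
    opn (B - cs (s i) (un (p i))) \<le> d i \<and> opn C \<le> L i / d i" if "i < r" for i
    using Sol_scale_disc[OF Sol[OF that] disc(1)[OF that]] .
  then obtain B C where BC: "\<And>i. i < r \<Longrightarrow> cor (p i) (p i) (B i)" "\<And>i. i < r \<Longrightarrow> cor (p i) (p i) (C i)"
    "\<And>i. i < r \<Longrightarrow> star (V i) * A * V i = B i * C i - C i * B i"
    "\<And>i. i < r \<Longrightarrow> opn (B i - cs (s i) (un (p i))) \<le> d i" "\<And>i. i < r \<Longrightarrow> opn (C i) \<le> L i / d i"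
    by metis
  have C: "opn (C i) \<le> M" if "i < r" for i using BC(5)[OF that] L(1)[OF that] by linarith
  note ass = assemble[OF isom perp compl A BC(1,4,2) C BC(3) disc(2) gap L(2)]
  show ?thesis unfolding Sol_def using ass by blast
qed

lemma tr_split:
  assumes "cor n n A" "V * star V + W * star W = un n"
  shows "tr (star V * A * V) + tr (star W * A * W) = tr A"
proof -
  have "tr (star V * A * V) = tr (A * (V * star V))" for V by (metis mult.assoc tr_mult_commute)
  then have "tr (star V * A * V) + tr (star W * A * W) = tr (A * (V * star V + W * star W))"
    by (simp add: ring_distribs tr_add)
  then show ?thesis using assms by (simp add: cor_def)
qed

text \<open>The two discs have the diameters [-1, 1 - 6t] and [1 - 2t, 1], that is, radii
  \<open>1 - 3 * t\<close> and \<open>t\<close> and distance \<open>4 * t\<close>, so the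
  off-diagonal blocks cost \<open>4 / (4 * t)\<close>. For small \<open>t\<close> the first block is
  almost unaffected, while the second must come with a cost proportional to
  \<open>t\<close>.\<close>

lemma combine2:
  assumes V: "isom n p V" and W: "isom n q W" and VW: "star V * W = 0" "V * star V + W * star W = un n"
    and A: "cor n n A" "opn A \<le> 1" and S1: "Sol p (star V * A * V) L1" and S2: "Sol q (star W * A * W) L2"
    and t: "0 < t" "t \<le> 1/6" and M: "L1 / (1 - 3 * t) \<le> M" "L2 / t \<le> M"
  shows "Sol n A (M + 1 / t)"
proof -
  have WV: "star W * V = 0" using VW(1) by (metis star_0 star_mult star_star)
  have M0: "0 \<le> M" using M(2) t Sol_nonneg[OF S2] by (meson divide_nonneg_pos order_trans)
  have sub: "cmod (complex_of_real (- (3 * t)) - complex_of_real (1 - t)) = 1 + 2 * t"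
    "cmod (complex_of_real (1 - t) - complex_of_real (- (3 * t))) = 1 + 2 * t"
    using t by (simp_all only: of_real_diff[symmetric] norm_of_real)
  have "Sol n A (M + (real 2)\<^sup>2 * 1 / (4 * t))"
    by (rule assemble_Sol[where r = 2 and p = "\<lambda>i. if i = 0 then p else q" and V = "\<lambda>i. if i = 0 then V else W"
          and L = "\<lambda>i. if i = 0 then L1 else L2" and d = "\<lambda>i. if i = 0 then 1 - 3 * t else t"
          and s = "\<lambda>i. of_real (if i = 0 then - 3 * t else 1 - t)"])
      (use assms WV M0 in \<open>auto simp: less_2_cases_iff numeral_2_eq_2 sub norm_of_real simp del: of_real_diff of_real_mult of_real_minus\<close>)
  then show ?thesis by simp
qed

lemma goodI:
  assumes "\<And>A. cor n n A \<Longrightarrow> tr A = 0 \<Longrightarrow> opn A \<le> 1 \<Longrightarrow> Sol n A K"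
  shows "good K n"
  unfolding good_def
proof (intro allI impI)
  fix A assume A: "cor n n A" "tr A = 0"
  show "Sol n A (K * opn A)"
  proof (cases "opn A = 0")
    case True
    then show ?thesis using opn_eq_0[OF True] by (simp add: Sol_zero)
  next
    case False
    let ?c = "complex_of_real (opn A)"
    have "Sol n (cs (inverse ?c) A) K"
      using A False opn_nonneg[of A] by (intro assms) (auto simp: cor_cs norm_inverse)
    then have "Sol n (cs ?c (cs (inverse ?c) A)) (cmod ?c * K)" by (rule Sol_cs)
    then show ?thesis using False opn_nonneg[of A] by (simp add: mult.commute)
  qed
qed

lemma goodD: "good K n \<Longrightarrow> 0 \<le> K \<Longrightarrow> cor n n A \<Longrightarrow> tr A = 0 \<Longrightarrow> opn A \<le> a \<Longrightarrow> Sol n A (K * a)"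
  unfolding good_def by (meson Sol_mono mult_left_mono)

lemma good_mono: "good K n \<Longrightarrow> K \<le> K' \<Longrightarrow> good K' n"
  unfolding good_def by (meson Sol_mono mult_right_mono opn_nonneg)

subsection \<open>The numerical range\<close>

definition csub :: "nat \<Rightarrow> fmat set \<Rightarrow> bool" where
  "csub n E \<longleftrightarrow> (\<forall>x\<in>E. cvec n x) \<and> (\<forall>x\<in>E. \<forall>y\<in>E. x + y \<in> E) \<and> (\<forall>c. \<forall>x\<in>E. cs c x \<in> E)"
text \<open>The numerical range of the compression of \<open>A\<close> to the subspace
  \<open>E\<close>; keeping \<open>E\<close> as a set avoids choosing an isometry onto it.\<close>

definition numr :: "fmat \<Rightarrow> fmat set \<Rightarrow> complex set" where
  "numr A E = {cip z (A * z) | z. z \<in> E \<and> norm z = 1}"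

lemma csub_cvec: "csub n {x. cvec n x}" by (simp add: csub_def cvec_add cvec_cs)

lemma csub_perp: "csub n {x. cvec n x \<and> (\<forall>i\<in>I. cip (u i) x = 0)}"
  by (auto simp: csub_def cvec_add cvec_cs cip_add_right)

lemma exists_phase_real: "\<exists>u. cmod u = 1 \<and> Im (u * d1 + cnj u * d2) = 0"
proof (cases "d1 = cnj d2")
  case True
  then show ?thesis by (intro exI[of _ 1]) simp
next
  case False
  define w where "w = d1 - cnj d2"
  have w: "cmod w \<noteq> 0" using False by (simp add: w_def)
  let ?u = "cnj w / of_real (cmod w)"
  have "Im (u * d1 + cnj u * d2) = Im (u * w)" for u by (simp add: w_def algebra_simps)
  then have "Im (?u * d1 + cnj ?u * d2) = Im (?u * w)" .
  also have "?u * w = of_real (cmod w)"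
    using w complex_norm_square[of w] by (simp add: field_simps power2_eq_square)
  finally show ?thesis using w by (intro exI[of _ ?u]) (simp add: norm_divide)
qed

text \<open>Toeplitz--Hausdorff: a real path through a suitably rotated pair of vectors joins the two
  values by a segment.\<close>

lemma convex_numr:
  assumes "csub n E" shows "convex (numr A E)"
proof (rule convexI)
  fix a b :: complex and v t :: real
  assume "a \<in> numr A E" "b \<in> numr A E" and vt: "0 \<le> v" "0 \<le> t" "v + t = 1"
  then obtain x y where x: "x \<in> E" "norm x = 1" "a = cip x (A * x)" and y: "y \<in> E" "norm y = 1" "b = cip y (A * y)"
    by (auto simp: numr_def)
  show "v *\<^sub>R a + t *\<^sub>R b \<in> numr A E"
  proof (cases "a = b")
    case True
    then have "v *\<^sub>R a + t *\<^sub>R b = a" using vt by (simp add: scaleR_add_left[symmetric])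
    then show ?thesis using \<open>a \<in> numr A E\<close> by simp
  next
    case False
    define e where "e = cip x y"
    have e': "cip y x = cnj e" using cip_commute[of y x] by (simp add: e_def)
    \<comment> \<open>\<open>d1\<close> and \<open>d2\<close> are the mixed terms after the affine
      change that takes \<open>a\<close> to 0 and \<open>b\<close> to 1. The phase \<open>u\<close>
      makes their contribution along the path real, so the values stay on the line through
      \<open>a\<close> and \<open>b\<close>.\<close>
    define d1 where "d1 = (cip x (A * y) - a * e) / (b - a)"
    define d2 where "d2 = (cip y (A * x) - a * cnj e) / (b - a)"
    obtain u where u: "cmod u = 1" "Im (u * d1 + cnj u * d2) = 0" using exists_phase_real by blast
    have uu: "cnj u * u = 1" using u(1) complex_norm_square[of u] by (simp add: mult.commute)
    define r where "r = Re (u * d1 + cnj u * d2)"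
    have r: "u * d1 + cnj u * d2 = of_real r" using u(2) by (simp add: r_def complex_eq_iff)
    define m where "m = 2 * Re (u * e)"
    have m: "u * e + cnj u * cnj e = of_real m" by (simp add: m_def complex_eq_iff)
    define z where "z s = cs (of_real (1 - s)) x + cs (of_real s * u) y" for s :: real
    define N where "N s = (1 - s)\<^sup>2 + s\<^sup>2 + s * (1 - s) * m" for s
    have zE: "z s \<in> E" for s using assms x(1) y(1) by (simp add: z_def csub_def)
    have zz: "cip (z s) (z s) = of_real (N s)" for s
    proof -
      have "cip (z s) (z s) = of_real ((1 - s)\<^sup>2) * cip x x + of_real (s\<^sup>2) * (cnj u * u) * cip y y
          + of_real (s * (1 - s)) * (u * e + cnj u * cnj e)"
        by (simp add: z_def cip_add_left cip_add_right e_def[symmetric] e' algebra_simps power2_eq_square)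
      then show ?thesis using x(2) y(2) by (simp add: cip_self uu m N_def)
    qed
    have zA: "cip (z s) (A * z s) - a * of_real (N s) = (b - a) * of_real (s\<^sup>2 + s * (1 - s) * r)" for s
    proof -
      have "cip (z s) (A * z s) = of_real ((1 - s)\<^sup>2) * a + of_real (s\<^sup>2) * (cnj u * u) * b
          + of_real (s * (1 - s)) * (u * cip x (A * y) + cnj u * cip y (A * x))"
        by (simp add: z_def cip_add_left cip_add_right distrib_left x(3) y(3) algebra_simps power2_eq_square)
      moreover have "(b - a) * (u * d1 + cnj u * d2) = u * cip x (A * y) + cnj u * cip y (A * x) - a * (u * e + cnj u * cnj e)"
      proof -
        have "(b - a) * d1 = cip x (A * y) - a * e" "(b - a) * d2 = cip y (A * x) - a * cnj e"
          using False by (simp_all add: d1_def d2_def)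
        then have *: "u * ((b - a) * d1) + cnj u * ((b - a) * d2) = u * (cip x (A * y) - a * e) + cnj u * (cip y (A * x) - a * cnj e)"
          by simp
        have "(b - a) * (u * d1 + cnj u * d2) = u * ((b - a) * d1) + cnj u * ((b - a) * d2)"
          by (simp add: algebra_simps)
        then show ?thesis unfolding * by (simp add: algebra_simps)
      qed
      ultimately have P: "u * cip x (A * y) + cnj u * cip y (A * x) = (b - a) * of_real r + a * of_real m"
        and Q: "cip (z s) (A * z s) = of_real ((1 - s)\<^sup>2) * a + of_real (s\<^sup>2) * (cnj u * u) * b
          + of_real (s * (1 - s)) * (u * cip x (A * y) + cnj u * cip y (A * x))"
        unfolding r m by (simp_all add: algebra_simps)
      show ?thesis unfolding Q P uu N_def by (simp add: algebra_simps power2_eq_square)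
    qed
    have Npos: "N s > 0" for s
    proof -
      have nn: "N s = (norm (z s))\<^sup>2" using zz[of s] cip_self[of "z s"] by (metis of_real_eq_iff)
      \<comment> \<open>If the path met 0, then \<open>x\<close> and \<open>y\<close> would differ
        by a phase only, and the values \<open>a\<close> and \<open>b\<close> would agree.\<close>
      have "z s \<noteq> 0"
      proof
        assume z0: "z s = 0"
        then have 0: "N s = 0" using nn by simp
        have "of_real (s\<^sup>2 + s * (1 - s) * r) = (0::complex)" using zA[of s] z0 0 False by simp
        have "cs (of_real (1 - s)) x = - cs (of_real s * u) y" using z0 unfolding z_def by (simp add: eq_neg_iff_add_eq_0)
        then have "norm (cs (of_real (1 - s)) x) = norm (cs (of_real s * u) y)" by (metis norm_minus_cancel)
        then have abs: "\<bar>1 - s\<bar> = \<bar>s\<bar>" using x(2) y(2) u(1) by (simp add: norm_mult del: of_real_diff)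
        then have s: "s = 1/2" by linarith
        have half: "cs (of_real (1 - 1/2)) x = - cs (of_real (1/2) * u) y"
          using \<open>cs (of_real (1 - s)) x = _\<close> unfolding s .
        have "x = cs 2 (cs (of_real (1 - 1/2)) x)" by simp
        also have "\<dots> = cs (- u) y" unfolding half by (simp add: cs_minus)
        finally have xy: "x = cs (- u) y" .
        have "a = cnj (- u) * (- u) * b" unfolding x(3) y(3) by (subst (1 2) xy) simp
        then show False using False uu by simp
      qed
      then show ?thesis using nn by simp
    qed
    \<comment> \<open>The position of the value on that line, with 0 at \<open>a\<close> and 1 at
      \<open>b\<close>.\<close>
    define f where "f s = (s\<^sup>2 + s * (1 - s) * r) / N s" for s
    have "continuous_on {0..1} f" unfolding f_def
      using Npos by (intro continuous_intros) (auto simp: N_def less_le intro!: continuous_intros)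
    moreover have "f 0 \<le> t" "t \<le> f 1" using vt by (simp_all add: f_def N_def)
    ultimately obtain s where s: "0 \<le> s" "s \<le> 1" "f s = t" using IVT'[of f 0 t 1] by auto
    have "z s \<noteq> 0" using Npos[of s] zz[of s] by auto
    define w where "w = cs (of_real (inverse (norm (z s)))) (z s)"
    have "norm w = 1" using \<open>z s \<noteq> 0\<close> by (simp add: w_def norm_inverse)
    moreover have "w \<in> E" using zE assms by (simp add: w_def csub_def)
    moreover have "cip w (A * w) = v *\<^sub>R a + t *\<^sub>R b"
    proof -
      have nn: "N s = (norm (z s))\<^sup>2" using zz[of s] cip_self[of "z s"] by (metis of_real_eq_iff)
      have "cip w (A * w) = cip (z s) (A * z s) / of_real (N s)"
        by (simp add: w_def nn power2_eq_square divide_inverse mult_ac)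
      also have "\<dots> = a + (b - a) * of_real (f s)"
        using zA[of s] Npos[of s] by (simp add: f_def field_simps)
      also have "\<dots> = of_real (1 - t) * a + of_real t * b" using s(3) by (simp add: algebra_simps)
      also have "1 - t = v" using vt by simp
      finally show ?thesis by (simp add: scaleR_conv_of_real)
    qed
    ultimately show ?thesis unfolding numr_def by (metis (mono_tags, lifting) mem_Collect_eq)
  qed
qed

text \<open>The numerical range is convex, so if it misses 0, a line separates it from 0. The normal
  of that line, scaled to modulus one, gives the rotation \<open>u\<close>; homogeneity extends the
  sign condition from unit vectors to all of \<open>E\<close>.\<close>

lemma zero_or_halfplane:
  assumes "csub n E"
  shows "(\<exists>z\<in>E. norm z = 1 \<and> cip z (A * z) = 0) \<or> (\<exists>u. cmod u = 1 \<and> (\<forall>z\<in>E. 0 \<le> Re (u * cip z (A * z))))"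
proof (cases "0 \<in> numr A E")
  case True
  then show ?thesis by (auto simp: numr_def)
next
  case False
  obtain a where a: "a \<noteq> 0" "\<And>x. x \<in> numr A E \<Longrightarrow> 0 \<le> inner a x"
    using separating_hyperplane_set_0[OF convex_numr[OF assms] False] by blast
  define u where "u = cnj a / of_real (cmod a)"
  have "0 \<le> Re (u * cip z (A * z))" if z: "z \<in> E" for z
  proof (cases "z = 0")
    case False
    define w where "w = cs (of_real (inverse (norm z))) z"
    have "norm w = 1" using False by (simp add: w_def norm_inverse)
    moreover have "w \<in> E" using z assms by (simp add: w_def csub_def)
    ultimately have "0 \<le> inner a (cip w (A * w))" by (intro a(2)) (auto simp: numr_def)
    moreover have "inner a (cip w (A * w)) = cmod a * (inverse (norm z))\<^sup>2 * Re (u * cip z (A * z))"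
    proof -
      have "inner a v = Re (cnj a * v)" for v by (simp add: inner_complex_def)
      moreover have "cnj a = of_real (cmod a) * u" using a(1) by (simp add: u_def)
      moreover have "cip w (A * w) = of_real ((inverse (norm z))\<^sup>2) * cip z (A * z)"
        by (simp add: w_def power2_eq_square)
      ultimately have "inner a (cip w (A * w)) = Re (of_real (cmod a * (inverse (norm z))\<^sup>2) * (u * cip z (A * z)))"
        by (simp add: mult_ac)
      moreover have "Re (of_real k * v) = k * Re v" for k v by simp
      ultimately show ?thesis by (simp only:)
    qed
    moreover have "0 < cmod a * (inverse (norm z))\<^sup>2" using a(1) False by simp
    ultimately show ?thesis by (simp only: zero_le_mult_iff) linarith
  qed simp
  moreover have "cmod u = 1" using a(1) by (simp add: u_def norm_divide)
  ultimately show ?thesis by blast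
qed

lemma zero_value_of_sum_zero:
  fixes p :: nat
  assumes E: "csub n E" and x: "\<And>i. i < p \<Longrightarrow> x i \<in> E" "\<And>i. i < p \<Longrightarrow> norm (x i) = 1" "0 < p"
    and sum: "(\<Sum>i<p. cip (x i) (A * x i)) = 0"
  shows "\<exists>z\<in>E. norm z = 1 \<and> cip z (A * z) = 0"
proof -
  have "(\<Sum>i<p. (1 / real p) *\<^sub>R cip (x i) (A * x i)) \<in> numr A E"
    by (rule convex_sum[OF _ convex_numr[OF E]]) (use x in \<open>auto simp: numr_def\<close>)
  then have "0 \<in> numr A E" by (simp add: scaleR_sum_right[symmetric] sum)
  then show ?thesis by (auto simp: numr_def)
qed

lemma tr_cor: "cor n n A \<Longrightarrow> tr A = (\<Sum>i<n. ent A i i)"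
  by (rule tr_bound) (simp add: cor_iff)

lemma cip_eu: "a < n \<Longrightarrow> cvec n y \<Longrightarrow> cip (eu a 0) y = ent y a 0"
  by (subst cip_vec[of n]) (auto simp: if_distrib[of cnj] if_distrib[of "\<lambda>x. x * _"] cong: if_cong)

lemma traceless_zero_value:
  assumes "cor n n A" "tr A = 0" "0 < n"
  shows "\<exists>x. cvec n x \<and> norm x = 1 \<and> cip x (A * x) = 0"
proof -
  have "\<exists>z\<in>{x. cvec n x}. norm z = 1 \<and> cip z (A * z) = 0"
  proof (rule zero_value_of_sum_zero[where x = "\<lambda>i. eu i 0" and p = n])
    have o: "orth n n (\<lambda>i. un n * eu i 0)" by (rule orth_isom) simp
    show "norm (eu i 0) = 1" if "i < n" for i using orth_norm[OF o that] that by simp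
    have "cip (eu i 0) (A * eu i 0) = ent A i i" if "i < n" for i
      using that cvec_col[OF assms(1)] by (simp add: cip_eu)
    then show "(\<Sum>i<n. cip (eu i 0) (A * eu i 0)) = 0" using assms by (simp add: tr_cor)
  qed (use assms in \<open>auto intro: csub_cvec cvec_eu\<close>)
  then show ?thesis by auto
qed

lemma orth_single: "cvec n x \<Longrightarrow> norm x = 1 \<Longrightarrow> orth n 1 (\<lambda>_. x)"
  by (simp add: orth_def cip_self)

text \<open>A unit vector of value zero is a block of size one with compression 0, which costs
  nothing, and its complement is traceless again. The weight \<open>t\<close> is left open:
  \<open>good_exists\<close> takes 1/6, while \<open>strip_quarter_step\<close> takes 1/1000 to keep
  the factor near one.\<close>

lemma strip_one:
  assumes "cor (Suc n) (Suc n) A" "tr A = 0"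
  obtains W where "isom (Suc n) n W" "tr (star W * A * W) = 0"
    "\<And>L t. opn A \<le> 1 \<Longrightarrow> Sol n (star W * A * W) L \<Longrightarrow> 0 < t \<Longrightarrow> t \<le> 1/6 \<Longrightarrow> Sol (Suc n) A (L / (1 - 3 * t) + 1 / t)"
proof -
  obtain x where x: "cvec (Suc n) x" "norm x = 1" "cip x (A * x) = 0"
    using traceless_zero_value[OF assms] by auto
  have V: "isom (Suc n) 1 (of_cols 1 (\<lambda>_. x))" (is "isom _ _ ?V") by (intro isom_of_cols orth_single x)
  have VAV: "star ?V * A * ?V = 0"
    by (rule fmat_eqI, subst of_cols_compress) (use x in auto)
  obtain W where W: "isom (Suc n) (Suc n - 1) W" "star W * ?V = 0" "?V * star ?V + W * star W = un (Suc n)"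
    using isom_complement[OF V] by metis
  show ?thesis
  proof (rule that[of W])
    show "isom (Suc n) n W" using W(1) by simp
    show "tr (star W * A * W) = 0" using tr_split[OF assms(1) W(3)] assms(2) VAV by simp
    fix L t :: real
    assume "opn A \<le> 1" and S: "Sol n (star W * A * W) L" and "0 < t" "t \<le> 1/6"
    then show "Sol (Suc n) A (L / (1 - 3 * t) + 1 / t)"
      using Sol_nonneg[OF S] W VAV assms V
      by (intro combine2[of "Suc n" n W 1 ?V A L 0 t]) (auto simp: add.commute intro!: Sol_zero)
  qed
qed

text \<open>A bound growing exponentially with \<open>n\<close>. It serves to start the uniform
  argument on the finitely many sizes below a fixed threshold.\<close>

lemma good_exists: "\<exists>K\<ge>0. good K n"
proof (induction n)
  case 0
  have "good 0 0" by (rule goodI) (auto simp: cor_def Sol_zero)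
  then show ?case by auto
next
  case (Suc n)
  then obtain K where K: "K \<ge> 0" "good K n" by blast
  have "good (K / (1 - 3 * (1/6)) + 1 / (1/6)) (Suc n)"
  proof (rule goodI)
    fix A assume A: "cor (Suc n) (Suc n) A" "tr A = 0" "opn A \<le> 1"
    obtain W where W: "isom (Suc n) n W" "tr (star W * A * W) = 0"
      "\<And>L t. opn A \<le> 1 \<Longrightarrow> Sol n (star W * A * W) L \<Longrightarrow> 0 < t \<Longrightarrow> t \<le> 1/6 \<Longrightarrow> Sol (Suc n) A (L / (1 - 3 * t) + 1 / t)"
      using strip_one[OF A(1,2)] by metis
    have "Sol n (star W * A * W) (K * 1)"
      using K W A opn_sandwich[OF W(1) W(1), of A] by (intro goodD cor_compress[OF W(1) W(1)]) auto
    then show "Sol (Suc n) A (K / (1 - 3 * (1/6)) + 1 / (1/6))" by (intro W(3) A) auto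
  qed
  then show ?case using K(1) by (intro exI[of _ "K / (1 - 3 * (1/6)) + 1 / (1/6)"]) auto
qed

subsection \<open>Mixing orthogonal blocks\<close>

definition blk :: "nat \<Rightarrow> nat \<Rightarrow> fmat" where "blk m k = (\<Sum>i<m. eu (k * m + i) i)"

lemma ent_blk: "ent (blk m k) a i = (if i < m \<and> a = k * m + i then 1 else 0)"
  unfolding blk_def by (auto simp: if_distrib cong: if_cong intro!: sum.neutral)

lemma blk_isom: "k < r \<Longrightarrow> isom (r * m) m (blk m k)"
proof -
  assume "k < r"
  then have "k * m + m \<le> r * m" by (metis Suc_leI add.commute mult_Suc mult_le_mono1)
  then have 1: "a < r * m" if "a < k * m + m" for a using that by simp
  then have 2: "k * m + i < r * m" if "i < m" for i using that by simp
  have "star (blk m k) * blk m k = un m"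
  proof (rule fmat_eqI)
    fix i j
    have "ent (star (blk m k) * blk m k) i j = (\<Sum>a<r * m. cnj (ent (blk m k) a i) * ent (blk m k) a j)"
      by (subst ent_mult[of "r * m"]) (auto simp: ent_blk dest: 2)
    also have "\<dots> = (\<Sum>a<r * m. if a = k * m + i then (if i < m \<and> i = j then 1 else 0) else 0)"
      by (intro sum.cong) (auto simp: ent_blk)
    also have "\<dots> = ent (un m) i j" using 1[of "k * m + i"] by (subst sum.delta) auto
    finally show "ent (star (blk m k) * blk m k) i j = ent (un m) i j" .
  qed
  moreover have "un (r * m) * blk m k = blk m k"
    by (rule fmat_eqI) (auto simp: ent_blk dest: 2)
  ultimately show ?thesis by (simp add: isom_def)
qed

lemma blk_perp: "k \<noteq> l \<Longrightarrow> star (blk m k) * blk m l = 0"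
proof -
  assume kl: "k \<noteq> l"
  have "eu i (k * m + i) * eu (l * m + j) j = 0" if "i < m" "j < m" for i j
  proof -
    have "(k * m + i) div m = k" "(l * m + j) div m = l" using that by auto
    then have "k * m + i \<noteq> l * m + j" using kl by metis
    then show ?thesis by (simp add: eu_eu)
  qed
  then show ?thesis by (simp add: blk_def sum_distrib_left sum_distrib_right)
qed

lemma blk_complete: "(\<Sum>k<r. blk m k * star (blk m k)) = un (r * m)"
proof -
  have "blk m k * star (blk m k) = (\<Sum>a = k * m..<k * m + m. eu a a)" for k
  proof -
    have "blk m k * star (blk m k) = (\<Sum>i<m. \<Sum>j<m. eu (k * m + j) j * eu i (k * m + i))"
      by (simp add: blk_def sum_distrib_left sum_distrib_right)
    also have "\<dots> = (\<Sum>i<m. \<Sum>j<m. if j = i then eu (k * m + i) (k * m + i) else 0)"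
      by (intro sum.cong) (auto simp: eu_eu)
    also have "\<dots> = (\<Sum>i<m. eu (k * m + i) (k * m + i))" by simp
    also have "\<dots> = (\<Sum>a = k * m..<k * m + m. eu a a)"
      using sum.shift_bounds_nat_ivl[of "\<lambda>a. eu a a" 0 "k * m" m] by (simp add: add.commute atLeast0LessThan)
    finally show ?thesis .
  qed
  then show ?thesis
  proof (induction r)
    case (Suc r)
    have "(\<Sum>a<r * m. eu a a) + (\<Sum>a = r * m..<r * m + m. eu a a) = (\<Sum>a<r * m + m. eu a a)"
      by (simp add: lessThan_atLeast0 sum.atLeastLessThan_concat)
    then show ?case using Suc by (simp add: un_sum add.commute)
  qed simp
qed

text \<open>One complex equation amounts to two real ones for four real unknowns. If
  \<open>c1\<close> and \<open>c2\<close> have equal modulus, the real-linear map sending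
  \<open>a\<close> to \<open>a * c1 + cnj a * c2\<close> is singular and a square root gives a
  kernel vector; otherwise its determinant \<open>D\<close> is nonzero and \<open>b = 1\<close> can
  be prescribed.\<close>

lemma real_linear_kernel:
  "\<exists>a b. (a, b) \<noteq> (0, 0) \<and> a * c1 + cnj a * c2 + b * d1 + cnj b * d2 = 0"
proof (cases "cmod c1 = cmod c2")
  case True
  show ?thesis
  proof (cases "c1 = 0")
    case True
    then show ?thesis using \<open>cmod c1 = cmod c2\<close> by (intro exI[of _ 1] exI[of _ 0]) auto
  next
    case False
    define a where "a = csqrt (- c2 / c1)"
    have a2: "a * a = - c2 / c1" unfolding a_def power2_eq_square[symmetric] by simp
    have "cmod (a * a) = 1" unfolding a2 using True False by (auto simp: norm_divide)
    then have "cmod a = 1" by (simp add: norm_mult) (metis norm_ge_zero power2_eq_1_iff power2_eq_square neg_equal_0_iff_equal not_one_le_zero le_minus_one_simps(3))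
    then have aa: "cnj a * a = 1" using complex_norm_square[of a] by (simp add: mult.commute)
    have "a * (a * c1 + cnj a * c2) = (a * a) * c1 + (cnj a * a) * c2" by (simp add: algebra_simps)
    also have "\<dots> = 0" unfolding a2 aa using False by simp
    finally have "a * c1 + cnj a * c2 = 0" using aa by auto
    then show ?thesis using aa by (intro exI[of _ a] exI[of _ 0]) auto
  qed
next
  case False
  define w where "w = d1 + d2"
  define D where "D = c1 * cnj c1 - c2 * cnj c2"
  have D: "D = of_real ((cmod c1)\<^sup>2 - (cmod c2)\<^sup>2)" by (simp add: D_def complex_norm_square del: of_real_power)
  have D0: "D \<noteq> 0" and Dc: "cnj D = D"
    using False unfolding D by (simp_all add: power2_eq_iff_nonneg del: of_real_diff)
  define a where "a = (cnj w * c2 - w * cnj c1) / D"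
  have aD: "a * D = cnj w * c2 - w * cnj c1" "cnj a * D = w * cnj c2 - cnj w * c1"
    using D0 by (simp_all add: a_def Dc)
  have "(a * c1 + cnj a * c2) * D = (a * D) * c1 + (cnj a * D) * c2" by (simp add: algebra_simps)
  also have "\<dots> = - w * D" unfolding aD by (simp add: D_def algebra_simps)
  finally have "a * c1 + cnj a * c2 + 1 * d1 + cnj 1 * d2 = 0" using D0 by (simp add: w_def)
  then show ?thesis by (intro exI[of _ a] exI[of _ 1]) auto
qed

text \<open>The unitaries \<open>a S* S + a' S S* + b S - b' S*\<close>, with \<open>a'\<close> and \<open>b'\<close> the conjugates, form the unit
  sphere of a real-linear space of dimension 4, so two real-linear conditions can be met.\<close>

lemma exists_mixing_unitary:
  assumes "even m"
  obtains U where "cor m m U" "star U * U = un m" "U * star U = un m" "tr (X * U) + tr (star U * Y) = 0"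
proof -
  obtain h where m: "m = 2 * h" using assms by blast
  let ?S0 = "blk h 0" and ?S1 = "blk h (Suc 0)"
  \<comment> \<open>\<open>S\<close> carries the first half of the coordinates to the second, so
    that \<open>S\<close>, \<open>star S\<close> and their two products behave like the four matrix
    units of size 2.\<close>
  define S where "S = ?S1 * star ?S0"
  have i0: "isom m h ?S0" and i1: "isom m h ?S1" using blk_isom[of 0 2 h] blk_isom[of "Suc 0" 2 h] m by simp_all
  note r = isom_rules[OF i0] isom_rules[OF i1]
  have p: "star ?S0 * ?S1 = 0" "star ?S1 * ?S0 = 0" by (simp_all add: blk_perp)
  note pp = p perp_rule[OF p(1)] perp_rule[OF p(2)]
  have SS: "S * S = 0" "star S * star S = 0" "S * star S * S = S" "star S * S * star S = star S"
    by (simp_all add: S_def mult.assoc r pp)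
  have sum: "star S * S + S * star S = un m"
    using blk_complete[of h 2] m by (simp add: S_def mult.assoc r numeral_2_eq_2)
  have cS: "cor m m S" unfolding S_def by (rule cor_mult[OF isom_cor[OF i1] cor_star[OF isom_cor[OF i0]]])
  obtain a b where ab: "(a, b) \<noteq> (0, 0)"
    "a * (tr (X * (star S * S)) + tr (S * star S * Y)) + cnj a * (tr (X * (S * star S)) + tr (star S * S * Y))
     + b * (tr (X * S) - tr (S * Y)) + cnj b * (tr (star S * Y) - tr (X * star S)) = 0"
    using real_linear_kernel by metis
  define k where "k = sqrt ((cmod a)\<^sup>2 + (cmod b)\<^sup>2)"
  have k: "k > 0" "complex_of_real (k\<^sup>2) = a * cnj a + b * cnj b"
    using ab(1) unfolding k_def by (auto simp: add_pos_nonneg add_nonneg_pos complex_norm_square[symmetric])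
  define p q where "p = star S * S" and "q = S * star S"
  \<comment> \<open>As a block matrix with rows \<open>(a, - cnj b)\<close> and
    \<open>(b, cnj a)\<close> this is a quaternion, so \<open>star W * W\<close> is a multiple of
    the identity for all \<open>a\<close> and \<open>b\<close>.\<close>
  define W where "W = cs a p + cs (cnj a) q + cs b S - cs (cnj b) (star S)"
  have tab: "p * p = p" "q * q = q" "p * q = 0" "q * p = 0" "S * p = S" "q * S = S" "p * S = 0" "S * q = 0"
    "p * star S = star S" "star S * q = star S" "star S * p = 0" "q * star S = 0" "S * S = 0" "star S * star S = 0"
    "star S * S = p" "S * star S = q" "star p = p" "star q = q"
    unfolding p_def q_def using SS by (simp_all add: mult.assoc) (metis mult.assoc mult_zero_left mult_zero_right)+
  have WW: "star W * W = cs (a * cnj a + b * cnj b) (p + q)" "W * star W = cs (a * cnj a + b * cnj b) (p + q)"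
    by (simp_all add: W_def ring_distribs tab) (rule fmat_eqI, simp add: algebra_simps)+
  define U where "U = cs (of_real (1 / k)) W"
  have "of_real (1 / k) * of_real (1 / k) * (a * cnj a + b * cnj b) = 1"
    using k(1) by (simp add: k(2)[symmetric] power2_eq_square)
  then have UU: "star U * U = un m" "U * star U = un m"
    by (simp_all add: U_def WW sum[folded p_def q_def] mult.assoc del: of_real_divide)
  have "cor m m W" unfolding W_def p_def q_def
    by (intro cor_add cor_diff cor_cs cor_mult[OF cor_star[OF cS] cS] cor_mult[OF cS cor_star[OF cS]] cS cor_star[OF cS])
  then have cU: "cor m m U" by (simp add: U_def cor_cs)
  have "tr (X * W) + tr (star W * Y) = 0"
    using ab(2) by (simp add: W_def ring_distribs tr_add tr_diff tab) (simp add: algebra_simps)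
  then have "tr (X * U) + tr (star U * Y) = 0" by (simp add: U_def add_divide_distrib[symmetric])
  with cU UU show ?thesis by (rule that)
qed

text \<open>The pair \<open>mixp\<close>, \<open>mixm\<close> is the row \<open>(V, W)\<close> times
  the unitary block matrix with rows \<open>(1, 1)\<close> and \<open>(U, - U)\<close>, divided by
  \<open>sqrt 2\<close>.\<close>

definition mixp :: "fmat \<Rightarrow> fmat \<Rightarrow> fmat \<Rightarrow> fmat" where "mixp V W U = cs (of_real (1 / sqrt 2)) (V + W * U)"
definition mixm :: "fmat \<Rightarrow> fmat \<Rightarrow> fmat \<Rightarrow> fmat" where "mixm V W U = cs (of_real (1 / sqrt 2)) (V - W * U)"

lemma half_sqrt: "complex_of_real (1 / sqrt 2) * complex_of_real (1 / sqrt 2) = 1/2"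
  by (simp flip: of_real_mult)

text \<open>The traces of the two mixtures are the mean of the old ones plus and minus half the
  cross term. A unitary from \<open>exists_mixing_unitary\<close> removes the cross term, and both
  traces equal the mean.\<close>

lemma mix_isom:
  assumes V: "isom n m V" and W: "isom n m W" and VW: "star V * W = 0"
    and U: "cor m m U" "star U * U = un m" "U * star U = un m"
  shows "isom n m (mixp V W U)" "isom n m (mixm V W U)" "star (mixp V W U) * mixm V W U = 0"
    "mixp V W U * star (mixp V W U) + mixm V W U * star (mixm V W U) = V * star V + W * star W"
    "tr (star V * A * W * U) + tr (star U * (star W * A * V)) = 0 \<Longrightarrow>
      tr (star (mixp V W U) * A * mixp V W U) = (tr (star V * A * V) + tr (star W * A * W)) / 2"
    "tr (star V * A * W * U) + tr (star U * (star W * A * V)) = 0 \<Longrightarrow>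
      tr (star (mixm V W U) * A * mixm V W U) = (tr (star V * A * V) + tr (star W * A * W)) / 2"
proof -
  have WV: "star W * V = 0" using VW by (metis star_0 star_mult star_star)
  note r = isom_rules[OF V] isom_rules[OF W] VW WV perp_rule[OF VW] perp_rule[OF WV] cor_rules[OF U(1)] U
  have U2: "star U * (U * Z) = un m * Z" "U * (star U * Z) = un m * Z" for Z
    using U(2,3) by (metis mult.assoc)+
  have Us: "star U * un m = star U" "un m * star U = star U" using cor_star[OF U(1)] by (simp_all add: cor_def)
  have dbl: "cs (1/2) (Z + Z) = Z" for Z by (simp add: cs_add cs_add_left[symmetric])
  have "star (V + W * U) * (V + W * U) = un m + un m" "star (V - W * U) * (V - W * U) = un m + un m"
    "star (V + W * U) * (V - W * U) = 0"
    "(V + W * U) * star (V + W * U) + (V - W * U) * star (V - W * U) = (V * star V + W * star W) + (V * star V + W * star W)"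
    by (simp_all add: ring_distribs mult.assoc r U2 Us)
  then show "isom n m (mixp V W U)" "isom n m (mixm V W U)" "star (mixp V W U) * mixm V W U = 0"
    "mixp V W U * star (mixp V W U) + mixm V W U * star (mixm V W U) = V * star V + W * star W"
    unfolding isom_def mixp_def mixm_def
    by (simp_all add: half_sqrt dbl cs_add[symmetric] del: of_real_divide) (simp_all add: ring_distribs r)
  assume z: "tr (star V * A * W * U) + tr (star U * (star W * A * V)) = 0"
  have UWU: "tr (star U * (star W * A * W) * U) = tr (star W * A * W)"
  proof -
    have "tr (star U * (star W * A * W) * U) = tr (star W * A * W * (U * star U))"
      by (metis mult.assoc tr_mult_commute)
    then show ?thesis by (simp add: U mult.assoc r)
  qed
  have "tr (star (V + W * U) * A * (V + W * U)) = tr (star V * A * V) + tr (star W * A * W) + (tr (star V * A * W * U) + tr (star U * (star W * A * V)))"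
    using UWU by (simp add: ring_distribs tr_add mult.assoc)
  then show "tr (star (mixp V W U) * A * mixp V W U) = (tr (star V * A * V) + tr (star W * A * W)) / 2"
    unfolding z mixp_def by (simp add: half_sqrt del: of_real_divide)
  have "tr (star (V - W * U) * A * (V - W * U)) = tr (star V * A * V) + tr (star W * A * W) - (tr (star V * A * W * U) + tr (star U * (star W * A * V)))"
    using UWU by (simp add: ring_distribs tr_add tr_diff mult.assoc)
  then show "tr (star (mixm V W U) * A * mixm V W U) = (tr (star V * A * V) + tr (star W * A * W)) / 2"
    unfolding z mixm_def by (simp add: half_sqrt del: of_real_divide)
qed

lemma mix_perp:
  assumes "star Z * V = 0" "star Z * W = 0"
  shows "star Z * mixp V W U = 0" "star Z * mixm V W U = 0" "star (mixp V W U) * Z = 0" "star (mixm V W U) * Z = 0"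
proof -
  show 1: "star Z * mixp V W U = 0" "star Z * mixm V W U = 0"
    using assms perp_rule[OF assms(2)] by (simp_all add: mixp_def mixm_def ring_distribs)
  then show "star (mixp V W U) * Z = 0" "star (mixm V W U) * Z = 0" by (metis star_0 star_mult star_star)+
qed

lemma mix_pair:
  assumes V: "isom n m V" and W: "isom n m W" and VW: "star V * W = 0" and m: "even m"
  obtains P Q where "isom n m P" "isom n m Q" "star P * Q = 0" "P * star P + Q * star Q = V * star V + W * star W"
    "tr (star P * A * P) = (tr (star V * A * V) + tr (star W * A * W)) / 2"
    "tr (star Q * A * Q) = (tr (star V * A * V) + tr (star W * A * W)) / 2"
    "\<And>Z. star Z * V = 0 \<Longrightarrow> star Z * W = 0 \<Longrightarrow> star Z * P = 0 \<and> star Z * Q = 0"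
    "\<And>Z X. star Z * V = X \<Longrightarrow> star Z * W = 0 \<Longrightarrow>
      star Z * P = cs (of_real (1 / sqrt 2)) X \<and> star Z * Q = cs (of_real (1 / sqrt 2)) X"
proof -
  obtain U where U: "cor m m U" "star U * U = un m" "U * star U = un m"
    "tr (star V * A * W * U) + tr (star U * (star W * A * V)) = 0"
    using exists_mixing_unitary[OF m, of "star V * A * W" "star W * A * V"] by metis
  show ?thesis
  proof (rule that[of "mixp V W U" "mixm V W U"])
    fix Z X assume "star Z * V = X" "star Z * W = 0"
    then show "star Z * mixp V W U = cs (of_real (1 / sqrt 2)) X \<and> star Z * mixm V W U = cs (of_real (1 / sqrt 2)) X"
      using perp_rule[of Z W] by (simp add: mixp_def mixm_def ring_distribs)
  qed (use mix_isom[OF V W VW U(1,2,3)] U(4) mix_perp in auto)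
qed

text \<open>Two rounds of pairwise averaging, in the pattern of a Hadamard transform: blocks 0 with
  1 and 2 with 3, and then one result of each pair with one of the other. All traces become the
  mean, which is 0, and each round shrinks the overlap with \<open>V 0\<close> by
  \<open>1 / sqrt 2\<close>. The resulting 1/2 enters a compression of \<open>A\<close> twice and
  gives the quarter.\<close>

lemma mix_four:
  fixes V :: "nat \<Rightarrow> fmat"
  assumes V: "\<And>k. k < 4 \<Longrightarrow> isom n m (V k)" "\<And>k l. k < 4 \<Longrightarrow> l < 4 \<Longrightarrow> k \<noteq> l \<Longrightarrow> star (V k) * V l = 0"
    and compl: "(\<Sum>k<4. V k * star (V k)) = un n" and A: "cor n n A" "tr A = 0" and m: "even m"
  obtains Q :: "nat \<Rightarrow> fmat" where "\<And>k. k < 4 \<Longrightarrow> isom n m (Q k)" "\<And>k l. k < 4 \<Longrightarrow> l < 4 \<Longrightarrow> k \<noteq> l \<Longrightarrow> star (Q k) * Q l = 0"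
    "(\<Sum>k<4. Q k * star (Q k)) = un n" "\<And>k. k < 4 \<Longrightarrow> tr (star (Q k) * A * Q k) = 0"
    "\<And>k. k < 4 \<Longrightarrow> star (V 0) * Q k = cs (1/2) (un m)"
proof -
  have v: "isom n m (V 0)" "isom n m (V 1)" "isom n m (V 2)" "isom n m (V 3)" using V(1) by simp_all
  have vp: "star (V k) * V l = 0" if "k < 4" "l < 4" "k \<noteq> l" for k l using V(2) that by simp
  have vp01: "star (V 0) * V 1 = 0" and vp23: "star (V 2) * V 3 = 0" using vp by simp_all
  have total: "tr (star (V 0) * A * V 0) + tr (star (V 1) * A * V 1) + tr (star (V 2) * A * V 2) + tr (star (V 3) * A * V 3) = 0"
  proof -
    have "tr (star (V k) * A * V k) = tr (A * (V k * star (V k)))" for k by (metis mult.assoc tr_mult_commute)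
    then have "(\<Sum>k<4. tr (star (V k) * A * V k)) = tr (A * un n)" by (simp add: compl[symmetric] sum_distrib_left tr_sum)
    then show ?thesis using A by (simp add: cor_def numeral_eq_Suc add_ac)
  qed
  obtain P0 P1 where P: "isom n m P0" "isom n m P1" "star P0 * P1 = 0" "P0 * star P0 + P1 * star P1 = V 0 * star (V 0) + V 1 * star (V 1)"
    "tr (star P0 * A * P0) = (tr (star (V 0) * A * V 0) + tr (star (V 1) * A * V 1)) / 2"
    "tr (star P1 * A * P1) = (tr (star (V 0) * A * V 0) + tr (star (V 1) * A * V 1)) / 2"
    "\<And>Z. star Z * V 0 = 0 \<Longrightarrow> star Z * V 1 = 0 \<Longrightarrow> star Z * P0 = 0 \<and> star Z * P1 = 0"
    "\<And>Z X. star Z * V 0 = X \<Longrightarrow> star Z * V 1 = 0 \<Longrightarrow>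
      star Z * P0 = cs (of_real (1 / sqrt 2)) X \<and> star Z * P1 = cs (of_real (1 / sqrt 2)) X"
    by (rule mix_pair[OF v(1,2) vp01 m, of A]) (rule that; assumption)
  obtain P2 P3 where R: "isom n m P2" "isom n m P3" "star P2 * P3 = 0" "P2 * star P2 + P3 * star P3 = V 2 * star (V 2) + V 3 * star (V 3)"
    "tr (star P2 * A * P2) = (tr (star (V 2) * A * V 2) + tr (star (V 3) * A * V 3)) / 2"
    "tr (star P3 * A * P3) = (tr (star (V 2) * A * V 2) + tr (star (V 3) * A * V 3)) / 2"
    "\<And>Z. star Z * V 2 = 0 \<Longrightarrow> star Z * V 3 = 0 \<Longrightarrow> star Z * P2 = 0 \<and> star Z * P3 = 0"
    by (rule mix_pair[OF v(3,4) vp23 m, of A]) (rule that; assumption)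
  have flip: "star X * Y = 0 \<Longrightarrow> star Y * X = 0" for X Y by (metis star_0 star_mult star_star)
  have vP: "star (V k) * P2 = 0" "star (V k) * P3 = 0" if "k < 2" for k
    using R(7)[of "V k"] vp[of k 2] vp[of k 3] that by auto
  have PP: "star P0 * P2 = 0" "star P0 * P3 = 0" "star P1 * P2 = 0" "star P1 * P3 = 0"
    using P(7)[of P2] P(7)[of P3] vP[of 0] vP[of 1] flip by auto
  obtain Q0 Q1 where Q: "isom n m Q0" "isom n m Q1" "star Q0 * Q1 = 0" "Q0 * star Q0 + Q1 * star Q1 = P0 * star P0 + P2 * star P2"
    "tr (star Q0 * A * Q0) = (tr (star P0 * A * P0) + tr (star P2 * A * P2)) / 2"
    "tr (star Q1 * A * Q1) = (tr (star P0 * A * P0) + tr (star P2 * A * P2)) / 2"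
    "\<And>Z. star Z * P0 = 0 \<Longrightarrow> star Z * P2 = 0 \<Longrightarrow> star Z * Q0 = 0 \<and> star Z * Q1 = 0"
    "\<And>Z X. star Z * P0 = X \<Longrightarrow> star Z * P2 = 0 \<Longrightarrow>
      star Z * Q0 = cs (of_real (1 / sqrt 2)) X \<and> star Z * Q1 = cs (of_real (1 / sqrt 2)) X"
    by (rule mix_pair[OF P(1) R(1) PP(1) m, of A]) (rule that; assumption)
  obtain Q2 Q3 where S: "isom n m Q2" "isom n m Q3" "star Q2 * Q3 = 0" "Q2 * star Q2 + Q3 * star Q3 = P1 * star P1 + P3 * star P3"
    "tr (star Q2 * A * Q2) = (tr (star P1 * A * P1) + tr (star P3 * A * P3)) / 2"
    "tr (star Q3 * A * Q3) = (tr (star P1 * A * P1) + tr (star P3 * A * P3)) / 2"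
    "\<And>Z. star Z * P1 = 0 \<Longrightarrow> star Z * P3 = 0 \<Longrightarrow> star Z * Q2 = 0 \<and> star Z * Q3 = 0"
    "\<And>Z X. star Z * P1 = X \<Longrightarrow> star Z * P3 = 0 \<Longrightarrow>
      star Z * Q2 = cs (of_real (1 / sqrt 2)) X \<and> star Z * Q3 = cs (of_real (1 / sqrt 2)) X"
    by (rule mix_pair[OF P(2) R(2) PP(4) m, of A]) (rule that; assumption)
  have QP: "star P1 * Q0 = 0" "star P1 * Q1 = 0" "star P3 * Q0 = 0" "star P3 * Q1 = 0"
    using Q(7)[of P1] Q(7)[of P3] PP flip P(3) R(3) by auto
  have QQ: "star Q0 * Q2 = 0" "star Q0 * Q3 = 0" "star Q1 * Q2 = 0" "star Q1 * Q3 = 0"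
    using S(7)[of Q0] S(7)[of Q1] QP flip by auto
  have V0: "star (V 0) * P0 = cs (of_real (1 / sqrt 2)) (un m)" "star (V 0) * P1 = cs (of_real (1 / sqrt 2)) (un m)"
    using P(8)[of "V 0" "un m"] vp[of 0 1] isom_star_mult[OF v(1)] by auto
  have VQ: "star (V 0) * Z = cs (1/2) (un m)" if "Z \<in> {Q0, Q1, Q2, Q3}" for Z
    using Q(8)[OF V0(1)] S(8)[OF V0(2)] vP[of 0] that half_sqrt by (auto simp del: of_real_divide)
  define q where "q k = (if k = 0 then Q0 else if k = 1 then Q1 else if k = 2 then Q2 else Q3)" for k :: nat
  have c4: "k = 0 \<or> k = 1 \<or> k = 2 \<or> k = 3" if "k < 4" for k :: nat using that by auto
  have qv: "q 0 = Q0" "q 1 = Q1" "q 2 = Q2" "q 3 = Q3" by (simp_all add: q_def)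
  have tr4: "tr (star (q k) * A * q k) = 0" if "k < 4" for k
  proof -
    have "tr (star P0 * A * P0) + tr (star P2 * A * P2) = 0" "tr (star P1 * A * P1) + tr (star P3 * A * P3) = 0"
      unfolding P(5,6) R(5,6) using total by (simp_all add: add_divide_distrib[symmetric] add_ac)
    then have "tr (star Q0 * A * Q0) = 0" "tr (star Q1 * A * Q1) = 0" "tr (star Q2 * A * Q2) = 0" "tr (star Q3 * A * Q3) = 0"
      unfolding Q(5,6) S(5,6) by simp_all
    then show ?thesis using c4[OF that] by (elim disjE) (simp_all only: qv)
  qed
  show ?thesis
  proof (rule that[of q])
    show "isom n m (q k)" if "k < 4" for k 
      using c4[OF that] Q(1,2) S(1,2) by (elim disjE) (simp_all only: qv)
    have perp: "star (q k) * q l = 0" if "k < l" "l < 4" for k l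
    proof -
      have "k = 0 \<and> l = 1 \<or> k = 0 \<and> l = 2 \<or> k = 0 \<and> l = 3 \<or> k = 1 \<and> l = 2 \<or> k = 1 \<and> l = 3 \<or> k = 2 \<and> l = 3"
        using c4[of k] c4[of l] that by auto
      then show ?thesis using QQ Q(3) S(3) by (elim disjE conjE) (simp_all only: qv)
    qed
    show "star (q k) * q l = 0" if "k < 4" "l < 4" "k \<noteq> l" for k l
      using perp[of k l] perp[of l k] flip[of "q l" "q k"] that by (cases "k < l") auto
    have "(\<Sum>k<4. q k * star (q k)) = (Q0 * star Q0 + Q1 * star Q1) + (Q2 * star Q2 + Q3 * star Q3)"
      by (simp add: q_def numeral_eq_Suc add_ac)
    also have "\<dots> = (P0 * star P0 + P1 * star P1) + (P2 * star P2 + P3 * star P3)"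
      unfolding Q(4) S(4) by (simp add: add_ac)
    also have "\<dots> = un n" unfolding P(4) R(4) compl[symmetric] by (simp add: numeral_eq_Suc add_ac)
    finally show "(\<Sum>k<4. q k * star (q k)) = un n" .
    show "tr (star (q k) * A * q k) = 0" if "k < 4" for k by (rule tr4[OF that])
    show "star (V 0) * q k = cs (1/2) (un m)" if "k < 4" for k
      by (rule VQ) (use c4[OF that] qv in auto)
  qed
qed

subsection \<open>Matrices that are small off few directions\<close>

text \<open>Approximate low rank, stated through the form of \<open>A\<close>. The
  \<open>u i\<close> may be dependent or even fail to be vectors of length \<open>n\<close>, so a
  compression simply replaces them by \<open>star V * u i\<close> and keeps \<open>q\<close> and
  \<open>e\<close>.\<close>

definition LR :: "nat \<Rightarrow> nat \<Rightarrow> real \<Rightarrow> fmat \<Rightarrow> bool" where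
  "LR n q e A \<longleftrightarrow> (\<exists>u. \<forall>x y. cvec n x \<longrightarrow> cvec n y \<longrightarrow> (\<forall>i<q. cip (u i) x = 0 \<and> cip (u i) y = 0) \<longrightarrow>
     cmod (cip y (A * x)) \<le> e * norm x * norm y)"

lemma LR_compress:
  assumes "LR n q e A" "isom n p V" shows "LR p q e (star V * A * V)"
proof -
  obtain u where u: "\<And>x y. cvec n x \<Longrightarrow> cvec n y \<Longrightarrow> (\<And>i. i < q \<Longrightarrow> cip (u i) x = 0 \<and> cip (u i) y = 0) \<Longrightarrow>
      cmod (cip y (A * x)) \<le> e * norm x * norm y"
    using assms(1) unfolding LR_def by metis
  have "cmod (cip y (star V * A * V * x)) \<le> e * norm x * norm y"
    if "cvec p x" "cvec p y" "\<And>i. i < q \<Longrightarrow> cip (star V * u i) x = 0 \<and> cip (star V * u i) y = 0" for x y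
  proof -
    have "cmod (cip (V * y) (A * (V * x))) \<le> e * norm (V * x) * norm (V * y)"
      using that by (intro u cvec_mult[OF isom_cor[OF assms(2)]]) (auto simp: cip_star_mult)
    then show ?thesis using that by (simp add: cip_star_mult mult.assoc norm_isom_vec[OF assms(2)])
  qed
  then show ?thesis unfolding LR_def by (intro exI[of _ "\<lambda>i. star V * u i"]) blast
qed

lemma LR_zero: "0 \<le> e \<Longrightarrow> LR n 0 e 0"
  by (simp add: LR_def)

lemma cip_trunc: "cvec n x \<Longrightarrow> cip (un n * u * eu 0 0) x = cip u x"
  by (simp add: cip_vec cong: sum.cong_simp) 

text \<open>Against a vector of length \<open>n\<close>, \<open>cip\<close> only sees the first
  \<open>n\<close> entries of the first column, so the constraints may be arbitrary
  matrices.\<close>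

lemma exists_isom':
  assumes "finite I" "card I + p \<le> n"
  shows "\<exists>V. isom n p V \<and> (\<forall>i\<in>I. \<forall>z. cvec p z \<longrightarrow> cip (u i) (V * z) = 0)"
proof -
  have "cvec n (un n * u i * eu 0 0)" for i by (auto simp: cvec_iff)
  then obtain V where V: "isom n p V" "\<And>i. i \<in> I \<Longrightarrow> star V * (un n * u i * eu 0 0) = 0"
    using exists_isom[OF assms, of "\<lambda>i. un n * u i * eu 0 0"] by blast
  have "cip (u i) (V * z) = 0" if "i \<in> I" "cvec p z" for i z
  proof -
    have "cip (u i) (V * z) = cip (un n * u i * eu 0 0) (V * z)"
      using cip_trunc[OF cvec_mult[OF isom_cor[OF V(1)] that(2)]] by simp
    also have "\<dots> = cip (star V * (un n * u i * eu 0 0)) z" by (rule cip_mult_right)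
    finally show ?thesis by (simp add: V(2)[OF that(1)])
  qed
  then show ?thesis using V(1) by blast
qed

lemma opn_mult_le: "opn A \<le> a \<Longrightarrow> opn B \<le> b \<Longrightarrow> opn (A * B) \<le> a * b"
  by (meson mult_mono opn_mult opn_nonneg order_trans)

lemma cmod_cip_star: "cmod (cip y (star A * x)) = cmod (cip x (A * y))"
  unfolding cip_mult_right[of y "star A"] star_star by (subst cip_commute) simp

text \<open>Neighbouring centres are \<open>(3/5) * sqrt 2\<close> apart, about 0.8485; this leaves
  4/100 between discs of radius 2/5.\<close>

lemma i_power_gap: "k < 4 \<Longrightarrow> l < 4 \<Longrightarrow> k \<noteq> l \<Longrightarrow> 84 / 100 \<le> cmod ((3/5) * \<i> ^ k - (3/5) * \<i> ^ l)"
proof -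
  assume kl: "k < 4" "l < 4" "k \<noteq> l"
  have "(84 / 100)\<^sup>2 \<le> (cmod ((3/5) * \<i> ^ k - (3/5) * \<i> ^ l))\<^sup>2"
  proof -
    have "k \<in> {0, 1, 2, 3}" "l \<in> {0, 1, 2, 3}" using kl by auto
    moreover have "\<i> ^ 3 = - \<i>" by (simp add: power3_eq_cube)
    ultimately show ?thesis using kl(3) by (elim insertE emptyE) (simp_all add: cmod_power2 power_divide)
  qed
  then show ?thesis by (rule power2_le_imp_le) simp
qed

text \<open>\<open>R\<close> is chosen orthogonal to the \<open>u i\<close> and also to
  \<open>A * u i\<close> and \<open>star A * u i\<close>. Hence \<open>A * x\<close> and
  \<open>star A * x\<close> are orthogonal to the \<open>u i\<close> for \<open>x\<close> in the
  range of \<open>R\<close>, and testing the form against them upgrades the bound \<open>e\<close>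
  to the operator norms of \<open>A * R\<close> and \<open>star R * A\<close>. So \<open>A\<close>
  is within \<open>2 * e\<close> of its part on the range of \<open>V0\<close>, and the mixed blocks
  overlap that range by one half only.\<close>

lemma quarter_step:
  assumes m: "even m" "3 * q \<le> m" and N: "N = 4 * m" and A: "cor N N A" "tr A = 0" "opn A \<le> a" "a \<le> 1"
    and lr: "LR N q e A" "0 \<le> e"
    and sol: "\<And>A'. cor m m A' \<Longrightarrow> tr A' = 0 \<Longrightarrow> opn A' \<le> a / 4 + 2 * e \<Longrightarrow> LR m q e A' \<Longrightarrow> Sol m A' L"
    and L: "0 \<le> L"
  shows "Sol N A (5/2 * L + 400)"
proof -
  obtain u where u: "\<And>x y. cvec N x \<Longrightarrow> cvec N y \<Longrightarrow> (\<And>i. i < q \<Longrightarrow> cip (u i) x = 0 \<and> cip (u i) y = 0) \<Longrightarrow>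
      cmod (cip y (A * x)) \<le> e * norm x * norm y"
    using lr(1) unfolding LR_def by metis
  let ?I = "{..<3::nat} \<times> {..<q}"
  let ?w = "\<lambda>(c, i). if c = (0::nat) then u i else if c = 1 then A * u i else star A * u i"
  have "card ?I + 3 * m \<le> N" using m(2) N by (simp add: card_cartesian_product)
  then obtain R where R: "isom N (3 * m) R" "\<And>c z. c \<in> ?I \<Longrightarrow> cvec (3 * m) z \<Longrightarrow> cip (?w c) (R * z) = 0"
    using exists_isom'[of ?I "3 * m" N ?w] by auto
  obtain V0 where V0: "isom N (N - 3 * m) V0" "star R * V0 = 0" "star V0 * R = 0" "R * star R + V0 * star V0 = un N"
    using isom_complement[OF R(1)] by metis
  have V0m: "isom N m V0" using V0(1) N by simp
  have small: "opn (X * R) \<le> e" if X: "cor N N X" "X = A \<or> X = star A" for X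
  proof (rule opn_vec_leI[OF lr(2)])
    show "X * R * un (3 * m) = X * R" using isom_un[OF R(1)] by (simp add: mult.assoc)
    fix z assume z: "cvec (3 * m) z"
    let ?x = "R * z" and ?y = "X * (R * z)"
    have x: "cvec N ?x" by (rule cvec_mult[OF isom_cor[OF R(1)] z])
    have y: "cvec N ?y" by (rule cvec_mult[OF X(1) x])
    have cx: "cip (u i) ?x = 0" if "i < q" for i using R(2)[of "(0, i)" z] z that by simp
    have cy: "cip (u i) ?y = 0" if "i < q" for i
      unfolding cip_mult_right[of "u i"] using R(2)[of "(1, i)" z] R(2)[of "(2, i)" z] z that X(2) by auto
    have "(norm ?y)\<^sup>2 = cmod (cip ?y (X * ?x))" by (simp add: cip_self norm_power)
    also have "\<dots> \<le> e * norm ?x * norm ?y"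
      using X(2)
    proof
      assume "X = A" then show ?thesis using u[OF x y] cx cy by simp
    next
      assume X': "X = star A"
      have "cmod (cip ?y (X * ?x)) = cmod (cip ?x (A * ?y))" unfolding X' by (rule cmod_cip_star)
      then show ?thesis using u[OF y x] cx cy by (simp add: mult_ac)
    qed
    finally have "norm ?y \<le> e * norm ?x" by (rule power2_le_mult_imp_le) (simp_all add: lr(2))
    then show "norm (X * R * z) \<le> e * norm z" using norm_isom_vec[OF R(1) z] by (simp add: mult.assoc)
  qed
  have AR: "opn (A * R) \<le> e" "opn (star R * A) \<le> e"
    using small[OF A(1)] small[OF cor_star[OF A(1)]] opn_star[of "star A * R"] by auto
  define V where "V k = (if k = 0 then V0 else R * blk m (k - 1))" for k :: nat
  have b: "isom (3 * m) m (blk m k)" if "k < 3" for k using blk_isom[OF that] .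
  have V: "isom N m (V k)" if "k < 4" for k
    using V0m isom_mult[OF R(1) b[of "k - 1"]] that by (auto simp: V_def)
  have Vp: "star (V k) * V l = 0" if "k < 4" "l < 4" "k \<noteq> l" for k l
  proof -
    have "star (R * blk m i) * (R * blk m j) = 0" if "i \<noteq> j" "j < 3" for i j
      using blk_perp[OF that(1)] isom_rules[OF R(1)] isom_rules[OF b[OF that(2)]] by (simp add: mult.assoc)
    moreover have "k - 1 \<noteq> l - 1" "l - 1 < 3" if "k \<noteq> 0" "l \<noteq> 0" using that \<open>k \<noteq> l\<close> \<open>l < 4\<close> by auto
    ultimately show ?thesis using V0(2,3) perp_rule[OF V0(2)] perp_rule[OF V0(3)] that
      by (auto simp: V_def mult.assoc)
  qed
  have Vc: "(\<Sum>k<4. V k * star (V k)) = un N"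
  proof -
    have "(\<Sum>k<4. V k * star (V k)) = V0 * star V0 + R * (\<Sum>k<3. blk m k * star (blk m k)) * star R"
      by (simp add: V_def numeral_eq_Suc ring_distribs mult.assoc add_ac)
    also have "\<dots> = un N" using V0(4) isom_un[OF R(1)] by (simp add: blk_complete add.commute)
    finally show ?thesis .
  qed
  obtain Q :: "nat \<Rightarrow> fmat" where Q: "\<And>k. k < 4 \<Longrightarrow> isom N m (Q k)" "\<And>k l. k < 4 \<Longrightarrow> l < 4 \<Longrightarrow> k \<noteq> l \<Longrightarrow> star (Q k) * Q l = 0"
    "(\<Sum>k<4. Q k * star (Q k)) = un N" "\<And>k. k < 4 \<Longrightarrow> tr (star (Q k) * A * Q k) = 0"
    "\<And>k. k < 4 \<Longrightarrow> star (V 0) * Q k = cs (1/2) (un m)"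
    using mix_four[OF V Vp Vc A(1,2) m(1)] by blast
  have piece: "opn (star (Q k) * A * Q k) \<le> a / 4 + 2 * e" if k: "k < 4" for k
  proof -
    have half: "opn (star V0 * Q k) \<le> 1/2" "opn (star (Q k) * V0) \<le> 1/2"
    proof -
      have "star V0 * Q k = cs (1/2) (un m)" using Q(5)[OF k] by (simp add: V_def)
      then show "opn (star V0 * Q k) \<le> 1/2" using opn_un_le[of m] by simp
      then show "opn (star (Q k) * V0) \<le> 1/2" using opn_star[of "star V0 * Q k"] by simp
    qed
    have q1: "opn (Q k) \<le> 1" "opn (star (Q k)) \<le> 1" using opn_isom[OF Q(1)[OF k]] by simp_all
    have r1: "opn R \<le> 1" "opn (star R) \<le> 1" using opn_isom[OF R(1)] by simp_all
    have v1: "opn (V0 * star V0) \<le> 1 * 1" using opn_isom[OF V0m] by (intro opn_mult_le) simp_all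
    let ?P = "V0 * star V0"
    \<comment> \<open>The part \<open>R * star R * A\<close> is kept in one piece, so that just two
      error terms of norm at most \<open>e\<close> occur.\<close>
    have "A = (?P + R * star R) * A" "A * R * star R + A * ?P = A"
      using V0(4) A(1) by (simp_all add: cor_def add.commute distrib_left[symmetric] mult.assoc)
    then have "A = ?P * A * ?P + ?P * (A * R) * star R + R * (star R * A)"
      by (metis (no_types, lifting) add.commute distrib_left distrib_right mult.assoc)
    then have "star (Q k) * A * Q k = star (Q k) * (?P * A * ?P + ?P * (A * R) * star R + R * (star R * A)) * Q k" by simp
    also have "\<dots> = (star (Q k) * V0) * (star V0 * A * V0) * (star V0 * Q k)
        + star (Q k) * (?P * ((A * R) * (star R * Q k))) + (star (Q k) * R) * ((star R * A) * Q k)"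
      by (simp add: ring_distribs mult.assoc)
    finally have eq: "star (Q k) * A * Q k = \<dots>" .
    have "opn ((star (Q k) * V0) * (star V0 * A * V0) * (star V0 * Q k)) \<le> 1/2 * a * (1/2)"
      using half A(3) opn_sandwich[OF V0m V0m, of A] by (intro opn_mult_le) auto
    moreover have "opn (star (Q k) * (?P * ((A * R) * (star R * Q k)))) \<le> 1 * (1 * 1 * (e * (1 * 1)))"
      by (intro opn_mult_le[OF q1(2)] opn_mult_le[OF v1] opn_mult_le[OF AR(1)] opn_mult_le[OF r1(2) q1(1)])
    moreover have "opn ((star (Q k) * R) * ((star R * A) * Q k)) \<le> 1 * 1 * (e * 1)"
      by (intro opn_mult_le[OF opn_mult_le[OF q1(2) r1(1)]] opn_mult_le[OF AR(2) q1(1)])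
    ultimately have "opn ((star (Q k) * V0) * (star V0 * A * V0) * (star V0 * Q k))
       + opn (star (Q k) * (?P * ((A * R) * (star R * Q k)))) + opn ((star (Q k) * R) * ((star R * A) * Q k)) \<le> a / 4 + 2 * e"
      by simp
    then show ?thesis unfolding eq by (meson opn_add add_right_mono order_trans)
  qed
  \<comment> \<open>Radius 2/5 costs the factor 5/2; the count of sixteen blocks at gap 4/100 costs
    \<open>16 / (4/100) = 400\<close>.\<close>
  have "Sol N A (5/2 * L + (real 4)\<^sup>2 * 1 / (4/100))"
  proof (rule assemble_Sol[where V = Q and p = "\<lambda>_. m" and L = "\<lambda>_. L" and d = "\<lambda>_. 2/5" and s = "\<lambda>k. (3/5) * \<i> ^ k", OF Q(1,2,3) A(1)])
    show "opn A \<le> 1" using A by simp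
    show "Sol m (star (Q k) * A * Q k) L" if "k < 4" for k
      by (intro sol cor_compress[OF Q(1)[OF that] Q(1)[OF that] A(1)] Q(4)[OF that] piece[OF that]
          LR_compress[OF lr(1) Q(1)[OF that]])
    show "2/5 + 2/5 + 4/100 \<le> cmod ((3/5) * \<i> ^ k - (3/5) * \<i> ^ l)" if "k < 4" "l < 4" "k \<noteq> l" for k l
      using i_power_gap[OF that] by simp
  qed (use L in \<open>auto simp: norm_mult norm_power\<close>)
  then show ?thesis by simp
qed

text \<open>Four blocks of even size need a multiple of 8, so the remainder is stripped vector by
  vector. With weight 1/1000 each strip multiplies the cost by 1000/997, which is below 251/250, and
  adds 1000.\<close>

lemma strip_quarter_step:
  assumes "3 * q \<le> 2 * h" "cor (8 * h + r) (8 * h + r) A" "tr A = 0" "opn A \<le> a" "a \<le> 1" "LR (8 * h + r) q e A" "0 \<le> e"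
    and sol: "\<And>A'. cor (2 * h) (2 * h) A' \<Longrightarrow> tr A' = 0 \<Longrightarrow> opn A' \<le> a / 4 + 2 * e \<Longrightarrow> LR (2 * h) q e A' \<Longrightarrow> Sol (2 * h) A' L"
    and L: "0 \<le> L"
  shows "Sol (8 * h + r) A ((251/250) ^ r * (5/2 * L + 400 + 1000 * r))"
  using assms(2-6)
proof (induction r arbitrary: A)
  case 0
  then show ?case using quarter_step[of "2 * h" q "8 * h" A a e L] assms(1,7) sol L by simp
next
  case (Suc r)
  have A: "cor (Suc (8 * h + r)) (Suc (8 * h + r)) A" using Suc.prems(1) by simp
  obtain W where W: "isom (Suc (8 * h + r)) (8 * h + r) W" "tr (star W * A * W) = 0"
    "\<And>L t. opn A \<le> 1 \<Longrightarrow> Sol (8 * h + r) (star W * A * W) L \<Longrightarrow> 0 < t \<Longrightarrow> t \<le> 1/6 \<Longrightarrow> Sol (Suc (8 * h + r)) A (L / (1 - 3 * t) + 1 / t)"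
    by (rule strip_one[OF A Suc.prems(2)]) (rule that; assumption)
  let ?X = "(251/250) ^ r * (5/2 * L + 400 + 1000 * r)"
  have S: "Sol (8 * h + r) (star W * A * W) ?X"
    using Suc.prems W(1,2) opn_sandwich[OF W(1) W(1), of A]
    by (intro Suc.IH cor_compress[OF W(1) W(1) A] LR_compress[OF _ W(1)]) auto
  have "Sol (Suc (8 * h + r)) A (?X / (1 - 3 * (1/1000)) + 1 / (1/1000))"
    using Suc.prems by (intro W(3) S) auto
  moreover have "?X / (1 - 3 * (1/1000)) + 1 / (1/1000) \<le> (251/250) ^ Suc r * (5/2 * L + 400 + 1000 * Suc r)"
  proof -
    have X0: "0 \<le> ?X" using L by simp
    have "x / (1 - 3 * (1/1000)) \<le> 251/250 * x" if "0 \<le> x" for x :: real using that by (simp add: field_simps)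
    from this[OF X0] have "?X / (1 - 3 * (1/1000)) \<le> 251/250 * ?X" .
    moreover have "1 / (1/1000) \<le> (251/250) ^ Suc r * (1000::real)"
      using one_le_power[of "251/250::real" "Suc r"] by simp
    ultimately have "?X / (1 - 3 * (1/1000)) + 1 / (1/1000) \<le> 251/250 * ?X + (251/250) ^ Suc r * 1000" by (rule add_mono)
    also have "\<dots> = (251/250) ^ Suc r * (5/2 * L + 400 + 1000 * Suc r)" by (simp add: algebra_simps)
    finally show ?thesis .
  qed
  ultimately show ?case by (auto intro: Sol_mono)
qed

text \<open>At most seven strips occur, and \<open>(251/250) ^ 7 * (5/2)\<close> is still below
  13/5. The block size \<open>2 * (N div 8)\<close> is the largest even number of which four copies
  fit into \<open>N\<close>.\<close>

lemma Qstep: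
  assumes "3 * q \<le> 2 * (N div 8)" "cor N N A" "tr A = 0" "opn A \<le> a" "a \<le> 1" "LR N q e A" "0 \<le> e"
    and sol: "\<And>A'. cor (2 * (N div 8)) (2 * (N div 8)) A' \<Longrightarrow> tr A' = 0 \<Longrightarrow> opn A' \<le> a / 4 + 2 * e \<Longrightarrow>
      LR (2 * (N div 8)) q e A' \<Longrightarrow> Sol (2 * (N div 8)) A' L"
    and L: "0 \<le> L"
  shows "Sol N A (13/5 * L + 8000)"
proof -
  let ?r = "N mod 8"
  have N: "8 * (N div 8) + ?r = N" by simp
  have "Sol N A ((251/250) ^ ?r * (5/2 * L + 400 + 1000 * ?r))"
    using strip_quarter_step[of q "N div 8" ?r A a e L] assms unfolding N by blast
  moreover have "(251/250) ^ ?r * (5/2 * L + 400 + 1000 * ?r) \<le> (251/250) ^ 7 * (5/2 * L + 400 + 1000 * (7::real))"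
    using L by (intro mult_mono power_increasing) (auto simp: less_Suc_eq_le[symmetric])
  moreover have "(251/250) ^ 7 * (5/2 * L + 400 + 1000 * (7::real)) \<le> 13/5 * L + 8000"
    using L by (simp add: algebra_simps power_divide divide_simps)
  ultimately show ?thesis by (meson Sol_mono order_trans)
qed

text \<open>The norm bound moves from \<open>a\<close> to \<open>a / 4 + 2 * e\<close>, whose fixed
  point \<open>8/3 * e\<close> is rounded up to \<open>3 * e\<close>; the cost grows by 13/5 per
  step, and \<open>good\<close> is invoked only at the last level. The \<open>+ 3\<close> in the
  size condition absorbs the rounding in \<open>2 * (N div 8)\<close>, and
  \<open>e \<le> 1/4\<close> keeps the norm bound at most 1.\<close>

lemma gain:
  "\<exists>C\<ge>0. \<forall>N A q a e K. (\<forall>m\<le>N. good K m) \<longrightarrow> 0 \<le> K \<longrightarrow> cor N N A \<longrightarrow> tr A = 0 \<longrightarrow> opn A \<le> a \<longrightarrow> a \<le> 1 \<longrightarrow>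
     0 \<le> e \<longrightarrow> e \<le> 1/4 \<longrightarrow> LR N q e A \<longrightarrow> 4 ^ s * (16 * q + 16) \<le> N + 3 \<longrightarrow>
     Sol N A (C + K * (13/5) ^ s * (a / 4 ^ s + 3 * e * (1 - 1 / 4 ^ s)))"
proof (induction s)
  case 0
  show ?case by (intro exI[of _ 0]) (auto intro: goodD)
next
  case (Suc s)
  then obtain C where C: "0 \<le> C" "\<And>N A q a e K. \<lbrakk>\<And>m. m \<le> N \<Longrightarrow> good K m; 0 \<le> K; cor N N A; tr A = 0; opn A \<le> a; a \<le> 1;
     0 \<le> e; e \<le> 1/4; LR N q e A; 4 ^ s * (16 * q + 16) \<le> N + 3\<rbrakk> \<Longrightarrow>
     Sol N A (C + K * (13/5) ^ s * (a / 4 ^ s + 3 * e * (1 - 1 / 4 ^ s)))" by auto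
  have "Sol N A (13/5 * C + 8000 + K * (13/5) ^ Suc s * (a / 4 ^ Suc s + 3 * e * (1 - 1 / 4 ^ Suc s)))"
    if h: "\<And>m. m \<le> N \<Longrightarrow> good K m" "0 \<le> K" "cor N N A" "tr A = 0" "opn A \<le> a" "a \<le> 1"
     "0 \<le> e" "e \<le> 1/4" "LR N q e A" "4 ^ Suc s * (16 * q + 16) \<le> N + 3" for N A q a e K
  proof -
    let ?m = "2 * (N div 8)" and ?a = "a / 4 + 2 * e"
    let ?L = "C + K * (13/5) ^ s * (?a / 4 ^ s + 3 * e * (1 - 1 / 4 ^ s))"
    have a0: "0 \<le> a" using opn_nonneg[of A] h(5) by linarith
    have p4: "(1::nat) \<le> 4 ^ s" by simp
    have "(4::nat) ^ Suc s \<ge> 4 * 1" using p4 by simp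
    then have "4 * (16 * q + 16) \<le> 4 ^ Suc s * (16 * q + 16)" by (intro mult_le_mono1) simp
    then have "4 * (16 * q + 16) \<le> N + 3" using h(10) by (rule order_trans)
    then have N: "64 * q + 64 \<le> N + 3" by simp
    then have q: "3 * q \<le> ?m" by linarith
    have "4 * (4 ^ s * (16 * q + 16)) \<le> N + 3" using h(10) by (simp add: mult.assoc)
    then have size: "4 ^ s * (16 * q + 16) \<le> ?m + 3" by linarith
    have L0: "0 \<le> ?L" using C(1) h a0 by (intro add_nonneg_nonneg mult_nonneg_nonneg) auto
    have "Sol N A (13/5 * ?L + 8000)"
    proof (rule Qstep[OF q h(3-6,9,7) _ L0])
      fix A' assume "cor ?m ?m A'" "tr A' = 0" "opn A' \<le> ?a" "LR ?m q e A'"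
      then show "Sol ?m A' ?L" using h size by (intro C(2)) auto
    qed
    moreover have "13/5 * ?L + 8000 \<le> 13/5 * C + 8000 + K * (13/5) ^ Suc s * (a / 4 ^ Suc s + 3 * e * (1 - 1 / 4 ^ Suc s))"
    proof -
      have "?a / 4 ^ s + 3 * e * (1 - 1 / 4 ^ s) = a / 4 ^ Suc s + 3 * e - e / 4 ^ s" by (simp add: field_simps)
      also have "\<dots> \<le> a / 4 ^ Suc s + 3 * e - 3 * e / 4 ^ Suc s" using h(7) by (simp add: field_simps)
      also have "\<dots> = a / 4 ^ Suc s + 3 * e * (1 - 1 / 4 ^ Suc s)" by (simp add: field_simps)
      finally have "K * (13/5) ^ Suc s * (?a / 4 ^ s + 3 * e * (1 - 1 / 4 ^ s)) \<le> K * (13/5) ^ Suc s * (a / 4 ^ Suc s + 3 * e * (1 - 1 / 4 ^ Suc s))"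
        using h(2) by (intro mult_left_mono) auto
      moreover have "13/5 * (C + K * (13/5) ^ s * x) + 8000 = 13/5 * C + 8000 + K * (13/5) ^ Suc s * x" for x :: real
        by (simp add: algebra_simps)
      ultimately show ?thesis by (simp only: add_left_mono)
    qed
    ultimately show ?thesis by (rule Sol_mono)
  qed
  then show ?case using C(1) by (intro exI[of _ "13/5 * C + 8000"]) auto
qed

subsection \<open>Spectral decomposition of self-adjoint matrices\<close>

lemma exists_eigenvector:
  assumes A: "cor n n A" and n: "0 < n"
  shows "\<exists>x k. cvec n x \<and> norm x = 1 \<and> A * x = cs k x"
proof -
  define M where "M = Matrix.mat n n (\<lambda>(i, j). ent A i j)"
  have M: "M \<in> carrier_mat n n" by (simp add: M_def)
  obtain k where "k \<in> spectrum M" using spectrum_non_empty[OF M n] by blast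
  then obtain v where v: "v \<in> carrier_vec n" "v \<noteq> 0\<^sub>v n" "M *\<^sub>v v = k \<cdot>\<^sub>v v"
    using M by (auto simp: spectrum_def eigenvalue_def eigenvector_def)
  define x where "x = Fmat (\<lambda>i j. if i < n \<and> j = 0 then vec_index v i else 0)"
  have ex: "ent x i j = (if i < n \<and> j = 0 then vec_index v i else 0)" for i j
    unfolding x_def by (subst ent_Fmat[of "Suc n"]) auto
  have cx: "cvec n x" by (auto simp: cvec_iff ex)
  have x0: "x \<noteq> 0"
  proof
    assume "x = 0"
    then have "vec_index v i = 0" if "i < n" for i using ex[of i 0] that by simp
    then have "v = 0\<^sub>v n" using v(1) by (intro eq_vecI) auto
    then show False using v(2) by simp
  qed
  have Ax: "A * x = cs k x"
  proof (rule fmat_eqI)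
    fix i j
    show "ent (A * x) i j = ent (cs k x) i j"
    proof (cases "i < n \<and> j = 0")
      case True
      have "ent (A * x) i j = (\<Sum>l<n. ent A i l * vec_index v l)"
        using A True by (subst ent_mult[of n]) (auto simp: cor_iff ex)
      also have "\<dots> = vec_index (M *\<^sub>v v) i"
        using True v(1) by (auto simp: M_def scalar_prod_def lessThan_atLeast0 intro!: sum.cong)
      finally show ?thesis using True v by (simp add: ex)
    next
      case False
      then show ?thesis using cvec_mult[OF A cx] cx by (auto simp: cvec_iff)
    qed
  qed
  let ?y = "cs (of_real (inverse (norm x))) x"
  have "norm ?y = 1" using x0 by (simp add: norm_inverse)
  moreover have "A * ?y = cs k ?y" using Ax by (simp add: mult.commute)
  ultimately show ?thesis using cx cvec_cs by blast
qed

definition spec :: "nat \<Rightarrow> fmat \<Rightarrow> (nat \<Rightarrow> fmat) \<Rightarrow> (nat \<Rightarrow> real) \<Rightarrow> bool" where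
  "spec n H u l \<longleftrightarrow> orth n n u \<and> (\<forall>i<n. H * u i = cs (of_real (l i)) (u i))"

lemma spectral_theorem:
  assumes "cor n n H" "star H = H" shows "\<exists>u l. spec n H u l"
  using assms
proof (induction n arbitrary: H)
  case 0
  then show ?case by (auto simp: spec_def orth_def)
next
  case (Suc n)
  obtain x k where x: "cvec (Suc n) x" "norm x = 1" "H * x = cs k x"
    using exists_eigenvector[OF Suc.prems(1)] by auto
  have k1: "cip x (H * x) = k" using x by (simp add: cip_self)
  have "cnj k = k" using cip_mult_right[of x H x] Suc.prems(2) x by (simp add: cip_self)
  then obtain k' where k: "k = of_real k'" by (metis Reals_cases Reals_cnj_iff)
  have V: "isom (Suc n) 1 (of_cols 1 (\<lambda>_. x))" (is "isom _ _ ?V") by (intro isom_of_cols orth_single x)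
  obtain W where W: "isom (Suc n) (Suc n - 1) W" "star W * ?V = 0" "?V * star ?V + W * star W = un (Suc n)"
    using isom_complement[OF V] by metis
  have Wi: "isom (Suc n) n W" using W(1) by simp
  have Vx: "?V = x * eu 0 0" by (simp add: of_cols_def)
  then have Vx': "?V = x" using x(1) by (simp add: cvec_def)
  \<comment> \<open>The complement of an eigenvector is invariant because \<open>H\<close> is
    self-adjoint: \<open>star x * (H * W)\<close> is a multiple of \<open>star x * W\<close>, which
    is 0.\<close>
  have HW: "H * W = W * (star W * H * W)"
  proof -
    have "star x * (H * W) = star (H * x) * W" using Suc.prems(2) by (simp add: mult.assoc)
    also have "\<dots> = cs (cnj k) (star x * W)" unfolding x(3) by simp
    also have "star x * W = 0" using W(2) unfolding Vx' by (metis star_0 star_mult star_star)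
    finally have *: "star x * (H * W) = 0" by simp
    have "H * W = un (Suc n) * H * W" using Suc.prems(1) by (simp add: cor_def)
    also have "\<dots> = x * (star x * (H * W)) + W * (star W * H * W)"
      unfolding W(3)[symmetric] Vx' by (simp add: ring_distribs mult.assoc)
    finally show ?thesis using * by simp
  qed
  obtain u l where ul: "spec n (star W * H * W) u l"
    using Suc.IH[OF cor_compress[OF Wi Wi Suc.prems(1)]] Suc.prems(2) by (auto simp: mult.assoc)
  have o: "orth (Suc n) n (\<lambda>i. W * u i)" using ul Wi by (intro orth_isom_mult) (auto simp: spec_def)
  have "cip (W * u i) x = 0" for i
    using W(2) unfolding Vx' cip_star_mult by (simp add: cip_def)
  then have "orth (Suc n) (Suc n) ((\<lambda>i. W * u i)(n := x))" by (intro orth_extend[OF o] x) auto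
  moreover have "H * (W * u i) = cs (of_real (l i)) (W * u i)" if "i < n" for i
  proof -
    have "H * (W * u i) = W * (star W * H * W * u i)" using HW by (simp add: mult.assoc[symmetric])
    then show ?thesis using ul that by (simp add: spec_def)
  qed
  ultimately have "spec (Suc n) H ((\<lambda>i. W * u i)(n := x)) (l(n := k'))"
    using x(3) k by (auto simp: spec_def less_Suc_eq)
  then show ?case by blast
qed

section \<open>Orthonormal bases: expansion, Parseval's identity, Bessel's inequality\<close>

lemma orth_complete:
  assumes "orth n n u" "cvec n x" shows "x = (\<Sum>i<n. cs (cip (u i) x) (u i))"
proof -
  let ?U = "of_cols n u"
  have U: "isom n n ?U" using isom_of_cols[OF assms(1)] .
  \<comment> \<open>\<open>n\<close> orthonormal vectors leave a complement of dimension
    \<open>n - n\<close>, so \<open>W\<close> vanishes and the vectors are complete.\<close>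
  obtain W where W: "isom n (n - n) W" "?U * star ?U + W * star W = un n"
    using isom_complement[OF U] by metis
  then have "W = 0" using isom_un[OF W(1)] by simp
  then have UU: "?U * star ?U = un n" using W(2) by simp
  have "?U * star ?U = (\<Sum>i<n. u i * star (u i))"
  proof -
    have "?U * star ?U = (\<Sum>i<n. \<Sum>j<n. u j * (eu 0 j * eu i 0) * star (u i))"
      by (simp add: of_cols_def sum_distrib_left sum_distrib_right mult.assoc)
    also have "\<dots> = (\<Sum>i<n. \<Sum>j<n. if j = i then u i * eu 0 0 * star (u i) else 0)"
      by (intro sum.cong) (auto simp: eu_eu)
    also have "\<dots> = (\<Sum>i<n. u i * star (u i))"
      using assms(1) by (auto simp: orth_def cvec_def intro!: sum.cong)
    finally show ?thesis .
  qed
  then have "x = (\<Sum>i<n. u i * star (u i)) * x" using UU assms(2) by (simp add: cvec_def)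
  also have "\<dots> = (\<Sum>i<n. u i * (star (u i) * x))" by (simp add: sum_distrib_right mult.assoc)
  also have "\<dots> = (\<Sum>i<n. cs (cip (u i) x) (u i))"
  proof (intro sum.cong refl)
    fix i assume "i \<in> {..<n}"
    then have "cvec n (u i)" using assms(1) by (simp add: orth_def)
    then show "u i * (star (u i) * x) = cs (cip (u i) x) (u i)"
      using assms(2) by (subst star_vec_mult[of n]) (auto simp: cvec_def)
  qed
  finally show ?thesis .
qed

lemma parseval:
  assumes "orth n n u" "cvec n y" shows "cip x y = (\<Sum>i<n. cnj (cip (u i) x) * cip (u i) y)"
proof -
  have "cip x y = cip x (\<Sum>i<n. cs (cip (u i) y) (u i))" using orth_complete[OF assms] by simp
  also have "\<dots> = (\<Sum>i<n. cip (u i) y * cip x (u i))" by (simp add: cip_sum_right)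
  also have "\<dots> = (\<Sum>i<n. cnj (cip (u i) x) * cip (u i) y)"
    using cip_commute[of x] by (intro sum.cong) auto
  finally show ?thesis .
qed

lemma parseval_norm: "orth n n u \<Longrightarrow> cvec n x \<Longrightarrow> (norm x)\<^sup>2 = (\<Sum>i<n. (cmod (cip (u i) x))\<^sup>2)"
proof -
  assume "orth n n u" "cvec n x"
  then have "complex_of_real ((norm x)\<^sup>2) = of_real (\<Sum>i<n. (cmod (cip (u i) x))\<^sup>2)"
    using parseval[of n u x x] by (simp add: cip_self complex_norm_square mult.commute del: of_real_power)
  then show ?thesis by (simp only: of_real_eq_iff)
qed

lemma bessel: 
  assumes "orth n p x" "cvec n y" shows "(\<Sum>i<p. (cmod (cip (x i) y))\<^sup>2) \<le> (norm y)\<^sup>2"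
proof -
  let ?z = "y - (\<Sum>i<p. cs (cip (x i) y) (x i))"
  have xz: "cip (x j) ?z = 0" if "j < p" for j
  proof -
    have "cip (x j) (\<Sum>i<p. cs (cip (x i) y) (x i)) = (\<Sum>i<p. if i = j then cip (x j) y else 0)"
      unfolding cip_sum_right using assms(1) that by (intro sum.cong) (auto simp: orth_def)
    then show ?thesis using that by (simp add: cip_diff_right)
  qed
  have "cip y y = cip ?z ?z + (\<Sum>i<p. cip (x i) y * cnj (cip (x i) y))"
  proof -
    have "cip ?z ?z = cip y ?z - (\<Sum>i<p. cnj (cip (x i) y) * cip (x i) ?z)"
      by (simp add: cip_diff_left cip_sum_left)
    also have "\<dots> = cip y ?z" by (simp add: xz)
    also have "\<dots> = cip y y - (\<Sum>i<p. cip (x i) y * cip y (x i))" by (simp add: cip_diff_right cip_sum_right)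
    also have "(\<Sum>i<p. cip (x i) y * cip y (x i)) = (\<Sum>i<p. cip (x i) y * cnj (cip (x i) y))"
      using cip_commute[of y] by (intro sum.cong) auto
    finally show ?thesis by simp
  qed
  then have "complex_of_real ((norm y)\<^sup>2) = of_real ((norm ?z)\<^sup>2 + (\<Sum>i<p. (cmod (cip (x i) y))\<^sup>2))"
    by (simp add: cip_self complex_norm_square[symmetric] del: of_real_power)
  then have "(norm y)\<^sup>2 = (norm ?z)\<^sup>2 + (\<Sum>i<p. (cmod (cip (x i) y))\<^sup>2)" by (simp only: of_real_eq_iff)
  then show ?thesis using zero_le_power2[of "norm ?z"] by linarith
qed

section \<open>Forms, traces and norms in an eigenbasis\<close>

lemma spec_cip:
  assumes H: "cor n n H" "star H = H" "spec n H u l" and y: "cvec n y"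
  shows "cip x (H * y) = (\<Sum>i<n. of_real (l i) * (cnj (cip (u i) x) * cip (u i) y))"
proof -
  have "cip (u i) (H * y) = of_real (l i) * cip (u i) y" if "i < n" for i
    unfolding cip_mult_right using H that by (simp add: spec_def)
  then show ?thesis using parseval[of n u "H * y" x] H cvec_mult[OF H(1) y]
    by (auto simp: spec_def mult_ac intro!: sum.cong)
qed

lemma spec_quad:
  assumes H: "cor n n H" "star H = H" "spec n H u l" and y: "cvec n y"
  shows "cip y (H * y) = of_real (\<Sum>i<n. l i * (cmod (cip (u i) y))\<^sup>2)"
  unfolding spec_cip[OF assms] by (simp add: complex_norm_square mult.commute del: of_real_power)

lemma spec_bound: "spec n H u l \<Longrightarrow> i < n \<Longrightarrow> \<bar>l i\<bar> \<le> opn H"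
  using norm_mult_opn[of H "u i"] orth_norm[of n n u i] by (simp add: spec_def)

lemma tr_orth:
  assumes "cor n n A" "orth n n u" shows "tr A = (\<Sum>i<n. cip (u i) (A * u i))"
proof -
  let ?U = "of_cols n u"
  have U: "isom n n ?U" using isom_of_cols[OF assms(2)] .
  have v: "cvec n (u i)" if "i < n" for i using assms(2) that by (simp add: orth_def)
  obtain W where W: "isom n (n - n) W" "?U * star ?U + W * star W = un n"
    using isom_complement[OF U] by metis
  then have "W = 0" using isom_un[OF W(1)] by simp
  then have "tr A = tr (A * (?U * star ?U))" using W(2) assms(1) by (simp add: cor_def)
  also have "\<dots> = tr (star ?U * A * ?U)" by (metis mult.assoc tr_mult_commute)
  also have "\<dots> = (\<Sum>i<n. ent (star ?U * A * ?U) i i)" by (rule tr_cor[OF cor_compress[OF U U assms(1)]])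
  also have "\<dots> = (\<Sum>i<n. cip (u i) (A * u i))" using of_cols_compress[OF v v] by (intro sum.cong) auto
  finally show ?thesis .
qed

lemma tr_of_cols:
  assumes "cor n n A" "orth n p u" shows "tr (star (of_cols p u) * A * of_cols p u) = (\<Sum>i<p. cip (u i) (A * u i))"
proof -
  have v: "cvec n (u i)" if "i < p" for i using assms(2) that by (simp add: orth_def)
  have U: "isom n p (of_cols p u)" using isom_of_cols[OF assms(2)] .
  have "tr (star (of_cols p u) * A * of_cols p u) = (\<Sum>i<p. ent (star (of_cols p u) * A * of_cols p u) i i)"
    by (rule tr_cor[OF cor_compress[OF U U assms(1)]])
  also have "\<dots> = (\<Sum>i<p. cip (u i) (A * u i))" using of_cols_compress[OF v v] by (intro sum.cong) auto
  finally show ?thesis .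
qed

lemma spec_tr: "cor n n H \<Longrightarrow> spec n H u l \<Longrightarrow> tr H = of_real (\<Sum>i<n. l i)"
  using tr_orth[of n H u] orth_cip[of n n u] by (auto simp: spec_def)

lemma spec_small:
  assumes H: "cor n n H" "star H = H" "spec n H u l" and x: "cvec n x"
    and t: "\<And>i. i < n \<Longrightarrow> t < \<bar>l i\<bar> \<Longrightarrow> cip (u i) x = 0" "0 \<le> t"
  shows "norm (H * x) \<le> t * norm x"
proof -
  have o: "orth n n u" using H by (simp add: spec_def)
  have "cip (u i) (H * x) = of_real (l i) * cip (u i) x" if "i < n" for i
    unfolding cip_mult_right using H that by (simp add: spec_def)
  then have "(norm (H * x))\<^sup>2 = (\<Sum>i<n. (\<bar>l i\<bar> * cmod (cip (u i) x))\<^sup>2)"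
    unfolding parseval_norm[OF o cvec_mult[OF H(1) x]] by (intro sum.cong) (auto simp: norm_mult)
  also have "\<dots> \<le> (\<Sum>i<n. (t * cmod (cip (u i) x))\<^sup>2)"
  proof (intro sum_mono power_mono)
    fix i assume "i \<in> {..<n}"
    then show "\<bar>l i\<bar> * cmod (cip (u i) x) \<le> t * cmod (cip (u i) x)"
      using t(1)[of i] by (cases "t < \<bar>l i\<bar>") (auto intro: mult_right_mono)
  qed auto
  also have "\<dots> = (t * norm x)\<^sup>2" by (simp add: power_mult_distrib parseval_norm[OF o x] sum_distrib_left)
  finally show ?thesis by (rule power2_le_imp_le) (simp add: t)
qed

text \<open>The exceptional directions are the eigenvectors whose eigenvalues exceed
  \<open>t\<close> in absolute value.\<close>

lemma spec_LR:
  assumes H: "cor n n H" "star H = H" "spec n H u l" and t: "0 \<le> t"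
    and q: "card {i. i < n \<and> t < \<bar>l i\<bar>} \<le> q"
  shows "LR n q t H"
proof -
  let ?T = "{i. i < n \<and> t < \<bar>l i\<bar>}"
  obtain e where e: "bij_betw e {..<card ?T} ?T" using ex_bij_betw_nat_finite[of ?T] by (auto simp: lessThan_atLeast0)
  have "cmod (cip y (H * x)) \<le> t * norm x * norm y"
    if x: "cvec n x" "cvec n y" and perp: "\<forall>i<q. cip (u (e i)) x = 0 \<and> cip (u (e i)) y = 0" for x y
  proof -
    have "cip (u i) x = 0" if "i < n" "t < \<bar>l i\<bar>" for i
    proof -
      have "e ` {..<card ?T} = ?T" using e by (rule bij_betw_imp_surj_on)
      moreover have "i \<in> ?T" using that by simp
      ultimately have "i \<in> e ` {..<card ?T}" by (simp only:)
      then obtain j where j: "j < card ?T" "i = e j" by (elim imageE) simp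
      from j(1) q have "j < q" by (rule less_le_trans)
      with perp j(2) show ?thesis by simp
    qed
    then have "norm (H * x) \<le> t * norm x" using spec_small[OF H x(1) _ t] by blast
    then have "norm y * norm (H * x) \<le> norm y * (t * norm x)" by (rule mult_left_mono) simp
    then show ?thesis using cip_bound[of y "H * x"] by (simp add: mult_ac)
  qed
  then show ?thesis unfolding LR_def by (intro exI[of _ "\<lambda>i. u (e i)"]) blast
qed

text \<open>Otherwise the negative eigenvectors would span more dimensions than there are
  constraints, and some nonzero combination of them would meet all constraints although the form is
  negative on it.\<close>

lemma halfplane_card_neg:
  assumes H: "cor n n H" "star H = H" "spec n H u l" and I: "finite I" "card I \<le> f"
    and pos: "\<And>z. cvec n z \<Longrightarrow> (\<And>i. i \<in> I \<Longrightarrow> cip (w i) z = 0) \<Longrightarrow> 0 \<le> Re (cip z (H * z))"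
  shows "card {i. i < n \<and> l i < 0} \<le> f"
proof (rule ccontr)
  let ?S = "{i. i < n \<and> l i < 0}"
  assume "\<not> card ?S \<le> f"
  then have c: "card I < card ?S" using I by simp
  obtain x where x: "\<exists>k\<in>?S. x k \<noteq> 0" "\<And>k. k \<notin> ?S \<Longrightarrow> x k = 0" "\<And>i. i \<in> I \<Longrightarrow> (\<Sum>k\<in>?S. cip (w i) (u k) * x k) = 0"
    using underdetermined[OF I(1) _ c, of "\<lambda>i k. cip (w i) (u k)"] by auto
  define z where "z = (\<Sum>k\<in>?S. cs (x k) (u k))"
  have o: "orth n n u" using H by (simp add: spec_def)
  have z: "cvec n z" unfolding z_def using o by (intro cvec_sum cvec_cs) (auto simp: orth_def)
  have uz: "cip (u i) z = x i" if "i < n" for i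
  proof -
    have "cip (u i) z = (\<Sum>k\<in>?S. if k = i then x i else 0)"
      unfolding z_def cip_sum_right using o that by (intro sum.cong) (auto simp: orth_def)
    then show ?thesis using x(2)[of i] by (auto simp: sum.delta)
  qed
  have "0 \<le> Re (cip z (H * z))" using x(3) by (intro pos z) (simp add: z_def cip_sum_right mult.commute)
  also have "Re (cip z (H * z)) = (\<Sum>i<n. l i * (cmod (x i))\<^sup>2)"
    unfolding spec_quad[OF H z] by (simp add: uz)
  also have "\<dots> < 0"
  proof -
    obtain k where k: "k \<in> ?S" "x k \<noteq> 0" using x(1) by blast
    have "(\<Sum>i<n. l i * (cmod (x i))\<^sup>2) < (\<Sum>i<n. 0)"
    proof (rule sum_strict_mono_ex1)
      show "\<forall>i\<in>{..<n}. l i * (cmod (x i))\<^sup>2 \<le> 0" using x(2)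
        by (metis (mono_tags, lifting) mem_Collect_eq lessThan_iff mult_nonpos_nonneg less_imp_le zero_le_power2 norm_zero power_zero_numeral mult_zero_right order_refl)
      show "\<exists>i\<in>{..<n}. l i * (cmod (x i))\<^sup>2 < 0" using k by (intro bexI[of _ k]) (auto simp: mult_less_0_iff)
    qed simp
    then show ?thesis by simp
  qed
  finally show False by simp
qed

subsection \<open>Isotropic families\<close>

text \<open>The isotropic family is extended by a unit vector of value zero orthogonal to every
  \<open>x i\<close>, \<open>A * x i\<close> and \<open>star A * x i\<close>, which is three
  constraints per vector. If no such vector exists, the numerical range on the subspace cut out by
  the constraints lies in a half-plane.\<close>

lemma greedy_isotropic:
  assumes A: "cor d d A" and "3 * p \<le> d"
  shows "(\<exists>x. orth d p x \<and> (\<forall>i<p. \<forall>j<p. cip (x i) (A * x j) = 0)) \<or>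
    (\<exists>u (I :: (nat \<times> nat) set) w. cmod u = 1 \<and> finite I \<and> card I \<le> 3 * p \<and>
      (\<forall>z. cvec d z \<longrightarrow> (\<forall>i\<in>I. cip (w i) z = 0) \<longrightarrow> 0 \<le> Re (u * cip z (A * z))))"
  using assms(2)
proof (induction p)
  case 0
  then show ?case by (auto simp: orth_def)
next
  case (Suc p)
  then have "3 * p \<le> d" by simp
  from Suc.IH[OF this] show ?case
  proof (elim disjE exE conjE)
    fix x assume x: "orth d p x" "\<forall>i<p. \<forall>j<p. cip (x i) (A * x j) = 0"
    let ?I = "{..<3::nat} \<times> {..<p}"
    define w where "w = (\<lambda>(c, i). if c = (0::nat) then x i else if c = 1 then A * x i else star A * x i)"
    let ?E = "{z. cvec d z \<and> (\<forall>c\<in>?I. cip (w c) z = 0)}"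
    have "csub d ?E" by (rule csub_perp)
    from zero_or_halfplane[OF this, of A] show ?thesis
    proof (elim disjE bexE conjE exE)
      fix y assume y: "y \<in> ?E" "norm y = 1" "cip y (A * y) = 0"
      then have wy: "cip (w c) y = 0" if "c \<in> ?I" for c using that by blast
      have yx: "cip (x i) y = 0" "cip (A * x i) y = 0" "cip (star A * x i) y = 0" if "i < p" for i
        using wy[of "(0, i)"] wy[of "(1, i)"] wy[of "(2, i)"] that by (simp_all add: w_def)
      have o: "orth d (Suc p) (x(p := y))" using y yx by (intro orth_extend[OF x(1)]) auto
      have "cip (x i) (A * y) = 0" if "i < p" for i unfolding cip_mult_right using yx[OF that] by simp
      moreover have "cip y (A * x i) = 0" if "i < p" for i by (subst cip_commute) (simp add: yx[OF that])
      ultimately have "\<forall>i<Suc p. \<forall>j<Suc p. cip ((x(p := y)) i) (A * (x(p := y)) j) = 0"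
        using x(2) y(3) by (auto simp: less_Suc_eq)
      then show ?thesis using o by blast
    next
      fix u assume u: "cmod u = 1" "\<forall>z\<in>?E. 0 \<le> Re (u * cip z (A * z))"
      show ?thesis
        by (rule disjI2, rule exI[of _ u], rule exI[of _ ?I], rule exI[of _ w]) (use u in \<open>auto simp: card_cartesian_product\<close>)
    qed
  next
    fix u and I :: "(nat \<times> nat) set" and w
    assume "cmod u = 1" "finite I" "card I \<le> 3 * p"
      "\<forall>z. cvec d z \<longrightarrow> (\<forall>i\<in>I. cip (w i) z = 0) \<longrightarrow> 0 \<le> Re (u * cip z (A * z))"
    then show ?thesis by (intro disjI2 exI[of _ u] exI[of _ I] exI[of _ w]) auto
  qed
qed

lemma self_adjoint_real: "star H = H \<Longrightarrow> cip z (H * z) = of_real (Re (cip z (H * z)))"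
proof -
  assume "star H = H"
  then have "cnj (cip z (H * z)) = cip z (H * z)"
    using cip_mult_right[of z H z] cip_commute[of "H * z" z] by simp
  then show ?thesis by (simp add: complex_eq_iff)
qed

lemma quad_combination:
  "cip (cs (of_real c) x + cs (of_real s) y) (A * (cs (of_real c) x + cs (of_real s) y)) =
    of_real (c\<^sup>2) * cip x (A * x) + of_real (s\<^sup>2) * cip y (A * y) + of_real (c * s) * (cip x (A * y) + cip y (A * x))"
  by (simp add: distrib_left cip_add_left cip_add_right algebra_simps power2_eq_square)

lemma self_adjoint_swap: "star H = H \<Longrightarrow> cip x (H * y) = 0 \<Longrightarrow> cip y (H * x) = 0"
  using cmod_cip_star[of y H x] by simp

lemma orth_block: "orth n m x \<Longrightarrow> b * p + p \<le> m \<Longrightarrow> orth n p (\<lambda>i. x (b * p + i))"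
  unfolding orth_def by auto

lemma block_sum:
  fixes r :: "nat \<Rightarrow> real"
  assumes "(\<Sum>i<M * p. r i) \<le> v" "0 < M"
  shows "\<exists>b<M. (\<Sum>i<p. r (b * p + i)) \<le> v / M"
proof (rule ccontr)
  assume "\<not> ?thesis"
  then have *: "v / M < (\<Sum>i<p. r (b * p + i))" if "b < M" for b using that by auto
  have "(\<Sum>i<M * p. r i) = (\<Sum>b<M. \<Sum>i = b * p..<b * p + p. r i)" by (rule sum.nat_group[symmetric])
  also have "\<dots> = (\<Sum>b<M. \<Sum>i<p. r (b * p + i))"
  proof (rule sum.cong[OF refl])
    fix b
    show "(\<Sum>i = b * p..<b * p + p. r i) = (\<Sum>i<p. r (b * p + i))"
      using sum.shift_bounds_nat_ivl[of r 0 "b * p" p] by (simp add: add.commute lessThan_atLeast0)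
  qed
  also have "\<dots> > (\<Sum>b<M. v / M)" using * assms(2) by (intro sum_strict_mono) auto
  finally show False using assms by simp
qed

text \<open>Lying in the span of the \<open>u k\<close> with \<open>k\<close> in \<open>S\<close> is
  expressed as orthogonality to the remaining \<open>u k\<close>, and so becomes a further set of
  linear constraints.\<close>

lemma span_family:
  assumes u: "orth d d u" and I: "finite I" "card I + m \<le> card S" and S: "S \<subseteq> {..<d}"
  shows "\<exists>x. orth d m x \<and> (\<forall>i\<in>I. \<forall>j<m. cip (w i) (x j) = 0) \<and> (\<forall>k<d. k \<notin> S \<longrightarrow> (\<forall>j<m. cip (u k) (x j) = 0))"
proof -
  have fS: "finite S" using S finite_subset by blast
  have "card (I <+> ({..<d} - S)) + m \<le> d"
    using I S card_mono[OF _ S] by (simp add: card_Plus card_Diff_subset[OF fS S])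
  then obtain x where x: "orth d m x" "\<And>i j. i \<in> I <+> ({..<d} - S) \<Longrightarrow> j < m \<Longrightarrow> cip (case_sum w u i) (x j) = 0"
    using exists_orth[of "I <+> ({..<d} - S)" m d "case_sum w u"] I(1) by auto
  show ?thesis using x(1) x(2)[OF InlI] x(2)[OF InrI] by (intro exI[of _ x]) auto
qed

lemma spec_lower:
  assumes H: "cor d d H" "star H = H" "spec d H u l" and y: "cvec d y" "\<And>k. k < d \<Longrightarrow> l k < c \<Longrightarrow> cip (u k) y = 0"
  shows "c * (norm y)\<^sup>2 \<le> Re (cip y (H * y))"
proof -
  have o: "orth d d u" using H by (simp add: spec_def)
  have "c * (norm y)\<^sup>2 = (\<Sum>i<d. c * (cmod (cip (u i) y))\<^sup>2)" by (simp add: parseval_norm[OF o y(1)] sum_distrib_left)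
  also have "\<dots> \<le> (\<Sum>i<d. l i * (cmod (cip (u i) y))\<^sup>2)"
  proof (rule sum_mono)
    fix i assume "i \<in> {..<d}"
    then show "c * (cmod (cip (u i) y))\<^sup>2 \<le> l i * (cmod (cip (u i) y))\<^sup>2"
      using y(2)[of i] by (cases "l i < c") (auto intro: mult_right_mono)
  qed
  finally show ?thesis unfolding spec_quad[OF H y(1)] by simp
qed

lemma spec_upper:
  assumes H: "cor d d H" "star H = H" "spec d H u l" and y: "cvec d y" "\<And>k. k < d \<Longrightarrow> c < l k \<Longrightarrow> cip (u k) y = 0"
  shows "Re (cip y (H * y)) \<le> c * (norm y)\<^sup>2"
proof -
  have s: "spec d (- H) u (\<lambda>k. - l k)" using H by (simp add: spec_def cs_minus)
  have "(- c) * (norm y)\<^sup>2 \<le> Re (cip y ((- H) * y))"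
    by (rule spec_lower[OF _ _ s y(1)]) (use H y(2) in \<open>auto simp: cor_def\<close>)
  then show ?thesis using cip_cs_right[of y "-1" "H * y"] by (simp add: cs_minus)
qed

text \<open>By Bessel's inequality every eigenvector enters the sum with weight at most 1, and those
  with negative eigenvalue do not enter.\<close>

lemma psd_family_sum:
  assumes H: "cor d d H" "star H = H" "spec d H u l" and x: "orth d m x"
    and perp: "\<And>k i. k < d \<Longrightarrow> l k < 0 \<Longrightarrow> i < m \<Longrightarrow> cip (u k) (x i) = 0"
  shows "(\<Sum>i<m. Re (cip (x i) (H * x i))) \<le> (\<Sum>k | k < d \<and> 0 \<le> l k. l k)"
proof -
  have o: "orth d d u" using H by (simp add: spec_def)
  have v: "cvec d (x i)" if "i < m" for i using x that by (simp add: orth_def)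
  have "(\<Sum>i<m. Re (cip (x i) (H * x i))) = (\<Sum>i<m. \<Sum>k<d. l k * (cmod (cip (u k) (x i)))\<^sup>2)"
    using spec_quad[OF H v] by (intro sum.cong) auto
  also have "\<dots> = (\<Sum>k<d. \<Sum>i<m. l k * (cmod (cip (u k) (x i)))\<^sup>2)" by (rule sum.swap)
  also have "\<dots> \<le> (\<Sum>k<d. if 0 \<le> l k then l k else 0)"
  proof (rule sum_mono)
    fix k assume k: "k \<in> {..<d}"
    show "(\<Sum>i<m. l k * (cmod (cip (u k) (x i)))\<^sup>2) \<le> (if 0 \<le> l k then l k else 0)"
    proof (cases "0 \<le> l k")
      case True
      have "(\<Sum>i<m. (cmod (cip (u k) (x i)))\<^sup>2) = (\<Sum>i<m. (cmod (cip (x i) (u k)))\<^sup>2)"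
        by (intro sum.cong) (auto simp: cip_commute[of "u k"])
      also have "\<dots> \<le> (norm (u k))\<^sup>2" using o k by (intro bessel[OF x]) (auto simp: orth_def)
      also have "\<dots> = 1" using orth_norm[OF o] k by simp
      finally show ?thesis using True mult_left_mono[of _ 1 "l k"] by (simp add: sum_distrib_left[symmetric])
    next
      case False
      then show ?thesis using perp k by auto
    qed
  qed
  also have "\<dots> = (\<Sum>k | k < d \<and> 0 \<le> l k. l k)" by (simp add: sum.inter_filter[symmetric])
  finally show ?thesis .
qed

text \<open>The next vector must be orthogonal to all \<open>x i\<close> and \<open>G * x i\<close>;
  as \<open>G\<close> is self-adjoint, these two constraints per vector suffice. Both the positive
  and the negative spectral subspace still contain a unit vector meeting them, so the numerical
  range has points on both sides of 0 and, being convex, contains 0.\<close>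

lemma isotropic_of_indefinite:
  assumes G: "cor d d G" "star G = G" "spec d G u l" and c: "0 < c" and I: "finite I"
    and big: "card I + 2 * m \<le> card {k. k < d \<and> c < l k}" "card I + 2 * m \<le> card {k. k < d \<and> l k < - c}"
  shows "\<exists>x. orth d m x \<and> (\<forall>i\<in>I. \<forall>j<m. cip (w i) (x j) = 0) \<and> (\<forall>i<m. \<forall>j<m. cip (x i) (G * x j) = 0)"
  using big
proof (induction m)
  case 0
  then show ?case by (auto simp: orth_def)
next
  case (Suc m)
  then obtain x where x: "orth d m x" "\<forall>i\<in>I. \<forall>j<m. cip (w i) (x j) = 0" "\<forall>i<m. \<forall>j<m. cip (x i) (G * x j) = 0"
    by auto
  have o: "orth d d u" using G by (simp add: spec_def)
  let ?J = "I <+> {..<m} <+> {..<m}"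
  define v where "v = case_sum w (case_sum x (\<lambda>i. G * x i))"
  have fJ: "finite ?J" "card ?J = card I + 2 * m" using I by (auto simp: card_Plus)
  let ?E = "{z. cvec d z \<and> (\<forall>c\<in>?J. cip (v c) z = 0)}"
  have E: "csub d ?E" by (rule csub_perp)
  obtain y where y: "orth d 1 y" "\<forall>i\<in>?J. \<forall>j<1. cip (v i) (y j) = 0" "\<forall>k<d. k \<notin> {k. k < d \<and> c < l k} \<longrightarrow> (\<forall>j<1. cip (u k) (y j) = 0)"
    using span_family[OF o fJ(1), of 1 "{k. k < d \<and> c < l k}" v] Suc.prems(1) fJ(2) by auto
  obtain z where z: "orth d 1 z" "\<forall>i\<in>?J. \<forall>j<1. cip (v i) (z j) = 0" "\<forall>k<d. k \<notin> {k. k < d \<and> l k < - c} \<longrightarrow> (\<forall>j<1. cip (u k) (z j) = 0)"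
    using span_family[OF o fJ(1), of 1 "{k. k < d \<and> l k < - c}" v] Suc.prems(2) fJ(2) by auto
  have yz: "cvec d (y 0)" "cvec d (z 0)" "norm (y 0) = 1" "norm (z 0) = 1"
    using y(1) z(1) orth_norm[OF y(1)] orth_norm[OF z(1)] by (auto simp: orth_def)
  define a where "a = Re (cip (y 0) (G * y 0))"
  define b where "b = Re (cip (z 0) (G * z 0))"
  have a: "0 \<le> a" unfolding a_def using spec_lower[OF G yz(1), of 0] y(3) c by force
  have b: "b \<le> 0" unfolding b_def using spec_upper[OF G yz(2), of 0] z(3) c by force
  have yE: "y 0 \<in> ?E" and zE: "z 0 \<in> ?E" using y(2) z(2) yz by blast+
  have "of_real a = cip (y 0) (G * y 0)" "of_real b = cip (z 0) (G * z 0)"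
    unfolding a_def b_def by (rule self_adjoint_real[OF G(2), symmetric])+
  then have in_numr: "of_real a \<in> numr G ?E" "of_real b \<in> numr G ?E"
    unfolding numr_def using yE zE yz(3,4) by blast+
  have "0 \<in> numr G ?E"
  proof (cases "a = b")
    case True
    then show ?thesis using in_numr(1) a b by simp
  next
    case False
    then have ab: "a - b > 0" using a b by simp
    have "(- b / (a - b)) *\<^sub>R complex_of_real a + (a / (a - b)) *\<^sub>R complex_of_real b \<in> numr G ?E"
      using ab a b by (intro convexD[OF convex_numr[OF E] in_numr]) (auto simp: divide_simps)
    moreover have "(- b / (a - b)) *\<^sub>R complex_of_real a + (a / (a - b)) *\<^sub>R complex_of_real b = 0"
      by (simp add: scaleR_conv_of_real add_divide_distrib[symmetric] mult.commute)
    ultimately show ?thesis by simp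
  qed
  then obtain t where t: "t \<in> ?E" "norm t = 1" "cip t (G * t) = 0" unfolding numr_def by auto
  have vt: "cip (v c) t = 0" if "c \<in> ?J" for c using t(1) that by blast
  have tx: "cip (w i) t = 0" if "i \<in> I" for i using vt[OF InlI[OF that]] by (simp add: v_def)
  have tx': "cip (x i) t = 0" "cip (G * x i) t = 0" if "i < m" for i
    using vt[OF InrI[OF InlI[of i]]] vt[OF InrI[OF InrI[of i]]] that by (simp_all add: v_def)
  have o': "orth d (Suc m) (x(m := t))" using t tx' by (intro orth_extend[OF x(1)]) auto
  have "cip (x i) (G * t) = 0" "cip t (G * x i) = 0" if "i < m" for i
    using tx'(2)[OF that] G(2) cip_mult_right[of "x i" G t] self_adjoint_swap[OF G(2)] by auto
  then have "\<forall>i<Suc m. \<forall>j<Suc m. cip ((x(m := t)) i) (G * (x(m := t)) j) = 0"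
    using x(3) t(3) by (auto simp: less_Suc_eq)
  moreover have "\<forall>i\<in>I. \<forall>j<Suc m. cip (w i) ((x(m := t)) j) = 0" using x(2) tx by (auto simp: less_Suc_eq)
  ultimately show ?case using o' by blast
qed

lemma cip_swap_0: "cip x y = 0 \<Longrightarrow> cip y x = 0"
  by (subst cip_commute) simp

lemma orth_rotate:
  assumes v: "orth n p v" and w: "orth n D w" and D: "D \<le> p"
    and vw: "\<And>i j. i < D \<Longrightarrow> j < p \<Longrightarrow> cip (w i) (v j) = 0" and cs1: "c\<^sup>2 + s\<^sup>2 = 1"
  shows "orth n p (\<lambda>i. if i < D then cs (of_real c) (v i) + cs (of_real s) (w i) else v i)"
proof -
  have wv: "cip (v j) (w i) = 0" if "i < D" "j < p" for i j using vw[OF that] by (rule cip_swap_0)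
  have one: "complex_of_real c * of_real c + of_real s * of_real s = 1"
  proof -
    have "c * c + s * s = 1" using cs1 by (simp add: power2_eq_square)
    then have "complex_of_real (c * c + s * s) = 1" by simp
    then show ?thesis by (simp only: of_real_mult of_real_add)
  qed
  have "cip (cs (of_real c) (v i) + cs (of_real s) (w i)) (cs (of_real c) (v j) + cs (of_real s) (w j)) = (if i = j then 1 else 0)"
    if "i < D" "j < D" for i j
    using that D v w wv vw one by (simp add: cip_add_left cip_add_right orth_def)
  moreover have "cip (cs (of_real c) (v i) + cs (of_real s) (w i)) (v j) = 0" "cip (v j) (cs (of_real c) (v i) + cs (of_real s) (w i)) = 0"
    if "i < D" "\<not> j < D" "j < p" for i j
    using that D v w wv vw by (simp_all add: cip_add_left cip_add_right orth_def)
  moreover have "cvec n (cs (of_real c) (v i) + cs (of_real s) (w i))" if "i < D" for i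
    using that D v w by (intro cvec_add cvec_cs) (auto simp: orth_def)
  ultimately show ?thesis using v unfolding orth_def by auto
qed

lemma orth_append:
  assumes "orth n f x" "orth n e y" "\<And>i j. i < f \<Longrightarrow> j < e \<Longrightarrow> cip (x i) (y j) = 0"
  shows "orth n (f + e) (\<lambda>i. if i < f then x i else y (i - f))"
proof -
  have "cip (y j) (x i) = 0" if "i < f" "j < e" for i j using assms(3)[OF that] by (rule cip_swap_0)
  then show ?thesis using assms unfolding orth_def by auto
qed

lemma orth_inj: "orth n m x \<Longrightarrow> inj_on g {..<p} \<Longrightarrow> (\<And>i. i < p \<Longrightarrow> g i < m) \<Longrightarrow> orth n p (\<lambda>i. x (g i))"
  unfolding orth_def by (auto simp: inj_on_def)

lemma sum_split_if:
  fixes D p :: nat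
  shows "D \<le> p \<Longrightarrow> (\<Sum>i<p. if i < D then f i else g i) = (\<Sum>i<D. f i) + (\<Sum>i = D..<p. g i :: 'a::comm_monoid_add)"
proof -
  assume "D \<le> p"
  then have p: "{..<p} = {..<D} \<union> {D..<p}" by auto
  have "(\<Sum>i<p. if i < D then f i else g i) = (\<Sum>i<D. if i < D then f i else g i) + (\<Sum>i = D..<p. if i < D then f i else g i)"
    unfolding p by (rule sum.union_disjoint) auto
  also have "\<dots> = (\<Sum>i<D. f i) + (\<Sum>i = D..<p. g i)" by (intro arg_cong2[of _ _ _ _ "(+)"] sum.cong) auto
  finally show ?thesis .
qed

text \<open>The trace of \<open>H\<close> on a large \<open>G\<close>-isotropic space is corrected by rotating part of it into
  \<open>w\<close>, which consists of the negative eigenvectors of \<open>H\<close> and of vectors that balance the trace of \<open>G\<close>.\<close>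

lemma balanced_isotropic:
  assumes H: "cor d d H" "star H = H" "spec d H hu hl" and trH: "tr H = 0"
    and G: "cor d d G" "star G = G" "spec d G gu gl" "opn G \<le> 1"
    and f: "card {k. k < d \<and> hl k < 0} = f" and c: "0 < c" "real f \<le> c * real e"
    and big1: "f + 16 * e \<le> card {k. k < d \<and> c < gl k}" "f + 16 * e \<le> card {k. k < d \<and> gl k < - c}"
    and big2: "2 * (f + e) + 8 * p \<le> card {k. k < d \<and> c < gl k}" "2 * (f + e) + 8 * p \<le> card {k. k < d \<and> gl k < - c}"
    and p: "f + e \<le> p"
  shows "\<exists>z. orth d p z \<and> (\<Sum>i<p. cip (z i) (H * z i)) = 0 \<and> (\<Sum>i<p. cip (z i) (G * z i)) = 0 \<and>
    (\<forall>i j. f + e \<le> i \<longrightarrow> i < p \<longrightarrow> f + e \<le> j \<longrightarrow> j < p \<longrightarrow> cip (z i) (G * z j) = 0)"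
proof -
  define qH where "qH z = Re (cip z (H * z))" for z
  define qG where "qG z = Re (cip z (G * z))" for z
  have HqH: "cip z (H * z) = of_real (qH z)" for z unfolding qH_def by (rule self_adjoint_real[OF H(2)])
  have GqG: "cip z (G * z) = of_real (qG z)" for z unfolding qG_def by (rule self_adjoint_real[OF G(2)])
  have quadH: "qH (cs (of_real a) x + cs (of_real b) y) = a\<^sup>2 * qH x + b\<^sup>2 * qH y + a * b * Re (cip x (H * y) + cip y (H * x))" for a b x y
    unfolding qH_def quad_combination by simp
  have quadG: "qG (cs (of_real a) x + cs (of_real b) y) = a\<^sup>2 * qG x + b\<^sup>2 * qG y" if "cip x (G * y) = 0" for a b x y
    unfolding qG_def quad_combination using that self_adjoint_swap[OF G(2) that] by simp
  let ?Neg = "{k. k < d \<and> hl k < 0}"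
  \<comment> \<open>The trace of the positive part of \<open>H\<close>; as \<open>tr H = 0\<close>,
    the negative eigenvectors alone contribute \<open>- \<nu>\<close>. The choices below keep all
    other contributions to a fraction of \<nu>.\<close>
  define \<nu> where "\<nu> = (\<Sum>k | k < d \<and> 0 \<le> hl k. hl k)"
  have \<nu>0: "0 \<le> \<nu>" unfolding \<nu>_def by (rule sum_nonneg) simp
  have sumNeg: "(\<Sum>k\<in>?Neg. hl k) = - \<nu>"
  proof -
    have "(\<Sum>k<d. hl k) = 0" using trH spec_tr[OF H(1,3)] by (metis of_real_eq_0_iff)
    moreover have "{..<d} = ?Neg \<union> {k. k < d \<and> 0 \<le> hl k}" by auto
    ultimately have "(\<Sum>k\<in>?Neg \<union> {k. k < d \<and> 0 \<le> hl k}. hl k) = 0" by metis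
    then show ?thesis unfolding \<nu>_def by (subst (asm) sum.union_disjoint) auto
  qed
  have oh: "orth d d hu" and og: "orth d d gu" using H G by (auto simp: spec_def)
  obtain e0 where e0: "bij_betw e0 {..<f} ?Neg"
    using ex_bij_betw_nat_finite[of ?Neg] f by (auto simp: lessThan_atLeast0)
  then have e0i: "inj_on e0 {..<f}" "e0 ` {..<f} = ?Neg" by (auto simp: bij_betw_def)
  have e0N: "e0 i < d" "hl (e0 i) < 0" if "i < f" for i using e0i(2) that by auto
  define n where "n i = hu (e0 i)" for i
  have on: "orth d f n" unfolding n_def by (rule orth_inj[OF oh e0i(1)]) (rule e0N)
  have nperp: "cip (hu k) z = 0" if "\<And>i. i < f \<Longrightarrow> cip (n i) z = 0" "k < d" "hl k < 0" for k z
  proof -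
    have "k \<in> e0 ` {..<f}" using that unfolding e0i(2) by simp
    then show ?thesis using that(1) by (auto simp: n_def)
  qed
  have qHn: "(\<Sum>i<f. qH (n i)) = - \<nu>"
  proof -
    have "qH (n i) = hl (e0 i)" if "i < f" for i
      using e0N[OF that] H(3) orth_cip[OF oh] by (simp add: qH_def n_def spec_def)
    then have "(\<Sum>i<f. qH (n i)) = (\<Sum>i<f. hl (e0 i))" by simp
    also have "\<dots> = (\<Sum>k\<in>?Neg. hl k)" using sum.reindex[OF e0i(1), of hl] e0i(2) by simp
    finally show ?thesis using sumNeg by simp
  qed
  have psd: "0 \<le> qH z" if "cvec d z" "\<And>i. i < f \<Longrightarrow> cip (n i) z = 0" for z
    unfolding qH_def using spec_lower[OF H that(1), of 0] nperp[OF that(2)] by auto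
  have psd_sum: "(\<Sum>i<m. qH (x i)) \<le> \<nu>" if "orth d m x" "\<And>i j. i < f \<Longrightarrow> j < m \<Longrightarrow> cip (n i) (x j) = 0" for m x
    unfolding qH_def \<nu>_def by (rule psd_family_sum[OF H that(1)]) (use nperp that(2) in blast)
  \<comment> \<open>A family 16 times as long is cut into 16 blocks, one of which has
    \<open>H\<close>-trace at most \<open>\<nu> / 16\<close>.\<close>
  have pick: "\<exists>b. orth d m b \<and> (\<forall>j<m. \<forall>k<d. k \<notin> S \<longrightarrow> cip (gu k) (b j) = 0) \<and> (\<forall>i<f. \<forall>j<m. cip (n i) (b j) = 0) \<and> (\<Sum>j<m. qH (b j)) \<le> \<nu> / 16"
    if S: "S \<subseteq> {..<d}" "f + 16 * m \<le> card S" for S m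
  proof -
    obtain x where x: "orth d (16 * m) x" "\<forall>i\<in>{..<f}. \<forall>j<16 * m. cip (n i) (x j) = 0"
      "\<forall>k<d. k \<notin> S \<longrightarrow> (\<forall>j<16 * m. cip (gu k) (x j) = 0)"
      using span_family[OF og, of "{..<f}" "16 * m" S n] S by auto
    have "(\<Sum>i<16 * m. qH (x i)) \<le> \<nu>" using x(2) by (intro psd_sum x(1)) auto
    then obtain b where b: "b < 16" "(\<Sum>i<m. qH (x (b * m + i))) \<le> \<nu> / 16" using block_sum[where M = 16 and p = m and r = "\<lambda>i. qH (x i)" and v = \<nu>] by auto
    then have bm: "b * m + m \<le> 16 * m" using mult_le_mono1[of "Suc b" 16 m] by simp
    then have bi: "b * m + i < 16 * m" if "i < m" for i using that by linarith
    show ?thesis using orth_block[OF x(1) bm] x(2,3) b(2) bi by (intro exI[of _ "\<lambda>i. x (b * m + i)"]) auto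
  qed
  let ?P = "{k. k < d \<and> c < gl k}" and ?M = "{k. k < d \<and> gl k < - c}"
  obtain a where a: "orth d e a" "\<And>j k. j < e \<Longrightarrow> k < d \<Longrightarrow> k \<notin> ?P \<Longrightarrow> cip (gu k) (a j) = 0"
    "\<And>i j. i < f \<Longrightarrow> j < e \<Longrightarrow> cip (n i) (a j) = 0" "(\<Sum>j<e. qH (a j)) \<le> \<nu> / 16"
    using pick[OF _ big1(1)] by fastforce
  obtain b where b: "orth d e b" "\<And>j k. j < e \<Longrightarrow> k < d \<Longrightarrow> k \<notin> ?M \<Longrightarrow> cip (gu k) (b j) = 0"
    "\<And>i j. i < f \<Longrightarrow> j < e \<Longrightarrow> cip (n i) (b j) = 0" "(\<Sum>j<e. qH (b j)) \<le> \<nu> / 16"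
    using pick[OF _ big1(2)] by fastforce
  have va: "cvec d (a j)" "norm (a j) = 1" and vb: "cvec d (b j)" "norm (b j) = 1" if "j < e" for j
    using orth_vec[OF a(1) that] orth_norm[OF a(1) that] orth_vec[OF b(1) that] orth_norm[OF b(1) that] .
  have disj: "cip (gu k) (a i) = 0 \<or> cip (gu k) (b j) = 0" if "i < e" "j < e" "k < d" for i j k
    using a(2)[OF that(1,3)] b(2)[OF that(2,3)] c(1) by (cases "k \<in> ?P") auto
  have ab: "cip (a i) (b j) = 0" if "i < e" "j < e" for i j
  proof -
    have "(\<Sum>k<d. cnj (cip (gu k) (a i)) * cip (gu k) (b j)) = 0"
      using disj[OF that] by (intro sum.neutral) auto
    then show ?thesis using parseval[OF og vb(1)[OF that(2)], of "a i"] by simp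
  qed
  have aGb: "cip (a i) (G * b j) = 0" if "i < e" "j < e" for i j
    unfolding spec_cip[OF G(1-3) vb(1)[OF that(2)]] using disj[OF that] by (intro sum.neutral) auto
  have qGa: "c \<le> qG (a j)" and qGb: "qG (b j) \<le> - c" if "j < e" for j
    using spec_lower[OF G(1-3) va(1)[OF that], of c] a(2)[OF that] va(2)[OF that]
      spec_upper[OF G(1-3) vb(1)[OF that], of "- c"] b(2)[OF that] vb(2)[OF that]
    by (force simp: qG_def)+
  define \<gamma> where "\<gamma> = (\<Sum>i<f. qG (n i))"
  define \<alpha> where "\<alpha> = (\<Sum>i<e. qG (a i))"
  define \<beta> where "\<beta> = (\<Sum>i<e. qG (b i))"
  have \<gamma>: "\<bar>\<gamma>\<bar> \<le> f"
  proof -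
    have "\<bar>qG (n i)\<bar> \<le> 1" if "i < f" for i
    proof -
      have "cmod (cip (n i) (G * n i)) \<le> opn G * norm (n i) * norm (n i)" by (rule cip_opn)
      then show ?thesis using G(4) orth_norm[OF on that] unfolding GqG by simp
    qed
    then have "(\<Sum>i<f. \<bar>qG (n i)\<bar>) \<le> (\<Sum>i<f. 1)" by (intro sum_mono) auto
    then show ?thesis unfolding \<gamma>_def by (intro order_trans[OF sum_abs]) simp
  qed
  \<comment> \<open>This is where \<open>f \<le> c * e\<close> enters: the \<open>e\<close> vectors
    \<open>a i\<close> outweigh the negative eigenvectors of \<open>H\<close>, whose
    \<open>G\<close>-values are at most 1 in modulus.\<close>
  have \<alpha>: "real f \<le> \<alpha>" using sum_mono[of "{..<e}" "\<lambda>_. c" "\<lambda>i. qG (a i)"] qGa c(2) by (simp add: \<alpha>_def mult.commute)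
  have \<beta>: "\<beta> \<le> - real f" using sum_mono[of "{..<e}" "\<lambda>i. qG (b i)" "\<lambda>_. - c"] qGb c(2) by (simp add: \<beta>_def mult.commute)
  obtain \<tau> where \<tau>: "0 \<le> \<tau>" "\<tau> \<le> 1" "\<gamma> + \<tau> * \<alpha> + (1 - \<tau>) * \<beta> = 0"
  proof (cases "\<alpha> = \<beta>")
    case True
    then have "\<alpha> = 0" "\<beta> = 0" "\<gamma> = 0" using \<alpha> \<beta> \<gamma> by linarith+
    then show ?thesis using that[of 0] by simp
  next
    case False
    then have pos: "\<alpha> - \<beta> > 0" using \<alpha> \<beta> by linarith
    have t: "(- \<gamma> - \<beta>) / (\<alpha> - \<beta>) * (\<alpha> - \<beta>) = - \<gamma> - \<beta>" using pos by simp
    show ?thesis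
    proof (rule that[of "(- \<gamma> - \<beta>) / (\<alpha> - \<beta>)"])
      show "0 \<le> (- \<gamma> - \<beta>) / (\<alpha> - \<beta>)" using pos \<beta> \<gamma> by simp
      show "(- \<gamma> - \<beta>) / (\<alpha> - \<beta>) \<le> 1" using pos \<alpha> \<gamma> by simp
      have "\<gamma> + x * \<alpha> + (1 - x) * \<beta> = \<gamma> + \<beta> + x * (\<alpha> - \<beta>)" for x by (simp add: algebra_simps)
      then show "\<gamma> + (- \<gamma> - \<beta>) / (\<alpha> - \<beta>) * \<alpha> + (1 - (- \<gamma> - \<beta>) / (\<alpha> - \<beta>)) * \<beta> = 0" by (simp only: t)
    qed
  qed
  \<comment> \<open>Since \<open>cip (a i) (G * b i)\<close> vanishes, the \<open>G\<close>-value of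
    \<open>y i\<close> is a convex combination of those of \<open>a i\<close> and
    \<open>b i\<close>; \<tau> is the weight for which the \<open>y i\<close> balance the
    \<open>G\<close>-trace \<gamma> of the negative eigenvectors.\<close>
  define y where "y i = cs (of_real (sqrt \<tau>)) (a i) + cs (of_real (sqrt (1 - \<tau>))) (b i)" for i
  have sq: "(sqrt \<tau>)\<^sup>2 = \<tau>" "(sqrt (1 - \<tau>))\<^sup>2 = 1 - \<tau>" using \<tau> by simp_all
  have oy: "orth d e y"
  proof -
    have "orth d e (\<lambda>i. if i < e then y i else a i)" unfolding y_def
      by (rule orth_rotate[OF a(1) b(1)]) (use ab cip_swap_0 sq in auto)
    then show ?thesis unfolding orth_def by auto
  qed
  have qGy: "qG (y i) = \<tau> * qG (a i) + (1 - \<tau>) * qG (b i)" if "i < e" for i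
    unfolding y_def using quadG[OF aGb[OF that that]] sq by simp
  \<comment> \<open>\<open>y i\<close> and its companion \<open>?y'\<close> arise from
    \<open>a i\<close> and \<open>b i\<close> by a plane orthogonal transformation, so their
    \<open>H\<close>-values have the same sum; the value at \<open>?y'\<close> is nonnegative
    because \<open>?y'\<close> is orthogonal to the negative eigenvectors.\<close>
  have qHy: "qH (y i) \<le> qH (a i) + qH (b i)" if "i < e" for i
  proof -
    let ?y' = "cs (of_real (sqrt (1 - \<tau>))) (a i) + cs (of_real (- sqrt \<tau>)) (b i)"
    have "qH (y i) + qH ?y' = (\<tau> + (1 - \<tau>)) * (qH (a i) + qH (b i))"
      unfolding y_def quadH sq power2_minus by (simp add: algebra_simps)
    moreover have "0 \<le> qH ?y'"
      using va[OF that] vb[OF that] a(3) b(3) that by (intro psd cvec_add cvec_cs) (auto simp: cip_add_right)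
    ultimately show ?thesis by simp
  qed
  define D where "D = f + e"
  define w where "w i = (if i < f then n i else y (i - f))" for i
  have ow: "orth d D w" unfolding w_def D_def
    by (rule orth_append[OF on oy]) (use a(3) b(3) in \<open>auto simp: y_def cip_add_right\<close>)
  have sum_w: "(\<Sum>i<D. q (w i)) = (\<Sum>i<f. q (n i)) + (\<Sum>i<e. q (y i))" for q :: "fmat \<Rightarrow> real"
  proof -
    have "(\<Sum>i<D. q (w i)) = (\<Sum>i<D. if i < f then q (n i) else q (y (i - f)))" by (intro sum.cong) (auto simp: w_def)
    also have "\<dots> = (\<Sum>i<f. q (n i)) + (\<Sum>i = f..<D. q (y (i - f)))" by (rule sum_split_if) (simp add: D_def)
    also have "(\<Sum>i = f..<D. q (y (i - f))) = (\<Sum>i<e. q (y i))"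
      using sum.shift_bounds_nat_ivl[of "\<lambda>i. q (y (i - f))" 0 f e] by (simp add: D_def add.commute lessThan_atLeast0)
    finally show ?thesis .
  qed
  have qGw: "(\<Sum>i<D. qG (w i)) = 0"
    unfolding sum_w using \<tau>(3) qGy by (simp add: \<gamma>_def \<alpha>_def \<beta>_def sum.distrib sum_distrib_left)
  have qHw: "(\<Sum>i<D. qH (w i)) \<le> - \<nu> + \<nu> / 8"
  proof -
    have "(\<Sum>i<e. qH (y i)) \<le> (\<Sum>i<e. qH (a i) + qH (b i))" by (intro sum_mono qHy) simp
    then show ?thesis unfolding sum_w qHn using a(4) b(4) by (simp add: sum.distrib)
  qed
  \<comment> \<open>Orthogonality to the \<open>w i\<close> keeps the rotated family orthonormal;
    orthogonality to the \<open>G * w i\<close> removes the mixed terms of \<open>G\<close>.\<close>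
  let ?I = "{..<D} <+> {..<D}"
  obtain x where x: "orth d (4 * p) x" "\<forall>i\<in>?I. \<forall>j<4 * p. cip (case_sum w (\<lambda>i. G * w i) i) (x j) = 0"
    "\<forall>i<4 * p. \<forall>j<4 * p. cip (x i) (G * x j) = 0"
    using isotropic_of_indefinite[OF G(1-3) c(1), of ?I "4 * p" "case_sum w (\<lambda>i. G * w i)"] big2
    by (auto simp: card_Plus D_def)
  have xw: "cip (w i) (x j) = 0" "cip (G * w i) (x j) = 0" if "i < D" "j < 4 * p" for i j
    using x(2)[rule_format, OF InlI[of i], of j] x(2)[rule_format, OF InrI[of i], of j] that by simp_all
  have xn: "cip (n i) (x j) = 0" if "i < f" "j < 4 * p" for i j
    using xw(1)[of i j] that by (simp add: w_def D_def)
  have "(\<Sum>i<4 * p. qH (x i)) \<le> \<nu>" by (rule psd_sum[OF x(1) xn])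
  then obtain k where k: "k < 4" "(\<Sum>i<p. qH (x (k * p + i))) \<le> \<nu> / 4" using block_sum[where M = 4 and p = p and r = "\<lambda>i. qH (x i)" and v = \<nu>] by auto
  then have kp: "k * p + p \<le> 4 * p" using mult_le_mono1[of "Suc k" 4 p] by simp
  then have ki: "k * p + i < 4 * p" if "i < p" for i using that by linarith
  define v where "v i = x (k * p + i)" for i
  have ov: "orth d p v" unfolding v_def by (rule orth_block[OF x(1) kp])
  have vw: "cip (w i) (v j) = 0" "cip (v j) (G * w i) = 0" if "i < D" "j < p" for i j
    unfolding v_def using xw[OF that(1) ki[OF that(2)]] cip_swap_0 by auto
  have vv: "cip (v i) (G * v j) = 0" if "i < p" "j < p" for i j using x(3) ki that by (simp add: v_def)
  have vH: "0 \<le> qH (v i)" if "i < p" for i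
    using orth_vec[OF ov that] xn ki[OF that] by (intro psd) (auto simp: v_def)
  have vs: "(\<Sum>i<p. qH (v i)) \<le> \<nu> / 4" using k(2) by (simp add: v_def)
  have Dp: "D \<le> p" using p by (simp add: D_def)
  \<comment> \<open>The first \<open>D\<close> vectors are rotated from \<open>v i\<close> to
    \<open>w i\<close>. The \<open>G\<close>-trace is \<open>(sin \<phi>)\<^sup>2\<close> times that
    of \<open>w\<close>, hence 0 for every angle, and only the \<open>H\<close>-trace remains to be
    adjusted.\<close>
  define z where "z \<phi> i = (if i < D then cs (of_real (cos \<phi>)) (v i) + cs (of_real (sin \<phi>)) (w i) else v i)" for \<phi> i
  have oz: "orth d p (z \<phi>)" for \<phi>
    unfolding z_def by (rule orth_rotate[OF ov ow Dp vw(1)]) auto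
  define F where "F \<phi> = (\<Sum>i<p. qH (z \<phi> i))" for \<phi>
  have F: "F \<phi> = (\<Sum>i<D. (cos \<phi>)\<^sup>2 * qH (v i) + (sin \<phi>)\<^sup>2 * qH (w i) + cos \<phi> * sin \<phi> * Re (cip (v i) (H * w i) + cip (w i) (H * v i)))
      + (\<Sum>i = D..<p. qH (v i))" for \<phi>
    unfolding F_def quadH[symmetric] sum_split_if[OF Dp, symmetric] by (intro sum.cong) (auto simp: z_def)
  have "continuous_on {0..pi/2} F" unfolding F by (intro continuous_intros)
  moreover have "0 \<le> F 0"
    unfolding F using vH Dp by (auto intro!: add_nonneg_nonneg sum_nonneg)
  \<comment> \<open>The total is at most \<open>- \<nu> + \<nu> / 8 + \<nu> / 4\<close>; the block
    counts 16 and 4 are more than enough to keep it from being positive.\<close>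
  moreover have "F (pi/2) \<le> 0"
  proof -
    have "(\<Sum>i = D..<p. qH (v i)) \<le> (\<Sum>i<p. qH (v i))"
      using vH by (intro sum_mono2) auto
    then show ?thesis unfolding F using qHw vs \<nu>0 by simp
  qed
  ultimately obtain \<phi> where \<phi>: "F \<phi> = 0" using IVT2'[of F "pi/2" 0 0] by (auto simp: pi_ge_zero)
  have "(\<Sum>i<p. cip (z \<phi> i) (H * z \<phi> i)) = of_real (F \<phi>)" by (simp add: HqH F_def)
  moreover have "(\<Sum>i<p. cip (z \<phi> i) (G * z \<phi> i)) = 0"
  proof -
    have "qG (z \<phi> i) = (if i < D then (sin \<phi>)\<^sup>2 * qG (w i) else 0)" if "i < p" for i
      using quadG[OF vw(2)[of i i], of "cos \<phi>" "sin \<phi>"] vv[OF that that] that by (simp add: z_def qG_def)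
    then have "(\<Sum>i<p. qG (z \<phi> i)) = (\<Sum>i<p. if i < D then (sin \<phi>)\<^sup>2 * qG (w i) else 0)" by simp
    also have "\<dots> = (sin \<phi>)\<^sup>2 * (\<Sum>i<D. qG (w i))" unfolding sum_split_if[OF Dp] by (simp add: sum_distrib_left)
    finally have "(\<Sum>i<p. qG (z \<phi> i)) = 0" using qGw by simp
    then show ?thesis unfolding GqG of_real_sum[symmetric] by simp
  qed
  moreover have "cip (z \<phi> i) (G * z \<phi> j) = 0" if "D \<le> i" "i < p" "D \<le> j" "j < p" for i j
    using vv that by (simp add: z_def)
  ultimately show ?thesis using oz \<phi> unfolding D_def by (intro exI[of _ "z \<phi>"]) auto
qed

lemma LR_add:
  assumes "LR n q e A" "LR n q' e' B" shows "LR n (q + q') (e + e') (A + B)"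
proof -
  obtain u where u: "\<And>x y. cvec n x \<Longrightarrow> cvec n y \<Longrightarrow> \<forall>i<q. cip (u i) x = 0 \<and> cip (u i) y = 0 \<Longrightarrow>
      cmod (cip y (A * x)) \<le> e * norm x * norm y"
    using assms(1) unfolding LR_def by metis
  obtain v where v: "\<And>x y. cvec n x \<Longrightarrow> cvec n y \<Longrightarrow> \<forall>i<q'. cip (v i) x = 0 \<and> cip (v i) y = 0 \<Longrightarrow>
      cmod (cip y (B * x)) \<le> e' * norm x * norm y"
    using assms(2) unfolding LR_def by metis
  have "cmod (cip y ((A + B) * x)) \<le> (e + e') * norm x * norm y"
    if xy: "cvec n x" "cvec n y" and perp: "\<forall>i<q + q'. cip (if i < q then u i else v (i - q)) x = 0 \<and> cip (if i < q then u i else v (i - q)) y = 0" for x y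
  proof -
    have "cip (u i) x = 0 \<and> cip (u i) y = 0" if "i < q" for i using perp[rule_format, of i] that by simp
    moreover have "cip (v i) x = 0 \<and> cip (v i) y = 0" if "i < q'" for i using perp[rule_format, of "q + i"] that by simp
    ultimately have "cmod (cip y (A * x)) \<le> e * norm x * norm y" "cmod (cip y (B * x)) \<le> e' * norm x * norm y"
      using u[OF xy] v[OF xy] by blast+
    then show ?thesis using norm_triangle_ineq[of "cip y (A * x)" "cip y (B * x)"]
      by (simp add: distrib_right cip_add_right)
  qed
  then show ?thesis unfolding LR_def by (intro exI[of _ "\<lambda>i. if i < q then u i else v (i - q)"]) blast
qed

lemma LR_cs: "LR n q e A \<Longrightarrow> cmod c = 1 \<Longrightarrow> LR n q e (cs c A)"
  unfolding LR_def by (simp add: norm_mult)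

subsection \<open>The dichotomy\<close>

lemma card_sum_if: "finite A \<Longrightarrow> (\<Sum>i\<in>A. if P i then (c::real) else 0) = c * card {i\<in>A. P i}"
  by (subst sum.inter_filter[symmetric]) auto

lemma sum_max_eq:
  fixes l :: "nat \<Rightarrow> real"
  assumes "(\<Sum>i<d. l i) = 0" shows "(\<Sum>i<d. max (l i) 0) = (\<Sum>i<d. max (- l i) 0)"
proof -
  have "(\<Sum>i<d. max (l i) 0) - (\<Sum>i<d. max (- l i) 0) = (\<Sum>i<d. l i)"
    unfolding sum_subtractf[symmetric] by (intro sum.cong) auto
  then show ?thesis using assms by simp
qed

text \<open>Since the sum is 0, the positive eigenvalues add up to as much as the negative ones,
  which is at most \<open>f\<close> in absolute value; so at most \<open>f / t\<close> of them
  exceed \<open>t\<close>.\<close>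

lemma count_small:
  fixes l :: "nat \<Rightarrow> real"
  assumes l: "(\<Sum>i<d. l i) = 0" "\<And>i. i < d \<Longrightarrow> \<bar>l i\<bar> \<le> 1" and f: "card {i. i < d \<and> l i < 0} \<le> f" and t: "0 < t"
  shows "real (card {i. i < d \<and> t < \<bar>l i\<bar>}) \<le> f + f / t"
proof -
  have "t * card {i\<in>{..<d}. t < l i} = (\<Sum>i<d. if t < l i then t else 0)" by (simp add: card_sum_if)
  also have "\<dots> \<le> (\<Sum>i<d. max (l i) 0)" using t by (intro sum_mono) auto
  also have "\<dots> = (\<Sum>i<d. max (- l i) 0)" by (rule sum_max_eq[OF l(1)])
  also have "\<dots> \<le> (\<Sum>i<d. if l i < 0 then 1 else 0)"
  proof (rule sum_mono)
    fix i assume "i \<in> {..<d}"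
    then show "max (- l i) 0 \<le> (if l i < 0 then 1 else 0)" using l(2)[of i] by auto
  qed
  also have "\<dots> = card {i\<in>{..<d}. l i < 0}" by (simp add: card_sum_if)
  also have "\<dots> \<le> f" using f by simp
  finally have "real (card {i. i < d \<and> t < l i}) \<le> f / t" using t by (simp add: field_simps)
  moreover have "card {i. i < d \<and> t < \<bar>l i\<bar>} \<le> card ({i. i < d \<and> l i < 0} \<union> {i. i < d \<and> t < l i})"
    by (intro card_mono) auto
  moreover have "\<dots> \<le> card {i. i < d \<and> l i < 0} + card {i. i < d \<and> t < l i}" by (rule card_Un_le)
  ultimately show ?thesis using f by linarith
qed

text \<open>The absolute values sum to at least \<open>d / 10000\<close>, and the positive parts to
  half of that. Entries up to 1/40000 account for at most \<open>d / 40000\<close>, and each larger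
  one for little more than 1 at most, with the bound 1 on its excess.\<close>

lemma count_large:
  fixes l :: "nat \<Rightarrow> real"
  assumes l: "(\<Sum>i<d. l i) = 0" "\<And>i. i < d \<Longrightarrow> \<bar>l i\<bar> \<le> 1" and g: "real d / 100 \<le> card {i. i < d \<and> 1/100 < \<bar>l i\<bar>}"
  shows "real d / 40000 \<le> card {i. i < d \<and> 1/40000 < l i}"
proof -
  have "(1/100) * card {i\<in>{..<d}. 1/100 < \<bar>l i\<bar>} = (\<Sum>i<d. if 1/100 < \<bar>l i\<bar> then 1/100 else 0)" by (simp add: card_sum_if)
  also have "\<dots> \<le> (\<Sum>i<d. 2 * max (l i) 0 - l i)" by (intro sum_mono) auto
  also have "\<dots> = 2 * (\<Sum>i<d. max (l i) 0)" using l(1) by (simp add: sum_subtractf sum_distrib_left)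
  also have "(\<Sum>i<d. max (l i) 0) \<le> (\<Sum>i<d. 1/40000 + (if 1/40000 < l i then 1 else 0))"
  proof (rule sum_mono)
    fix i assume "i \<in> {..<d}"
    then show "max (l i) 0 \<le> 1/40000 + (if 1/40000 < l i then 1 else 0)" using l(2)[of i] by auto
  qed
  also have "\<dots> = real d / 40000 + card {i\<in>{..<d}. 1/40000 < l i}" by (simp only: sum.distrib card_sum_if finite_lessThan) simp
  finally show ?thesis using g by simp
qed

lemma LR_corner:
  assumes A: "cor p p A" and z: "\<And>i j. D \<le> i \<Longrightarrow> i < p \<Longrightarrow> D \<le> j \<Longrightarrow> j < p \<Longrightarrow> ent A i j = 0" and D: "D \<le> p"
  shows "LR p D 0 A"
proof -
  have "cip y (A * x) = 0" if x: "cvec p x" "cvec p y" and perp: "\<forall>i<D. cip (eu i 0) x = 0 \<and> cip (eu i 0) y = 0" for x y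
  proof -
    have 0: "ent x i 0 = 0" "ent y i 0 = 0" if "i < D" for i
      using perp that D cip_eu[OF _ x(1), of i] cip_eu[OF _ x(2), of i] by auto
    have "ent (A * x) i 0 = 0" if "i < p" "D \<le> i" for i
    proof -
      have "ent (A * x) i 0 = (\<Sum>j<p. ent A i j * ent x j 0)"
        by (rule ent_mult') (use x in \<open>auto simp: cvec_iff\<close>)
      also have "\<dots> = 0" using z that 0(1) by (intro sum.neutral) (metis lessThan_iff mult_eq_0_iff not_less)
      finally show ?thesis .
    qed
    then show ?thesis unfolding cip_vec[OF cvec_mult[OF A x(1)]] using 0(2)
      by (intro sum.neutral) (metis complex_cnj_zero lessThan_iff mult_eq_0_iff not_less)
  qed
  then show ?thesis unfolding LR_def by (intro exI[of _ "\<lambda>i. eu i 0"]) auto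
qed

text \<open>Without an isotropic family of size \<open>p0\<close>, some rotation
  \<open>cs u A = H + cs \<i> G\<close> has an \<open>H\<close> with at most \<open>3 * p0\<close>
  negative eigenvalues, and trace zero then makes \<open>H\<close> small off few directions. The
  parameter \<open>t\<close> trades tolerance against the number of these directions, and
  \<open>p0\<close> scales that number. The spectrum of \<open>G\<close> decides between the two
  remaining cases.\<close>

lemma dichotomy:
  assumes A: "cor d d A" "tr A = 0" "opn A \<le> 1" and p0: "0 < p0" "1000000000000 * p0 \<le> d" and t: "0 < t"
  obtains (small) q where "LR d q (1/100 + t) A" "real q \<le> real d / 100 + 3 * real p0 + 3 * real p0 / t"
    | (isotropic) V where "isom d p0 V" "star V * A * V = 0"
    | (balanced) V q where "isom d (d div 1048576) V" "tr (star V * A * V) = 0" "LR (d div 1048576) q t (star V * A * V)"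
        "real q \<le> 120006 * real p0 + 3 * real p0 / t"
proof (cases "\<exists>x. orth d p0 x \<and> (\<forall>i<p0. \<forall>j<p0. cip (x i) (A * x j) = 0)")
  case True
  then obtain x where x: "orth d p0 x" "\<And>i j. i < p0 \<Longrightarrow> j < p0 \<Longrightarrow> cip (x i) (A * x j) = 0" by blast
  have v: "cvec d (x i)" if "i < p0" for i using orth_vec[OF x(1) that] .
  have "star (of_cols p0 x) * A * of_cols p0 x = 0"
    by (rule fmat_eqI, subst of_cols_compress[OF v v]) (auto simp: x(2))
  then show ?thesis using isotropic isom_of_cols[OF x(1)] by blast
next
  case False
  then obtain u and I :: "(nat \<times> nat) set" and w where u: "cmod u = 1" and I: "finite I" "card I \<le> 3 * p0"
    and pos: "\<And>z. cvec d z \<Longrightarrow> \<forall>i\<in>I. cip (w i) z = 0 \<Longrightarrow> 0 \<le> Re (u * cip z (A * z))"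
    using greedy_isotropic[OF A(1), of p0] p0 by auto
  have uu: "cnj u * u = 1" using u by (simp add: complex_norm_square[symmetric] mult.commute)
  \<comment> \<open>The real and imaginary parts of \<open>cs u A\<close>, both self-adjoint,
    traceless and of norm at most 1.\<close>
  define H where "H = cs (1/2) (cs u A + star (cs u A))"
  define G where "G = cs (- \<i> / 2) (cs u A - star (cs u A))"
  have AHG: "A = cs (cnj u) (H + cs \<i> G)"
  proof -
    have "H + cs \<i> G = cs u A"
      by (rule fmat_eqI) (simp add: H_def G_def algebra_simps)
    then show ?thesis using uu by simp
  qed
  have H: "cor d d H" and G: "cor d d G" unfolding H_def G_def using A(1) by (auto simp: cor_iff)
  have Hs: "star H = H" by (simp add: H_def add.commute)
  have Gs: "star G = G" unfolding G_def
    by (rule fmat_eqI) (simp add: algebra_simps)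
  have trs: "tr H = 0" "tr G = 0" using A(2) by (simp_all add: H_def G_def tr_add tr_diff tr_star)
  have opA: "opn (cs u A) \<le> 1" using A(3) u by simp
  have oH: "opn H \<le> 1"
  proof -
    have "opn (cs u A + star (cs u A)) \<le> 1 + 1" by (intro order_trans[OF opn_add] add_mono) (use opA in \<open>simp_all only: opn_star\<close>)
    then show ?thesis by (simp add: H_def norm_divide)
  qed
  have oG: "opn G \<le> 1"
  proof -
    have "opn (cs u A - star (cs u A)) \<le> 1 + 1" by (intro order_trans[OF opn_diff] add_mono) (use opA in \<open>simp_all only: opn_star\<close>)
    then show ?thesis by (simp add: G_def norm_divide norm_mult)
  qed
  obtain hu hl where h: "spec d H hu hl" using spectral_theorem[OF H Hs] by blast
  obtain gu gl where g: "spec d G gu gl" using spectral_theorem[OF G Gs] by blast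
  have h0: "(\<Sum>i<d. hl i) = 0" using trs(1) unfolding spec_tr[OF H h] by (simp only: of_real_eq_0_iff)
  have g0: "(\<Sum>i<d. gl i) = 0" using trs(2) unfolding spec_tr[OF G g] by (simp only: of_real_eq_0_iff)
  have h1: "\<bar>hl i\<bar> \<le> 1" if "i < d" for i using spec_bound[OF h that] oH by simp
  have g1: "\<bar>gl i\<bar> \<le> 1" if "i < d" for i using spec_bound[OF g that] oG by simp
  have f: "card {i. i < d \<and> hl i < 0} \<le> 3 * p0"
  proof (rule halfplane_card_neg[OF H Hs h I])
    fix z assume "cvec d z" "\<And>i. i \<in> I \<Longrightarrow> cip (w i) z = 0"
    then have "0 \<le> Re (u * cip z (A * z))" using pos by blast
    moreover have "cip z (star A * z) = cnj (cip z (A * z))" by (metis cip_commute cip_star_mult star_star)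
    ultimately show "0 \<le> Re (cip z (H * z))"
      by (simp add: H_def distrib_right cip_add_right)
  qed
  define qH where "qH = card {i. i < d \<and> t < \<bar>hl i\<bar>}"
  have qH: "real qH \<le> 3 * real p0 + 3 * real p0 / t" using count_small[OF h0 h1 f t] by (simp add: qH_def)
  have LH: "LR d qH t H" using spec_LR[OF H Hs h, of t qH] t by (simp add: qH_def)
  let ?qG = "card {i. i < d \<and> 1/100 < \<bar>gl i\<bar>}"
  show ?thesis
  proof (cases "real ?qG \<le> real d / 100")
    case True
    have "LR d ?qG (1/100) G" using spec_LR[OF G Gs g, of "1/100"] by simp
    then have "LR d (qH + ?qG) (t + 1/100) A"
      unfolding AHG by (intro LR_cs LR_add LH) (use u in auto)
    then show ?thesis using small[of "qH + ?qG"] True qH by (simp add: add.commute)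
  next
    case False
    then have big: "real d / 40000 \<le> card {i. i < d \<and> 1/40000 < gl i}" using count_large[OF g0 g1] by simp
    have "real d / 40000 \<le> card {i. i < d \<and> 1/40000 < - gl i}"
      using False by (intro count_large) (auto simp: sum_negf g0 g1)
    moreover have "{i. i < d \<and> 1/40000 < - gl i} = {i. i < d \<and> gl i < - (1/40000)}" by auto
    ultimately have big': "real d / 40000 \<le> card {i. i < d \<and> gl i < - (1/40000)}" by simp
    \<comment> \<open>With \<open>c = 1/40000\<close> and \<open>f \<le> 3 * p0\<close>, the
      condition \<open>f \<le> c * e\<close> is met by \<open>e = 120000 * p0\<close>. The divisor
      \<open>2 ^ 20\<close> keeps \<open>8 * ?p\<close> well below \<open>d / 40000\<close>, and
      \<open>1000000000000 * p0 \<le> d\<close> leaves room for the terms with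
      \<open>p0\<close>.\<close>
    let ?p = "d div 1048576" and ?f = "card {i. i < d \<and> hl i < 0}" and ?e = "120000 * p0"
    have arith: "real p0 * 1000000000000 \<le> real d" "real ?p \<le> real d / 1048576" "?f + ?e \<le> ?p"
    proof -
      have "real (1000000000000 * p0) \<le> real d" using p0(2) by (simp only: of_nat_le_iff)
      then show "real p0 * 1000000000000 \<le> real d" by simp
      show "real ?p \<le> real d / 1048576" using of_nat_div_le_of_nat[of d 1048576, where ?'a = real] by simp
      have "?f + ?e \<le> 3 * p0 + 120000 * p0" using f by simp
      also have "\<dots> \<le> ?p"
        using p0(2) by (simp add: less_eq_div_iff_mult_less_eq)
      finally show "?f + ?e \<le> ?p" .
    qed
    have rf: "real ?f \<le> 3 * real p0" using f by linarith
    have b1: "real (?f + 16 * ?e) \<le> real d / 40000" "real (2 * (?f + ?e) + 8 * ?p) \<le> real d / 40000"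
      using rf arith(1,2) by simp_all
    obtain z where z: "orth d ?p z" "(\<Sum>i<?p. cip (z i) (H * z i)) = 0" "(\<Sum>i<?p. cip (z i) (G * z i)) = 0"
      "\<And>i j. ?f + ?e \<le> i \<Longrightarrow> i < ?p \<Longrightarrow> ?f + ?e \<le> j \<Longrightarrow> j < ?p \<Longrightarrow> cip (z i) (G * z j) = 0"
    proof -
      have "\<exists>z. orth d ?p z \<and> (\<Sum>i<?p. cip (z i) (H * z i)) = 0 \<and> (\<Sum>i<?p. cip (z i) (G * z i)) = 0 \<and>
        (\<forall>i j. ?f + ?e \<le> i \<longrightarrow> i < ?p \<longrightarrow> ?f + ?e \<le> j \<longrightarrow> j < ?p \<longrightarrow> cip (z i) (G * z j) = 0)"
      proof (rule balanced_isotropic[OF H Hs h trs(1) G Gs g oG refl, of "1/40000"])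
        show "real ?f \<le> 1/40000 * real ?e" using rf by simp
        show "?f + 16 * ?e \<le> card {i. i < d \<and> 1/40000 < gl i}" "?f + 16 * ?e \<le> card {i. i < d \<and> gl i < - (1/40000)}"
          "2 * (?f + ?e) + 8 * ?p \<le> card {i. i < d \<and> 1/40000 < gl i}"
          "2 * (?f + ?e) + 8 * ?p \<le> card {i. i < d \<and> gl i < - (1/40000)}"
          using b1 big big' by linarith+
      qed (use arith(3) in auto)
      then show ?thesis using that by blast
    qed
    let ?V = "of_cols ?p z"
    have V: "isom d ?p ?V" by (rule isom_of_cols[OF z(1)])
    have split: "star ?V * A * ?V = cs (cnj u) (star ?V * H * ?V + cs \<i> (star ?V * G * ?V))"
      unfolding AHG by (simp add: distrib_left distrib_right)
    have "tr (star ?V * A * ?V) = 0"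
      unfolding split tr_cs tr_add tr_of_cols[OF H z(1)] tr_of_cols[OF G z(1)] z(2,3) by simp
    \<comment> \<open>On the piece \<open>H\<close> keeps its exceptional directions and its
      tolerance, while \<open>G\<close> vanishes off the first \<open>?f + ?e\<close>
      coordinates.\<close>
    moreover have "LR ?p (qH + (?f + ?e)) (t + 0) (star ?V * A * ?V)"
      unfolding split
    proof (intro LR_cs LR_add LR_compress[OF LH V] LR_corner)
      show "cor ?p ?p (star ?V * G * ?V)" by (rule cor_compress[OF V V G])
      fix i j assume ij: "?f + ?e \<le> i" "i < ?p" "?f + ?e \<le> j" "j < ?p"
      have v: "cvec d (z i)" if "i < ?p" for i using orth_vec[OF z(1) that] .
      show "ent (star ?V * G * ?V) i j = 0"
        by (subst of_cols_compress[OF v v]) (use z(4) ij in auto)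
    qed (use u arith(3) in auto)
    moreover have "real (qH + (?f + ?e)) \<le> 120006 * real p0 + 3 * real p0 / t"
      using qH rf by simp
    ultimately show ?thesis using balanced[OF V, of "qH + (?f + ?e)"] by simp
  qed
qed

subsection \<open>Splitting off pieces\<close>

lemma exp_minus_le: "0 \<le> x \<Longrightarrow> x \<le> 1 \<Longrightarrow> exp (- x) \<le> 1 - x / 2" for x :: real
proof -
  assume x: "0 \<le> x" "x \<le> 1"
  have "exp (- x) \<le> 1 / (1 + x)" using exp_ge_add_one_self[of x] x by (simp add: exp_minus field_simps)
  also have "\<dots> \<le> 1 - x / 2" using x mult_left_le[of x x] by (simp add: field_simps)
  finally show ?thesis .
qed

text \<open>Losing the fraction \<open>p / d\<close> of the dimension gives a factor of at most
  \<open>exp (- 2 * \<beta> * p / d)\<close>, hence at most \<open>exp (- 12 * \<theta>)\<close>,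
  and \<open>exp (- 6 * \<theta>) \<le> 1 - 3 * \<theta>\<close>. The square provides two factors
  \<open>1 - 3 * \<theta>\<close>: one cancels the loss in \<open>combine2\<close>, the other pays
  for its additive term.\<close>

lemma powr_step:
  fixes \<beta> \<theta> d p w :: real
  assumes "0 < \<beta>" "0 \<le> \<theta>" "6 * \<theta> \<le> 1" "0 < w" "0 \<le> p" "p < d" "6 * \<theta> * d \<le> \<beta> * p"
  shows "(w * (d - p)) powr (2 * \<beta>) \<le> (1 - 3 * \<theta>)\<^sup>2 * (w * d) powr (2 * \<beta>)"
proof -
  have d: "0 < d" using assms by simp
  have e: "w * (d - p) = (1 - p / d) * (w * d)" using d by (simp add: field_simps)
  have "1 - p / d \<le> exp (- (p / d))" using exp_ge_add_one_self[of "- (p / d)"] by simp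
  then have "(1 - p / d) powr (2 * \<beta>) \<le> exp (- (p / d)) powr (2 * \<beta>)"
    using assms d by (intro powr_mono2) (auto simp: field_simps)
  also have "\<dots> = (exp (- (\<beta> * p / d)))\<^sup>2"
    by (simp add: powr_def exp_double[symmetric] field_simps)
  also have "\<dots> \<le> (exp (- (6 * \<theta>)))\<^sup>2"
    using assms d by (intro power_mono) (auto simp: field_simps)
  also have "\<dots> \<le> (1 - 3 * \<theta>)\<^sup>2"
    using exp_minus_le[of "6 * \<theta>"] assms by (intro power_mono) auto
  finally have "(1 - p / d) powr (2 * \<beta>) * (w * d) powr (2 * \<beta>) \<le> (1 - 3 * \<theta>)\<^sup>2 * (w * d) powr (2 * \<beta>)"
    by (intro mult_right_mono) auto
  then show ?thesis unfolding e using assms d by (subst powr_mult) (auto simp: field_simps)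
qed

text \<open>A basis of the range of \<open>W\<close> joins the exceptional directions; a vector
  orthogonal to it lies in the range of \<open>V\<close>.\<close>

lemma LR_extend:
  assumes V: "isom n v V" and W: "isom n d W" and sum: "V * star V + W * star W = un n" and A: "cor n n A"
    and lr: "LR v q e (star V * A * V)"
  shows "LR n (q + d) e A"
proof -
  obtain u where u: "\<And>x y. cvec v x \<Longrightarrow> cvec v y \<Longrightarrow> \<forall>i<q. cip (u i) x = 0 \<and> cip (u i) y = 0 \<Longrightarrow>
      cmod (cip y (star V * A * V * x)) \<le> e * norm x * norm y"
    using lr unfolding LR_def by metis
  let ?u = "\<lambda>i. if i < q then V * u i else W * eu (i - q) 0"
  have in_V: "cvec v (star V * x)" "V * (star V * x) = x" if x: "cvec n x" and perp: "\<forall>i<q + d. cip (?u i) x = 0" for x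
  proof -
    have Wx: "cvec d (star W * x)" by (rule cvec_mult[OF cor_star[OF isom_cor[OF W]] x])
    have "ent (star W * x) j 0 = 0" if j: "j < d" for j
      using perp[rule_format, of "q + j"] j cip_eu[OF j Wx] by (simp add: cip_star_mult)
    then have "star W * x = 0" using Wx by (intro fmat_eqI) (metis cvec_iff ent_0 not_less)
    moreover have "V * (star V * x) + W * (star W * x) = x"
      using arg_cong[OF sum, of "\<lambda>M. M * x"] cvec_rules[OF x] by (simp add: distrib_right mult.assoc)
    ultimately show "V * (star V * x) = x" by simp
    show "cvec v (star V * x)" by (rule cvec_mult[OF cor_star[OF isom_cor[OF V]] x])
  qed
  have "cmod (cip y (A * x)) \<le> e * norm x * norm y"
    if x: "cvec n x" and y: "cvec n y" and perp: "\<forall>i<q + d. cip (?u i) x = 0 \<and> cip (?u i) y = 0" for x y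
  proof -
    have X: "cvec v (star V * x)" "V * (star V * x) = x" using in_V[OF x] perp by auto
    have Y: "cvec v (star V * y)" "V * (star V * y) = y" using in_V[OF y] perp by auto
    have "cip (u i) (star V * x) = 0 \<and> cip (u i) (star V * y) = 0" if "i < q" for i
      using perp[rule_format, of i] that by (simp add: cip_star_mult)
    then have "cmod (cip (star V * y) (star V * A * V * (star V * x))) \<le> e * norm (star V * x) * norm (star V * y)"
      by (intro u X Y) auto
    also have "cip (star V * y) (star V * A * V * (star V * x)) = cip y (A * x)"
      using X(2) Y(2) by (simp add: mult.assoc cip_mult_right)
    also have "norm (star V * x) = norm x" using norm_isom_vec[OF V X(1)] X(2) by simp
    also have "norm (star V * y) = norm y" using norm_isom_vec[OF V Y(1)] Y(2) by simp
    finally show ?thesis .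
  qed
  then show ?thesis unfolding LR_def by (intro exI[of _ ?u]) blast
qed

text \<open>Either the whole matrix has cost \<open>Y\<close>, or there is a traceless piece whose
  weight \<theta> is bounded by a multiple of its relative size and whose cost is
  \<open>\<theta> * Z\<close>, so that it becomes \<open>Z\<close> in a disc of radius \<theta>. The
  last three conjuncts serve the first piece, to which the final remainder gets attached.\<close>

definition splittable :: "real \<Rightarrow> real \<Rightarrow> real \<Rightarrow> real \<Rightarrow> real \<Rightarrow> real \<Rightarrow> nat \<Rightarrow> fmat \<Rightarrow> bool" where
  "splittable \<beta> \<theta>\<^sub>0 t R Y Z d S \<longleftrightarrow> Sol d S Y \<or>
     (\<exists>p V \<theta> q. isom d p V \<and> 0 < p \<and> 2 * p \<le> d \<and> tr (star V * S * V) = 0 \<and> \<theta>\<^sub>0 \<le> \<theta> \<and> \<theta> \<le> 1/1000 \<and>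
       6 * \<theta> * real d \<le> \<beta> * real p \<and> Sol p (star V * S * V) (\<theta> * Z) \<and> LR p q t (star V * S * V) \<and>
       1000 * q \<le> p \<and> real d \<le> R * real p)"

text \<open>The potential \<open>(100 d / v) powr (2 \<beta>)\<close> absorbs the factor \<open>1 / (1 - 3 \<theta>)\<close> and the additive
  constant \<open>1 / \<theta>\<close> that are lost when a piece of relative size proportional to \<open>\<theta>\<close> is split off.\<close>

lemma chain:
  fixes v :: nat
  assumes split: "\<And>d S. d0 \<le> d \<Longrightarrow> d \<le> n \<Longrightarrow> cor d d S \<Longrightarrow> tr S = 0 \<Longrightarrow> opn S \<le> 1 \<Longrightarrow> splittable \<beta> \<theta>\<^sub>0 t R Y Z d S"
    and good: "\<And>m. m < n \<Longrightarrow> good K m" "0 \<le> K"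
    and par: "0 < \<theta>\<^sub>0" "0 \<le> t" "0 < \<beta>"
    and X: "13/5 * (K * (1/4 + 2 * t)) + 8000 \<le> X" "1000/997 * Y + 1 / \<theta>\<^sub>0 \<le> X" "Z + 1 / \<theta>\<^sub>0 \<le> X" "1 / (3 * \<theta>\<^sub>0\<^sup>2) \<le> X"
    and v: "1000 * q \<le> v" "50 * d0 \<le> v" "0 < d0" and \<theta>: "\<theta>\<^sub>0 \<le> \<theta>\<^sub>1" "\<theta>\<^sub>1 \<le> 1/1000"
  shows "v + d \<le> n \<Longrightarrow> v \<le> 100 * d \<Longrightarrow> isom (v + d) v V \<Longrightarrow> isom (v + d) d W \<Longrightarrow> star V * W = 0 \<Longrightarrow>
    V * star V + W * star W = un (v + d) \<Longrightarrow> cor (v + d) (v + d) A \<Longrightarrow> tr A = 0 \<Longrightarrow> opn A \<le> 1 \<Longrightarrow>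
    tr (star V * A * V) = 0 \<Longrightarrow> LR v q t (star V * A * V) \<Longrightarrow> Sol v (star V * A * V) (\<theta>\<^sub>1 * Z) \<Longrightarrow>
    Sol (v + d) A (X * (100 / v * d) powr (2 * \<beta>))"
proof (induction d arbitrary: V W A rule: less_induct)
  case (less d)
  note N = less.prems(1) and vd = less.prems(2) and V = less.prems(3) and W = less.prems(4) and VW = less.prems(5)
    and sum = less.prems(6) and A = less.prems(7-9) and VAV = less.prems(10-12)
  define \<phi> where "\<phi> = (100 / v * d) powr (2 * \<beta>)"
  have v0: "0 < v" using v by simp
  have d_pos: "0 < d" using vd v0 by simp
  have "real v \<le> real (100 * d)" using vd by (simp only: of_nat_le_iff)
  then have "1 \<le> 100 / v * d" using v0 by (simp add: field_simps)
  then have \<phi>: "1 \<le> \<phi>" unfolding \<phi>_def using par by (intro ge_one_powr_ge_zero) auto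
  have X0: "0 \<le> X" using X(4) par by (smt (verit) divide_nonneg_nonneg zero_le_power2)
  then have X\<phi>: "X \<le> X * \<phi>" using \<phi> by (simp add: mult_le_cancel_left1)
  have inv: "1 / \<theta> \<le> 1 / \<theta>\<^sub>0" if "\<theta>\<^sub>0 \<le> \<theta>" for \<theta> using par that by (simp add: frac_le)
  show ?case
  proof (cases "50 * d \<le> v")
    \<comment> \<open>The remainder is now so small that its dimensions can count as exceptional
      directions: the whole matrix is small off \<open>q + d\<close> of them, and one quartering
      step, with \<open>K\<close> at the smaller size, gives the gain.\<close>
    case True
    have "LR (v + d) (q + d) t A" by (rule LR_extend[OF V W sum A(1) VAV(2)])
    moreover have "v + d < 8 + 8 * ((v + d) div 8)" by (rule dividend_less_times_div) simp
    then have "3 * (q + d) \<le> 2 * ((v + d) div 8)" using True v unfolding distrib_left by linarith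
    ultimately have "Sol (v + d) A (13/5 * (K * (1/4 + 2 * t)) + 8000)"
    proof (intro Qstep[OF _ A(1,2,3)])
      fix A' assume A': "cor (2 * ((v + d) div 8)) (2 * ((v + d) div 8)) A'" "tr A' = 0" "opn A' \<le> 1 / 4 + 2 * t"
      have "2 * ((v + d) div 8) < n" using N v0 by linarith
      then show "Sol (2 * ((v + d) div 8)) A' (K * (1/4 + 2 * t))" using goodD[OF good(1) good(2) A'] by blast
    qed (use par good(2) in auto)
    then show ?thesis using X(1) X\<phi> Sol_mono unfolding \<phi>_def by (meson order_trans)
  next
    case False
    let ?S = "star W * A * W"
    have S: "cor d d ?S" by (rule cor_compress[OF W W A(1)])
    have trS: "tr ?S = 0" using tr_split[OF A(1) sum] VAV(1) A(2) by simp
    have oS: "opn ?S \<le> 1" using opn_sandwich[OF W W, of A] A(3) by simp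
    have WV: "star W * V = 0" using arg_cong[OF VW, of star] by simp
    have sum': "W * star W + V * star V = un (v + d)" using sum by (simp add: add.commute)
    have "splittable \<beta> \<theta>\<^sub>0 t R Y Z d ?S"
      by (rule split[OF _ _ S trS oS]) (use False v N in linarith)+
    then consider "Sol d ?S Y" | p P \<theta> where "isom d p P" "0 < p" "2 * p \<le> d" "tr (star P * ?S * P) = 0" "\<theta>\<^sub>0 \<le> \<theta>" "\<theta> \<le> 1/1000"
       "6 * \<theta> * real d \<le> \<beta> * real p" "Sol p (star P * ?S * P) (\<theta> * Z)"
      unfolding splittable_def by blast
    then show ?thesis
    proof cases
      case 1
      \<comment> \<open>The remainder has cost \<open>Y\<close> and gets the large disc; the piece
        \<open>V\<close> gets the disc of radius \<open>\<theta>\<^sub>1\<close>.\<close>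
      have \<theta>1: "0 < \<theta>\<^sub>1" using par \<theta> by simp
      have Y0: "0 \<le> Y" using 1 by (rule Sol_nonneg)
      have "Y / (1 - 3 * \<theta>\<^sub>1) \<le> Y / (997/1000)" using Y0 \<theta> by (intro divide_left_mono) auto
      also have "\<dots> = 1000/997 * Y" by simp
      finally have "Y / (1 - 3 * \<theta>\<^sub>1) \<le> X - 1 / \<theta>\<^sub>1" using X(2) inv[OF \<theta>(1)] by linarith
      moreover have "\<theta>\<^sub>1 * Z / \<theta>\<^sub>1 \<le> X - 1 / \<theta>\<^sub>1" using X(3) inv[OF \<theta>(1)] \<theta>1 by simp
      ultimately have "Sol (v + d) A (X - 1 / \<theta>\<^sub>1 + 1 / \<theta>\<^sub>1)"
        using \<theta> by (intro combine2[OF W V WV sum' A(1,3) 1 VAV(3) \<theta>1]) auto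
      then show ?thesis using X\<phi> Sol_mono unfolding \<phi>_def by (simp add: order_trans)
    next
      case (2 p P \<theta>)
      \<comment> \<open>The piece \<open>P\<close> of the remainder is removed from the whole space.
        \<open>T\<close> spans everything else, namely \<open>V\<close> and the rest
        \<open>Q\<close> of the remainder; the induction hypothesis applies there because
        \<open>2 * p \<le> d\<close> and \<open>v < 50 * d\<close> give
        \<open>v \<le> 100 * (d - p)\<close>.\<close>
      obtain Q where Q: "p \<le> d" "isom d (d - p) Q" "star P * Q = 0" "star Q * P = 0" "P * star P + Q * star Q = un d"
        using isom_complement[OF 2(1)] by blast
      have U: "isom (v + d) p (W * P)"
        using isom_rules[OF W] isom_rules[OF 2(1)] by (simp add: isom_def mult.assoc)
      obtain T where T: "p \<le> v + d" "isom (v + d) (v + d - p) T" "star (W * P) * T = 0" "star T * (W * P) = 0"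
        "W * P * star (W * P) + T * star T = un (v + d)"
        using isom_complement[OF U] by blast
      have Np: "v + d - p = v + (d - p)" using Q(1) by simp
      have TT: "T * (star T * Y) = un (v + d) * Y - W * (P * (star P * (star W * Y)))" for Y
        using arg_cong[OF T(5), of "\<lambda>M. M * Y"] by (simp add: distrib_right mult.assoc algebra_simps)
      have PQ: "P * (star P * Y) = un d * Y - Q * (star Q * Y)" for Y
        using arg_cong[OF Q(5), of "\<lambda>M. M * Y"] by (simp add: distrib_right mult.assoc algebra_simps)
      note IR = isom_rules[OF V] isom_rules[OF W] isom_rules[OF 2(1)] isom_rules[OF Q(2)] isom_rules[OF T(2)]
      have VWr: "star V * (W * Y) = 0" "star W * (V * Y) = 0" for Y using VW WV by (simp_all flip: mult.assoc)
      have PQr: "star P * (Q * Y) = 0" "star Q * (P * Y) = 0" for Y using Q(3,4) by (simp_all flip: mult.assoc)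
      have TV: "T * (star T * (V * Y)) = V * Y" for Y unfolding TT using VWr IR by simp
      have TWQ: "T * (star T * (W * (Q * Y))) = W * (Q * Y)" for Y unfolding TT using PQr IR by simp
      have TV1: "T * (star T * V) = V" using TV[of "un v"] IR by simp
      have TWQ1: "T * (star T * (W * Q)) = W * Q" using TWQ[of "un (d - p)"] IR by simp
      let ?A = "star T * A * T" and ?V = "star T * V" and ?W = "star T * (W * Q)"
      have "cor (v + d - p) (v + d - p) ?A" by (rule cor_compress[OF T(2) T(2) A(1)])
      moreover have "star (W * P) * A * (W * P) = star P * ?S * P" by (simp add: mult.assoc)
      then have "tr ?A = 0" using tr_split[OF A(1) T(5)] A(2) 2(4) by simp
      moreover have "opn ?A \<le> 1" using opn_sandwich[OF T(2) T(2), of A] A(3) by simp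
      moreover have isV: "isom (v + d - p) v ?V"
        using IR TV1 by (simp add: isom_def mult.assoc)
      moreover have isW: "isom (v + d - p) (d - p) ?W"
        using IR TWQ1 by (simp add: isom_def mult.assoc)
      moreover have "star ?V * ?W = 0" using TWQ1 VWr by (simp add: mult.assoc)
      moreover have "?V * star ?V + ?W * star ?W = un (v + d - p)"
      proof -
        have e: "V * (star V * T) + W * (Q * (star Q * (star W * T))) = T"
        proof -
          have "W * (P * (star P * (star W * T))) = 0" using T(3) by (simp add: mult.assoc)
          moreover have "W * (P * (star P * (star W * T))) + W * (Q * (star Q * (star W * T))) = W * (star W * T)"
            unfolding PQ using IR by (simp add: right_diff_distrib)
          moreover have "V * (star V * T) + W * (star W * T) = T"
            using arg_cong[OF sum, of "\<lambda>M. M * T"] IR by (simp add: distrib_right mult.assoc)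
          ultimately show ?thesis by simp
        qed
        have "?V * star ?V + ?W * star ?W = star T * (V * (star V * T) + W * (Q * (star Q * (star W * T))))"
          by (simp add: distrib_left mult.assoc)
        then show ?thesis unfolding e using IR by simp
      qed
      moreover have VAV': "star ?V * ?A * ?V = star V * A * V"
      proof -
        have "star V * (T * star T) = star V" using arg_cong[OF TV1, of star] by (simp add: mult.assoc)
        then have "star V * (T * (star T * Y)) = star V * Y" for Y by (metis mult.assoc)
        then show ?thesis by (simp add: mult.assoc TV1)
      qed
      ultimately have IH: "Sol (v + d - p) ?A (X * (100 / v * (d - p)) powr (2 * \<beta>))"
        using less.IH[of "d - p" ?V ?W ?A] VAV N 2(2,3) False unfolding Np VAV' by (simp add: of_nat_diff)
      have \<theta>0: "0 < \<theta>" using 2(5) par by simp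
      have "(100 / v * (real d - real p)) powr (2 * \<beta>) \<le> (1 - 3 * \<theta>)\<^sup>2 * \<phi>"
        unfolding \<phi>_def by (rule powr_step) (use par \<theta>0 2 v0 d_pos in auto)
      then have "X * (100 / v * (real d - real p)) powr (2 * \<beta>) \<le> X * ((1 - 3 * \<theta>)\<^sup>2 * \<phi>)"
        using X0 by (rule mult_left_mono)
      moreover have pos: "0 < 1 - 3 * \<theta>" using 2(6) by simp
      ultimately have "X * (100 / v * (real d - real p)) powr (2 * \<beta>) / (1 - 3 * \<theta>) \<le> X * \<phi> * (1 - 3 * \<theta>)"
        by (simp add: divide_le_eq power2_eq_square mult_ac)
      \<comment> \<open>The spare factor \<open>1 - 3 * \<theta>\<close> frees the amount
        \<open>3 * \<theta> * X * \<phi>\<close>, which covers \<open>1 / \<theta>\<close> because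
        \<open>X\<close> is at least \<open>1 / (3 * \<theta>\<^sub>0\<^sup>2)\<close>.\<close>
      moreover have "1 / \<theta> \<le> X * \<phi> * (3 * \<theta>)"
      proof -
        have "1 / (3 * \<theta>\<^sup>2) \<le> 1 / (3 * \<theta>\<^sub>0\<^sup>2)"
          using 2(5) par \<theta>0 by (intro divide_left_mono mult_left_mono power_mono mult_pos_pos) auto
        then have "1 / (3 * \<theta>\<^sup>2) \<le> X * \<phi>" using X(4) X\<phi> by linarith
        then have "1 / (3 * \<theta>\<^sup>2) * (3 * \<theta>) \<le> X * \<phi> * (3 * \<theta>)" using \<theta>0 by (intro mult_right_mono) auto
        then show ?thesis using \<theta>0 by (simp add: power2_eq_square)
      qed
      ultimately have M1: "X * (100 / v * (real d - real p)) powr (2 * \<beta>) / (1 - 3 * \<theta>) \<le> X * \<phi> - 1 / \<theta>"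
        by (simp add: algebra_simps)
      have M2: "\<theta> * Z / \<theta> \<le> X * \<phi> - 1 / \<theta>" using X(3) X\<phi> inv[OF 2(5)] \<theta>0 by simp
      have "Sol (v + d) A (X * \<phi> - 1 / \<theta> + 1 / \<theta>)"
      proof (rule combine2[OF T(2) U T(4) _ A(1,3) _ _ \<theta>0 _ M1 M2])
        show "T * star T + W * P * star (W * P) = un (v + d)" using T(5) by (simp add: add.commute)
        show "Sol (v + d - p) (star T * A * T) (X * (100 / v * (real d - real p)) powr (2 * \<beta>))"
          using IH 2(3) by (simp add: of_nat_diff)
        show "Sol p (star (W * P) * A * (W * P)) (\<theta> * Z)" using 2(8) by (simp add: mult.assoc)
        show "\<theta> \<le> 1/6" using 2(6) by simp
      qed
      then show ?thesis unfolding \<phi>_def by simp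
    qed
  qed
qed

text \<open>The first piece found becomes the \<open>V\<close> of \<open>chain\<close>. It fills at
  least a fraction \<open>1 / R\<close> of the space, so the potential starts at no more than
  \<open>(100 * R) powr (2 * \<beta>)\<close>, and all cuts together raise the constant by at most a
  tenth.\<close>

lemma chain_start:
  assumes split: "\<And>d S. d0 \<le> d \<Longrightarrow> d \<le> n \<Longrightarrow> cor d d S \<Longrightarrow> tr S = 0 \<Longrightarrow> opn S \<le> 1 \<Longrightarrow> splittable \<beta> \<theta>\<^sub>0 t R Y Z d S"
    and good: "\<And>m. m < n \<Longrightarrow> good K m" "0 \<le> K"
    and par: "0 < \<theta>\<^sub>0" "0 \<le> t" "0 < \<beta>" "0 < R" "(100 * R) powr (2 * \<beta>) \<le> 11/10"
    and X: "13/5 * (K * (1/4 + 2 * t)) + 8000 \<le> X" "1000/997 * Y + 1 / \<theta>\<^sub>0 \<le> X" "Z + 1 / \<theta>\<^sub>0 \<le> X" "1 / (3 * \<theta>\<^sub>0\<^sup>2) \<le> X"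
    and n: "R * real (50 * d0) \<le> n" "d0 \<le> n" "0 < d0" and A: "cor n n A" "tr A = 0" "opn A \<le> 1"
  shows "Sol n A (11/10 * X)"
proof -
  have X0: "0 \<le> X" using X(1) good(2) par(2) by (smt (verit) mult_nonneg_nonneg zero_le_divide_iff)
  from split[OF n(2) order_refl A] consider "Sol n A Y" | p V \<theta> q where "isom n p V" "0 < p" "2 * p \<le> n" "tr (star V * A * V) = 0" "\<theta>\<^sub>0 \<le> \<theta>" "\<theta> \<le> 1/1000"
       "6 * \<theta> * real n \<le> \<beta> * real p" "Sol p (star V * A * V) (\<theta> * Z)" "LR p q t (star V * A * V)" "1000 * q \<le> p" "real n \<le> R * real p"
    unfolding splittable_def by blast
  then show ?thesis
  proof cases
    case 1
    have "Y \<le> 1000/997 * Y" using Sol_nonneg[OF 1] by simp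
    also have "\<dots> \<le> X" using X(2) par(1) by (smt (verit) divide_nonneg_pos)
    also have "\<dots> \<le> 11/10 * X" using X0 by simp
    finally show ?thesis using 1 Sol_mono by blast
  next
    case (2 p V \<theta> q)
    obtain W where W: "p \<le> n" "isom n (n - p) W" "star V * W = 0" "V * star V + W * star W = un n"
      using isom_complement[OF 2(1)] by blast
    have np: "p + (n - p) = n" using W(1) by simp
    have "R * real (50 * d0) \<le> R * real p" using n(1) 2(11) by simp
    then have dp: "50 * d0 \<le> p" using par(4) by (simp only: mult_le_cancel_left_pos of_nat_le_iff)
    have "Sol (p + (n - p)) A (X * (100 / p * (n - p)) powr (2 * \<beta>))"
    proof (rule chain[OF split good par(1-3) X 2(10) dp n(3) 2(5,6)])
    qed (use 2 W A np in auto)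
    then have "Sol n A (X * (100 / p * (n - p)) powr (2 * \<beta>))" unfolding np .
    moreover have "(100 / p * (n - p)) powr (2 * \<beta>) \<le> (100 * R) powr (2 * \<beta>)"
    proof (rule powr_mono2)
      have "real (n - p) \<le> R * real p" using 2(11) by linarith
      then show "100 / p * (n - p) \<le> 100 * R" using 2(2) by (simp add: field_simps)
    qed (use par in auto)
    then have "X * (100 / p * (n - p)) powr (2 * \<beta>) \<le> X * (11/10)" using par(5) X0 by (intro mult_left_mono) auto
    ultimately show ?thesis using Sol_mono by (simp add: mult.commute)
  qed
qed

text \<open>Seventy quartering steps turn \<open>K\<close> into \<open>(13/20)\<^sup>7\<^sup>0 K\<close>, less than the \<open>\<theta> K / 2\<close> with \<open>\<theta> = 1 / (39600 * 2\<^sup>2\<^sup>1)\<close>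
  that a balanced piece of relative size \<open>2\<^sup>-\<^sup>2\<^sup>1\<close> may cost. The tolerance \<open>2\<^sup>-\<^sup>1\<^sup>5\<^sup>0\<close> is negligible against the
  factor \<open>(13/5)\<^sup>7\<^sup>0\<close>, and isotropic pieces of relative size about \<open>2\<^sup>-\<^sup>3\<^sup>2\<^sup>0\<close> keep the number of exceptional
  directions below \<open>4\<^sup>-\<^sup>7\<^sup>0\<close> times the dimension. The potential starts below \<open>2\<^sup>3\<^sup>3\<^sup>0\<close>, whose power with exponent
  \<open>2 / 6600\<close> is less than \<open>11/10\<close>.\<close>

lemma exists_splittable:
  "\<exists>C\<ge>0. \<forall>K d S. 0 \<le> K \<longrightarrow> (\<forall>m<d. good K m) \<longrightarrow> 2 ^ 330 \<le> d \<longrightarrow> cor d d S \<longrightarrow> tr S = 0 \<longrightarrow> opn S \<le> 1 \<longrightarrow>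
     splittable (1/6600) (1 / (39600 * 2 ^ 321)) (1 / 2 ^ 150) (2 ^ 321) (13/5 * (K * (1/4 + 2 * (1/100 + 1 / 2 ^ 150))) + 8000) (C + K / 2) d S"
proof -
  obtain C where C: "0 \<le> C" and gain: "\<And>N A q a e K. \<forall>m\<le>N. good K m \<Longrightarrow> 0 \<le> K \<Longrightarrow> cor N N A \<Longrightarrow> tr A = 0 \<Longrightarrow> opn A \<le> a \<Longrightarrow> a \<le> 1 \<Longrightarrow>
     0 \<le> e \<Longrightarrow> e \<le> 1/4 \<Longrightarrow> LR N q e A \<Longrightarrow> 4 ^ 70 * (16 * q + 16) \<le> N + 3 \<Longrightarrow>
     Sol N A (C + K * (13/5) ^ 70 * (a / 4 ^ 70 + 3 * e * (1 - 1 / 4 ^ 70)))"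
    using gain[of 70] by blast
  have "splittable (1/6600) (1 / (39600 * 2 ^ 321)) (1 / 2 ^ 150) (2 ^ 321) (13/5 * (K * (1/4 + 2 * (1/100 + 1 / 2 ^ 150))) + 8000) (39600 * 2 ^ 21 * C + K / 2) d S"
    if K: "0 \<le> K" "\<forall>m<d. good K m" and d: "2 ^ 330 \<le> d" and S: "cor d d S" "tr S = 0" "opn S \<le> 1" for K d S
  proof -
    define p0 where "p0 = d div 2 ^ 320"
    have rd: "2 ^ 330 \<le> real d" using d by (simp only: of_nat_le_iff flip: of_nat_power of_nat_numeral[where 'a = real])
    have p0d: "real p0 * 2 ^ 320 \<le> real d"
    proof -
      have "p0 * 2 ^ 320 \<le> d" unfolding p0_def by (rule div_times_less_eq_dividend)
      then show ?thesis by (simp only: of_nat_le_iff flip: of_nat_power of_nat_numeral[where 'a = real] of_nat_mult)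
    qed
    \<comment> \<open>Since \<open>2 ^ 330 \<le> d\<close>, the rounding in \<open>p0\<close> loses
      at most a factor of two.\<close>
    have dp0: "real d \<le> 2 ^ 321 * real p0"
    proof -
      have "d < 2 ^ 320 + 2 ^ 320 * p0" unfolding p0_def by (rule dividend_less_times_div) simp
      then have "real d < 2 ^ 320 + 2 ^ 320 * real p0"
        by (simp only: of_nat_less_iff flip: of_nat_power of_nat_numeral[where 'a = real] of_nat_mult of_nat_add)
      then show ?thesis using rd by simp
    qed
    have p0: "0 < p0" using dp0 rd by (cases "p0 = 0") auto
    have p0': "1000000000000 * p0 \<le> d"
    proof -
      have "real (1000000000000 * p0) \<le> real d" using p0d by simp
      then show ?thesis by (simp only: of_nat_le_iff)
    qed
    have t: "(0::real) < 1 / 2 ^ 150" by simp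
    show ?thesis
    proof (rule dichotomy[OF S p0 p0' t], goal_cases small isotropic balanced)
      case (small q)
      have q: "real q \<le> real d / 100 + (3 + 3 * 2 ^ 150) * real p0" using small(2) by simp
      have "3 * q \<le> 2 * (d div 8)"
      proof -
        have "d < 8 + 8 * (d div 8)" by (rule dividend_less_times_div) simp
        then have "real d < real (8 + 8 * (d div 8))" by (simp only: of_nat_less_iff)
        then have "real (3 * q) \<le> real (2 * (d div 8))" using q p0d rd by simp
        then show ?thesis by (simp only: of_nat_le_iff)
      qed
      then have "Sol d S (13/5 * (K * (1/4 + 2 * (1/100 + 1 / 2 ^ 150))) + 8000)"
      proof (rule Qstep[OF _ S order_refl small(1)])
        fix A' assume A': "cor (2 * (d div 8)) (2 * (d div 8)) A'" "tr A' = 0" "opn A' \<le> 1 / 4 + 2 * (1/100 + 1 / 2 ^ 150)"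
        have "0 < d" using p0' p0 by linarith
        then have "2 * (d div 8) < d" by linarith
        then show "Sol (2 * (d div 8)) A' (K * (1/4 + 2 * (1/100 + 1 / 2 ^ 150)))" using goodD[OF _ K(1) A'] K(2) by blast
      qed (use K(1) in auto)
      then show ?thesis unfolding splittable_def by blast
    next
      case (isotropic V)
      \<comment> \<open>The weight is \<open>\<beta> / (6 * 2 ^ 321)\<close> with
        \<open>\<beta> = 1/6600\<close>, the largest that a relative size of
        \<open>1 / 2 ^ 321\<close> allows; this is the origin of 39600.\<close>
      have "Sol p0 (star V * S * V) (1 / (39600 * 2 ^ 321) * (39600 * 2 ^ 21 * C + K / 2))"
        unfolding isotropic(2) using C K by (intro Sol_zero) simp
      moreover have "LR p0 0 (1 / 2 ^ 150) (star V * S * V)" unfolding isotropic(2) by (rule LR_zero) simp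
      moreover have "2 * p0 \<le> d" using p0' by linarith
      ultimately show ?thesis unfolding splittable_def using isotropic p0 dp0
        by (intro disjI2 exI[of _ p0] exI[of _ V] exI[of _ "1 / (39600 * 2 ^ 321)"] exI[of _ 0]) (simp add: field_simps)
    next
      case (balanced V q)
      let ?p = "d div 1048576"
      have p1: "2 * ?p \<le> d" by linarith
      have p2: "real d \<le> 2 ^ 21 * real ?p"
      proof -
        have "d < 1048576 + 1048576 * ?p" by (rule dividend_less_times_div) simp
        then have "real d < real (1048576 + 1048576 * ?p)" by (simp only: of_nat_less_iff)
        then show ?thesis using rd by simp
      qed
      have p3: "0 < ?p"
      proof -
        have "0 < real ?p" using p2 rd by simp
        then show ?thesis by (simp only: of_nat_0_less_iff)
      qed
      have q: "real q \<le> (120006 + 3 * 2 ^ 150) * real p0" using balanced(4) by (simp add: distrib_right)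
      have q': "4 ^ 70 * (16 * q + 16) \<le> ?p + 3"
      proof -
        \<comment> \<open>In powers of two: \<open>q\<close> is at most about
          \<open>d / 2 ^ 168\<close>, so the left side is about \<open>d / 2 ^ 24\<close>, below the
          \<open>d / 2 ^ 21\<close> available in the piece.\<close>
        have "4 ^ 70 * (16 * real q + 16) \<le> real ?p + 3" using q p0d p2 rd by simp
        then have "real (4 ^ 70 * (16 * q + 16)) \<le> real (?p + 3)" by simp
        then show ?thesis by (simp only: of_nat_le_iff)
      qed
      have "1000 * (16 * q + 16) \<le> 4 ^ 70 * (16 * q + 16)" by (rule mult_le_mono1) simp
      also note q'
      finally have q1: "1000 * (16 * q + 16) \<le> ?p + 3" .
      have "1000 * q \<le> P" if "1000 * (16 * q + 16) \<le> P + 3" for P :: nat using that by simp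
      from this[OF q1] have q1: "1000 * q \<le> ?p" .
      have pd: "?p < d" using p1 p3 by linarith
      have "Sol ?p (star V * S * V) (C + K * (13/5) ^ 70 * (1 / 4 ^ 70 + 3 * (1 / 2 ^ 150) * (1 - 1 / 4 ^ 70)))"
        by (rule gain[OF _ K(1) cor_compress[OF balanced(1) balanced(1) S(1)] balanced(2) _ order_refl _ _ balanced(3) q'])
          (use K(2) pd opn_sandwich[OF balanced(1) balanced(1), of S] S(3) in auto)
      \<comment> \<open>The main term \<open>(13/20) ^ 70\<close> is about
        \<open>8 / 10 ^ 14\<close> and the tolerance adds about \<open>2 / 10 ^ 16\<close>, while
        the factor on the right is about \<open>6 / 10 ^ 12\<close>.\<close>
      moreover have "K * ((13/5) ^ 70 * (1 / 4 ^ 70 + 3 * (1 / 2 ^ 150) * (1 - 1 / 4 ^ 70))) \<le> K * (1 / (39600 * 2 ^ 21) / 2)"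
        using K(1) by (rule mult_left_mono[rotated]) (simp add: power_divide)
      then have "C + K * (13/5) ^ 70 * (1 / 4 ^ 70 + 3 * (1 / 2 ^ 150) * (1 - 1 / 4 ^ 70)) \<le> 1 / (39600 * 2 ^ 21) * (39600 * 2 ^ 21 * C + K / 2)"
        by (simp add: algebra_simps)
      ultimately have "Sol ?p (star V * S * V) (1 / (39600 * 2 ^ 21) * (39600 * 2 ^ 21 * C + K / 2))" by (rule Sol_mono)
      moreover have "6 * (1 / (39600 * 2 ^ 21)) * real d \<le> 1/6600 * real ?p" using p2 by simp
      moreover have "real d \<le> 2 ^ 321 * real ?p"
        using p2 by (rule order_trans) (intro mult_right_mono, simp_all)
      moreover have "(1::real) / (39600 * 2 ^ 321) \<le> 1 / (39600 * 2 ^ 21)" "(1::real) / (39600 * 2 ^ 21) \<le> 1/1000" by simp_all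
      ultimately show ?thesis unfolding splittable_def using balanced(1-3) p1 p3 q1
        by (intro disjI2 exI[of _ ?p] exI[of _ V] exI[of _ "1 / (39600 * 2 ^ 21)"] exI[of _ q] conjI)
    qed
  qed
  then show ?thesis using C by (intro exI[of _ "39600 * 2 ^ 21 * C"]) simp
qed

section \<open>Induction on the dimension\<close>

lemma good_below: "\<exists>K\<ge>0. \<forall>m<n. good K m" for n :: nat
proof (induction n)
  case (Suc n)
  then obtain K where K: "0 \<le> K" "\<forall>m<n. good K m" by blast
  obtain K' where K': "0 \<le> K'" "good K' n" using good_exists by blast
  have "good (max K K') m" if "m < Suc n" for m
    using that K K' good_mono[of K m "max K K'"] good_mono[of K' n "max K K'"] by (cases "m = n") auto
  then show ?case using K by (intro exI[of _ "max K K'"]) auto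
qed auto

text \<open>The induction closes numerically: matrices that are small off few directions return
  about \<open>0.71 * K\<close> and the pieces contribute \<open>K / 2\<close>, so
  \<open>X = 77/100 * K + C2\<close> dominates every case. Then \<open>11/10 * X\<close> is
  \<open>0.847 * K + 1.1 * C2\<close>, which is at most \<open>K\<close> once
  \<open>8 * C2 \<le> K\<close>.\<close>

theorem good_uniform: "\<exists>K\<ge>0. \<forall>n. good K n"
proof -
  define \<theta> :: real where "\<theta> = 1 / (39600 * 2 ^ 321)"
  have \<theta>: "0 < \<theta>" by (simp add: \<theta>_def)
  obtain C where C: "0 \<le> C" and split: "\<And>K d S. 0 \<le> K \<Longrightarrow> \<forall>m<d. good K m \<Longrightarrow> 2 ^ 330 \<le> d \<Longrightarrow> cor d d S \<Longrightarrow> tr S = 0 \<Longrightarrow> opn S \<le> 1 \<Longrightarrow>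
     splittable (1/6600) \<theta> (1 / 2 ^ 150) (2 ^ 321) (13/5 * (K * (1/4 + 2 * (1/100 + 1 / 2 ^ 150))) + 8000) (C + K / 2) d S"
    using exists_splittable unfolding \<theta>_def by blast
  \<comment> \<open>Beyond this size the first piece has dimension at least
    \<open>50 * 2 ^ 330\<close>, so every remainder that still has to be split has dimension at
    least \<open>2 ^ 330\<close>.\<close>
  define n0 :: nat where "n0 = 2 ^ 321 * (50 * 2 ^ 330)"
  obtain K0 where K0: "0 \<le> K0" "\<forall>m<n0. good K0 m" using good_below by blast
  define C2 where "C2 = 9000 + C + 1 / \<theta> + 1 / (3 * \<theta>\<^sup>2)"
  define K where "K = max K0 (8 * C2)"
  have C2: "9000 \<le> C2" "9000 + 1 / \<theta> \<le> C2" "C + 1 / \<theta> \<le> C2" "1 / (3 * \<theta>\<^sup>2) \<le> C2"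
    using C \<theta> by (simp_all add: C2_def)
  have K: "0 \<le> K" "8 * C2 \<le> K" using K0(1) by (auto simp: K_def)
  have R: "(100 * 2 ^ 321) powr (2 * (1/6600)) \<le> (11/10 :: real)"
  proof -
    have "(100 * 2 ^ 321 :: real) powr (2 * (1/6600)) \<le> (2 ^ 330) powr (1/3300)"
      by (simp add: powr_mono2)
    also have "(2::real) ^ 330 = 2 powr 330" by (rule powr_numeral[symmetric]) simp
    also have "(2 powr 330) powr (1/3300) = (2 powr (1/10) :: real)" unfolding powr_powr by simp
    also have "\<dots> \<le> ((11/10) ^ 10) powr (1/10)" by (intro powr_mono2) (simp_all add: power_divide)
    also have "(11/10 :: real) ^ 10 = (11/10) powr 10" by (rule powr_numeral[symmetric]) simp
    also have "((11/10) powr 10) powr (1/10) = (11/10 :: real)" unfolding powr_powr by simp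
    finally show ?thesis .
  qed
  have "good K n" for n
  proof (induction n rule: less_induct)
    case (less n)
    show ?case
    proof (cases "n < n0")
      case True
      then show ?thesis using K0 good_mono[of K0 n K] by (auto simp: K_def)
    next
      case False
      define X where "X = 77/100 * K + C2"
      have rn: "2 ^ 321 * real (50 * 2 ^ 330) \<le> real n"
      proof -
        have "real n0 \<le> real n" using False by simp
        then show ?thesis by (simp add: n0_def)
      qed
      show ?thesis
      proof (rule goodI)
        fix A assume A: "cor n n A" "tr A = 0" "opn A \<le> 1"
        have "Sol n A (11/10 * X)"
        proof (rule chain_start[where ?d0.0 = "2 ^ 330" and Z = "C + K / 2" and \<theta>\<^sub>0 = \<theta> and R = "2 ^ 321" and t = "1 / 2 ^ 150"
              and K = K and \<beta> = "1/6600" and Y = "13/5 * (K * (1/4 + 2 * (1/100 + 1 / 2 ^ 150))) + 8000"])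
          show "(2::nat) ^ 330 \<le> n"
          proof -
            have "(2::nat) ^ 330 \<le> n0" by (simp add: n0_def)
            then show ?thesis using False by linarith
          qed
          show "13/5 * (K * (1/4 + 2 * (1 / 2 ^ 150))) + 8000 \<le> X" "C + K / 2 + 1 / \<theta> \<le> X" "1 / (3 * \<theta>\<^sup>2) \<le> X"
            using C2 K(1) unfolding X_def by simp_all
          show "1000/997 * (13/5 * (K * (1/4 + 2 * (1/100 + 1 / 2 ^ 150))) + 8000) + 1 / \<theta> \<le> X"
          proof -
            have "K * (1/4 + 2 * (1/100 + 1 / 2 ^ 150)) \<le> K * (271/1000)" using K(1) by (rule mult_left_mono[rotated]) simp
            moreover have "1000/997 * (13/5 * k + 8000) + r \<le> 77/100 * K + C2" if "k \<le> K * (271/1000)" "9000 + r \<le> C2" for k r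
              using that K(1) by argo
            ultimately show ?thesis using C2(2) unfolding X_def by blast
          qed
        qed (use less.IH split K(1) \<theta> R rn A in auto)
        moreover have "11/10 * X \<le> K" using K C2(1) by (simp add: X_def)
        ultimately show "Sol n A K" by (rule Sol_mono)
      qed
    qed
  qed
  then show ?thesis using K(1) by blast
qed

subsection \<open>Real matrices\<close>

definition RSol :: "nat \<Rightarrow> fmat \<Rightarrow> real \<Rightarrow> bool" where
  "RSol n A L \<longleftrightarrow> (\<exists>B C. cor n n B \<and> cor n n C \<and> cnjm B = B \<and> cnjm C = C \<and> A = B * C - C * B \<and> opn B \<le> 1 \<and> opn C \<le> L)"

lemma RSol_mono: "RSol n A L \<Longrightarrow> L \<le> L' \<Longrightarrow> RSol n A L'"
  unfolding RSol_def by force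

text \<open>If \<open>A\<close> and \<open>B\<close> are real, then \<open>C\<close> can be replaced by its real part.\<close>

lemma RSolI:
  assumes "cor n n B" "cor n n C" "A = B * C - C * B" "opn B \<le> 1" "opn C \<le> L" "cnjm A = A" "cnjm B = B"
  shows "RSol n A L"
proof -
  let ?C = "cs (1/2) (C + cnjm C)"
  have "A = B * cnjm C - cnjm C * B" using arg_cong[OF assms(3), of cnjm] assms(6,7) by simp
  then have "cs 2 A = B * (C + cnjm C) - (C + cnjm C) * B"
    using assms(3) cs_add_left[of 1 1 A] by (simp add: distrib_left distrib_right)
  then have "cs (1/2) (cs 2 A) = B * ?C - ?C * B" by (simp add: cs_diff)
  then have "A = B * ?C - ?C * B" by simp
  moreover have "opn ?C \<le> L" using opn_add[of C "cnjm C"] assms(5) by (simp add: norm_divide)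
  moreover have "cor n n ?C" using assms(2) by (auto simp: cor_iff)
  ultimately show ?thesis unfolding RSol_def using assms(1,4,7)
    by (intro exI[of _ B] exI[of _ ?C]) (simp add: add.commute)
qed

text \<open>Only the assembled first factor has to be real, since \<open>RSolI\<close> replaces the
  second one by its real part. The blocks themselves may be complex, as when they are conjugate to
  each other.\<close>

lemma assemble_real:
  assumes V: "isom n p V" and W: "isom n q W" and VW: "star V * W = 0" "V * star V + W * star W = un n"
    and A: "cor n n A" "opn A \<le> 1" "cnjm A = A"
    and B: "cor p p B\<^sub>1" "opn (B\<^sub>1 - cs s\<^sub>1 (un p)) \<le> d\<^sub>1" "cor q q B\<^sub>2" "opn (B\<^sub>2 - cs s\<^sub>2 (un q)) \<le> d\<^sub>2"
    and C: "cor p p C\<^sub>1" "opn C\<^sub>1 \<le> L" "cor q q C\<^sub>2" "opn C\<^sub>2 \<le> L"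
    and BC: "star V * A * V = B\<^sub>1 * C\<^sub>1 - C\<^sub>1 * B\<^sub>1" "star W * A * W = B\<^sub>2 * C\<^sub>2 - C\<^sub>2 * B\<^sub>2"
    and disc: "cmod s\<^sub>1 + d\<^sub>1 \<le> 1" "cmod s\<^sub>2 + d\<^sub>2 \<le> 1" and gap: "d\<^sub>1 + d\<^sub>2 + g \<le> cmod (s\<^sub>1 - s\<^sub>2)" "0 < g" "0 \<le> L"
    and real: "cnjm (V * B\<^sub>1 * star V + W * B\<^sub>2 * star W) = V * B\<^sub>1 * star V + W * B\<^sub>2 * star W"
  shows "RSol n A (L + 4 / g)"
proof -
  have WV: "star W * V = 0" using VW(1) by (metis star_0 star_mult star_star)
  let ?if = "\<lambda>x y i. if i = (0::nat) then x else y"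
  have sum2: "(\<Sum>i<2. F i) = F 0 + F (Suc 0)" for F :: "nat \<Rightarrow> fmat" by (simp add: numeral_2_eq_2)
  have B_sum: "(\<Sum>i<2. ?if V W i * ?if B\<^sub>1 B\<^sub>2 i * star (?if V W i)) = V * B\<^sub>1 * star V + W * B\<^sub>2 * star W"
    by (simp add: sum2)
  have gap': "d\<^sub>2 + d\<^sub>1 + g \<le> cmod (s\<^sub>2 - s\<^sub>1)" using gap(1) by (simp add: norm_minus_commute add.commute)
  note ass = assemble[where r = 2 and n = n and p = "?if p q" and V = "?if V W" and B = "?if B\<^sub>1 B\<^sub>2" and C = "?if C\<^sub>1 C\<^sub>2"
      and s = "?if s\<^sub>1 s\<^sub>2" and d = "?if d\<^sub>1 d\<^sub>2" and L = L and a = 1 and g = g and A = A, unfolded B_sum]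
  have "\<exists>D. cor n n D \<and> A = (V * B\<^sub>1 * star V + W * B\<^sub>2 * star W) * D - D * (V * B\<^sub>1 * star V + W * B\<^sub>2 * star W) \<and> opn D \<le> L + (real 2)\<^sup>2 * 1 / g"
    by (rule ass(1)) (use assms WV gap' in \<open>auto simp: less_2_cases_iff sum2\<close>)
  moreover have "cor n n (V * B\<^sub>1 * star V + W * B\<^sub>2 * star W)"
    by (rule ass(2)) (use assms WV gap' in \<open>auto simp: less_2_cases_iff sum2\<close>)
  moreover have "opn (V * B\<^sub>1 * star V + W * B\<^sub>2 * star W) \<le> 1"
    by (rule ass(3)) (use assms WV gap' in \<open>auto simp: less_2_cases_iff sum2\<close>)
  ultimately show ?thesis using RSolI[OF _ _ _ _ _ A(3) real, of n] by auto
qed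

text \<open>The convexity argument yields a complex vector only. For a real one, diagonal entries on
  either side of 0 are joined by a rotation in a real coordinate plane.\<close>

lemma real_zero_value:
  assumes A: "cor n n A" "tr A = 0" "cnjm A = A" and n: "0 < n"
  shows "\<exists>x. cvec n x \<and> cnjm x = x \<and> norm x = 1 \<and> cip x (A * x) = 0"
proof -
  have re: "ent A i j = of_real (Re (ent A i j))" for i j
    using arg_cong[OF A(3), of "\<lambda>M. ent M i j"] by (simp add: complex_eq_iff)
  have cv: "cvec n (eu i 0)" if "i < n" for i using that by (auto simp: cvec_iff)
  have q: "cip (eu i 0) (A * eu j 0) = of_real (Re (ent A i j))" if "i < n" "j < n" for i j
    using cip_eu[OF that(1) cvec_mult[OF A(1) cv[OF that(2)]]] re by simp
  have "of_real (\<Sum>i<n. Re (ent A i i)) = tr A" unfolding tr_cor[OF A(1)] using re by simp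
  then have s0: "(\<Sum>i<n. Re (ent A i i)) = 0" using A(2) by (simp only: of_real_eq_0_iff)
  have "\<exists>i<n. Re (ent A i i) \<le> 0"
  proof (rule ccontr)
    assume "\<not> ?thesis"
    then have "0 < (\<Sum>i<n. Re (ent A i i))" using n by (intro sum_pos) auto
    then show False using s0 by simp
  qed
  moreover have "\<exists>j<n. 0 \<le> Re (ent A j j)"
  proof (rule ccontr)
    assume "\<not> ?thesis"
    then have "0 < (\<Sum>i<n. - Re (ent A i i))" using n by (intro sum_pos) auto
    then show False using s0 by (simp add: sum_negf)
  qed
  ultimately obtain i j where ij: "i < n" "j < n" "Re (ent A i i) \<le> 0" "0 \<le> Re (ent A j j)" by blast
  show ?thesis
  proof (cases "i = j")
    case True
    have "cip (eu i 0) (eu i 0) = 1" using cip_eu[OF ij(1) cv[OF ij(1)]] by simp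
    then have "norm (eu i 0) = 1" using cip_self[of "eu i 0"] by (metis norm_ge_zero of_real_eq_1_iff power2_eq_1_iff real_sqrt_abs real_sqrt_one abs_of_nonneg)
    then show ?thesis using True ij q[OF ij(1,1)] cv[OF ij(1)] by (intro exI[of _ "eu i 0"]) auto
  next
    case False
    define x where "x \<phi> = cs (of_real (cos \<phi>)) (eu i 0) + cs (of_real (sin \<phi>)) (eu j 0)" for \<phi>
    define F where "F \<phi> = (cos \<phi>)\<^sup>2 * Re (ent A i i) + (sin \<phi>)\<^sup>2 * Re (ent A j j) + cos \<phi> * sin \<phi> * (Re (ent A i j) + Re (ent A j i))" for \<phi>
    have xF: "cip (x \<phi>) (A * x \<phi>) = of_real (F \<phi>)" for \<phi>
      unfolding x_def quad_combination by (simp add: q ij F_def)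
    have "continuous_on {0..pi/2} F" unfolding F_def by (intro continuous_intros)
    moreover have "F 0 \<le> 0" "0 \<le> F (pi/2)" using ij by (simp_all add: F_def)
    ultimately obtain \<phi> where \<phi>: "F \<phi> = 0" using IVT'[of F 0 0 "pi/2"] by (auto simp: pi_ge_zero)
    have cv': "cvec n (x \<phi>)" unfolding x_def by (intro cvec_add cvec_cs cv ij)
    have "complex_of_real (cos \<phi>) * of_real (cos \<phi>) + of_real (sin \<phi>) * of_real (sin \<phi>) = 1"
      unfolding of_real_mult[symmetric] of_real_add[symmetric] by (simp flip: power2_eq_square)
    then have "cip (x \<phi>) (x \<phi>) = 1"
      unfolding x_def using False ij
      by (simp add: cip_add_left cip_add_right cip_eu[OF ij(1) cv[OF ij(1)]] cip_eu[OF ij(1) cv[OF ij(2)]]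
          cip_eu[OF ij(2) cv[OF ij(1)]] cip_eu[OF ij(2) cv[OF ij(2)]])
    then have "(norm (x \<phi>))\<^sup>2 = 1" unfolding cip_self by (simp only: of_real_eq_1_iff)
    then have "norm (x \<phi>) = 1" by (metis abs_norm_cancel abs_square_eq_1)
    then show ?thesis using cv' xF[of \<phi>] \<phi> by (intro exI[of _ "x \<phi>"]) (auto simp: x_def)
  qed
qed

text \<open>The complement of \<open>x\<close> has to be real, so it is read off from the reflection
  \<open>U\<close> that exchanges \<open>x\<close> with the last coordinate vector: the first
  \<open>n\<close> columns of \<open>U\<close> are real and orthogonal to \<open>x\<close>.\<close>

lemma householder:
  assumes x: "cvec (Suc n) x" "cnjm x = x" "norm x = 1"
  obtains W where "isom (Suc n) n W" "cnjm W = W" "star x * W = 0" "x * star x + W * star W = un (Suc n)"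
proof -
  let ?e = "eu n 0" and ?N = "Suc n"
  have un: "un ?N = eu n 0 * eu 0 n + un n" by (rule fmat_eqI) (auto simp: eu_eu)
  have cip0: "star a * b = cs (cip a b) (eu 0 0)" if "cvec ?N a" "cvec ?N b" for a b
    by (rule star_vec_mult[OF that])
  have e: "cvec ?N ?e" by (auto simp: cvec_iff)
  have ce: "cip ?e b = ent b n 0" if "cvec ?N b" for b using cip_eu[OF _ that, of n] by simp
  obtain U where U: "star U = U" "cnjm U = U" "cor ?N ?N U" "U * U = un ?N" "U * ?e = x"
  proof (cases "x = ?e")
    case True
    then show ?thesis using that[of "un ?N"] by simp
  next
    case False
    define v where "v = x - ?e"
    have v: "cvec ?N v" unfolding v_def using x(1) e by (auto simp: cvec_iff)
    have v0: "norm v \<noteq> 0" using False by (simp add: v_def)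
    have vr: "cnjm v = v" using x(2) by (simp add: v_def)
    define \<rho> where "\<rho> = Re (ent x n 0)"
    have \<rho>: "ent x n 0 = of_real \<rho>"
      using arg_cong[OF x(2), of "\<lambda>M. ent M n 0"] by (simp add: complex_eq_iff \<rho>_def)
    have xe: "cip x ?e = of_real \<rho>" using ce[OF x(1)] \<rho> cip_commute[of x ?e] by simp
    have "complex_of_real ((norm v)\<^sup>2) = of_real (2 - 2 * \<rho>)"
      unfolding cip_self[symmetric] v_def using x(3) cip_self[of x] xe ce[OF e] ce[OF x(1)] \<rho>
      by (simp add: cip_diff_left cip_diff_right)
    then have nv: "(norm v)\<^sup>2 = 2 - 2 * \<rho>" by (simp only: of_real_eq_iff)
    define k where "k = complex_of_real (2 / (norm v)\<^sup>2)"
    define U where "U = un ?N - cs k (v * star v)"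
    have vv: "star v * v = cs (of_real ((norm v)\<^sup>2)) (eu 0 0)" using cip0[OF v v] by (simp only: cip_self)
    have kk: "k * of_real ((norm v)\<^sup>2) = 2" using v0 by (simp add: k_def)
    have ve: "star v * ?e = cs (of_real (\<rho> - 1)) (eu 0 0)"
      using cip0[OF v e] xe ce[OF e] by (simp add: v_def cip_diff_left)
    note vr' = cvec_rules[OF v]
    have vvv: "v * (star v * (v * star v)) = cs (of_real ((norm v)\<^sup>2)) (v * star v)"
    proof -
      have "v * (star v * (v * star v)) = v * (star v * v) * star v" by (simp add: mult.assoc)
      then show ?thesis unfolding vv using vr' by simp
    qed
    have cs2: "cs (2 * k) M = cs k M + cs k M" for M using cs_add_left[of k k M] by simp
    have "U * U = un ?N - cs (k + k) (v * star v) + cs (k * k) (v * (star v * (v * star v)))"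
      unfolding U_def using vr' by (simp add: left_diff_distrib right_diff_distrib mult.assoc cs2 cs_diff)
    also have "\<dots> = un ?N + cs (k * (k * of_real ((norm v)\<^sup>2)) - (k + k)) (v * star v)"
      unfolding vvv by (simp add: cs_diff_left mult.assoc)
    also have "\<dots> = un ?N" unfolding kk by (simp add: mult.commute mult_2)
    finally have UU: "U * U = un ?N" .
    have "U * ?e = ?e - cs k (v * (star v * ?e))" by (simp add: U_def left_diff_distrib mult.assoc)
    also have "\<dots> = ?e - cs (k * of_real (\<rho> - 1)) v" unfolding ve using vr' by simp
    also have "k * of_real (\<rho> - 1) = - 1"
    proof -
      have "k * of_real ((norm v)\<^sup>2) = - 2 * (k * of_real (\<rho> - 1))" unfolding nv by (simp add: algebra_simps)
      then show ?thesis unfolding kk by (simp add: complex_eq_iff)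
    qed
    also have "?e - cs (- 1) v = x" by (simp add: v_def cs_minus)
    finally have Ue: "U * ?e = x" .
    show ?thesis
    proof (rule that[of U])
      show "star U = U" by (simp add: U_def k_def)
      show "cnjm U = U" using vr by (simp add: U_def k_def cnjm_star)
      show "cor ?N ?N U" using vr' by (simp add: cor_def U_def left_diff_distrib right_diff_distrib mult.assoc)
    qed (use UU Ue in auto)
  qed
  show ?thesis
  proof (rule that[of "U * un n"])
    note cU = cor_rules[OF U(3)]
    have UUr: "U * (U * Y) = un ?N * Y" for Y by (simp flip: mult.assoc U(4))
    show "isom (Suc n) n (U * un n)" using U(1,4) cU by (simp add: isom_def mult.assoc UUr)
    show "cnjm (U * un n) = U * un n" using U(2) by simp
    have sx: "star x = eu 0 n * U" using arg_cong[OF U(5), of star] U(1) by simp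
    show "star x * (U * un n) = 0" unfolding sx by (simp add: mult.assoc UUr)
    have unr: "un n * (un n * Y) = un n * Y" for Y by (simp flip: mult.assoc)
    have "x * star x + U * un n * star (U * un n) = U * (eu n 0 * eu 0 n + un n) * U"
      unfolding sx using U(1) by (simp add: U(5)[symmetric] mult.assoc distrib_left distrib_right unr)
    also have "\<dots> = un ?N" unfolding un[symmetric] using cU U(4) by simp
    finally show "x * star x + U * un n * star (U * un n) = un (Suc n)" .
  qed
qed

text \<open>The discs have radius 1/2 around 0 and radius 0 around 1, at distance 1/2. The factor 2
  is harmless because \<open>real_uniform\<close> strips at most three vectors.\<close>

lemma real_strip:
  assumes A: "cor (Suc n) (Suc n) A" "tr A = 0" "cnjm A = A" "opn A \<le> 1"
    and step: "\<And>A'. cor n n A' \<Longrightarrow> tr A' = 0 \<Longrightarrow> cnjm A' = A' \<Longrightarrow> opn A' \<le> 1 \<Longrightarrow> RSol n A' L" and L: "0 \<le> L"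
  shows "RSol (Suc n) A (2 * L + 8)"
proof -
  obtain x where x: "cvec (Suc n) x" "cnjm x = x" "norm x = 1" "cip x (A * x) = 0" using real_zero_value[OF A(1-3)] by blast
  obtain W where W: "isom (Suc n) n W" "cnjm W = W" "star x * W = 0" "x * star x + W * star W = un (Suc n)"
    using householder[OF x(1-3)] by blast
  have xx: "star x * x = un 1" using star_vec_mult[OF x(1,1)] x(3) by (simp add: cip_self un_sum)
  then have X: "isom (Suc n) 1 x" using cvec_rules[OF x(1)] by (simp add: isom_def)
  have xAx: "star x * A * x = 0" using star_vec_mult[OF x(1) cvec_mult[OF A(1) x(1)]] x(4) by (simp add: mult.assoc)
  have Wx: "star W * x = 0" using arg_cong[OF W(3), of star] by simp
  let ?A = "star W * A * W"
  have "RSol n ?A L"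
  proof (rule step)
    show "cor n n ?A" by (rule cor_compress[OF W(1,1) A(1)])
    show "tr ?A = 0" using tr_split[OF A(1) W(4)] A(2) xAx by simp
    show "cnjm ?A = ?A" using W(2) A(3) by (simp add: cnjm_star)
    show "opn ?A \<le> 1" using opn_sandwich[OF W(1,1), of A] A(4) by simp
  qed
  then obtain B C where BC: "cor n n B" "cor n n C" "cnjm B = B" "?A = B * C - C * B" "opn B \<le> 1" "opn C \<le> L"
    unfolding RSol_def by blast
  have "RSol (Suc n) A (2 * L + 4 / (1/2))"
  proof (rule assemble_real[OF W(1) X Wx _ A(1,4,3)])
    show "W * star W + x * star x = un (Suc n)" using W(4) by (simp add: add.commute)
    show "cor n n (cs (1/2) B)" "cor n n (cs 2 C)" using BC by (auto simp: cor_iff)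
    show "opn (cs (1/2) B - cs 0 (un n)) \<le> 1/2" using BC(5) by (simp add: norm_divide)
    show "opn (cs 2 C) \<le> 2 * L" using BC(6) by simp
    show "star W * A * W = cs (1/2) B * cs 2 C - cs 2 C * cs (1/2) B" using BC(4) by simp
    show "cor 1 1 (un 1)" "cor 1 1 0" by (auto simp: cor_iff)
    show "opn (un 1 - cs 1 (un 1)) \<le> 0" "opn 0 \<le> 2 * L" using L by auto
    show "star x * A * x = un 1 * 0 - 0 * un 1" using xAx by simp
    show "cnjm (W * cs (1/2) B * star W + x * un 1 * star x) = W * cs (1/2) B * star W + x * un 1 * star x"
      using W(2) x(2) BC(3) by (simp add: cnjm_star)
  qed (use L in auto)
  then show ?thesis by simp
qed

text \<open>For \<open>P = (E0 + i E1 R) / sqrt 2\<close> with \<open>R\<close> real orthogonal,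
  \<open>star P * cnjm P\<close> is half of \<open>un ?m - star R * R\<close>, that is 0, so
  \<open>P\<close> and its conjugate split the space. For real \<open>A\<close> the real part of the
  trace on \<open>P\<close> is half of \<open>tr A\<close>, hence 0, and its imaginary part is a
  single real condition on \<open>R\<close>, which a rotation can meet.\<close>

lemma real_split:
  assumes A: "cor (2 * (2 * h)) (2 * (2 * h)) A" "cnjm A = A" "tr A = 0"
  obtains P where "isom (2 * (2 * h)) (2 * h) P" "star P * cnjm P = 0"
    "P * star P + cnjm P * star (cnjm P) = un (2 * (2 * h))" "tr (star P * A * P) = 0"
proof -
  let ?n = "2 * (2 * h)" and ?m = "2 * h"
  let ?E0 = "blk ?m 0" and ?E1 = "blk ?m (Suc 0)" and ?F0 = "blk h 0" and ?F1 = "blk h (Suc 0)"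
  have sum2: "(\<Sum>i<2. F i) = F 0 + F (Suc 0)" for F :: "nat \<Rightarrow> fmat" by (simp add: numeral_2_eq_2)
  have E0: "isom ?n ?m ?E0" and E1: "isom ?n ?m ?E1" using blk_isom[of 0 2 ?m] blk_isom[of "Suc 0" 2 ?m] by simp_all
  have F0: "isom ?m h ?F0" and F1: "isom ?m h ?F1" using blk_isom[of 0 2 h] blk_isom[of "Suc 0" 2 h] by simp_all
  have pE: "star ?E0 * ?E1 = 0" "star ?E1 * ?E0 = 0" and pF: "star ?F0 * ?F1 = 0" "star ?F1 * ?F0 = 0"
    by (simp_all add: blk_perp)
  have cE: "?E0 * star ?E0 + ?E1 * star ?E1 = un ?n" using blk_complete[of ?m 2] by (simp only: sum2)
  have cF: "?F0 * star ?F0 + ?F1 * star ?F1 = un ?m" using blk_complete[of h 2] by (simp only: sum2)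
  have real: "cnjm (blk a b) = blk a b" for a b by (simp add: blk_def)
  have pEr: "star ?E0 * (?E1 * Y) = 0" "star ?E1 * (?E0 * Y) = 0" and pFr: "star ?F0 * (?F1 * Y) = 0" "star ?F1 * (?F0 * Y) = 0" for Y
    using pE pF by (simp_all flip: mult.assoc)
  \<comment> \<open>A real square root of \<open>- un ?m\<close>, so that the matrices
    \<open>c + s J\<close> with \<open>c\<^sup>2 + s\<^sup>2 = 1\<close> are real orthogonal. It
    exchanges two halves of \<open>?m\<close> up to sign, which is why the size is a multiple of
    4.\<close>
  define J where "J = ?F1 * star ?F0 - ?F0 * star ?F1"
  have J: "star J = - J" "cnjm J = J" by (simp_all add: J_def real cnjm_star)
  have cJ: "cor ?m ?m J" unfolding J_def using isom_rules[OF F0] isom_rules[OF F1]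
    by (simp add: cor_def left_diff_distrib right_diff_distrib mult.assoc)
  have JJ: "J * J = - un ?m"
    unfolding J_def cF[symmetric] using pFr isom_rules[OF F0] isom_rules[OF F1]
    by (simp add: left_diff_distrib right_diff_distrib mult.assoc)
  let ?X = "star ?E0 * A * ?E1" and ?Y = "star ?E1 * A * ?E0"
  define \<alpha> where "\<alpha> = Re (tr ?X - tr ?Y)"
  define \<beta> where "\<beta> = Re (tr (?X * J) + tr (J * ?Y))"
  have tr_real: "tr M = of_real (Re (tr M))" if "cnjm M = M" for M
    using tr_cnjm[of M] that by (simp add: complex_eq_iff)
  have cX: "cnjm ?X = ?X" "cnjm ?Y = ?Y" using A(2) by (simp_all add: cnjm_star real)
  have \<alpha>: "tr ?X - tr ?Y = of_real \<alpha>" using tr_real[OF cX(1)] tr_real[OF cX(2)] by (simp add: \<alpha>_def)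
  have \<beta>: "tr (?X * J) + tr (J * ?Y) = of_real \<beta>" using tr_real[of "?X * J"] tr_real[of "J * ?Y"] cX J by (simp add: \<beta>_def)
  obtain c s :: real where cs1: "c\<^sup>2 + s\<^sup>2 = 1" and cs0: "c * \<alpha> + s * \<beta> = 0"
  proof (cases "\<alpha> = 0 \<and> \<beta> = 0")
    case True
    then show ?thesis using that[of 1 0] by simp
  next
    case False
    define r where "r = sqrt (\<alpha>\<^sup>2 + \<beta>\<^sup>2)"
    have r: "r\<^sup>2 = \<alpha>\<^sup>2 + \<beta>\<^sup>2" "r\<^sup>2 \<noteq> 0" using False by (auto simp: r_def add_nonneg_eq_0_iff)
    show ?thesis
    proof (rule that[of "\<beta> / r" "- \<alpha> / r"])
      show "(\<beta> / r)\<^sup>2 + (- \<alpha> / r)\<^sup>2 = 1"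
        using r by (simp add: power_divide add.commute flip: add_divide_distrib)
    qed simp
  qed
  define R where "R = cs (of_real c) (un ?m) + cs (of_real s) J"
  have sR: "star R = cs (of_real c) (un ?m) - cs (of_real s) J" by (simp add: R_def J cs_minus)
  have rR: "cnjm R = R" by (simp add: R_def J)
  note rJ = cor_rules[OF cJ]
  have cR: "cor ?m ?m R" using rJ by (simp add: R_def cor_def distrib_left distrib_right)
  have "cs (of_real c * of_real c) (un ?m) + cs (of_real s * of_real s) (un ?m) = un ?m"
  proof -
    have "complex_of_real (c\<^sup>2 + s\<^sup>2) = 1" using cs1 by simp
    then have "complex_of_real c * of_real c + of_real s * of_real s = 1" by (simp add: power2_eq_square)
    then show ?thesis by (simp flip: cs_add_left)
  qed
  then have RR: "star R * R = un ?m" "R * star R = un ?m"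
    unfolding sR unfolding R_def using rJ JJ
    by (simp_all add: left_diff_distrib right_diff_distrib distrib_left distrib_right mult.commute cs_minus cs_add cs_diff)
  have RRr: "star R * (R * Y) = un ?m * Y" "R * (star R * Y) = un ?m * Y" for Y using RR by (simp_all flip: mult.assoc)
  define k where "k = complex_of_real (1 / sqrt 2)"
  have kk: "k * k = 1/2" unfolding k_def of_real_mult[symmetric] by simp
  have kr: "cnj k = k" by (simp add: k_def)
  define P where "P = cs k (?E0 + cs \<i> (?E1 * R))"
  have cP: "cnjm P = cs k (?E0 - cs \<i> (?E1 * R))" by (simp add: P_def real rR kr cs_minus)
  have sP: "star P = cs k (star ?E0 - cs \<i> (star R * star ?E1))" by (simp add: P_def kr cs_minus)
  have scP: "star (cnjm P) = cs k (star ?E0 + cs \<i> (star R * star ?E1))" unfolding cP by (simp add: kr cs_minus)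
  note rules = isom_rules[OF E0] isom_rules[OF E1] cor_rules[OF cR] RR RRr pE pEr
  have ki: "k * (\<i> * (k * \<i>)) = - (1/2)" "k * (\<i> * k) = \<i> / 2" "k * (k * \<i>) = \<i> / 2" "k * k * \<i> = \<i> / 2"
  proof -
    have e: "k * (\<i> * (k * \<i>)) = k * k * (\<i> * \<i>)" "k * (\<i> * k) = k * k * \<i>" "k * (k * \<i>) = k * k * \<i>" by (simp_all only: mult_ac)
    show "k * (\<i> * (k * \<i>)) = - (1/2)" "k * (\<i> * k) = \<i> / 2" "k * (k * \<i>) = \<i> / 2" "k * k * \<i> = \<i> / 2"
      unfolding e kk by simp_all
  qed
  have neg_half: "cs (- 1 / 2) M = - cs (1/2) M" "cs (- (1 / 2)) M = - cs (1/2) M" for M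
    using cs_minus(1)[of "1/2" M] by simp_all
  have half: "cs (1/2) M + cs (1/2) M = M" for M by (simp flip: cs_add_left)
  show ?thesis
  proof (rule that[of P])
    show "isom ?n ?m P" unfolding isom_def sP unfolding P_def using rules half
      by (simp add: left_diff_distrib right_diff_distrib distrib_left distrib_right mult.assoc kk cs_add cs_diff cs_minus ki kr neg_half)
    show "star P * cnjm P = 0" unfolding sP cP using rules
      by (simp add: left_diff_distrib right_diff_distrib distrib_left distrib_right mult.assoc kk cs_add cs_diff cs_minus ki kr neg_half)
    have "P * star P + cnjm P * star (cnjm P) = cs (1/2) (?E0 * star ?E0 + ?E1 * star ?E1) + cs (1/2) (?E0 * star ?E0 + ?E1 * star ?E1)"
      unfolding sP scP cP unfolding P_def using rules
      by (simp add: left_diff_distrib right_diff_distrib distrib_left distrib_right mult.assoc kk cs_add cs_diff cs_minus ki kr neg_half)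
    then show "P * star P + cnjm P * star (cnjm P) = un ?n" unfolding half cE .
    have "tr (star R * (star ?E1 * A * ?E1) * R) = tr (star ?E1 * A * ?E1)"
      using tr_mult_commute[of "star R * (star ?E1 * A * ?E1)" R] rules by (simp add: mult.assoc flip: mult.assoc[of R "star R"])
    moreover have "star P * A * P = cs (1/2) (star ?E0 * A * ?E0 + cs \<i> (?X * R) - cs \<i> (star R * ?Y) + star R * (star ?E1 * A * ?E1) * R)"
      unfolding sP unfolding P_def
      by (simp add: left_diff_distrib right_diff_distrib distrib_left distrib_right mult.assoc kk cs_add cs_diff cs_minus ki kr neg_half)
    moreover have "tr (?X * R) - tr (star R * ?Y) = of_real c * (tr ?X - tr ?Y) + of_real s * (tr (?X * J) + tr (J * ?Y))"
    proof -
      have "?X * R = cs (of_real c) ?X + cs (of_real s) (?X * J)" "star R * ?Y = cs (of_real c) ?Y - cs (of_real s) (J * ?Y)"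
        unfolding sR unfolding R_def using rules by (simp_all add: distrib_left left_diff_distrib mult.assoc)
      then show ?thesis by (simp only: tr_add tr_diff tr_cs) (simp add: algebra_simps)
    qed
    then have "tr (?X * R) = tr (star R * ?Y)"
      unfolding \<alpha> \<beta> using cs0 by (simp flip: of_real_mult of_real_add)
    ultimately show "tr (star P * A * P) = 0" using tr_split[OF A(1) cE] A(3)
      by (simp add: tr_add tr_diff)
  qed
qed

text \<open>On \<open>P\<close> the problem is solved with \<open>B\<close> in the disc of radius
  2/5 around \<open>3/5 * \<i>\<close>, on \<open>cnjm P\<close> by the conjugate matrices. The
  conjugate disc is disjoint from the first, and the assembled first factor is a sum of two
  conjugate terms, hence real.\<close>

theorem real_uniform:
  "\<exists>K\<ge>0. \<forall>n A. cor n n A \<longrightarrow> tr A = 0 \<longrightarrow> cnjm A = A \<longrightarrow> opn A \<le> 1 \<longrightarrow> RSol n A K"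
proof -
  obtain K where K: "0 \<le> K" "\<And>n. good K n" using good_uniform by blast
  have base: "RSol (2 * (2 * h)) A (K / (2/5) + 10)"
    if A: "cor (2 * (2 * h)) (2 * (2 * h)) A" "tr A = 0" "cnjm A = A" "opn A \<le> 1" for h A
  proof -
    obtain P where P: "isom (2 * (2 * h)) (2 * h) P" "star P * cnjm P = 0"
      "P * star P + cnjm P * star (cnjm P) = un (2 * (2 * h))" "tr (star P * A * P) = 0"
      using real_split[OF A(1,3,2)] by blast
    let ?A = "star P * A * P"
    have "Sol (2 * h) ?A (K * 1)"
    proof (rule goodD[OF K(2,1) _ P(4)])
      show "cor (2 * h) (2 * h) ?A" by (rule cor_compress[OF P(1,1) A(1)])
      show "opn ?A \<le> 1" using opn_sandwich[OF P(1,1), of A] A(4) by simp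
    qed
    then have "Sol (2 * h) ?A K" by simp
    then obtain B C where BC: "cor (2 * h) (2 * h) B" "cor (2 * h) (2 * h) C" "?A = B * C - C * B"
      "opn (B - cs (3/5 * \<i>) (un (2 * h))) \<le> 2/5" "opn C \<le> K / (2/5)"
      using Sol_scale_disc[of "2 * h" ?A K "2/5" "3/5 * \<i>"] by auto
    have cPi: "isom (2 * (2 * h)) (2 * h) (cnjm P)"
      using arg_cong[OF P(1)[unfolded isom_def, THEN conjunct1], of cnjm] arg_cong[OF P(1)[unfolded isom_def, THEN conjunct2], of cnjm]
      by (simp add: isom_def cnjm_star)
    have "RSol (2 * (2 * h)) A (K / (2/5) + 4 / (2/5))"
    proof (rule assemble_real[OF P(1) cPi P(2,3) A(1,4,3) BC(1,4) _ _ BC(2,5) _ _ BC(3)])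
      show "cor (2 * h) (2 * h) (cnjm B)" "cor (2 * h) (2 * h) (cnjm C)" using BC cor_cnjm by auto
      have "cnjm (B - cs (3/5 * \<i>) (un (2 * h))) = cnjm B - cs (- (3/5) * \<i>) (un (2 * h))" by simp
      then show "opn (cnjm B - cs (- (3/5) * \<i>) (un (2 * h))) \<le> 2/5" using BC(4) opn_cnjm by metis
      show "opn (cnjm C) \<le> K / (2/5)" using BC(5) by simp
      show "star (cnjm P) * A * cnjm P = cnjm B * cnjm C - cnjm C * cnjm B"
        using arg_cong[OF BC(3), of cnjm] A(3) by (simp add: cnjm_star)
      show "cmod (3/5 * \<i>) + 2/5 \<le> 1" "cmod (- (3/5) * \<i>) + 2/5 \<le> 1" by (simp_all add: norm_mult norm_divide)
      have "3/5 * \<i> - - (3/5) * \<i> = 6/5 * \<i>" by simp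
      then show "2/5 + 2/5 + 2/5 \<le> cmod (3/5 * \<i> - - (3/5) * \<i>)" by (simp only: norm_mult norm_divide norm_ii norm_numeral)
      show "cnjm (P * B * star P + cnjm P * cnjm B * star (cnjm P)) = P * B * star P + cnjm P * cnjm B * star (cnjm P)"
        by (simp add: cnjm_star add.commute)
    qed (use K(1) in auto)
    then show ?thesis by simp
  qed
  define L where "L = K / (2/5) + 10"
  have L: "0 \<le> L" using K(1) by (simp add: L_def)
  have up: "RSol (4 * h + r) A (8 * L + 56)" if r: "r < 4" and A: "cor (4 * h + r) (4 * h + r) A" "tr A = 0" "cnjm A = A" "opn A \<le> 1" for h r A
  proof -
    \<comment> \<open>Under the recursion from \<open>x\<close> to \<open>2 * x + 8\<close> of
      \<open>real_strip\<close>, the quantity \<open>x + 8\<close> doubles.\<close>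
    have "RSol (4 * h + r) A (2 ^ r * (L + 8) - 8)"
      using A
    proof (induction r arbitrary: A)
      case 0
      then show ?case using base[of h A] by (simp add: L_def add.commute)
    next
      case (Suc r)
      have "RSol (Suc (4 * h + r)) A (2 * (2 ^ r * (L + 8) - 8) + 8)"
      proof (rule real_strip)
        have "1 * (0 + 8) \<le> 2 ^ r * (L + 8)" using L by (intro mult_mono) auto
        then show "0 \<le> 2 ^ r * (L + 8) - 8" by simp
      qed (use Suc in auto)
      then show ?case by (simp add: algebra_simps)
    qed
    moreover have "2 ^ r \<le> (2::real) ^ 3" using r by (intro power_increasing) auto
    then have "2 ^ r * (L + 8) \<le> 8 * (L + 8)" using L by (intro mult_right_mono) auto
    ultimately show ?thesis by (elim RSol_mono) simp
  qed
  have "RSol n A (8 * L + 56)" if "cor n n A" "tr A = 0" "cnjm A = A" "opn A \<le> 1" for n A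
    using up[of "n mod 4" "n div 4" A] that by simp
  then show ?thesis using L by (intro exI[of _ "8 * L + 56"]) auto
qed

subsection \<open>Transfer to matrices of a given size\<close>

lemma RSol_scale:
  assumes K: "0 \<le> K" "\<And>A. cor n n A \<Longrightarrow> tr A = 0 \<Longrightarrow> cnjm A = A \<Longrightarrow> opn A \<le> 1 \<Longrightarrow> RSol n A K"
    and A: "cor n n A" "tr A = 0" "cnjm A = A"
  shows "RSol n A (K * opn A)"
proof (cases "opn A = 0")
  case True
  then have "A = 0" by (rule opn_eq_0)
  then show ?thesis unfolding RSol_def by (intro exI[of _ 0]) (auto simp: cor_iff)
next
  case False
  then have a: "0 < opn A" using opn_nonneg[of A] by simp
  let ?A = "cs (of_real (1 / opn A)) A"
  have "RSol n ?A K"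
    using A a by (intro K) (auto simp: cor_iff norm_divide)
  then obtain B C where BC: "cor n n B" "cor n n C" "cnjm B = B" "cnjm C = C" "?A = B * C - C * B" "opn B \<le> 1" "opn C \<le> K"
    unfolding RSol_def by blast
  have "cs (of_real (opn A)) ?A = B * cs (of_real (opn A)) C - cs (of_real (opn A)) C * B"
    unfolding BC(5) by (simp add: cs_diff)
  then have "A = B * cs (of_real (opn A)) C - cs (of_real (opn A)) C * B" using a by simp
  moreover have "opn (cs (of_real (opn A)) C) \<le> K * opn A"
    using BC(6,7) a by (simp add: mult.commute)
  moreover have "cor n n (cs (of_real (opn A)) C)" using BC(2) by (auto simp: cor_iff)
  ultimately show ?thesis unfolding RSol_def using BC by (intro exI[of _ B] exI[of _ "cs (of_real (opn A)) C"]) simp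
qed

text \<open>The mixed terms are \<i> times real traces and drop out of the real part.\<close>

lemma norm_real_imag:
  assumes "cnjm X = X" "cnjm Y = Y"
  shows "(norm (X + cs \<i> Y))\<^sup>2 = (norm X)\<^sup>2 + (norm Y)\<^sup>2"
proof -
  have im: "Im (tr (star M * N)) = 0" if "cnjm M = M" "cnjm N = N" for M N
    using tr_cnjm[of "star M * N"] that by (simp add: cnjm_star complex_eq_iff)
  show ?thesis unfolding norm_sq
    using im[OF assms] im[OF assms(2,1)] by (simp add: ring_distribs tr_add cs_minus tr_uminus tr_diff)
qed

text \<open>A common treatment of the real and the complex scalars, as subfields of the complex numbers.\<close>

locale scalar_embedding =
  fixes f :: "'a::{real_normed_field, conjugatable_field, heine_borel} \<Rightarrow> complex"
  assumes f_add: "f (x + y) = f x + f y" and f_mult: "f (x * y) = f x * f y"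
    and f_of_real: "f (of_real r) = of_real r" and f_conjugate: "f (conjugate x) = cnj (f x)"
    and f_norm: "cmod (f x) = norm x" and f_cases: "surj f \<or> (\<forall>x. cnj (f x) = f x)"
begin

lemma f_0 [simp]: "f 0 = 0" using f_of_real[of 0] by simp
lemma f_1 [simp]: "f 1 = 1" using f_of_real[of 1] by simp
lemma f_minus: "f (- x) = - f x" using f_add[of x "- x"] by (simp add: eq_neg_iff_add_eq_0 add.commute)
lemma f_diff: "f (x - y) = f x - f y" using f_add[of x "- y"] by (simp add: f_minus)
lemma f_sum: "f (sum g I) = (\<Sum>i\<in>I. f (g i))"
  by (induction I rule: infinite_finite_induct) (auto simp: f_add)
lemma f_inj: "f x = f y \<longleftrightarrow> x = y"
proof
  assume "f x = f y"
  then have "cmod (f (x - y)) = 0" by (simp add: f_diff)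
  then show "x = y" by (simp add: f_norm)
qed simp
lemma f_of_nat: "f (of_nat n) = of_nat n" using f_of_real[of "real n"] by simp
lemma f_divide: "f (x / y) = f x / f y"
proof (cases "y = 0")
  case False
  then have "f (x / y) * f y = f x" by (simp flip: f_mult)
  moreover have "f y \<noteq> 0" using False f_inj[of y 0] by simp
  ultimately show ?thesis by (simp add: field_simps)
qed simp

definition emb :: "'a mat \<Rightarrow> fmat" where
  "emb A = Fmat (\<lambda>i j. if i < dim_row A \<and> j < dim_col A then f (A $$ (i, j)) else 0)"
definition vemb :: "'a Matrix.vec \<Rightarrow> fmat" where
  "vemb v = Fmat (\<lambda>i j. if i < dim_vec v \<and> j = 0 then f (vec_index v i) else 0)"

lemma ent_emb: "ent (emb A) i j = (if i < dim_row A \<and> j < dim_col A then f (A $$ (i, j)) else 0)"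
  unfolding emb_def by (subst ent_Fmat[of "max (dim_row A) (dim_col A)"]) auto
lemma ent_vemb: "ent (vemb v) i j = (if i < dim_vec v \<and> j = 0 then f (vec_index v i) else 0)"
  unfolding vemb_def by (subst ent_Fmat[of "Suc (dim_vec v)"]) auto

lemma cor_emb: "A \<in> carrier_mat n m \<Longrightarrow> cor n m (emb A)"
  by (auto simp: cor_iff ent_emb)
lemma emb_inj: "A \<in> carrier_mat n m \<Longrightarrow> B \<in> carrier_mat n m \<Longrightarrow> emb A = emb B \<Longrightarrow> A = B"
proof -
  assume A: "A \<in> carrier_mat n m" and B: "B \<in> carrier_mat n m" and e: "emb A = emb B"
  have "f (A $$ (i, j)) = f (B $$ (i, j))" if "i < n" "j < m" for i j
    using arg_cong[OF e, of "\<lambda>M. ent M i j"] A B that by (simp add: ent_emb)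
  then show "A = B" using A B by (intro eq_matI) (auto simp: f_inj)
qed

lemma emb_add: "A \<in> carrier_mat n m \<Longrightarrow> B \<in> carrier_mat n m \<Longrightarrow> emb (A + B) = emb A + emb B"
  by (rule fmat_eqI) (auto simp: ent_emb f_add)
lemma emb_uminus: "emb (- A) = - emb A"
  by (rule fmat_eqI) (auto simp: ent_emb f_minus)
lemma emb_diff: "A \<in> carrier_mat n m \<Longrightarrow> B \<in> carrier_mat n m \<Longrightarrow> emb (A - B) = emb A - emb B"
  by (rule fmat_eqI) (auto simp: ent_emb f_diff)
lemma emb_0: "emb (0\<^sub>m n m) = 0"
  by (rule fmat_eqI) (auto simp: ent_emb)
lemma emb_1: "emb (1\<^sub>m n) = un n"
  by (rule fmat_eqI) (auto simp: ent_emb)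
lemma emb_smult: "emb (c \<cdot>\<^sub>m A) = cs (f c) (emb A)"
  by (rule fmat_eqI) (auto simp: ent_emb f_mult)
lemma emb_mult: "A \<in> carrier_mat n m \<Longrightarrow> B \<in> carrier_mat m p \<Longrightarrow> emb (A * B) = emb A * emb B"
proof (rule fmat_eqI)
  fix i j assume A: "A \<in> carrier_mat n m" and B: "B \<in> carrier_mat m p"
  have "ent (emb A * emb B) i j = (\<Sum>k<m. ent (emb A) i k * ent (emb B) k j)"
    using A by (intro ent_mult) (auto simp: ent_emb)
  then show "ent (emb (A * B)) i j = ent (emb A * emb B) i j"
    using A B by (auto simp: ent_emb scalar_prod_def f_sum f_mult atLeast0LessThan)
qed
lemma emb_adjoint: "emb (mat_adjoint A) = star (emb A)"
  by (rule fmat_eqI) (auto simp: ent_emb mat_adjoint_def mat_of_rows_def f_conjugate)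
lemma vemb_mult: "A \<in> carrier_mat n m \<Longrightarrow> v \<in> carrier_vec m \<Longrightarrow> vemb (A *\<^sub>v v) = emb A * vemb v"
proof (rule fmat_eqI)
  fix i j assume A: "A \<in> carrier_mat n m" and v: "v \<in> carrier_vec m"
  have "ent (emb A * vemb v) i j = (\<Sum>k<m. ent (emb A) i k * ent (vemb v) k j)"
    using A by (intro ent_mult) (auto simp: ent_emb)
  then show "ent (vemb (A *\<^sub>v v)) i j = ent (emb A * vemb v) i j"
    using A v by (auto simp: ent_emb ent_vemb scalar_prod_def f_sum f_mult atLeast0LessThan)
qed
lemma vemb_smult: "vemb (c \<cdot>\<^sub>v v) = cs (f c) (vemb v)"
  by (rule fmat_eqI) (auto simp: ent_vemb f_mult)

lemma tr_emb: "A \<in> carrier_mat n n \<Longrightarrow> tr (emb A) = f (mat_trace A)"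
  by (subst tr_cor[OF cor_emb]) (auto simp: mat_trace_def f_sum ent_emb)

lemma norm_vemb: "norm (vemb v) = vec_l2_norm v"
proof -
  have "(norm (vemb v))\<^sup>2 = (\<Sum>i<Suc (dim_vec v). \<Sum>j<Suc (dim_vec v). (cmod (ent (vemb v) j i))\<^sup>2)"
    by (rule norm_sq_sum) (auto simp: ent_vemb)
  also have "\<dots> = (\<Sum>i<Suc (dim_vec v). if i = 0 then \<Sum>j<dim_vec v. (norm (vec_index v j))\<^sup>2 else 0)"
    by (intro sum.cong) (auto simp: ent_vemb f_norm)
  also have "\<dots> = (\<Sum>j<dim_vec v. (norm (vec_index v j))\<^sup>2)" by (subst sum.delta) auto
  finally show ?thesis unfolding vec_l2_norm_def L2_set_def by (metis norm_ge_zero real_sqrt_unique)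
qed

lemma op_norm_bdd: "bdd_above ((\<lambda>v. vec_l2_norm (A *\<^sub>v v)) ` {v \<in> carrier_vec (dim_col A). vec_l2_norm v \<le> 1})"
  and op_norm_le: "mat_op_norm A \<le> opn (emb A)"
proof -
  have le: "vec_l2_norm (A *\<^sub>v v) \<le> opn (emb A)" if "v \<in> carrier_vec (dim_col A)" "vec_l2_norm v \<le> 1" for v
  proof -
    have "vec_l2_norm (A *\<^sub>v v) = norm (emb A * vemb v)"
      using vemb_mult[of A "dim_row A" "dim_col A" v] that norm_vemb[of "A *\<^sub>v v"] by simp
    also have "\<dots> \<le> opn (emb A) * norm (vemb v)" by (rule norm_mult_opn)
    also have "\<dots> \<le> opn (emb A) * 1" using that by (intro mult_left_mono opn_nonneg) (simp add: norm_vemb)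
    finally show ?thesis by simp
  qed
  then show "bdd_above ((\<lambda>v. vec_l2_norm (A *\<^sub>v v)) ` {v \<in> carrier_vec (dim_col A). vec_l2_norm v \<le> 1})"
    by (intro bdd_aboveI2[of _ _ "opn (emb A)"]) auto
  have "vec_l2_norm (0\<^sub>v (dim_col A) :: 'a Matrix.vec) \<le> 1" by (simp add: vec_l2_norm_def L2_set_def)
  then have "0\<^sub>v (dim_col A) \<in> {v \<in> carrier_vec (dim_col A). vec_l2_norm (v :: 'a Matrix.vec) \<le> 1}" by simp
  then show "mat_op_norm A \<le> opn (emb A)"
    unfolding mat_op_norm_def using le by (intro cSUP_least) blast+
qed

lemma op_norm_nonneg: "0 \<le> mat_op_norm (A :: 'a mat)"
proof -
  have "vec_l2_norm (0\<^sub>v (dim_col A) :: 'a Matrix.vec) \<le> 1" by (simp add: vec_l2_norm_def L2_set_def)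
  then have "vec_l2_norm (A *\<^sub>v 0\<^sub>v (dim_col A)) \<le> mat_op_norm A"
    unfolding mat_op_norm_def by (intro cSUP_upper op_norm_bdd) auto
  then show ?thesis by (rule order_trans[rotated]) (simp add: vec_l2_norm_def L2_set_nonneg)
qed

lemma op_norm_vec: "v \<in> carrier_vec (dim_col A) \<Longrightarrow> norm (emb A * vemb v) \<le> mat_op_norm A * norm (vemb v)"
proof (cases "norm (vemb v) = 0")
  case False
  assume v: "v \<in> carrier_vec (dim_col A)"
  define c where "c = norm (vemb v)"
  have c: "0 < c" using False by (simp add: c_def)
  let ?w = "of_real (1 / c) \<cdot>\<^sub>v v"
  have w: "?w \<in> carrier_vec (dim_col A)" using v by simp
  have ew: "vemb ?w = cs (of_real (1 / c)) (vemb v)" unfolding vemb_smult f_of_real ..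
  have "vec_l2_norm ?w = 1" unfolding norm_vemb[symmetric] ew using c by (simp add: norm_divide c_def)
  then have "vec_l2_norm (A *\<^sub>v ?w) \<le> mat_op_norm A"
    unfolding mat_op_norm_def using w by (intro cSUP_upper op_norm_bdd) auto
  moreover have "vec_l2_norm (A *\<^sub>v ?w) = norm (emb A * vemb ?w)"
    using vemb_mult[of A "dim_row A" "dim_col A" ?w] w norm_vemb[of "A *\<^sub>v ?w"] by simp
  ultimately have "1 / c * norm (emb A * vemb v) \<le> mat_op_norm A" unfolding ew using c by (simp add: norm_divide)
  then show ?thesis using c unfolding c_def by (simp add: field_simps)
qed simp

text \<open>The supremum over vectors with scalars in \<open>'a\<close> has to control all complex
  vectors. If \<open>f\<close> is onto, these are the same; in the real case a complex vector is a
  real one plus \<i> times another, and the squared norms of the two parts add up before and after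
  applying \<open>A\<close>.\<close>

lemma op_norm_emb: "mat_op_norm A = opn (emb A)"
proof (rule antisym[OF op_norm_le])
  let ?m = "dim_col A"
  show "opn (emb A) \<le> mat_op_norm A"
  proof (rule opn_vec_leI[OF op_norm_nonneg])
    show "emb A * un ?m = emb A" using cor_emb[of A "dim_row A" ?m] by (simp add: cor_def)
    fix x assume x: "cvec ?m x"
    from f_cases show "norm (emb A * x) \<le> mat_op_norm A * norm x"
    proof
      assume s: "surj f"
      define v where "v = Matrix.vec ?m (\<lambda>i. inv_into UNIV f (ent x i 0))"
      have "vemb v = x"
        by (rule fmat_eqI) (use x in \<open>auto simp: ent_vemb v_def cvec_iff surj_f_inv_f[OF s]\<close>)
      then show ?thesis using op_norm_vec[of v A] by (simp add: v_def)
    next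
      assume r: "\<forall>x. cnj (f x) = f x"
      define v where "v = Matrix.vec ?m (\<lambda>i. of_real (Re (ent x i 0)) :: 'a)"
      define w where "w = Matrix.vec ?m (\<lambda>i. of_real (Im (ent x i 0)) :: 'a)"
      have v: "v \<in> carrier_vec ?m" and w: "w \<in> carrier_vec ?m" by (simp_all add: v_def w_def)
      have xs: "x = vemb v + cs \<i> (vemb w)"
        by (rule fmat_eqI) (use x in \<open>auto simp: ent_vemb v_def w_def cvec_iff f_of_real complex_eq_iff\<close>)
      have rv: "cnjm (vemb u) = vemb u" for u by (rule fmat_eqI) (auto simp: ent_vemb r)
      have rA: "cnjm (emb A) = emb A" by (rule fmat_eqI) (auto simp: ent_emb r)
      have "(norm (emb A * x))\<^sup>2 = (norm (emb A * vemb v))\<^sup>2 + (norm (emb A * vemb w))\<^sup>2"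
        unfolding xs using norm_real_imag[of "emb A * vemb v" "emb A * vemb w"] rv rA by (simp add: distrib_left)
      also have "\<dots> \<le> (mat_op_norm A * norm (vemb v))\<^sup>2 + (mat_op_norm A * norm (vemb w))\<^sup>2"
        by (intro add_mono power_mono op_norm_vec v w) auto
      also have "\<dots> = (mat_op_norm A)\<^sup>2 * ((norm (vemb v))\<^sup>2 + (norm (vemb w))\<^sup>2)"
        by (simp add: power_mult_distrib distrib_left)
      also have "\<dots> = (mat_op_norm A * norm x)\<^sup>2"
        unfolding xs norm_real_imag[OF rv rv] power_mult_distrib ..
      finally show ?thesis by (rule power2_le_imp_le) (simp add: op_norm_nonneg)
    qed
  qed
qed

lemma emb_surj:
  assumes X: "cor n m X" "surj f \<or> cnjm X = X"
  obtains A where "A \<in> carrier_mat n m" "emb A = X"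
proof (cases "surj f")
  case True
  let ?A = "Matrix.mat n m (\<lambda>(i, j). inv_into UNIV f (ent X i j))"
  have "emb ?A = X" by (rule fmat_eqI) (use X(1) in \<open>auto simp: ent_emb cor_iff surj_f_inv_f[OF True]\<close>)
  then show ?thesis using that[of ?A] by simp
next
  case False
  then have "cnj (ent X i j) = ent X i j" for i j using X(2) by (metis ent_cnjm)
  then have r: "of_real (Re (ent X i j)) = ent X i j" for i j by (metis Reals_cnj_iff of_real_Re)
  let ?A = "Matrix.mat n m (\<lambda>(i, j). of_real (Re (ent X i j)) :: 'a)"
  have "emb ?A = X" by (rule fmat_eqI) (use X(1) r in \<open>auto simp: ent_emb cor_iff f_of_real\<close>)
  then show ?thesis using that[of ?A] by simp
qed

lemma matrix_commutator:
  "\<exists>K\<ge>0. \<forall>n. \<forall>A \<in> (carrier_mat n n :: 'a mat set). mat_trace A = 0 \<longrightarrow> (\<exists>B \<in> carrier_mat n n. \<exists>C \<in> carrier_mat n n.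
     A = B * C - C * B \<and> mat_op_norm B \<le> 1 \<and> mat_op_norm C \<le> K * mat_op_norm A)"
proof -
  obtain K\<^sub>1 where K1: "0 \<le> K\<^sub>1" "\<And>n. good K\<^sub>1 n" using good_uniform by blast
  obtain K\<^sub>2 where K2: "0 \<le> K\<^sub>2" "\<And>n A. cor n n A \<Longrightarrow> tr A = 0 \<Longrightarrow> cnjm A = A \<Longrightarrow> opn A \<le> 1 \<Longrightarrow> RSol n A K\<^sub>2"
    using real_uniform by blast
  have "\<exists>B \<in> carrier_mat n n. \<exists>C \<in> carrier_mat n n. A = B * C - C * B \<and> mat_op_norm B \<le> 1 \<and> mat_op_norm C \<le> max K\<^sub>1 K\<^sub>2 * mat_op_norm A"
    if A: "A \<in> carrier_mat n n" "mat_trace A = 0" for n and A :: "'a mat"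
  proof -
    have A': "cor n n (emb A)" "tr (emb A) = 0" using cor_emb[OF A(1)] tr_emb[OF A(1)] A(2) by simp_all
    have "\<exists>B C. cor n n B \<and> cor n n C \<and> (surj f \<or> cnjm B = B) \<and> (surj f \<or> cnjm C = C) \<and> emb A = B * C - C * B \<and> opn B \<le> 1 \<and>
        opn C \<le> max K\<^sub>1 K\<^sub>2 * opn (emb A)"
      using f_cases
    proof
      assume "surj f"
      have "Sol n (emb A) (K\<^sub>1 * opn (emb A))" by (rule goodD[OF K1(2,1) A' order_refl])
      then have "Sol n (emb A) (max K\<^sub>1 K\<^sub>2 * opn (emb A))" by (rule Sol_mono) (intro mult_right_mono opn_nonneg, simp)
      then show ?thesis using \<open>surj f\<close> unfolding Sol_def by blast
    next
      assume "\<forall>x. cnj (f x) = f x"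
      then have r: "cnjm (emb A) = emb A" by (intro fmat_eqI) (auto simp: ent_emb)
      have "RSol n (emb A) (K\<^sub>2 * opn (emb A))" by (rule RSol_scale[OF K2(1) _ A' r]) (rule K2(2))
      then have "RSol n (emb A) (max K\<^sub>1 K\<^sub>2 * opn (emb A))" by (rule RSol_mono) (intro mult_right_mono opn_nonneg, simp)
      then show ?thesis unfolding RSol_def by blast
    qed
    then obtain X Y where XY: "cor n n X" "cor n n Y" "surj f \<or> cnjm X = X" "surj f \<or> cnjm Y = Y" "emb A = X * Y - Y * X"
      "opn X \<le> 1" "opn Y \<le> max K\<^sub>1 K\<^sub>2 * opn (emb A)" by blast
    obtain B where B: "B \<in> carrier_mat n n" "emb B = X" using emb_surj[OF XY(1,3)] .
    obtain C where C: "C \<in> carrier_mat n n" "emb C = Y" using emb_surj[OF XY(2,4)] .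
    have "emb A = emb (B * C - C * B)"
      using XY(5) B C emb_mult[OF B(1) C(1)] emb_mult[OF C(1) B(1)] emb_diff[of "B * C" n n "C * B"] by simp
    then have "A = B * C - C * B" by (rule emb_inj[rotated 2]) (use A B C in auto)
    then show ?thesis using B C XY(6,7) unfolding op_norm_emb by blast
  qed
  then show ?thesis using K1(1) by (intro exI[of _ "max K\<^sub>1 K\<^sub>2"]) auto
qed

end

interpretation real_scalars: scalar_embedding "complex_of_real"
  by unfold_locales auto

interpretation complex_scalars: scalar_embedding "\<lambda>z::complex. z"
  by unfold_locales auto

subsection \<open>The tracial ultraproduct\<close>

text \<open>Compactness gives a cluster point of the image filter, and for an ultrafilter a cluster
  point is a limit: otherwise the image filter would contain the complement of some
  neighbourhood.\<close>

lemma ultrafilter_compact_limit: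
  fixes g :: "'b \<Rightarrow> 'a::topological_space"
  assumes \<omega>: "nonprincipal_ultrafilter \<omega>" and S: "compact S" "\<And>k. g k \<in> S"
  shows "\<exists>l. (g \<longlongrightarrow> l) \<omega>"
proof -
  have ne: "\<omega> \<noteq> bot" and ultra: "eventually P \<omega> \<or> eventually (\<lambda>x. \<not> P x) \<omega>" for P
    using \<omega> unfolding nonprincipal_ultrafilter_def by auto
  have "filtermap g \<omega> \<noteq> bot" "eventually (\<lambda>x. x \<in> S) (filtermap g \<omega>)"
    using ne S(2) by (auto simp: filtermap_bot_iff eventually_filtermap)
  then obtain l where l: "inf (nhds l) (filtermap g \<omega>) \<noteq> bot"
    using S(1) unfolding compact_filter by blast
  have "(g \<longlongrightarrow> l) \<omega>"
  proof (rule topological_tendstoI)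
    fix U assume U: "open U" "l \<in> U"
    show "eventually (\<lambda>k. g k \<in> U) \<omega>"
    proof (rule ccontr)
      assume "\<not> ?thesis"
      then have "eventually (\<lambda>x. x \<notin> U) (filtermap g \<omega>)" using ultra[of "\<lambda>k. g k \<in> U"] by (simp add: eventually_filtermap)
      moreover have "eventually (\<lambda>x. x \<in> U) (nhds l)" using U by (auto simp: eventually_nhds)
      ultimately have "eventually (\<lambda>_. False) (inf (nhds l) (filtermap g \<omega>))"
        unfolding eventually_inf by (intro exI[of _ "\<lambda>x. x \<in> U"] exI[of _ "\<lambda>x. x \<notin> U"]) auto
      then show False using l by (simp add: trivial_limit_def)
    qed
  qed
  then show ?thesis by blast
qed

lemma norm_add_sq: "(norm (x + y))\<^sup>2 \<le> 2 * (norm x)\<^sup>2 + 2 * (norm y)\<^sup>2" for x y :: "'a::real_inner"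
proof -
  have "(norm (x + y))\<^sup>2 + (norm (x - y))\<^sup>2 = 2 * (norm x)\<^sup>2 + 2 * (norm y)\<^sup>2"
    by (simp add: power2_norm_eq_inner inner_add_left inner_add_right inner_diff_left inner_diff_right)
  then show ?thesis using zero_le_power2[of "norm (x - y)"] by linarith
qed

lemma norm_opn_right: "norm (X * A) \<le> norm X * opn A"
proof -
  have "norm (X * A) = norm (star A * star X)" by (metis norm_star star_mult)
  also have "\<dots> \<le> opn (star A) * norm (star X)" by (rule norm_mult_opn)
  finally show ?thesis by (simp add: mult.commute)
qed

lemma norm_un_sq: "(norm (un n))\<^sup>2 = real n"
  unfolding norm_sq by simp

section \<open>Bounded sequences and the ideal of null sequences\<close>

locale ultraproduct = scalar_embedding f
  for f :: "'a::{real_normed_field, conjugatable_field, heine_borel} \<Rightarrow> complex" +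
  fixes n :: "nat \<Rightarrow> nat" and \<omega> :: "nat filter"
  assumes n_pos: "1 \<le> n k" and ultra: "nonprincipal_ultrafilter \<omega>"
begin

abbreviation R :: "(nat \<Rightarrow> 'a mat) ring" where "R \<equiv> bounded_seq_ring n"
abbreviation I :: "(nat \<Rightarrow> 'a mat) set" where "I \<equiv> trace_null_ideal n \<omega>"

text \<open>The square of the normalised Hilbert--Schmidt norm, which is the quantity tending to 0
  in \<open>trace_null_ideal\<close>; see \<open>I_iff\<close>.\<close>

definition nrm2 :: "nat \<Rightarrow> 'a mat \<Rightarrow> real" where "nrm2 k A = (norm (emb A))\<^sup>2 / n k"

lemma nrm2_nonneg [simp]: "0 \<le> nrm2 k A" by (simp add: nrm2_def)

lemma \<omega>_ne: "\<omega> \<noteq> bot" using ultra by (simp add: nonprincipal_ultrafilter_def)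

lemma carrier_R: "a \<in> carrier R \<longleftrightarrow> (\<forall>k. a k \<in> carrier_mat (n k) (n k)) \<and> (\<exists>M. \<forall>k. opn (emb (a k)) \<le> M)"
  by (auto simp: bounded_seq_ring_def bdd_above_def op_norm_emb)

lemma carrier_RI: "(\<And>k. a k \<in> carrier_mat (n k) (n k)) \<Longrightarrow> (\<And>k. opn (emb (a k)) \<le> M) \<Longrightarrow> a \<in> carrier R"
  unfolding carrier_R by blast

lemma carrier_RE:
  assumes "a \<in> carrier R"
  obtains M where "\<And>k. a k \<in> carrier_mat (n k) (n k)" "\<And>k. opn (emb (a k)) \<le> M" "0 \<le> M"
proof -
  obtain M where M: "\<And>k. a k \<in> carrier_mat (n k) (n k)" "\<And>k. opn (emb (a k)) \<le> M"
    using assms unfolding carrier_R by blast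
  moreover have "0 \<le> M" using opn_nonneg M(2)[of 0] by (rule order_trans)
  ultimately show ?thesis using that by blast
qed

lemma R_simps: "x \<otimes>\<^bsub>R\<^esub> y = (\<lambda>k. x k * y k)" "x \<oplus>\<^bsub>R\<^esub> y = (\<lambda>k. x k + y k)"
  "\<zero>\<^bsub>R\<^esub> = (\<lambda>k. 0\<^sub>m (n k) (n k))" "\<one>\<^bsub>R\<^esub> = (\<lambda>k. 1\<^sub>m (n k))"
  by (simp_all add: bounded_seq_ring_def)

lemma R_closed:
  assumes "a \<in> carrier R" "b \<in> carrier R"
  shows "(\<lambda>k. a k + b k) \<in> carrier R" "(\<lambda>k. a k * b k) \<in> carrier R" "(\<lambda>k. - a k) \<in> carrier R"
proof -
  obtain M where M: "\<And>k. a k \<in> carrier_mat (n k) (n k)" "\<And>k. opn (emb (a k)) \<le> M" "0 \<le> M"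
    using carrier_RE[OF assms(1)] by blast
  obtain N where N: "\<And>k. b k \<in> carrier_mat (n k) (n k)" "\<And>k. opn (emb (b k)) \<le> N" "0 \<le> N"
    using carrier_RE[OF assms(2)] by blast
  show "(\<lambda>k. a k + b k) \<in> carrier R"
    by (rule carrier_RI[where M = "M + N"])
      (use M N in \<open>auto simp: emb_add[OF M(1) N(1)] intro!: order_trans[OF opn_add] add_mono\<close>)
  show "(\<lambda>k. a k * b k) \<in> carrier R"
    by (rule carrier_RI[where M = "M * N"])
      (use M N mult_carrier_mat[OF M(1) N(1)] in \<open>auto simp: emb_mult[OF M(1) N(1)] opn_nonneg intro!: order_trans[OF opn_mult] mult_mono\<close>)
  show "(\<lambda>k. - a k) \<in> carrier R"
    by (rule carrier_RI[where M = M]) (use M in \<open>auto simp: emb_uminus\<close>)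
qed

lemma R_zero: "(\<lambda>k. 0\<^sub>m (n k) (n k)) \<in> carrier R" and R_one: "(\<lambda>k. 1\<^sub>m (n k)) \<in> carrier R"
  by (rule carrier_RI[where M = 0], auto simp: emb_0) (rule carrier_RI[where M = 1], auto simp: emb_1 opn_un_le)

lemma R_mat: "a \<in> carrier R \<Longrightarrow> a k \<in> carrier_mat (n k) (n k)"
  by (simp add: carrier_R)

lemma ring_R: "ring R"
proof (rule ringI)
  note [simp] = R_simps R_closed R_zero R_one
  show "abelian_group R"
  proof (rule abelian_groupI)
    fix x y z assume x: "x \<in> carrier R" and y: "y \<in> carrier R" and z: "z \<in> carrier R"
    show "x \<oplus>\<^bsub>R\<^esub> y \<oplus>\<^bsub>R\<^esub> z = x \<oplus>\<^bsub>R\<^esub> (y \<oplus>\<^bsub>R\<^esub> z)"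
      using assoc_add_mat[OF R_mat[OF x] R_mat[OF y] R_mat[OF z]] by simp
  next
    fix x y assume x: "x \<in> carrier R" and y: "y \<in> carrier R"
    show "x \<oplus>\<^bsub>R\<^esub> y = y \<oplus>\<^bsub>R\<^esub> x" using comm_add_mat[OF R_mat[OF x] R_mat[OF y]] by simp
  next
    fix x assume x: "x \<in> carrier R"
    show "\<zero>\<^bsub>R\<^esub> \<oplus>\<^bsub>R\<^esub> x = x" using left_add_zero_mat[OF R_mat[OF x]] by simp
    show "\<exists>y\<in>carrier R. y \<oplus>\<^bsub>R\<^esub> x = \<zero>\<^bsub>R\<^esub>"
      using uminus_l_inv_mat[OF R_mat[OF x]] x by (intro bexI[of _ "\<lambda>k. - x k"]) auto
  qed auto
  show "monoid R"
  proof (rule monoidI)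
    fix x y z assume x: "x \<in> carrier R" and y: "y \<in> carrier R" and z: "z \<in> carrier R"
    show "x \<otimes>\<^bsub>R\<^esub> y \<otimes>\<^bsub>R\<^esub> z = x \<otimes>\<^bsub>R\<^esub> (y \<otimes>\<^bsub>R\<^esub> z)"
      using assoc_mult_mat[OF R_mat[OF x] R_mat[OF y] R_mat[OF z]] by simp
  next
    fix x assume x: "x \<in> carrier R"
    show "\<one>\<^bsub>R\<^esub> \<otimes>\<^bsub>R\<^esub> x = x" using left_mult_one_mat[OF R_mat[OF x]] by simp
    show "x \<otimes>\<^bsub>R\<^esub> \<one>\<^bsub>R\<^esub> = x" using right_mult_one_mat[OF R_mat[OF x]] by simp
  qed auto
  fix x y z assume x: "x \<in> carrier R" and y: "y \<in> carrier R" and z: "z \<in> carrier R"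
  show "(x \<oplus>\<^bsub>R\<^esub> y) \<otimes>\<^bsub>R\<^esub> z = x \<otimes>\<^bsub>R\<^esub> z \<oplus>\<^bsub>R\<^esub> y \<otimes>\<^bsub>R\<^esub> z"
    using add_mult_distrib_mat[OF R_mat[OF x] R_mat[OF y] R_mat[OF z]] by simp
  show "z \<otimes>\<^bsub>R\<^esub> (x \<oplus>\<^bsub>R\<^esub> y) = z \<otimes>\<^bsub>R\<^esub> x \<oplus>\<^bsub>R\<^esub> z \<otimes>\<^bsub>R\<^esub> y"
    using mult_add_distrib_mat[OF R_mat[OF z] R_mat[OF x] R_mat[OF y]] by simp
qed

sublocale R: ring R by (rule ring_R)

lemma R_a_inv: "a \<in> carrier R \<Longrightarrow> \<ominus>\<^bsub>R\<^esub> a = (\<lambda>k. - a k)"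
proof (rule R.minus_equality)
  assume a: "a \<in> carrier R"
  show "(\<lambda>k. - a k) \<oplus>\<^bsub>R\<^esub> a = \<zero>\<^bsub>R\<^esub>" using uminus_l_inv_mat[OF R_mat[OF a]] by (simp add: R_simps)
qed (use R_closed in auto)

lemma R_minus: "a \<in> carrier R \<Longrightarrow> b \<in> carrier R \<Longrightarrow> a \<ominus>\<^bsub>R\<^esub> b = (\<lambda>k. a k - b k)"
  using add_uminus_minus_mat[OF R_mat R_mat] by (simp add: a_minus_def R_a_inv R_simps)

lemma I_iff: "a \<in> I \<longleftrightarrow> a \<in> carrier R \<and> ((\<lambda>k. nrm2 k (a k)) \<longlongrightarrow> 0) \<omega>"
proof (cases "a \<in> carrier R")
  case True
  have "norm (normalized_trace (mat_adjoint (a k) * a k)) = nrm2 k (a k)" for k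
  proof -
    have a: "a k \<in> carrier_mat (n k) (n k)" by (rule R_mat[OF True])
    have d: "mat_adjoint (a k) \<in> carrier_mat (n k) (n k)" using a by (auto simp: mat_adjoint_def)
    have "f (normalized_trace (mat_adjoint (a k) * a k)) = tr (star (emb (a k)) * emb (a k)) / of_nat (n k)"
      using tr_emb[of "mat_adjoint (a k) * a k" "n k"] emb_mult[OF d a] a d
      by (simp add: normalized_trace_def f_divide f_of_nat emb_adjoint)
    also have "\<dots> = of_real (nrm2 k (a k))" unfolding tr_star_self by (simp add: nrm2_def)
    finally have "norm (normalized_trace (mat_adjoint (a k) * a k)) = cmod (of_real (nrm2 k (a k)))" by (simp only: f_norm[symmetric])
    then show ?thesis unfolding norm_of_real by (simp add: nrm2_def)
  qed
  then have "((\<lambda>k. normalized_trace (mat_adjoint (a k) * a k)) \<longlongrightarrow> 0) \<omega> \<longleftrightarrow> ((\<lambda>k. nrm2 k (a k)) \<longlongrightarrow> 0) \<omega>"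
    using tendsto_norm_zero_iff[of "\<lambda>k. normalized_trace (mat_adjoint (a k) * a k)" \<omega>] by simp
  then show ?thesis using True by (simp add: trace_null_ideal_def)
qed (simp add: trace_null_ideal_def)

lemma null_compare:
  assumes "\<And>k. nrm2 k (b k) \<le> c * nrm2 k (a k)" "((\<lambda>k. nrm2 k (a k)) \<longlongrightarrow> 0) \<omega>"
  shows "((\<lambda>k. nrm2 k (b k)) \<longlongrightarrow> 0) \<omega>"
proof (rule Lim_null_comparison)
  show "((\<lambda>k. c * nrm2 k (a k)) \<longlongrightarrow> 0) \<omega>" using tendsto_mult_right_zero[OF assms(2)] .
  show "\<forall>\<^sub>F k in \<omega>. norm (nrm2 k (b k)) \<le> c * nrm2 k (a k)" using assms(1) by simp
qed

lemma nrm2_add: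
  assumes "A \<in> carrier_mat (n k) (n k)" "B \<in> carrier_mat (n k) (n k)"
  shows "nrm2 k (A + B) \<le> 2 * nrm2 k A + 2 * nrm2 k B"
  using divide_right_mono[OF norm_add_sq[of "emb A" "emb B"], of "real (n k)"]
  by (simp add: nrm2_def emb_add[OF assms] add_divide_distrib)

text \<open>For sequences bounded in operator norm, these two estimates make the null sequences an
  ideal on both sides.\<close>

lemma nrm2_mult:
  assumes "A \<in> carrier_mat (n k) (n k)" "B \<in> carrier_mat (n k) (n k)"
  shows "nrm2 k (A * B) \<le> (opn (emb A))\<^sup>2 * nrm2 k B" "nrm2 k (A * B) \<le> (opn (emb B))\<^sup>2 * nrm2 k A"
proof -
  have "(norm (emb A * emb B))\<^sup>2 \<le> (opn (emb A) * norm (emb B))\<^sup>2" by (intro power_mono norm_mult_opn) simp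
  from divide_right_mono[OF this, of "real (n k)"] show "nrm2 k (A * B) \<le> (opn (emb A))\<^sup>2 * nrm2 k B"
    by (simp add: nrm2_def emb_mult[OF assms] power_mult_distrib)
  have "(norm (emb A * emb B))\<^sup>2 \<le> (norm (emb A) * opn (emb B))\<^sup>2" by (intro power_mono norm_opn_right) simp
  from divide_right_mono[OF this, of "real (n k)"] show "nrm2 k (A * B) \<le> (opn (emb B))\<^sup>2 * nrm2 k A"
    by (simp add: nrm2_def emb_mult[OF assms] power_mult_distrib mult.commute)
qed

lemma nrm2_opn: "A \<in> carrier_mat (n k) (n k) \<Longrightarrow> nrm2 k A \<le> (opn (emb A))\<^sup>2"
proof -
  assume "A \<in> carrier_mat (n k) (n k)"
  then have "emb A * un (n k) = emb A" using cor_emb by (simp add: cor_def)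
  then have "norm (emb A) \<le> opn (emb A) * norm (un (n k))" using norm_mult_opn[of "emb A" "un (n k)"] by simp
  then have "(norm (emb A))\<^sup>2 \<le> (opn (emb A) * norm (un (n k)))\<^sup>2" by (intro power_mono) auto
  then have "(norm (emb A))\<^sup>2 \<le> (opn (emb A))\<^sup>2 * n k" by (simp add: power_mult_distrib norm_un_sq)
  then show ?thesis using n_pos[of k] by (simp add: nrm2_def divide_le_eq)
qed

text \<open>Cauchy--Schwarz against \<open>un (n k)\<close>. In particular the traces of a null
  sequence tend to 0, so the limit of traces does not depend on the representative.\<close>

lemma trace_nrm2: "A \<in> carrier_mat (n k) (n k) \<Longrightarrow> (norm (normalized_trace A))\<^sup>2 \<le> nrm2 k A"
proof -
  assume A: "A \<in> carrier_mat (n k) (n k)"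
  have "tr (emb A) = cip (un (n k)) (emb A)" using cor_emb[OF A] by (simp add: cip_def cor_def)
  then have "cmod (tr (emb A)) \<le> norm (un (n k)) * norm (emb A)" using cip_bound[of "un (n k)" "emb A"] by simp
  then have "(cmod (tr (emb A)))\<^sup>2 \<le> (norm (un (n k)) * norm (emb A))\<^sup>2" by (intro power_mono) auto
  then have "(cmod (tr (emb A)))\<^sup>2 \<le> n k * (norm (emb A))\<^sup>2" by (simp add: power_mult_distrib norm_un_sq)
  moreover have "norm (normalized_trace A) = cmod (tr (emb A)) / n k"
    using A by (simp add: normalized_trace_def tr_emb[OF A] norm_divide f_norm)
  ultimately show ?thesis using n_pos[of k]
    by (simp add: nrm2_def power_divide divide_le_eq) (simp add: power2_eq_square divide_simps mult_ac)
qed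

lemma ideal_I: "ideal I R"
proof (rule idealI[OF ring_R])
  show "subgroup I (add_monoid R)"
  proof
    show "I \<subseteq> carrier (add_monoid R)" by (auto simp: I_iff)
    fix x y assume x: "x \<in> I" and y: "y \<in> I"
    then have c: "x \<in> carrier R" "y \<in> carrier R" by (auto simp: I_iff)
    have "((\<lambda>k. 2 * nrm2 k (x k) + 2 * nrm2 k (y k)) \<longlongrightarrow> 2 * 0 + 2 * 0) \<omega>"
      using x y by (intro tendsto_intros) (auto simp: I_iff)
    then have lim: "((\<lambda>k. 2 * nrm2 k (x k) + 2 * nrm2 k (y k)) \<longlongrightarrow> 0) \<omega>" by simp
    have "nrm2 k (x k + y k) \<le> 2 * nrm2 k (x k) + 2 * nrm2 k (y k)" for k by (rule nrm2_add[OF R_mat[OF c(1)] R_mat[OF c(2)]])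
    then have "((\<lambda>k. nrm2 k (x k + y k)) \<longlongrightarrow> 0) \<omega>"
      by (intro Lim_null_comparison[OF _ lim]) simp
    then show "x \<otimes>\<^bsub>add_monoid R\<^esub> y \<in> I" using c R_closed by (simp add: R_simps I_iff)
    have "inv\<^bsub>add_monoid R\<^esub> x = (\<lambda>k. - x k)" using R_a_inv[OF c(1)] by (simp add: a_inv_def)
    then show "inv\<^bsub>add_monoid R\<^esub> x \<in> I" using x R_closed(3)[OF c] by (simp add: I_iff nrm2_def emb_uminus)
  next
    show "\<one>\<^bsub>add_monoid R\<^esub> \<in> I" using R_zero by (simp add: R_simps I_iff nrm2_def emb_0)
  qed
  fix a x assume a: "a \<in> I" and x: "x \<in> carrier R"
  then have c: "a \<in> carrier R" and lim: "((\<lambda>k. nrm2 k (a k)) \<longlongrightarrow> 0) \<omega>" by (auto simp: I_iff)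
  obtain M where M: "\<And>k. opn (emb (x k)) \<le> M" "0 \<le> M" using carrier_RE[OF x] by metis
  have le: "(opn (emb (x k)))\<^sup>2 * nrm2 k (a k) \<le> M\<^sup>2 * nrm2 k (a k)" for k
    using M by (intro mult_right_mono power_mono opn_nonneg) (auto simp: nrm2_def)
  have "((\<lambda>k. nrm2 k (x k * a k)) \<longlongrightarrow> 0) \<omega>"
    by (rule null_compare[OF order_trans[OF nrm2_mult(1)[OF R_mat[OF x] R_mat[OF c]] le] lim])
  then show "x \<otimes>\<^bsub>R\<^esub> a \<in> I" using R_closed(2)[OF x c] by (simp add: I_iff R_simps)
  have "((\<lambda>k. nrm2 k (a k * x k)) \<longlongrightarrow> 0) \<omega>"
    by (rule null_compare[OF order_trans[OF nrm2_mult(2)[OF R_mat[OF c] R_mat[OF x]] le] lim])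
  then show "a \<otimes>\<^bsub>R\<^esub> x \<in> I" using R_closed(2)[OF c x] by (simp add: I_iff R_simps)
qed

sublocale I: ideal I R by (rule ideal_I)

section \<open>Cosets, their norm and their trace\<close>

abbreviation M :: "(nat \<Rightarrow> 'a mat) set ring" where "M \<equiv> tracial_ultraproduct n \<omega>"

lemma M_eq: "M = R Quot I" by (simp add: tracial_ultraproduct_def)

lemma carrier_M: "T \<in> carrier M \<longleftrightarrow> (\<exists>a\<in>carrier R. T = I +>\<^bsub>R\<^esub> a)"
  by (auto simp: M_eq FactRing_def A_RCOSETS_def')

lemma coset_commutator:
  assumes "b \<in> carrier R" "c \<in> carrier R"
  shows "ring_commutator M (I +>\<^bsub>R\<^esub> b) (I +>\<^bsub>R\<^esub> c) = I +>\<^bsub>R\<^esub> (\<lambda>k. b k * c k - c k * b k)"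
proof -
  interpret h: ring_hom_ring R "R Quot I" "(+>\<^bsub>R\<^esub>) I" by (rule I.rcos_ring_hom_ring)
  have "ring_commutator M (I +>\<^bsub>R\<^esub> b) (I +>\<^bsub>R\<^esub> c) = I +>\<^bsub>R\<^esub> (b \<otimes>\<^bsub>R\<^esub> c \<ominus>\<^bsub>R\<^esub> c \<otimes>\<^bsub>R\<^esub> b)"
    using assms by (simp add: ring_commutator_def M_eq a_minus_def)
  also have "b \<otimes>\<^bsub>R\<^esub> c \<ominus>\<^bsub>R\<^esub> c \<otimes>\<^bsub>R\<^esub> b = (\<lambda>k. b k * c k - c k * b k)"
    using R_minus[of "b \<otimes>\<^bsub>R\<^esub> c" "c \<otimes>\<^bsub>R\<^esub> b"] R_closed(2) assms by (simp add: R_simps)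
  finally show ?thesis .
qed

lemma coset_diff: "a \<in> carrier R \<Longrightarrow> b \<in> I +>\<^bsub>R\<^esub> a \<Longrightarrow> b \<in> carrier R \<and> (\<lambda>k. b k - a k) \<in> I"
proof -
  assume a: "a \<in> carrier R" and b: "b \<in> I +>\<^bsub>R\<^esub> a"
  have "b \<in> carrier R" by (rule I.a_elemrcos_carrier[OF a b])
  then show ?thesis using I.a_rcos_module_minus[OF ring_R a, of b] b R_minus[OF _ a] by simp
qed

lemma coset_eqI: "a \<in> carrier R \<Longrightarrow> b \<in> carrier R \<Longrightarrow> (\<lambda>k. b k - a k) \<in> I \<Longrightarrow> I +>\<^bsub>R\<^esub> a = I +>\<^bsub>R\<^esub> b"
  using I.a_rcos_module_minus[OF ring_R, of a b] R_minus R.a_repr_independence[OF _ _ I.a_subgroup] by simp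

lemma norm_seq_le: "b \<in> carrier R \<Longrightarrow> (\<And>k. opn (emb (b k)) \<le> c) \<Longrightarrow> ultraproduct_norm (I +>\<^bsub>R\<^esub> b) \<le> c"
  and norm_nonneg: "b \<in> carrier R \<Longrightarrow> 0 \<le> ultraproduct_norm (I +>\<^bsub>R\<^esub> b)"
proof -
  assume b: "b \<in> carrier R"
  have pos: "0 \<le> (SUP k. mat_op_norm (a k))" if a: "a \<in> I +>\<^bsub>R\<^esub> b" for a
  proof -
    have "bdd_above (range (\<lambda>k. mat_op_norm (a k)))" using coset_diff[OF b a] by (simp add: bounded_seq_ring_def)
    then have "mat_op_norm (a 0) \<le> (SUP k. mat_op_norm (a k))" by (intro cSUP_upper) auto
    then show ?thesis using op_norm_nonneg[of "a 0"] by linarith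
  qed
  have self: "b \<in> I +>\<^bsub>R\<^esub> b" by (rule I.a_rcos_self[OF b])
  show "0 \<le> ultraproduct_norm (I +>\<^bsub>R\<^esub> b)"
    unfolding ultraproduct_norm_def using self pos by (intro cINF_greatest) auto
  assume c: "\<And>k. opn (emb (b k)) \<le> c"
  have "ultraproduct_norm (I +>\<^bsub>R\<^esub> b) \<le> (SUP k. mat_op_norm (b k))"
    unfolding ultraproduct_norm_def using pos by (intro cINF_lower self bdd_belowI2[of _ 0])
  also have "\<dots> \<le> c" using c by (intro cSUP_least) (auto simp: op_norm_emb)
  finally show "ultraproduct_norm (I +>\<^bsub>R\<^esub> b) \<le> c" .
qed

text \<open>The quotient norm is an infimum over representatives, so they are found only for
  constants strictly above it.\<close>

lemma norm_approx:
  assumes a: "a \<in> carrier R" and c: "ultraproduct_norm (I +>\<^bsub>R\<^esub> a) < c"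
  obtains b where "b \<in> carrier R" "I +>\<^bsub>R\<^esub> b = I +>\<^bsub>R\<^esub> a" "\<And>k. opn (emb (b k)) \<le> c"
proof -
  have "(INF b \<in> I +>\<^bsub>R\<^esub> a. SUP k. mat_op_norm (b k)) < c" using c by (simp add: ultraproduct_norm_def)
  moreover have "I +>\<^bsub>R\<^esub> a \<noteq> {}" using I.a_rcos_self[OF a] by blast
  ultimately obtain b where b: "b \<in> I +>\<^bsub>R\<^esub> a" "(SUP k. mat_op_norm (b k)) < c"
    using cInf_lessD[of "(\<lambda>b. SUP k. mat_op_norm (b k)) ` (I +>\<^bsub>R\<^esub> a)" c] by auto
  have bR: "b \<in> carrier R" using coset_diff[OF a b(1)] by simp
  then have "bdd_above (range (\<lambda>k. mat_op_norm (b k)))" by (simp add: bounded_seq_ring_def)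
  then have "mat_op_norm (b k) \<le> (SUP k. mat_op_norm (b k))" for k by (intro cSUP_upper) auto
  then have "opn (emb (b k)) \<le> c" for k using b(2) by (force simp: op_norm_emb intro: order_trans less_imp_le)
  then show ?thesis using that[OF bR] R.a_repr_independence[OF b(1) a I.a_subgroup] by auto
qed

text \<open>The traces are bounded by the operator norms, so compactness of a ball gives a limit
  along \<omega>. By \<open>trace_nrm2\<close> all members of the coset share it, which is the
  uniqueness that the definite description in \<open>ultraproduct_trace\<close> asks for.\<close>

lemma trace_limit:
  assumes a: "a \<in> carrier R"
  shows "((\<lambda>k. normalized_trace (a k)) \<longlongrightarrow> ultraproduct_trace \<omega> (I +>\<^bsub>R\<^esub> a)) \<omega>"
proof -
  obtain B where B: "\<And>k. opn (emb (a k)) \<le> B" "0 \<le> B" using carrier_RE[OF a] by metis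
  have "norm (normalized_trace (a k)) \<le> B" for k
  proof -
    have "(norm (normalized_trace (a k)))\<^sup>2 \<le> (opn (emb (a k)))\<^sup>2"
      using trace_nrm2[OF R_mat[OF a]] nrm2_opn[OF R_mat[OF a]] by (rule order_trans)
    then have "norm (normalized_trace (a k)) \<le> opn (emb (a k))" by (rule power2_le_imp_le) (rule opn_nonneg)
    then show ?thesis using B(1)[of k] by linarith
  qed
  then have "normalized_trace (a k) \<in> cball 0 B" for k by simp
  then have "\<exists>l. ((\<lambda>k. normalized_trace (a k)) \<longlongrightarrow> l) \<omega>"
    by (rule ultrafilter_compact_limit[OF ultra compact_cball])
  then obtain l where l: "((\<lambda>k. normalized_trace (a k)) \<longlongrightarrow> l) \<omega>" by blast
  have "Lim \<omega> (\<lambda>k. normalized_trace (b k)) = l" if b: "b \<in> I +>\<^bsub>R\<^esub> a" for b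
  proof -
    have d: "b \<in> carrier R" "(\<lambda>k. b k - a k) \<in> I" using coset_diff[OF a b] by auto
    have m: "a k \<in> carrier_mat (n k) (n k)" "b k \<in> carrier_mat (n k) (n k)" for k using R_mat a d by auto
    have "((\<lambda>k. (norm (normalized_trace (b k - a k)))\<^sup>2) \<longlongrightarrow> 0) \<omega>"
      by (rule Lim_null_comparison[where g = "\<lambda>k. nrm2 k (b k - a k)"])
        (use d(2) m trace_nrm2[OF minus_carrier_mat[OF m(1)]] in \<open>auto simp: I_iff\<close>)
    then have "((\<lambda>k. sqrt ((norm (normalized_trace (b k - a k)))\<^sup>2)) \<longlongrightarrow> sqrt 0) \<omega>" by (rule tendsto_real_sqrt)
    then have "((\<lambda>k. normalized_trace (b k - a k)) \<longlongrightarrow> 0) \<omega>" by (simp add: tendsto_norm_zero_iff)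
    then have "((\<lambda>k. normalized_trace (b k - a k) + normalized_trace (a k)) \<longlongrightarrow> 0 + l) \<omega>" using l by (rule tendsto_add)
    moreover have "normalized_trace (b k - a k) + normalized_trace (a k) = normalized_trace (b k)" for k
      using m[of k] by (simp add: normalized_trace_def mat_trace_def sum_subtractf flip: add_divide_distrib)
    ultimately have "((\<lambda>k. normalized_trace (b k)) \<longlongrightarrow> l) \<omega>" by simp
    then show ?thesis using \<omega>_ne by (intro tendsto_Lim)
  qed
  then have "ultraproduct_trace \<omega> (I +>\<^bsub>R\<^esub> a) = l"
    unfolding ultraproduct_trace_def using I.a_rcos_self[OF a] by (intro the_equality) auto
  then show ?thesis using l by simp
qed

text \<open>There are representatives of arbitrarily small operator norm, and they differ from
  \<open>a\<close> by null sequences; so \<open>nrm2 k (a k)\<close> is eventually below every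
  positive number.\<close>

lemma norm_zero_imp_null:
  assumes a: "a \<in> carrier R" and "ultraproduct_norm (I +>\<^bsub>R\<^esub> a) = 0" shows "a \<in> I"
proof -
  have "((\<lambda>k. nrm2 k (a k)) \<longlongrightarrow> 0) \<omega>"
  proof (rule tendstoI)
    fix e :: real assume e: "0 < e"
    have "ultraproduct_norm (I +>\<^bsub>R\<^esub> a) < sqrt (e / 4)" using assms(2) e by simp
    then obtain b where b: "b \<in> carrier R" "I +>\<^bsub>R\<^esub> b = I +>\<^bsub>R\<^esub> a" "\<And>k. opn (emb (b k)) \<le> sqrt (e / 4)"
      using norm_approx[OF a] by blast
    have d: "(\<lambda>k. a k - b k) \<in> I" using coset_diff[OF b(1), of a] b(2) I.a_rcos_self[OF a] by simp
    have m: "a k \<in> carrier_mat (n k) (n k)" "b k \<in> carrier_mat (n k) (n k)" for k using R_mat a b by auto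
    have le: "nrm2 k (a k) \<le> 2 * nrm2 k (a k - b k) + e / 2" for k
    proof -
      have "a k = (a k - b k) + b k" using m[of k] by (intro eq_matI) auto
      then have "nrm2 k (a k) \<le> 2 * nrm2 k (a k - b k) + 2 * nrm2 k (b k)"
        using nrm2_add[of "a k - b k" k "b k"] m[of k] by (metis minus_carrier_mat)
      moreover have "nrm2 k (b k) \<le> e / 4"
      proof -
        have "(opn (emb (b k)))\<^sup>2 \<le> (sqrt (e / 4))\<^sup>2" using b(3) opn_nonneg by (intro power_mono)
        then show ?thesis using nrm2_opn[OF m(2)[of k]] e by simp
      qed
      ultimately show ?thesis by simp
    qed
    have "eventually (\<lambda>k. dist (nrm2 k (a k - b k)) 0 < e / 4) \<omega>"
      using d e by (intro tendstoD) (auto simp: I_iff)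
    then show "eventually (\<lambda>k. dist (nrm2 k (a k)) 0 < e) \<omega>"
    proof (rule eventually_mono)
      fix k assume "dist (nrm2 k (a k - b k)) 0 < e / 4"
      then have "nrm2 k (a k - b k) < e / 4" by (simp add: dist_real_def)
      moreover have "0 \<le> nrm2 k (a k)" by (simp add: nrm2_def)
      ultimately show "dist (nrm2 k (a k)) 0 < e" using le[of k] by (simp add: dist_real_def)
    qed
  qed
  then show ?thesis using a by (simp add: I_iff)
qed

text \<open>The 4 is made of two factors 2: one for a representative with norm at most twice that of
  \<open>T\<close>, one for subtracting the normalised traces, which are bounded by the operator
  norms. Norm zero is a separate case, since twice the norm is then not strictly larger.\<close>

lemma ultraproduct_commutator:
  assumes K: "0 \<le> K" "\<And>n A. A \<in> (carrier_mat n n :: 'a mat set) \<Longrightarrow> mat_trace A = 0 \<Longrightarrow>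
      \<exists>B \<in> carrier_mat n n. \<exists>C \<in> carrier_mat n n. A = B * C - C * B \<and> mat_op_norm B \<le> 1 \<and> mat_op_norm C \<le> K * mat_op_norm A"
    and T: "T \<in> carrier M" "ultraproduct_trace \<omega> T = 0"
  shows "\<exists>B \<in> carrier M. \<exists>C \<in> carrier M. T = ring_commutator M B C \<and>
    ultraproduct_norm B * ultraproduct_norm C \<le> 4 * K * ultraproduct_norm T"
proof -
  obtain a0 where a0: "a0 \<in> carrier R" "T = I +>\<^bsub>R\<^esub> a0" using T(1) carrier_M by blast
  show ?thesis
  proof (cases "ultraproduct_norm T = 0")
    case True
    let ?z = "\<lambda>k. 0\<^sub>m (n k) (n k) :: 'a mat"
    have z: "?z \<in> carrier R" by (rule R_zero)
    have "a0 k - ?z k = a0 k" for k using R_mat[OF a0(1), of k] by (intro eq_matI) auto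
    then have "T = I +>\<^bsub>R\<^esub> ?z" unfolding a0(2) using norm_zero_imp_null[OF a0(1)] True coset_eqI[OF z a0(1)] a0(2) by simp
    moreover have "ring_commutator M (I +>\<^bsub>R\<^esub> ?z) (I +>\<^bsub>R\<^esub> ?z) = I +>\<^bsub>R\<^esub> ?z"
      unfolding coset_commutator[OF z z] by (rule arg_cong[of _ _ "(+>\<^bsub>R\<^esub>) I"]) (auto intro!: ext eq_matI)
    moreover have "I +>\<^bsub>R\<^esub> ?z \<in> carrier M" using z carrier_M by blast
    ultimately show ?thesis using True by (intro bexI[of _ "I +>\<^bsub>R\<^esub> ?z"]) auto
  next
    case False
    then have pos: "0 < ultraproduct_norm T" using norm_nonneg[OF a0(1)] a0(2) by simp
    then obtain a where a: "a \<in> carrier R" "I +>\<^bsub>R\<^esub> a = T" "\<And>k. opn (emb (a k)) \<le> 2 * ultraproduct_norm T"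
      using norm_approx[OF a0(1), of "2 * ultraproduct_norm T"] a0(2) by auto
    define \<tau> where "\<tau> k = normalized_trace (a k)" for k
    \<comment> \<open>The trace is now exactly 0 in every term. The corrections tend to 0 along
      \<omega> because \<open>ultraproduct_trace \<omega> T = 0\<close>, so the class is
      unchanged.\<close>
    define a' where "a' k = a k - \<tau> k \<cdot>\<^sub>m 1\<^sub>m (n k)" for k
    have m: "a k \<in> carrier_mat (n k) (n k)" for k by (rule R_mat[OF a(1)])
    have m': "a' k \<in> carrier_mat (n k) (n k)" for k using m[of k] by (auto simp: a'_def)
    have e1: "emb (\<tau> k \<cdot>\<^sub>m 1\<^sub>m (n k)) = cs (f (\<tau> k)) (un (n k))" for k by (simp add: emb_smult emb_1)
    have e': "emb (a' k) = emb (a k) - cs (f (\<tau> k)) (un (n k))" for k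
      unfolding a'_def e1[symmetric] by (rule emb_diff[OF m]) simp
    have \<tau>_le: "norm (\<tau> k) \<le> opn (emb (a k))" for k
    proof -
      have "(norm (\<tau> k))\<^sup>2 \<le> (opn (emb (a k)))\<^sup>2"
        unfolding \<tau>_def using trace_nrm2[OF m] nrm2_opn[OF m] by (rule order_trans)
      then show ?thesis by (rule power2_le_imp_le) (rule opn_nonneg)
    qed
    have a'_le: "opn (emb (a' k)) \<le> 4 * ultraproduct_norm T" for k
    proof -
      have "opn (emb (a' k)) \<le> opn (emb (a k)) + opn (cs (f (\<tau> k)) (un (n k)))" unfolding e' by (rule opn_diff)
      also have "opn (cs (f (\<tau> k)) (un (n k))) \<le> norm (\<tau> k)" using mult_left_mono[OF opn_un_le[of "n k"], of "norm (\<tau> k)"] by (simp add: f_norm)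
      finally show ?thesis using \<tau>_le[of k] a(3)[of k] by linarith
    qed
    have a'R: "a' \<in> carrier R" by (rule carrier_RI[OF m' a'_le])
    have "(\<tau> \<longlongrightarrow> 0) \<omega>" using trace_limit[OF a(1)] T(2) a(2) unfolding \<tau>_def by simp
    then have "((\<lambda>k. (norm (\<tau> k))\<^sup>2) \<longlongrightarrow> (norm (0::'a))\<^sup>2) \<omega>" by (intro tendsto_intros)
    moreover have "nrm2 k (a k - a' k) = (norm (\<tau> k))\<^sup>2" for k
    proof -
      have "emb (a k - a' k) = cs (f (\<tau> k)) (un (n k))" unfolding emb_diff[OF m m'] e' by simp
      then show ?thesis using n_pos[of k] by (simp add: nrm2_def power_mult_distrib norm_un_sq f_norm)
    qed
    moreover have "(\<lambda>k. a k - a' k) \<in> carrier R" using R_minus[OF a(1) a'R] R.minus_closed[OF a(1) a'R] by simp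
    ultimately have "(\<lambda>k. a k - a' k) \<in> I" by (simp add: I_iff)
    then have Ta': "T = I +>\<^bsub>R\<^esub> a'" using coset_eqI[OF a'R a(1)] a(2) by simp
    have tr0: "mat_trace (a' k) = 0" for k
    proof -
      have "mat_trace (a' k) = mat_trace (a k) - (\<Sum>i<n k. \<tau> k)"
        using m[of k] by (simp add: a'_def mat_trace_def sum_subtractf)
      also have "\<dots> = 0" using m[of k] n_pos[of k] by (simp add: \<tau>_def normalized_trace_def)
      finally show ?thesis .
    qed
    have "\<forall>k. \<exists>B C. B \<in> carrier_mat (n k) (n k) \<and> C \<in> carrier_mat (n k) (n k) \<and> a' k = B * C - C * B \<and>
        mat_op_norm B \<le> 1 \<and> mat_op_norm C \<le> K * mat_op_norm (a' k)"
      using K(2)[OF m' tr0] by blast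
    then obtain b c where bc: "\<And>k. b k \<in> carrier_mat (n k) (n k)" "\<And>k. c k \<in> carrier_mat (n k) (n k)"
      "\<And>k. a' k = b k * c k - c k * b k" "\<And>k. mat_op_norm (b k) \<le> 1" "\<And>k. mat_op_norm (c k) \<le> K * mat_op_norm (a' k)"
      by metis
    have ob: "opn (emb (b k)) \<le> 1" for k using bc(4) by (simp add: op_norm_emb)
    have oc: "opn (emb (c k)) \<le> 4 * K * ultraproduct_norm T" for k
      using bc(5)[of k] mult_left_mono[OF a'_le K(1), of k] by (simp add: op_norm_emb)
    have bR: "b \<in> carrier R" and cR: "c \<in> carrier R" using carrier_RI[OF bc(1) ob] carrier_RI[OF bc(2) oc] .
    have "T = ring_commutator M (I +>\<^bsub>R\<^esub> b) (I +>\<^bsub>R\<^esub> c)"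
      unfolding coset_commutator[OF bR cR] Ta' using bc(3) by (intro arg_cong[of _ _ "(+>\<^bsub>R\<^esub>) I"] ext)
    moreover have "ultraproduct_norm (I +>\<^bsub>R\<^esub> b) * ultraproduct_norm (I +>\<^bsub>R\<^esub> c) \<le> 1 * (4 * K * ultraproduct_norm T)"
      by (intro mult_mono norm_seq_le norm_nonneg bR cR ob oc) auto
    ultimately show ?thesis using carrier_M bR cR by (intro bexI[of _ "I +>\<^bsub>R\<^esub> b"] bexI[of _ "I +>\<^bsub>R\<^esub> c"]) auto
  qed
qed

end

context scalar_embedding
begin

text \<open>Stated for all constants from some \<open>K0\<close> on, so that one constant can serve
  the real and the complex scalars together.\<close>

lemma scalar_uniform:
  "\<exists>K0. \<forall>K\<ge>K0. (\<forall>n\<ge>1. \<forall>A \<in> (carrier_mat n n :: 'a mat set). mat_trace A = 0 \<longrightarrow>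
          (\<exists>B \<in> carrier_mat n n. \<exists>C \<in> carrier_mat n n.
             A = B * C - C * B \<and> mat_op_norm B * mat_op_norm C \<le> K * mat_op_norm A)) \<and>
      (\<forall>n \<omega>. (\<forall>k. n k \<ge> 1) \<longrightarrow> nonprincipal_ultrafilter \<omega> \<longrightarrow>
          (let M = (tracial_ultraproduct n \<omega> :: (nat \<Rightarrow> 'a mat) set ring) in
             \<forall>T \<in> carrier M. ultraproduct_trace \<omega> T = 0 \<longrightarrow>
               (\<exists>B \<in> carrier M. \<exists>C \<in> carrier M. T = ring_commutator M B C \<and>
                  ultraproduct_norm B * ultraproduct_norm C \<le> K * ultraproduct_norm T)))"
proof -
  obtain K where K: "0 \<le> K" and mat: "\<And>n A. A \<in> (carrier_mat n n :: 'a mat set) \<Longrightarrow> mat_trace A = 0 \<Longrightarrow>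
      \<exists>B \<in> carrier_mat n n. \<exists>C \<in> carrier_mat n n. A = B * C - C * B \<and> mat_op_norm B \<le> 1 \<and> mat_op_norm C \<le> K * mat_op_norm A"
    using matrix_commutator by blast
  have one: "\<exists>B \<in> carrier_mat n n. \<exists>C \<in> carrier_mat n n. A = B * C - C * B \<and> mat_op_norm B * mat_op_norm C \<le> K' * mat_op_norm A"
    if A: "A \<in> (carrier_mat n n :: 'a mat set)" "mat_trace A = 0" and K': "4 * K \<le> K'" for n A K'
  proof -
    obtain B C where BC: "B \<in> carrier_mat n n" "C \<in> carrier_mat n n" "A = B * C - C * B" "mat_op_norm B \<le> 1"
      "mat_op_norm C \<le> K * mat_op_norm A" using mat[OF A] by blast
    have "mat_op_norm B * mat_op_norm C \<le> 1 * (K * mat_op_norm A)" using BC op_norm_nonneg by (intro mult_mono) auto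
    also have "\<dots> \<le> K' * mat_op_norm A" using K K' op_norm_nonneg[of A] by (simp add: mult_right_mono)
    finally show ?thesis using BC by blast
  qed
  have two: "\<exists>B \<in> carrier M. \<exists>C \<in> carrier M. T = ring_commutator M B C \<and> ultraproduct_norm B * ultraproduct_norm C \<le> K' * ultraproduct_norm T"
    if n: "\<forall>k. 1 \<le> n k" "nonprincipal_ultrafilter \<omega>" and M: "M = (tracial_ultraproduct n \<omega> :: (nat \<Rightarrow> 'a mat) set ring)"
      and T: "T \<in> carrier M" "ultraproduct_trace \<omega> T = 0" and K': "4 * K \<le> K'" for n \<omega> M T K'
  proof -
    interpret U: ultraproduct f n \<omega> by unfold_locales (use n in auto)
    obtain B C where BC: "B \<in> carrier M" "C \<in> carrier M" "T = ring_commutator M B C"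
      "ultraproduct_norm B * ultraproduct_norm C \<le> 4 * K * ultraproduct_norm T"
      using U.ultraproduct_commutator[OF K mat] T unfolding M by blast
    have "0 \<le> ultraproduct_norm T" using T(1) U.carrier_M U.norm_nonneg unfolding M by auto
    then have "4 * K * ultraproduct_norm T \<le> K' * ultraproduct_norm T" using K' by (rule mult_right_mono[rotated])
    with BC(4) have "ultraproduct_norm B * ultraproduct_norm C \<le> K' * ultraproduct_norm T" by (rule order_trans)
    then show ?thesis using BC(1-3) by blast
  qed
  show ?thesis
  proof (rule exI[of _ "4 * K"], intro allI impI conjI ballI)
    fix K' n and A :: "'a mat"
    assume "4 * K \<le> K'" "1 \<le> n" "A \<in> carrier_mat n n" "mat_trace A = 0"
    then show "\<exists>B \<in> carrier_mat n n. \<exists>C \<in> carrier_mat n n. A = B * C - C * B \<and> mat_op_norm B * mat_op_norm C \<le> K' * mat_op_norm A"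
      by (intro one)
  next
    fix K' and n :: "nat \<Rightarrow> nat" and \<omega> :: "nat filter"
    assume K': "4 * K \<le> K'" and n: "\<forall>k. 1 \<le> n k" "nonprincipal_ultrafilter \<omega>"
    show "let M = (tracial_ultraproduct n \<omega> :: (nat \<Rightarrow> 'a mat) set ring) in
             \<forall>T \<in> carrier M. ultraproduct_trace \<omega> T = 0 \<longrightarrow>
               (\<exists>B \<in> carrier M. \<exists>C \<in> carrier M. T = ring_commutator M B C \<and>
                  ultraproduct_norm B * ultraproduct_norm C \<le> K' * ultraproduct_norm T)"
      unfolding Let_def by (intro ballI impI two[OF n refl _ _ K'])
  qed
qed

end

lemma exists_common_bound:
  "\<exists>K\<^sub>1. \<forall>K\<ge>K\<^sub>1. P K \<Longrightarrow> \<exists>K\<^sub>2. \<forall>K\<ge>K\<^sub>2. Q K \<Longrightarrow> \<exists>K::real. 0 < K \<and> P K \<and> Q K"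
proof -
  assume "\<exists>K\<^sub>1. \<forall>K\<ge>K\<^sub>1. P K" "\<exists>K\<^sub>2. \<forall>K\<ge>K\<^sub>2. Q K"
  then obtain K\<^sub>1 K\<^sub>2 where "\<forall>K\<ge>K\<^sub>1. P K" "\<forall>K\<ge>K\<^sub>2. Q K" by blast
  then show ?thesis by (intro exI[of _ "max 1 (max K\<^sub>1 K\<^sub>2)"]) auto
qed

theorem corollary1p2:
  shows "\<exists>K::real. K > 0 \<and>
      (\<forall>n\<ge>1. \<forall>A \<in> (carrier_mat n n :: real mat set). mat_trace A = 0 \<longrightarrow>
          (\<exists>B \<in> carrier_mat n n. \<exists>C \<in> carrier_mat n n.
             A = B * C - C * B \<and> mat_op_norm B * mat_op_norm C \<le> K * mat_op_norm A)) \<and>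
      (\<forall>n\<ge>1. \<forall>A \<in> (carrier_mat n n :: complex mat set). mat_trace A = 0 \<longrightarrow>
          (\<exists>B \<in> carrier_mat n n. \<exists>C \<in> carrier_mat n n.
             A = B * C - C * B \<and> mat_op_norm B * mat_op_norm C \<le> K * mat_op_norm A)) \<and>
      (\<forall>n \<omega>. (\<forall>k. n k \<ge> 1) \<longrightarrow> nonprincipal_ultrafilter \<omega> \<longrightarrow>
          (let M = (tracial_ultraproduct n \<omega> :: (nat \<Rightarrow> real mat) set ring) in
             \<forall>T \<in> carrier M. ultraproduct_trace \<omega> T = 0 \<longrightarrow>
               (\<exists>B \<in> carrier M. \<exists>C \<in> carrier M. T = ring_commutator M B C \<and>
                  ultraproduct_norm B * ultraproduct_norm C \<le> K * ultraproduct_norm T))) \<and>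
      (\<forall>n \<omega>. (\<forall>k. n k \<ge> 1) \<longrightarrow> nonprincipal_ultrafilter \<omega> \<longrightarrow>
          (let M = (tracial_ultraproduct n \<omega> :: (nat \<Rightarrow> complex mat) set ring) in
             \<forall>T \<in> carrier M. ultraproduct_trace \<omega> T = 0 \<longrightarrow>
               (\<exists>B \<in> carrier M. \<exists>C \<in> carrier M. T = ring_commutator M B C \<and>
                  ultraproduct_norm B * ultraproduct_norm C \<le> K * ultraproduct_norm T)))"
  using exists_common_bound[OF real_scalars.scalar_uniform complex_scalars.scalar_uniform]
  by (elim exE conjE, intro exI conjI) assumption+

end
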